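(* Let $k$ be a positive integer, let $G$ be a $50k$-connected graph and let $S \subseteq V(G)$ with $|S| \ge k$. At least one of the following holds: (i) $G$ contains $k$ pairwise vertex-disjoint odd $S$-cycles; (ii) there is a set $X \subseteq V(G)$ with $|X| \le \min_{S' \subseteq S,\ |S'| = k} \bigl(2k-2+\tau(G[S'])\bigr)$ such that $G - X$ is bipartite. In particular, since $\tau(G[S']) \le k-1$ for $|S'|=k$, in case (ii) $|X| \le 3k-3$.
   Context: All graphs are finite and simple. An $S$-cycle is a cycle containing at least one vertex of $S$. For a graph $H$, $\tau(H)$ denotes the vertex cover number of $H$, i.e. the minimum size of a set of vertices meeting every edge of $H$. $G[S']$ is the subgraph of $G$ induced by $S'$. *)

theory Defs
  imports Main
begin

definition simple_graph :: "'a set \<Rightarrow> ('a \<Rightarrow> 'a \<Rightarrow> bool) \<Rightarrow> bool" where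
  "simple_graph V E \<longleftrightarrow> finite V \<and>
     (\<forall>u v. E u v \<longrightarrow> u \<in> V \<and> v \<in> V \<and> u \<noteq> v \<and> E v u)"

definition connected_on :: "'a set \<Rightarrow> ('a \<Rightarrow> 'a \<Rightarrow> bool) \<Rightarrow> bool" where
  "connected_on W E \<longleftrightarrow>
     (\<forall>u\<in>W. \<forall>v\<in>W. (\<lambda>x y. E x y \<and> x \<in> W \<and> y \<in> W)\<^sup>*\<^sup>* u v)"

text \<open>k-connected (Diestel): more than k vertices and G - X connected whenever |X| < k.\<close>
definition k_connected :: "nat \<Rightarrow> 'a set \<Rightarrow> ('a \<Rightarrow> 'a \<Rightarrow> bool) \<Rightarrow> bool" where
  "k_connected k V E \<longleftrightarrow> card V > k \<and>
     (\<forall>X. X \<subseteq> V \<and> card X < k \<longrightarrow> connected_on (V - X) E)"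

definition is_cycle :: "('a \<Rightarrow> 'a \<Rightarrow> bool) \<Rightarrow> 'a list \<Rightarrow> bool" where
  "is_cycle E cs \<longleftrightarrow> distinct cs \<and> length cs \<ge> 3 \<and>
     (\<forall>i < length cs. E (cs ! i) (cs ! ((i + 1) mod length cs)))"

definition odd_S_cycle :: "'a set \<Rightarrow> ('a \<Rightarrow> 'a \<Rightarrow> bool) \<Rightarrow> 'a set \<Rightarrow> 'a list \<Rightarrow> bool" where
  "odd_S_cycle V E S cs \<longleftrightarrow> is_cycle E cs \<and> set cs \<subseteq> V \<and> odd (length cs) \<and> set cs \<inter> S \<noteq> {}"

definition bipartite_minus :: "'a set \<Rightarrow> ('a \<Rightarrow> 'a \<Rightarrow> bool) \<Rightarrow> 'a set \<Rightarrow> bool" where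
  "bipartite_minus V E X \<longleftrightarrow>
     (\<exists>A. \<forall>u v. u \<in> V - X \<and> v \<in> V - X \<and> E u v \<longrightarrow> (u \<in> A \<longleftrightarrow> v \<notin> A))"

definition tau_induced :: "('a \<Rightarrow> 'a \<Rightarrow> bool) \<Rightarrow> 'a set \<Rightarrow> nat" where
  "tau_induced E W = Min {card C | C. C \<subseteq> W \<and>
      (\<forall>u v. u \<in> W \<and> v \<in> W \<and> E u v \<longrightarrow> u \<in> C \<or> v \<in> C)}"

end

theory Submission
  imports Defs
begin

text \<open>Fix a \<open>k\<close>-set \<open>S' \<subseteq> S\<close> for which \<open>G[S']\<close> has the least vertex cover number. A maximum cut of
  \<open>G - S'\<close> contains a bipartite graph \<open>H\<close> that is so dense and connected that any \<open>4k\<close> of its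
  vertices can be joined in prescribed pairs by disjoint paths of \<open>H\<close>, by an argument of Thomas and
  Wollan. Call a path between two vertices of \<open>H\<close> odd if its parity disagrees with the colours of its
  ends. The Tutte-Berge formula for a doubled copy of \<open>G - S'\<close> gives either \<open>3k\<close> disjoint odd paths or
  a set \<open>Z\<close> of fewer than \<open>6k\<close> vertices for which \<open>G - S' - Z\<close> is bipartite.

  In the first case Menger's theorem attaches every vertex of \<open>S'\<close> to \<open>H\<close> by two disjoint stems, chosen
  so that \<open>k\<close> of the odd paths stay untouched; these correct the parity of the cycles that are closed
  up in \<open>H\<close>. In the second case \<open>G - S' - Z\<close> itself is linked. Every vertex of \<open>S' \<union> Z\<close> is coloured
  against the majority of its neighbours there, and we take a maximum matching of monochromatic edges
  not inside \<open>S'\<close>. If it has \<open>k\<close> edges, they play the role of the odd paths. Otherwise its at most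
  \<open>2k - 2\<close> ends together with a minimum vertex cover of \<open>G[S']\<close> meet all monochromatic edges.\<close>

section \<open>Connected sets and separations\<close>

text \<open>The parity of a cycle closed up in \<open>H\<close> through a vertex of S' is beyond the
  control of the linkage, so every such vertex needs an odd path of its own in reserve. As 2k stems
  spoil at most 2k paths, 3k are asked for; each odd path lowers the number of unmatched vertices of
  the doubled graph by two, whence the 6k.

  The budget 50k: deleting S' leaves degrees of at least 49k and a maximum cut keeps half of each,
  that is 49k/4 edges per vertex. Linking 4k terminals, which are 2k pairs, takes 6 edges per vertex
  and pair, that is 12k; the difference pays for the edges among the terminals.

  In the second case the whole of G - S' - Z is bipartite and highly connected, so no cut has to be
  taken and every monochromatic edge has an end in S' or Z. An edge inside S' would have to lie on
  the cycles of two vertices of S' at once; such edges are therefore barred from the matching and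
  covered separately, which is how the vertex cover number enters.\<close>

definition conn :: "('a \<Rightarrow> 'a \<Rightarrow> bool) \<Rightarrow> 'a set \<Rightarrow> bool" where
  "conn E C \<longleftrightarrow> C \<noteq> {} \<and>
     (\<forall>D. D \<subseteq> C \<and> D \<noteq> {} \<and> D \<noteq> C \<longrightarrow> (\<exists>x\<in>D. \<exists>y\<in>C - D. E x y))"

text \<open>The order of such a separation is \<open>card (A \<inter> B)\<close>. That
  \<open>A \<union> B\<close> is the whole vertex set is required separately, so that the same
  predicate serves all subgraphs.\<close>

definition sep :: "('a \<Rightarrow> 'a \<Rightarrow> bool) \<Rightarrow> 'a set \<Rightarrow> 'a set \<Rightarrow> bool" where
  "sep E A B \<longleftrightarrow> (\<forall>u v. E u v \<longrightarrow> (u \<in> A \<and> v \<in> A) \<or> (u \<in> B \<and> v \<in> B))"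

definition ind :: "('a \<Rightarrow> 'a \<Rightarrow> bool) \<Rightarrow> 'a set \<Rightarrow> 'a \<Rightarrow> 'a \<Rightarrow> bool" where
  "ind E A u v \<longleftrightarrow> E u v \<and> u \<in> A \<and> v \<in> A"

lemma connI:
  assumes "C \<noteq> {}" "\<And>D. D \<subseteq> C \<Longrightarrow> D \<noteq> {} \<Longrightarrow> D \<noteq> C \<Longrightarrow> \<exists>x\<in>D. \<exists>y\<in>C - D. E x y"
  shows "conn E C"
  using assms unfolding conn_def by blast

lemma connD:
  assumes "conn E C" "D \<subseteq> C" "D \<noteq> {}" "D \<noteq> C"
  obtains x y where "x \<in> D" "y \<in> C" "y \<notin> D" "E x y"
  using assms unfolding conn_def by blast

lemma conn_nonempty: "conn E C \<Longrightarrow> C \<noteq> {}"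
  unfolding conn_def by blast

lemma conn_single: "conn E {x}"
  by (rule connI) auto

lemma conn_mono:
  assumes "conn E C" "\<And>x y. x \<in> C \<Longrightarrow> y \<in> C \<Longrightarrow> E x y \<Longrightarrow> F x y"
  shows "conn F C"
  using assms unfolding conn_def by (meson DiffD1 subsetD)

lemma conn_indD: "conn (ind E A) C \<Longrightarrow> conn E C"
  by (erule conn_mono) (simp add: ind_def)

lemma conn_indI: "conn E C \<Longrightarrow> C \<subseteq> A \<Longrightarrow> conn (ind E A) C"
  by (erule conn_mono) (auto simp: ind_def)

lemma conn_Un:
  assumes "conn E C" "conn E D" "C \<inter> D \<noteq> {}"
  shows "conn E (C \<union> D)"
proof (rule connI)
  show "C \<union> D \<noteq> {}" using assms conn_nonempty by blast
next
  fix X assume X: "X \<subseteq> C \<union> D" "X \<noteq> {}" "X \<noteq> C \<union> D"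
  show "\<exists>x\<in>X. \<exists>y\<in>C \<union> D - X. E x y"
  proof (cases "X \<inter> C \<noteq> {} \<and> X \<inter> C \<noteq> C")
    case True
    then obtain x y where "x \<in> X \<inter> C" "y \<in> C" "y \<notin> X \<inter> C" "E x y"
      using connD[OF assms(1), of "X \<inter> C"] by blast
    then show ?thesis by blast
  next
    case F1: False
    show ?thesis
    proof (cases "X \<inter> D \<noteq> {} \<and> X \<inter> D \<noteq> D")
      case True
      then obtain x y where "x \<in> X \<inter> D" "y \<in> D" "y \<notin> X \<inter> D" "E x y"
        using connD[OF assms(2), of "X \<inter> D"] by blast
      then show ?thesis by blast
    next
      case False
      then show ?thesis using F1 X assms(3) by blast
    qed
  qed
qed

lemma conn_pair: "E x y \<Longrightarrow> E y x \<Longrightarrow> conn E {x, y}"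
proof (rule connI)
  fix D assume e: "E x y" "E y x" and "D \<subseteq> {x, y}" "D \<noteq> {}" "D \<noteq> {x, y}"
  then have "D = {x} \<and> x \<noteq> y \<or> D = {y} \<and> x \<noteq> y" by auto
  then show "\<exists>a\<in>D. \<exists>b\<in>{x, y} - D. E a b" using e by auto
qed simp

lemma conn_Un_edge:
  assumes "conn E C" "conn E D" "x \<in> C" "y \<in> D" "E x y" "E y x"
  shows "conn E (C \<union> D)"
proof -
  have "conn E (C \<union> {x, y})"
    using conn_Un[OF assms(1) conn_pair] assms by blast
  from conn_Un[OF this assms(2)] have "conn E (C \<union> {x, y} \<union> D)" using assms by blast
  moreover have "C \<union> {x, y} \<union> D = C \<union> D" using assms by blast
  ultimately show ?thesis by simp
qed

lemma conn_closed:
  assumes "conn E C" "x \<in> C" "x \<in> D" "\<And>a b. a \<in> D \<Longrightarrow> a \<in> C \<Longrightarrow> b \<in> C \<Longrightarrow> E a b \<Longrightarrow> b \<in> D"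
  shows "C \<subseteq> D"
proof (rule ccontr)
  assume "\<not> C \<subseteq> D"
  then have "C \<inter> D \<noteq> C" "C \<inter> D \<noteq> {}" using assms by auto
  then obtain a b where "a \<in> C \<inter> D" "b \<in> C" "b \<notin> C \<inter> D" "E a b"
    using connD[OF assms(1), of "C \<inter> D"] by auto
  then show False using assms(4) by blast
qed

lemma conn_walk:
  assumes "symp E" "successively E xs" "xs \<noteq> []"
  shows "conn E (set xs)"
  using assms(2,3)
proof (induction xs rule: induct_list012)
  case (2 x) then show ?case by (simp add: conn_single)
next
  case (3 x y zs)
  then have "conn E (set (y # zs))" by simp
  moreover have "E x y" "E y x" using 3 assms(1) by (auto dest: sympD)
  ultimately have "conn E ({x} \<union> set (y # zs))"
    using conn_Un_edge[OF conn_single, of E "set (y # zs)" x x y] by simp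
  then show ?case by (simp add: insert_commute)
qed simp

text \<open>Connectivity is defined by cuts, so that unions, contractions and added edges can be
  treated as operations on sets. Paths are extracted where the order of the vertices or a parity
  matters.\<close>

lemma conn_path:
  assumes "conn E C" "x \<in> C" "y \<in> C"
  obtains xs where "xs \<noteq> []" "hd xs = x" "last xs = y" "distinct xs" "set xs \<subseteq> C" "successively E xs"
proof -
  define P where "P z xs \<longleftrightarrow> xs \<noteq> [] \<and> hd xs = x \<and> last xs = z \<and> distinct xs \<and> set xs \<subseteq> C \<and> successively E xs" for z xs
  define D where "D = {z. \<exists>xs. P z xs}"
  \<comment> \<open>If the next vertex already lies on the path, the prefix up to it is a path as
    well.\<close>
  have pre: "z \<in> D" if p: "P w xs" "z \<in> set xs" for w z xs
  proof -
    obtain ys zs where "xs = ys @ z # zs" using p by (meson split_list)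
    then have x1: "xs = (ys @ [z]) @ zs" by simp
    then have "successively E (ys @ [z])" using p(1) unfolding P_def by (metis successively_append_iff)
    moreover have "hd (ys @ [z]) = hd xs" using x1 by (cases ys) auto
    ultimately have "P z (ys @ [z])" using p x1 unfolding P_def by auto
    then show ?thesis unfolding D_def by blast
  qed
  have "C \<subseteq> D"
  proof (rule conn_closed[OF assms(1,2)])
    have "P x [x]" unfolding P_def using assms by simp
    then show "x \<in> D" unfolding D_def by blast
  next
    fix a b assume ab: "a \<in> D" "a \<in> C" "b \<in> C" "E a b"
    then obtain xs where xs: "P a xs" unfolding D_def by blast
    show "b \<in> D"
    proof (cases "b \<in> set xs")
      case True then show ?thesis using pre[OF xs] by blast
    next
      case False
      then have "P b (xs @ [b])" using xs ab unfolding P_def by (auto simp: successively_append_iff)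
      then show ?thesis unfolding D_def by blast
    qed
  qed
  then obtain xs where "P y xs" using assms unfolding D_def by blast
  then show ?thesis using that unfolding P_def by blast
qed

lemma walk_path:
  assumes "symp E" "successively E ws" "ws \<noteq> []"
  obtains xs where "xs \<noteq> []" "hd xs = hd ws" "last xs = last ws" "distinct xs" "set xs \<subseteq> set ws"
    "successively E xs"
  using conn_path[OF conn_walk[OF assms], of "hd ws" "last ws"] assms(3) by auto

text \<open>A path into \<open>K\<close> is cut off at its first vertex there.\<close>

lemma path_to_set:
  assumes "conn E C" "z \<in> C" "C \<inter> K \<noteq> {}"
  shows "\<exists>xs. xs \<noteq> [] \<and> hd xs = z \<and> distinct xs \<and> set xs \<subseteq> C \<and> successively E xs \<and> set xs \<inter> K = {last xs}"
proof -
  obtain w where w: "w \<in> C" "w \<in> K" using assms by blast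
  obtain xs where xs: "xs \<noteq> []" "hd xs = z" "last xs = w" "distinct xs" "set xs \<subseteq> C" "successively E xs"
    by (rule conn_path[OF assms(1,2) w(1)])
  have "\<exists>x\<in>set xs. x \<in> K" using xs(1,3) w(2) last_in_set by metis
  then obtain ys y zs where s: "xs = ys @ y # zs" "y \<in> K" "\<forall>x\<in>set ys. x \<notin> K"
    using split_list_first_prop[of xs "\<lambda>x. x \<in> K"] by metis
  have "successively E (ys @ [y])" using xs(6) s(1) by (auto simp: successively_append_iff)
  moreover have "hd (ys @ [y]) = z" using xs(1,2) s(1) by (cases ys) auto
  moreover have "set (ys @ [y]) \<inter> K = {last (ys @ [y])}" using s(2,3) by auto
  ultimately show ?thesis using xs(4,5) s(1) by (intro exI[of _ "ys @ [y]"]) auto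
qed

lemma conn_to_set:
  assumes "symp E" "conn E C" "z \<in> C" "C \<inter> K \<noteq> {}"
  obtains D y where "D \<subseteq> C" "conn E D" "z \<in> D" "y \<in> K" "D \<inter> K = {y}"
proof -
  obtain xs where xs: "xs \<noteq> []" "hd xs = z" "set xs \<subseteq> C" "successively E xs" "set xs \<inter> K = {last xs}"
    using path_to_set[OF assms(2-4)] by blast
  have "z \<in> set xs" using xs(1,2) by auto
  moreover have "last xs \<in> K" using xs(5) by blast
  ultimately show ?thesis using that[of "set xs" "last xs"] xs conn_walk[OF assms(1) xs(4,1)] by simp
qed

lemma simple_graphD:
  assumes "simple_graph V E"
  shows "finite V" "symp E" "\<And>x. \<not> E x x" "\<And>x y. E x y \<Longrightarrow> x \<in> V" "\<And>x y. E x y \<Longrightarrow> y \<in> V"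
    "\<And>x y. E x y \<Longrightarrow> E y x" "\<And>x y. E x y \<Longrightarrow> x \<noteq> y"
  using assms unfolding simple_graph_def symp_def by blast+

lemma simple_graphI:
  assumes "finite V" "\<And>x y. E x y \<Longrightarrow> x \<in> V \<and> x \<noteq> y \<and> E y x"
  shows "simple_graph V E"
  using assms unfolding simple_graph_def by blast

lemma simple_graph_ind:
  assumes "simple_graph V E" "A \<subseteq> V"
  shows "simple_graph A (ind E A)"
  using assms finite_subset unfolding simple_graph_def ind_def by blast

section \<open>Menger's theorem\<close>

text \<open>Pigeonhole: as many disjoint sets as \<open>S\<close> has elements, each containing one
  of them, contain exactly one each. Indexed in this way, two families can be glued along a common
  separator.\<close>

lemma reps_of_disjoint:
  assumes "finite S" "card CC = card S" "finite CC" "\<And>C. C \<in> CC \<Longrightarrow> C \<inter> S \<noteq> {}" "pairwise disjnt CC"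
  obtains f where "\<And>z. z \<in> S \<Longrightarrow> f z \<in> CC \<and> f z \<inter> S = {z}"
proof -
  define g where "g C = (SOME z. z \<in> C \<inter> S)" for C
  have g: "g C \<in> C \<inter> S" if "C \<in> CC" for C
  proof -
    have "\<exists>z. z \<in> C \<inter> S" using assms(4)[OF that] by blast
    then show ?thesis unfolding g_def by (rule someI_ex)
  qed
  have inj: "inj_on g CC"
  proof (rule inj_onI)
    fix C D assume "C \<in> CC" "D \<in> CC" "g C = g D"
    then show "C = D" using g[of C] g[of D] assms(5) unfolding pairwise_def disjnt_def by auto
  qed
  have "g ` CC \<subseteq> S" using g by auto
  moreover have "card (g ` CC) = card S" using inj assms(2) by (simp add: card_image)
  ultimately have "g ` CC = S" using card_subset_eq[OF assms(1)] by blast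
  then have ex: "\<exists>C. C \<in> CC \<and> C \<inter> S = {z}" if z: "z \<in> S" for z
  proof -
    obtain C where C: "C \<in> CC" "g C = z" using z \<open>g ` CC = S\<close> by blast
    have "y = z" if y: "y \<in> C \<inter> S" for y
    proof -
      obtain D where D: "D \<in> CC" "g D = y" using y \<open>g ` CC = S\<close> by blast
      then have "C = D" using g[of D] y C assms(5) unfolding pairwise_def disjnt_def by blast
      then show ?thesis using C D by simp
    qed
    then show ?thesis using C g[of C] by blast
  qed
  define f where "f z = (SOME C. C \<in> CC \<and> C \<inter> S = {z})" for z
  have "\<And>z. z \<in> S \<Longrightarrow> f z \<in> CC \<and> f z \<inter> S = {z}" unfolding f_def by (rule someI_ex) (rule ex)
  then show ?thesis using that by blast
qed

lemma disjoint_subfamily: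
  fixes S :: "'b set"
  assumes "finite S" "\<And>z. z \<in> S \<Longrightarrow> C z \<noteq> {}" "\<And>z y. z \<in> S \<Longrightarrow> y \<in> S \<Longrightarrow> z \<noteq> y \<Longrightarrow> C z \<inter> C y = {}"
  shows "card (C ` S) = card S" "pairwise disjnt (C ` S)"
proof -
  have "inj_on C S" by (rule inj_onI) (metis assms(2,3) Int_absorb)
  then show "card (C ` S) = card S" by (rule card_image)
  show "pairwise disjnt (C ` S)" unfolding pairwise_def disjnt_def using assms(3) by auto
qed

text \<open>Induction on the number of arcs. If deleting an edge leaves a separation of order less
  than \<open>k\<close>, then adding either end of the edge to its separator gives two sets of
  exactly \<open>k\<close> vertices, and the induction hypothesis applies on both sides. Connected
  sets take the place of paths, since disjointness and the sets they reach are what matters.\<close>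

theorem menger:
  assumes "simple_graph V E" "A \<subseteq> V" "B \<subseteq> V"
    and "\<And>P Q. P \<union> Q = V \<Longrightarrow> A \<subseteq> P \<Longrightarrow> B \<subseteq> Q \<Longrightarrow> sep E P Q \<Longrightarrow> k \<le> card (P \<inter> Q)"
  shows "\<exists>CC. finite CC \<and> card CC = k \<and> pairwise disjnt CC \<and>
    (\<forall>C\<in>CC. conn E C \<and> C \<subseteq> V \<and> C \<inter> A \<noteq> {} \<and> C \<inter> B \<noteq> {})"
  using assms
proof (induction "card {(u, v). E u v}" arbitrary: V E A B rule: less_induct)
  case less
  note g = simple_graphD[OF less.prems(1)]
  have fE: "finite {(u, v). E u v}"
    by (rule finite_subset[of _ "V \<times> V"]) (use g in auto)
  show ?case
  proof (cases "\<exists>x y. E x y")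
    case False
    have "sep E (A \<union> (V - B)) B" using False unfolding sep_def by blast
    then have "k \<le> card ((A \<union> (V - B)) \<inter> B)"
      using less.prems(2,3) by (intro less.prems(4)) auto
    also have "(A \<union> (V - B)) \<inter> B = A \<inter> B" by blast
    finally obtain S where S: "S \<subseteq> A \<inter> B" "card S = k"
      using obtain_subset_with_card_n by blast
    have fS: "finite S" using S less.prems(2) g(1) by (meson finite_subset le_inf_iff order_trans)
    show ?thesis
      by (rule exI[of _ "(\<lambda>x. {x}) ` S"])
        (use S fS less.prems(2) disjoint_subfamily[OF fS, of "\<lambda>x. {x}"] conn_single in auto)
  next
    case True
    then obtain x y where xy: "E x y" by blast
    define F where "F u v \<longleftrightarrow> E u v \<and> {u, v} \<noteq> {x, y}" for u v
    have FE: "F u v \<Longrightarrow> E u v" for u v unfolding F_def by simp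
    have gF: "simple_graph V F"
      by (rule simple_graphI) (use g in \<open>auto simp: F_def insert_commute\<close>)
    have EF: "E u v \<Longrightarrow> F u v \<or> (u = x \<and> v = y) \<or> (u = y \<and> v = x)" for u v
      unfolding F_def by (auto simp: doubleton_eq_iff)
    have ltF: "card {(u, v). F u v} < card {(u, v). E u v}"
    proof (rule psubset_card_mono[OF fE], goal_cases)
      case 1
      have "(x, y) \<in> {(u, v). E u v}" "(x, y) \<notin> {(u, v). F u v}" using xy F_def by auto
      moreover have "{(u, v). F u v} \<subseteq> {(u, v). E u v}" using FE by auto
      ultimately show "{(u, v). F u v} \<subset> {(u, v). E u v}" by blast
    qed
    show ?thesis
    proof (cases "\<forall>P Q. P \<union> Q = V \<and> A \<subseteq> P \<and> B \<subseteq> Q \<and> sep F P Q \<longrightarrow> k \<le> card (P \<inter> Q)")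
      case True
      have "\<exists>CC. finite CC \<and> card CC = k \<and> pairwise disjnt CC \<and>
        (\<forall>C\<in>CC. conn F C \<and> C \<subseteq> V \<and> C \<inter> A \<noteq> {} \<and> C \<inter> B \<noteq> {})"
        by (rule less.hyps[OF ltF gF less.prems(2,3)]) (simp add: True)
      then obtain CC where CC: "finite CC" "card CC = k" "pairwise disjnt CC"
        "\<forall>C\<in>CC. conn F C \<and> C \<subseteq> V \<and> C \<inter> A \<noteq> {} \<and> C \<inter> B \<noteq> {}"
        by (elim exE conjE)
      have "conn E C" if "C \<in> CC" for C using CC(4) that FE conn_mono[of F C E] by simp
      then show ?thesis using CC by blast
    next
      case False
      then obtain P Q where PQ: "P \<union> Q = V" "A \<subseteq> P" "B \<subseteq> Q" "sep F P Q" "card (P \<inter> Q) < k"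
        using False by (metis not_le)
      \<comment> \<open>The deleted edge crosses the separation, as otherwise \<open>(P, Q)\<close>
        would separate \<open>E\<close> as well.\<close>
      have "\<exists>x y. E x y \<and> E y x \<and> x \<in> P - Q \<and> y \<in> Q - P \<and>
          (\<forall>u v. E u v \<longrightarrow> F u v \<or> (u = x \<and> v = y) \<or> (u = y \<and> v = x))"
      proof (rule ccontr)
        assume no: "\<not> ?thesis"
        have "sep E P Q" unfolding sep_def
        proof (intro allI impI)
          fix u v assume uv: "E u v"
          have "u \<in> V" "v \<in> V" using g uv by blast+
          moreover have "F u v \<Longrightarrow> (u \<in> P \<and> v \<in> P) \<or> (u \<in> Q \<and> v \<in> Q)" using PQ(4) unfolding sep_def by blast
          moreover have "x \<in> V" "y \<in> V" "E y x" using g xy by blast+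
          ultimately show "(u \<in> P \<and> v \<in> P) \<or> (u \<in> Q \<and> v \<in> Q)"
            using EF[OF uv] no EF xy PQ(1) by blast
        qed
        then show False using less.prems(4)[OF PQ(1-3)] PQ(5) by simp
      qed
      then obtain a b where ab: "E a b" "E b a" "a \<in> P - Q" "b \<in> Q - P"
        "\<And>u v. E u v \<Longrightarrow> F u v \<or> (u = a \<and> v = b) \<or> (u = b \<and> v = a)" by blast
      have fin: "finite P" "finite Q" using PQ(1) g(1) by (metis finite_Un)+
      define S where "S = P \<inter> Q"
      have sPQ: "F u v \<Longrightarrow> (u \<in> P \<and> v \<in> P) \<or> (u \<in> Q \<and> v \<in> Q)" for u v using PQ(4) unfolding sep_def by blast
      have "sep E (insert b P) Q" unfolding sep_def using ab sPQ by blast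
      then have "k \<le> card (insert b P \<inter> Q)" using PQ ab by (intro less.prems(4)) auto
      also have "insert b P \<inter> Q = insert b S" using ab S_def by auto
      finally have kS: "k = Suc (card S)" using PQ(5) fin ab(4) by (auto simp: S_def)
      have gP: "simple_graph P (ind F P)" using simple_graph_ind[OF gF] PQ(1) by blast
      have gQ: "simple_graph Q (ind F Q)" using simple_graph_ind[OF gF] PQ(1) by blast
      have fF: "finite {(u, v). F u v}" by (rule finite_subset[OF _ fE]) (use FE in auto)
      have lt: "card {(u, v). ind F Z u v} < card {(u, v). E u v}" for Z
        by (rule le_less_trans[OF card_mono[OF fF] ltF]) (auto simp: ind_def)
      \<comment> \<open>The part \<open>P\<close> without the deleted edge, with
        \<open>insert a S\<close> as target. A separation \<open>(P1, Q1)\<close> of it extends to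
        the separation \<open>(P1, Q1 \<union> Q)\<close> of the whole graph with the same order;
        the deleted edge lies inside the second side.\<close>
      have "\<exists>CC. finite CC \<and> card CC = k \<and> pairwise disjnt CC \<and>
          (\<forall>C\<in>CC. conn (ind F P) C \<and> C \<subseteq> P \<and> C \<inter> A \<noteq> {} \<and> C \<inter> insert a S \<noteq> {})"
      proof (rule less.hyps[OF lt gP PQ(2)])
        show "insert a S \<subseteq> P" using ab S_def by auto
      next
        fix P1 Q1 assume 1: "P1 \<union> Q1 = P" "A \<subseteq> P1" "insert a S \<subseteq> Q1" "sep (ind F P) P1 Q1"
        have "sep E P1 (Q1 \<union> Q)" unfolding sep_def
        proof (intro allI impI)
          fix u v assume uv: "E u v"
          show "(u \<in> P1 \<and> v \<in> P1) \<or> (u \<in> Q1 \<union> Q \<and> v \<in> Q1 \<union> Q)"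
            using ab(5)[OF uv] sPQ[of u v] 1(3,4) ab(4) unfolding sep_def ind_def by blast
        qed
        then have "k \<le> card (P1 \<inter> (Q1 \<union> Q))" using 1 PQ by (intro less.prems(4)) auto
        also have "P1 \<inter> (Q1 \<union> Q) = P1 \<inter> Q1" using 1 S_def by auto
        finally show "k \<le> card (P1 \<inter> Q1)" .
      qed
      then obtain CC where CC: "finite CC" "card CC = k" "pairwise disjnt CC"
        "\<And>C. C \<in> CC \<Longrightarrow> conn (ind F P) C \<and> C \<subseteq> P \<and> C \<inter> A \<noteq> {} \<and> C \<inter> insert a S \<noteq> {}" by blast
      have "\<exists>DD. finite DD \<and> card DD = k \<and> pairwise disjnt DD \<and>
          (\<forall>C\<in>DD. conn (ind F Q) C \<and> C \<subseteq> Q \<and> C \<inter> insert b S \<noteq> {} \<and> C \<inter> B \<noteq> {})"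
      proof (rule less.hyps[OF lt gQ _ PQ(3)])
        show "insert b S \<subseteq> Q" using ab S_def by auto
      next
        fix P1 Q1 assume 1: "P1 \<union> Q1 = Q" "insert b S \<subseteq> P1" "B \<subseteq> Q1" "sep (ind F Q) P1 Q1"
        have "sep E (P1 \<union> P) Q1" unfolding sep_def
        proof (intro allI impI)
          fix u v assume uv: "E u v"
          show "(u \<in> P1 \<union> P \<and> v \<in> P1 \<union> P) \<or> (u \<in> Q1 \<and> v \<in> Q1)"
            using ab(5)[OF uv] sPQ[of u v] 1(2,4) ab(3) unfolding sep_def ind_def by blast
        qed
        then have "k \<le> card ((P1 \<union> P) \<inter> Q1)" using 1 PQ by (intro less.prems(4)) auto
        also have "(P1 \<union> P) \<inter> Q1 = P1 \<inter> Q1" using 1 S_def by auto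
        finally show "k \<le> card (P1 \<inter> Q1)" .
      qed
      then obtain DD where DD: "finite DD" "card DD = k" "pairwise disjnt DD"
        "\<And>C. C \<in> DD \<Longrightarrow> conn (ind F Q) C \<and> C \<subseteq> Q \<and> C \<inter> insert b S \<noteq> {} \<and> C \<inter> B \<noteq> {}" by blast
      have fS: "finite S" using fin S_def by simp
      have c1: "card CC = card (insert a S)" using CC(2) kS fS ab by (simp add: S_def)
      have c2: "card DD = card (insert b S)" using DD(2) kS fS ab by (simp add: S_def)
      obtain f where f: "\<And>z. z \<in> insert a S \<Longrightarrow> f z \<in> CC \<and> f z \<inter> insert a S = {z}"
        using reps_of_disjoint[OF _ c1 CC(1) _ CC(3)] fS CC(4) by (metis finite_insert)
      obtain h where h: "\<And>z. z \<in> insert b S \<Longrightarrow> h z \<in> DD \<and> h z \<inter> insert b S = {z}"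
        using reps_of_disjoint[OF _ c2 DD(1) _ DD(3)] fS DD(4) by (metis finite_insert)
      \<comment> \<open>Sets meeting in a vertex of \<open>S\<close> are merged there; the set at
        \<open>a\<close> continues along the deleted edge to the set at \<open>b\<close>.\<close>
      define C where "C z = f z \<union> h (if z = a then b else z)" for z
      have hz: "(if z = a then b else z) \<in> insert b S" if "z \<in> insert a S" for z using that by auto
      have fP: "f z \<subseteq> P" if "z \<in> insert a S" for z using f[OF that] CC(4) by blast
      have hQ: "h z \<subseteq> Q" if "z \<in> insert b S" for z using h[OF that] DD(4) by blast
      have conn: "conn E (C z)" if z: "z \<in> insert a S" for z
      proof -
        have cf: "conn E (f z)" using f[OF z] CC(4) FE by (metis conn_indD conn_mono)
        have ch: "conn E (h (if z = a then b else z))"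
          using h[OF hz[OF z]] DD(4) FE by (metis conn_indD conn_mono)
        show ?thesis
        proof (cases "z = a")
          case True
          then show ?thesis using conn_Un_edge[OF cf ch, of a b] f[OF z] h[OF hz[OF z]] ab unfolding C_def by auto
        next
          case False
          then have "z \<in> f z \<inter> h z" using f[OF z] h[OF hz[OF z]] z by auto
          then show ?thesis using conn_Un[OF cf ch] False unfolding C_def by auto
        qed
      qed
      have disj: "C z \<inter> C w = {}" if z: "z \<in> insert a S" and w: "w \<in> insert a S" and "z \<noteq> w" for z w
      proof -
        define z' where "z' = (if z = a then b else z)"
        define w' where "w' = (if w = a then b else w)"
        have z'w': "z' \<noteq> w'" "z' \<in> insert b S" "w' \<in> insert b S"
          using that ab S_def unfolding z'_def w'_def by (auto split: if_splits)
        have "f z \<noteq> f w" using f[OF z] f[OF w] that by auto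
        then have 1: "f z \<inter> f w = {}" using f[OF z] f[OF w] CC(3) unfolding pairwise_def disjnt_def by blast
        have "h z' \<noteq> h w'" using h[OF z'w'(2)] h[OF z'w'(3)] z'w'(1) by auto
        then have 2: "h z' \<inter> h w' = {}" using h[OF z'w'(2)] h[OF z'w'(3)] DD(3) unfolding pairwise_def disjnt_def by blast
        \<comment> \<open>A common vertex lies in \<open>P \<inter> Q = S\<close>, where either set
          contains its own representative only.\<close>
        have 3: "f z \<inter> h w' = {}"
        proof (rule ccontr)
          assume "f z \<inter> h w' \<noteq> {}"
          then obtain p where p: "p \<in> f z" "p \<in> h w'" by blast
          then have "p \<in> S" using fP[OF z] hQ[OF z'w'(3)] S_def by auto
          then have "p = z" "p = w'" using f[OF z] h[OF z'w'(3)] p by auto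
          then show False using \<open>z \<noteq> w\<close> \<open>p \<in> S\<close> ab S_def unfolding w'_def by (auto split: if_splits)
        qed
        have 4: "f w \<inter> h z' = {}"
        proof (rule ccontr)
          assume "f w \<inter> h z' \<noteq> {}"
          then obtain p where p: "p \<in> f w" "p \<in> h z'" by blast
          then have "p \<in> S" using fP[OF w] hQ[OF z'w'(2)] S_def by auto
          then have "p = w" "p = z'" using f[OF w] h[OF z'w'(2)] p by auto
          then show False using \<open>z \<noteq> w\<close> \<open>p \<in> S\<close> ab S_def unfolding z'_def by (auto split: if_splits)
        qed
        show ?thesis using 1 2 3 4 unfolding C_def z'_def w'_def by blast
      qed
      have fiS: "finite (insert a S)" using fS by simp
      have ne: "C z \<noteq> {}" if "z \<in> insert a S" for z using conn[OF that] conn_nonempty by blast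
      have "card (C ` insert a S) = k" using disjoint_subfamily(1)[OF fiS ne disj] c1 CC(2) by simp
      moreover have "pairwise disjnt (C ` insert a S)" using disjoint_subfamily(2)[OF fiS ne disj] .
      moreover have "C z \<subseteq> V \<and> C z \<inter> A \<noteq> {} \<and> C z \<inter> B \<noteq> {}" if z: "z \<in> insert a S" for z
      proof -
        have "f z \<in> CC" "h (if z = a then b else z) \<in> DD" using f[OF z] h[OF hz[OF z]] by simp_all
        from CC(4)[OF this(1)] DD(4)[OF this(2)] show ?thesis using PQ(1) unfolding C_def by auto
      qed
      ultimately show ?thesis using conn fiS by (intro exI[of _ "C ` insert a S"]) simp
    qed
  qed
qed

corollary menger_indexed:
  assumes "simple_graph V E" "A \<subseteq> V" "B \<subseteq> V"
    and "\<And>P Q. P \<union> Q = V \<Longrightarrow> A \<subseteq> P \<Longrightarrow> B \<subseteq> Q \<Longrightarrow> sep E P Q \<Longrightarrow> card A \<le> card (P \<inter> Q)"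
  obtains C where "\<And>z. z \<in> A \<Longrightarrow> conn E (C z) \<and> C z \<subseteq> V \<and> C z \<inter> A = {z} \<and> C z \<inter> B \<noteq> {}"
    "\<And>z y. z \<in> A \<Longrightarrow> y \<in> A \<Longrightarrow> z \<noteq> y \<Longrightarrow> C z \<inter> C y = {}"
proof -
  obtain CC where CC: "finite CC" "card CC = card A" "pairwise disjnt CC"
    "\<And>C. C \<in> CC \<Longrightarrow> conn E C \<and> C \<subseteq> V \<and> C \<inter> A \<noteq> {} \<and> C \<inter> B \<noteq> {}"
    using menger[OF assms] by blast
  have fA: "finite A" using assms(1,2) simple_graphD(1) finite_subset by blast
  obtain f where f: "\<And>z. z \<in> A \<Longrightarrow> f z \<in> CC \<and> f z \<inter> A = {z}"
    using reps_of_disjoint[OF fA CC(2,1) _ CC(3)] CC(4) by metis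
  show ?thesis
  proof (rule that[of f])
    fix z assume "z \<in> A" then show "conn E (f z) \<and> f z \<subseteq> V \<and> f z \<inter> A = {z} \<and> f z \<inter> B \<noteq> {}" using f CC(4) by blast
  next
    fix z y assume zy: "z \<in> A" "y \<in> A" "z \<noteq> y"
    then have "f z \<noteq> f y" using f by (metis singleton_inject)
    then show "f z \<inter> f y = {}" using f zy CC(3) unfolding pairwise_def disjnt_def by blast
  qed
qed

section \<open>Hall's theorem with deficiency\<close>

text \<open>Induction on the number of sets. A tight proper subfamily is represented first, and the
  rest still satisfies the condition after its elements are removed; if there is none, every proper
  subfamily has a surplus and one element may be spent freely.\<close>

lemma hall:
  fixes N :: "'b \<Rightarrow> 'c set"
  assumes "finite P" "\<And>i. i \<in> P \<Longrightarrow> finite (N i)" "\<And>J. J \<subseteq> P \<Longrightarrow> card J \<le> card (\<Union>i\<in>J. N i)"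
  shows "\<exists>f. inj_on f P \<and> (\<forall>i\<in>P. f i \<in> N i)"
  using assms
proof (induction "card P" arbitrary: P N rule: less_induct)
  case less
  show ?case
  proof (cases "P = {}")
    case True then show ?thesis by simp
  next
    case False
    show ?thesis
    proof (cases "\<exists>J. J \<subseteq> P \<and> J \<noteq> {} \<and> J \<noteq> P \<and> card (\<Union>i\<in>J. N i) \<le> card J")
      case True
      then obtain J where J: "J \<subseteq> P" "J \<noteq> {}" "J \<noteq> P" "card (\<Union>i\<in>J. N i) \<le> card J" by blast
      have fJ: "finite J" using J less.prems(1) finite_subset by blast
      have lt1: "card J < card P" using J less.prems(1) by (simp add: psubset_card_mono psubsetI)
      have "\<exists>f. inj_on f J \<and> (\<forall>i\<in>J. f i \<in> N i)"
        by (rule less.hyps[OF lt1 fJ]) (use less.prems(2,3) J(1) in auto)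
      then obtain f where f: "inj_on f J" "\<And>i. i \<in> J \<Longrightarrow> f i \<in> N i" by blast
      define NJ where "NJ = (\<Union>i\<in>J. N i)"
      have lt2: "card (P - J) < card P"
        by (rule psubset_card_mono[OF less.prems(1)]) (use J in auto)
      have "\<exists>g. inj_on g (P - J) \<and> (\<forall>i\<in>P - J. g i \<in> N i - NJ)"
      proof (rule less.hyps[OF lt2])
        fix K assume K: "K \<subseteq> P - J"
        have fK: "finite K" using K less.prems(1) finite_subset by blast
        have "card K + card J = card (K \<union> J)" using K fK fJ by (intro card_Un_disjoint[symmetric]) auto
        also have "\<dots> \<le> card (\<Union>i\<in>K \<union> J. N i)" using K J by (intro less.prems(3)) auto
        also have "(\<Union>i\<in>K \<union> J. N i) = (\<Union>i\<in>K. N i - NJ) \<union> NJ" unfolding NJ_def by auto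
        also have "card \<dots> \<le> card (\<Union>i\<in>K. N i - NJ) + card NJ" by (rule card_Un_le)
        finally show "card K \<le> card (\<Union>i\<in>K. N i - NJ)" using J(4) unfolding NJ_def by linarith
      qed (use less.prems in auto)
      then obtain g where g: "inj_on g (P - J)" "\<And>i. i \<in> P - J \<Longrightarrow> g i \<in> N i - NJ" by blast
      have fNJ: "\<And>i. i \<in> J \<Longrightarrow> f i \<in> NJ" using f(2) unfolding NJ_def by blast
      define h where "h i = (if i \<in> J then f i else g i)" for i
      have "inj_on h P"
      proof (rule inj_onI)
        fix x y assume xy: "x \<in> P" "y \<in> P" "h x = h y"
        consider "x \<in> J" "y \<in> J" | "x \<notin> J" "y \<notin> J" | "x \<in> J" "y \<notin> J" | "x \<notin> J" "y \<in> J" by blast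
        then show "x = y"
        proof cases
          case 1 then show ?thesis using xy f(1) unfolding h_def inj_on_def by auto
        next
          case 2 then show ?thesis using xy g(1) unfolding h_def inj_on_def by auto
        next
          case 3 then show ?thesis using xy g(2)[of y] fNJ[of x] unfolding h_def by auto
        next
          case 4 then show ?thesis using xy g(2)[of x] fNJ[of y] unfolding h_def by auto
        qed
      qed
      moreover have "\<forall>i\<in>P. h i \<in> N i" using f(2) g(2) unfolding h_def by auto
      ultimately show ?thesis by blast
    next
      case no: False
      obtain p where p: "p \<in> P" using False by blast
      have "card {p} \<le> card (\<Union>i\<in>{p}. N i)" using p by (intro less.prems(3)) auto
      then obtain x where x: "x \<in> N p" by (cases "N p = {}") auto
      have lt: "card (P - {p}) < card P" using p less.prems(1) by (rule card_Diff1_less[rotated])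
      have "\<exists>g. inj_on g (P - {p}) \<and> (\<forall>i\<in>P - {p}. g i \<in> N i - {x})"
      proof (rule less.hyps[OF lt])
        fix K assume K: "K \<subseteq> P - {p}"
        show "card K \<le> card (\<Union>i\<in>K. N i - {x})"
        proof (cases "K = {}")
          case nK: False
          have fK: "finite K" using K less.prems(1) finite_subset by blast
          have "K \<subseteq> P" "K \<noteq> P" using K p by auto
          then have "card K < card (\<Union>i\<in>K. N i)" using no nK by (meson linorder_not_le)
          moreover have "(\<Union>i\<in>K. N i - {x}) = (\<Union>i\<in>K. N i) - {x}" by auto
          moreover have "finite (\<Union>i\<in>K. N i)" using fK K less.prems(2) by blast
          moreover have "card A - 1 \<le> card (A - {x})" for A by (simp add: card_Diff_singleton_if)
          ultimately show ?thesis by (metis One_nat_def Suc_leI Suc_le_mono Suc_pred le_trans less_nat_zero_code not_gr_zero)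
        qed simp
      qed (use less.prems in auto)
      then obtain g where g: "inj_on g (P - {p})" "\<And>i. i \<in> P - {p} \<Longrightarrow> g i \<in> N i - {x}" by blast
      define h where "h i = (if i = p then x else g i)" for i
      have "inj_on h P"
      proof (rule inj_onI)
        fix y z assume yz: "y \<in> P" "z \<in> P" "h y = h z"
        then show "y = z" using g(1) g(2)[of y] g(2)[of z] unfolding h_def inj_on_def
          by (auto split: if_splits)
      qed
      moreover have "\<forall>i\<in>P. h i \<in> N i" using g(2) x unfolding h_def by auto
      ultimately show ?thesis by blast
    qed
  qed
qed

lemma greedy_reps:
  assumes "finite D" "\<And>i. i \<in> D \<Longrightarrow> finite (S i) \<and> card D \<le> card (S i)"
  shows "\<exists>f. inj_on f D \<and> (\<forall>i\<in>D. f i \<in> S i)"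
proof (rule hall[OF assms(1)])
  fix J assume J: "J \<subseteq> D"
  show "card J \<le> card (\<Union>i\<in>J. S i)"
  proof (cases "J = {}")
    case False
    then obtain j where j: "j \<in> J" by blast
    have fJ: "finite J" using J assms(1) finite_subset by blast
    have "card J \<le> card D" using J assms(1) by (rule card_mono[rotated])
    also have "\<dots> \<le> card (S j)" using j J assms(2) by blast
    also have "\<dots> \<le> card (\<Union>i\<in>J. S i)" by (rule card_mono) (use fJ j J assms(2) in auto)
    finally show ?thesis .
  qed simp
qed (use assms(2) in blast)

text \<open>Let \<open>I\<close> have the largest deficiency, q. After q dummy elements are added to
  every set Hall's condition holds, and \<open>I\<close> alone needs all of the dummies, so that
  only indices in \<open>I\<close> go without a true representative. The elements used by
  \<open>I - D\<close> therefore exhaust the union over \<open>I\<close>, which is what the linking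
  argument exploits.\<close>

lemma hall_deficiency:
  fixes N :: "'b \<Rightarrow> 'c set"
  assumes "finite P" "\<And>i. i \<in> P \<Longrightarrow> finite (N i)"
  obtains I D f where "D \<subseteq> I" "I \<subseteq> P" "inj_on f (P - D)" "\<And>i. i \<in> P - D \<Longrightarrow> f i \<in> N i"
    "card I = card D + card (\<Union>i\<in>I. N i)"
proof -
  define g where "g J = int (card J) - int (card (\<Union>i\<in>J. N i))" for J
  have fin: "finite (g ` Pow P)" using assms(1) by simp
  have "Max (g ` Pow P) \<in> g ` Pow P" by (rule Max_in[OF fin]) auto
  then obtain I where I: "I \<subseteq> P" "g I = Max (g ` Pow P)" by auto
  have gI: "g J \<le> g I" if "J \<subseteq> P" for J using Max_ge[OF fin] that I by simp
  have "0 \<le> g I" using gI[of "{}"] unfolding g_def by simp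
  define q where "q = nat (g I)"
  have q: "card I = q + card (\<Union>i\<in>I. N i)" using \<open>0 \<le> g I\<close> unfolding q_def g_def by linarith
  have hallJ: "card J \<le> q + card (\<Union>i\<in>J. N i)" if "J \<subseteq> P" for J
    using gI[OF that] \<open>0 \<le> g I\<close> unfolding q_def g_def by linarith
  define N' where "N' i = Inl ` N i \<union> Inr ` {..<q}" for i :: 'b
  have "\<exists>f. inj_on f P \<and> (\<forall>i\<in>P. f i \<in> N' i)"
  proof (rule hall[OF assms(1)])
    fix J assume J: "J \<subseteq> P"
    show "card J \<le> card (\<Union>i\<in>J. N' i)"
    proof (cases "J = {}")
      case False
      have fJ: "finite J" using J assms(1) finite_subset by blast
      have "(\<Union>i\<in>J. N' i) = Inl ` (\<Union>i\<in>J. N i) \<union> Inr ` {..<q}" using False unfolding N'_def by auto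
      also have "card \<dots> = card (Inl ` (\<Union>i\<in>J. N i) :: ('c + nat) set) + card (Inr ` {..<q} :: ('c + nat) set)"
        using fJ J assms(2) by (intro card_Un_disjoint) auto
      also have "\<dots> = card (\<Union>i\<in>J. N i) + q" by (simp add: card_image)
      finally show ?thesis using hallJ[OF J] by simp
    qed simp
  qed (use assms(2) in \<open>simp add: N'_def\<close>)
  then obtain f where f: "inj_on f P" "\<And>i. i \<in> P \<Longrightarrow> f i \<in> N' i" by blast
  define D where "D = {i \<in> P. f i \<in> Inr ` {..<q}}"
  have fP: "finite D" "finite I" using assms(1) I finite_subset unfolding D_def by auto
  have "inj_on f D" by (rule inj_on_subset[OF f(1)]) (auto simp: D_def)
  then have "card D = card (f ` D)" by (simp add: card_image)
  also have "\<dots> \<le> card (Inr ` {..<q} :: ('c + nat) set)" by (rule card_mono) (auto simp: D_def)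
  finally have Dq: "card D \<le> q" by (simp add: card_image)
  have "f ` (I - D) \<subseteq> Inl ` (\<Union>i\<in>I. N i)" using f(2) I(1) unfolding D_def N'_def by fastforce
  moreover have finU: "finite (\<Union>i\<in>I. N i)" using fP(2) I(1) assms(2) by auto
  ultimately have "card (f ` (I - D)) \<le> card (Inl ` (\<Union>i\<in>I. N i) :: ('c + nat) set)"
    by (intro card_mono finite_imageI finU)
  moreover have "inj_on f (I - D)" using f(1) I(1) by (meson Diff_subset inj_on_subset order_trans)
  ultimately have "card (I - D) \<le> card (\<Union>i\<in>I. N i)" by (simp add: card_image)
  moreover have "card I = card (I \<inter> D) + card (I - D)" using fP by (simp add: card_Int_Diff)
  ultimately have qD: "q \<le> card (I \<inter> D)" using q by linarith
  have "card (I \<inter> D) \<le> card D" using fP by (intro card_mono) auto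
  then have eq: "card (I \<inter> D) = card D" "card D = q" using qD Dq by linarith+
  then have "I \<inter> D = D" using fP by (intro card_subset_eq) auto
  then have DI: "D \<subseteq> I" by blast
  define f' where "f' i = projl (f i)" for i
  have fl: "f i = Inl (f' i) \<and> f' i \<in> N i" if "i \<in> P - D" for i
    using f(2)[of i] that unfolding f'_def D_def N'_def by auto
  have "inj_on f' (P - D)"
  proof (rule inj_onI)
    fix x y assume "x \<in> P - D" "y \<in> P - D" "f' x = f' y"
    then show "x = y" using fl[of x] fl[of y] f(1) unfolding inj_on_def by simp
  qed
  then show ?thesis using that[of D I f'] DI I(1) fl q eq(2) by simp
qed

section \<open>Linking in dense graphs\<close>

definition terminals :: "'a set \<Rightarrow> nat \<Rightarrow> (nat \<Rightarrow> 'a) \<Rightarrow> (nat \<Rightarrow> 'a) \<Rightarrow> bool" where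
  "terminals U t s u \<longleftrightarrow> s ` {..<t} \<subseteq> U \<and> u ` {..<t} \<subseteq> U \<and> inj_on s {..<t} \<and> inj_on u {..<t} \<and>
     s ` {..<t} \<inter> u ` {..<t} = {}"

definition linkage :: "('a \<Rightarrow> 'a \<Rightarrow> bool) \<Rightarrow> 'a set \<Rightarrow> nat \<Rightarrow> (nat \<Rightarrow> 'a) \<Rightarrow> (nat \<Rightarrow> 'a) \<Rightarrow> (nat \<Rightarrow> 'a set) \<Rightarrow> bool" where
  "linkage E U t s u C \<longleftrightarrow> (\<forall>i<t. conn E (C i) \<and> C i \<subseteq> U \<and> s i \<in> C i \<and> u i \<in> C i) \<and>
     (\<forall>i<t. \<forall>j<t. i \<noteq> j \<longrightarrow> C i \<inter> C j = {})"

text \<open>This is vacuous if \<open>U\<close> has fewer than \<open>2 * t\<close> vertices, so the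
  bound \<open>2 * t \<le> card U\<close> accompanies it in what follows.\<close>

definition pair_linked :: "('a \<Rightarrow> 'a \<Rightarrow> bool) \<Rightarrow> 'a set \<Rightarrow> nat \<Rightarrow> bool" where
  "pair_linked E U t \<longleftrightarrow> (\<forall>s u. terminals U t s u \<longrightarrow> (\<exists>C. linkage E U t s u C))"

lemma terminalsD:
  assumes "terminals U t s u"
  shows "\<And>i. i < t \<Longrightarrow> s i \<in> U" "\<And>i. i < t \<Longrightarrow> u i \<in> U"
    "\<And>i j. i < t \<Longrightarrow> j < t \<Longrightarrow> s i = s j \<Longrightarrow> i = j" "\<And>i j. i < t \<Longrightarrow> j < t \<Longrightarrow> u i = u j \<Longrightarrow> i = j"
    "\<And>i j. i < t \<Longrightarrow> j < t \<Longrightarrow> s i \<noteq> u j"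
proof -
  show "s i \<in> U" "u i \<in> U" if "i < t" for i using assms that unfolding terminals_def by auto
  show "i = j" if "i < t" "j < t" "s i = s j" for i j using assms that unfolding terminals_def inj_on_def by auto
  show "i = j" if "i < t" "j < t" "u i = u j" for i j using assms that unfolding terminals_def inj_on_def by auto
  show "s i \<noteq> u j" if "i < t" "j < t" for i j
  proof
    assume "s i = u j"
    moreover have "u j \<in> u ` {..<t}" "s i \<in> s ` {..<t}" using that by auto
    ultimately have "s i \<in> s ` {..<t} \<inter> u ` {..<t}" by simp
    then show False using assms unfolding terminals_def by simp
  qed
qed

lemma terminals_card:
  assumes "terminals U t s u"
  shows "card (s ` {..<t} \<union> u ` {..<t}) = 2 * t"
  using assms card_image[of s "{..<t}"] card_image[of u "{..<t}"]
    card_Un_disjoint[of "s ` {..<t}" "u ` {..<t}"] unfolding terminals_def by simp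

text \<open>Nonadjacent pairs are joined through distinct common neighbours as far as Hall's theorem
  allows. The pairs left over, \<open>D\<close>, are joined by paths s-a-b-u through the remaining
  set \<open>R\<close>. There is room for these because the deficient family \<open>I\<close> has
  used up all its common neighbours: a vertex of \<open>R\<close> misses a terminal of each pair in
  \<open>I\<close>, so more of its neighbours lie in \<open>R\<close>.\<close>

lemma pair_linked_dense:
  assumes sy: "symp E" and ir: "\<And>x. \<not> E x x" and fU: "finite U"
    and deg: "\<And>v. v \<in> U \<Longrightarrow> d \<le> card {w \<in> U. E v w}"
    and dc: "card U + c \<le> 2 * d" and ct: "5 * t \<le> 2 * c" and dt: "3 * t \<le> d"
  shows "pair_linked E U t"
  unfolding pair_linked_def
proof (intro allI impI)
  fix s u assume tm: "terminals U t s u"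
  note tm' = terminalsD[OF tm]
  define T where "T = s ` {..<t} \<union> u ` {..<t}"
  have cT: "card T = 2 * t" unfolding T_def by (rule terminals_card[OF tm])
  have TU: "T \<subseteq> U" using tm' unfolding T_def by auto
  have fT: "finite T" unfolding T_def by simp
  define Nb where "Nb v = {w \<in> U. E v w}" for v
  have fNb: "finite (Nb v)" for v unfolding Nb_def using fU by simp
  have NbU: "Nb v \<subseteq> U" for v unfolding Nb_def by blast
  have dNb: "d \<le> card (Nb v)" if "v \<in> U" for v using deg[OF that] unfolding Nb_def .
  define P where "P = {i \<in> {..<t}. \<not> E (s i) (u i)}"
  have fP: "finite P" unfolding P_def by simp
  have cP: "card P \<le> t" using card_mono[of "{..<t}" P] unfolding P_def by auto
  define CN where "CN i = Nb (s i) \<inter> Nb (u i) - T" for i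
  have fCN: "finite (CN i)" for i unfolding CN_def using fNb by simp
  have T2: "card (T - {s i, u i}) = 2 * t - 2" if "i < t" for i
    using that tm'(5)[of i i] fT cT unfolding T_def by (subst card_Diff_subset) auto
  \<comment> \<open>Inclusion and exclusion in \<open>U - {s i, u i}\<close> gives
    \<open>c + 2\<close> common neighbours, of which at most \<open>2 * t - 2\<close> are
    terminals.\<close>
  have cCN: "c + 4 \<le> card (CN i) + 2 * t" if i: "i \<in> P" for i
  proof -
    have it: "i < t" and ne: "\<not> E (s i) (u i)" "\<not> E (u i) (s i)" using i sy unfolding P_def by (auto dest: sympD)
    have "Nb (s i) \<union> Nb (u i) \<subseteq> U - {s i, u i}" using ne ir unfolding Nb_def by auto
    then have "card (Nb (s i) \<union> Nb (u i)) \<le> card (U - {s i, u i})" using fU by (intro card_mono) auto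
    also have "\<dots> = card U - 2" using tm'[of i] tm'(5)[of i i] it fU by (subst card_Diff_subset) auto
    finally have 1: "card (Nb (s i) \<union> Nb (u i)) \<le> card U - 2" .
    have "2 \<le> card U" using card_mono[OF fU TU] cT it by linarith
    moreover have "card (Nb (s i)) + card (Nb (u i)) = card (Nb (s i) \<union> Nb (u i)) + card (Nb (s i) \<inter> Nb (u i))"
      by (rule card_Un_Int[OF fNb fNb])
    ultimately have 2: "c + 2 \<le> card (Nb (s i) \<inter> Nb (u i))"
      using 1 dNb[OF tm'(1)[OF it]] dNb[OF tm'(2)[OF it]] dc by linarith
    have "Nb (s i) \<inter> Nb (u i) \<subseteq> CN i \<union> (T - {s i, u i})" using ne ir unfolding CN_def Nb_def by auto
    then have "card (Nb (s i) \<inter> Nb (u i)) \<le> card (CN i \<union> (T - {s i, u i}))" using fCN fT by (intro card_mono) auto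
    also have "\<dots> \<le> card (CN i) + (2 * t - 2)" using card_Un_le[of "CN i" "T - {s i, u i}"] T2[OF it] by simp
    finally show ?thesis using 2 it by linarith
  qed
  obtain I D f where h: "D \<subseteq> I" "I \<subseteq> P" "inj_on f (P - D)" "\<And>i. i \<in> P - D \<Longrightarrow> f i \<in> CN i"
    "card I = card D + card (\<Union>i\<in>I. CN i)"
    by (rule hall_deficiency[where N = CN, OF fP fCN]) (rule that)
  have DP: "D \<subseteq> P" using h(1,2) by (rule order_trans)
  have fD: "finite D" "finite I" using finite_subset[OF DP fP] finite_subset[OF h(2) fP] by simp_all
  define M where "M = f ` (P - D)"
  have fM: "finite M" unfolding M_def using fP by simp
  have MT: "M \<inter> T = {}" and MU: "M \<subseteq> U" using h(4) unfolding M_def CN_def Nb_def by auto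
  have cM: "card M + card D \<le> t"
    using card_image[OF h(3)] card_Diff_subset[OF fD(1) DP] card_mono[OF fP DP] cP unfolding M_def by linarith
  define R where "R = U - T - M"
  have fR: "finite R" unfolding R_def using fU by simp
  have cR: "card R + 2 * t + card M = card U"
  proof -
    have "card (T \<union> M) = 2 * t + card M" using cT fT fM MT by (subst card_Un_disjoint) auto
    moreover have "R = U - (T \<union> M)" unfolding R_def by auto
    moreover have "T \<union> M \<subseteq> U" using TU MU by simp
    ultimately show ?thesis using card_Diff_subset[of "T \<union> M" U] card_mono[OF fU, of "T \<union> M"] fT fM by simp
  qed
  have CNM: "CN j \<subseteq> M" if "j \<in> I" for j
  proof -
    have sub: "f ` (I - D) \<subseteq> (\<Union>i\<in>I. CN i)" using h(2,4) by auto
    have "inj_on f (I - D)" by (rule inj_on_subset[OF h(3)]) (use h(2) in auto)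
    then have "card (f ` (I - D)) = card (\<Union>i\<in>I. CN i)"
      using h(1,5) fD by (simp add: card_image card_Diff_subset)
    then have "f ` (I - D) = (\<Union>i\<in>I. CN i)" using sub fD fCN by (intro card_subset_eq) auto
    moreover have "f ` (I - D) \<subseteq> M" using h(2) unfolding M_def by auto
    ultimately show ?thesis using that by auto
  qed
  have outside: "card (Nb v) \<le> card (Nb v \<inter> R) + card M + card (Nb v \<inter> T)" for v
  proof -
    have "Nb v \<subseteq> (Nb v \<inter> R) \<union> M \<union> (Nb v \<inter> T)" using NbU unfolding R_def by blast
    then have "card (Nb v) \<le> card ((Nb v \<inter> R) \<union> M \<union> (Nb v \<inter> T))"
      using fR fM fT by (intro card_mono) auto
    also have "\<dots> \<le> card (Nb v \<inter> R) + card M + card (Nb v \<inter> T)"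
      using card_Un_le[of "(Nb v \<inter> R) \<union> M" "Nb v \<inter> T"] card_Un_le[of "Nb v \<inter> R" M] by linarith
    finally show ?thesis .
  qed
  have termT: "card (Nb (s i) \<inter> T) \<le> 2 * t - 2" "card (Nb (u i) \<inter> T) \<le> 2 * t - 2" if i: "i \<in> P" for i
  proof -
    have it: "i < t" and ne: "\<not> E (s i) (u i)" "\<not> E (u i) (s i)" using i sy unfolding P_def by (auto dest: sympD)
    have "Nb (s i) \<inter> T \<subseteq> T - {s i, u i}" "Nb (u i) \<inter> T \<subseteq> T - {s i, u i}" using ne ir unfolding Nb_def by auto
    then show "card (Nb (s i) \<inter> T) \<le> 2 * t - 2" "card (Nb (u i) \<inter> T) \<le> 2 * t - 2"
      using T2[OF it] fT by (metis card_mono finite_Diff)+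
  qed
  have Pt: "i < t" if "i \<in> P" for i using that unfolding P_def by simp
  have "\<exists>a. inj_on a D \<and> (\<forall>i\<in>D. a i \<in> Nb (s i) \<inter> R)"
  proof (rule greedy_reps[OF fD(1)])
    fix i assume i: "i \<in> D"
    then have iP: "i \<in> P" using DP by blast
    have "d \<le> card (Nb (s i) \<inter> R) + card M + (2 * t - 2)"
      using dNb[OF tm'(1)[OF Pt[OF iP]]] outside[of "s i"] termT(1)[OF iP] by linarith
    then have "card D \<le> card (Nb (s i) \<inter> R)" using dt cM Pt[OF iP] by linarith
    then show "finite (Nb (s i) \<inter> R) \<and> card D \<le> card (Nb (s i) \<inter> R)" using fR by simp
  qed
  then obtain a where a: "inj_on a D" "\<And>i. i \<in> D \<Longrightarrow> a i \<in> Nb (s i) \<inter> R" by blast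
  have "\<exists>b. inj_on b D \<and> (\<forall>i\<in>D. b i \<in> (Nb (a i) \<inter> R) \<inter> (Nb (u i) \<inter> R) - a ` D)"
  proof (rule greedy_reps[OF fD(1)])
    fix i assume i: "i \<in> D"
    then have iP: "i \<in> P" and iI: "i \<in> I" using DP h(1) by auto
    have aR: "a i \<in> R" using a(2)[OF i] by blast
    define g where "g j = (if E (a i) (s j) then u j else s j)" for j
    have It: "j < t" if "j \<in> I" for j using that h(2) Pt by auto
    have one: "\<not> (E (a i) (s j) \<and> E (a i) (u j))" if j: "j \<in> I" for j
    proof
      assume e: "E (a i) (s j) \<and> E (a i) (u j)"
      then have "E (s j) (a i)" "E (u j) (a i)" using sy by (auto dest: sympD)
      then have "a i \<in> CN j" using aR unfolding CN_def Nb_def R_def by simp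
      then show False using CNM[OF j] aR unfolding R_def by blast
    qed
    have injg: "inj_on g I"
    proof (rule inj_onI)
      fix x y assume "x \<in> I" "y \<in> I" "g x = g y"
      then show "x = y" using It tm'(3)[of x y] tm'(4)[of x y] tm'(5)[of x y] tm'(5)[of y x] unfolding g_def
        by (auto split: if_splits)
    qed
    have gT: "g ` I \<subseteq> T" using It unfolding g_def T_def by auto
    have "Nb (a i) \<inter> T \<subseteq> T - g ` I" using one unfolding g_def Nb_def by auto
    then have "card (Nb (a i) \<inter> T) \<le> card (T - g ` I)" using fT by (intro card_mono) auto
    also have "\<dots> = 2 * t - card I" using gT fT cT card_image[OF injg] by (simp add: card_Diff_subset finite_subset)
    finally have 1: "card (Nb (a i) \<inter> T) \<le> 2 * t - card I" .
    have I2: "card I \<le> 2 * t" using card_mono[OF fT gT] cT card_image[OF injg] by simp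
    have 2: "d + card I \<le> card (Nb (a i) \<inter> R) + card M + 2 * t"
      using dNb[of "a i"] aR outside[of "a i"] 1 I2 unfolding R_def by auto
    have 3: "d + 2 \<le> card (Nb (u i) \<inter> R) + card M + 2 * t"
      using dNb[OF tm'(2)[OF Pt[OF iP]]] outside[of "u i"] termT(2)[OF iP] Pt[OF iP] by linarith
    define X where "X = Nb (a i) \<inter> R"
    define Y where "Y = Nb (u i) \<inter> R"
    have XY: "X \<subseteq> R" "Y \<subseteq> R" unfolding X_def Y_def by auto
    then have fXY: "finite X" "finite Y" using fR finite_subset by blast+
    have "card X + card Y = card (X \<union> Y) + card (X \<inter> Y)" using fXY by (rule card_Un_Int)
    moreover have "card (X \<union> Y) \<le> card R" using XY fR by (intro card_mono) auto
    ultimately have 4: "card X + card Y \<le> card R + card (X \<inter> Y)" by linarith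
    have "card (CN i) \<le> card (\<Union>i\<in>I. CN i)" using iI fD fCN by (intro card_mono) auto
    then have 5: "card D + c + 4 \<le> card I + 2 * t" using cCN[OF iP] h(5) by linarith
    \<comment> \<open>The estimates add up to at least \<open>2 * c + 2 * card D + 6 - 5 * t\<close>
      common neighbours in \<open>R\<close>, which is where \<open>5 * t \<le> 2 * c\<close> comes
      from. Of the \<open>2 * card D\<close> that remain, half may be lost to the vertices
      \<open>a i\<close>.\<close>
    have "2 * card D \<le> card (X \<inter> Y)" using 2 3 4 5 cR cM dc ct unfolding X_def[symmetric] Y_def[symmetric] by linarith
    moreover have "card (X \<inter> Y) - card (a ` D) \<le> card (X \<inter> Y - a ` D)" using fD by (intro diff_card_le_card_Diff) simp
    ultimately have "card D \<le> card (X \<inter> Y - a ` D)" using card_image[OF a(1)] by linarith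
    then show "finite ((Nb (a i) \<inter> R) \<inter> (Nb (u i) \<inter> R) - a ` D) \<and>
      card D \<le> card ((Nb (a i) \<inter> R) \<inter> (Nb (u i) \<inter> R) - a ` D)" using fXY unfolding X_def Y_def by simp
  qed
  then obtain b where b: "inj_on b D" "\<And>i. i \<in> D \<Longrightarrow> b i \<in> (Nb (a i) \<inter> R) \<inter> (Nb (u i) \<inter> R) - a ` D" by blast
  define Z where "Z i = (if i \<in> D then {a i, b i} else if i \<in> P then {f i} else {})" for i
  define C where "C i = {s i, u i} \<union> Z i" for i
  have sE: "E x y \<Longrightarrow> E y x" for x y using sy by (rule sympD)
  have ZU: "Z i \<subseteq> U" for i
    using a(2)[of i] b(2)[of i] h(4)[of i] NbU unfolding Z_def CN_def by auto
  have CU: "C i \<subseteq> U" if "i < t" for i using ZU[of i] tm'(1,2)[OF that] unfolding C_def by simp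
  have "conn E (C i) \<and> C i \<subseteq> U \<and> s i \<in> C i \<and> u i \<in> C i" if i: "i < t" for i
  proof -
    consider "i \<in> D" | "i \<notin> D" "i \<in> P" | "i \<notin> P" "i \<notin> D" using DP by blast
    then have "conn E (C i) \<and> C i \<subseteq> U"
    proof cases
      case 1
      have "E (s i) (a i)" "E (a i) (b i)" "E (b i) (u i)" using a(2)[OF 1] b(2)[OF 1] sE unfolding Nb_def by auto
      then have "conn E (set [s i, a i, b i, u i])" by (intro conn_walk[OF sy]) auto
      moreover have "set [s i, a i, b i, u i] = C i" unfolding C_def Z_def using 1 by auto
      ultimately show ?thesis using CU[OF i] by simp
    next
      case 2
      have "E (s i) (f i)" "E (f i) (u i)" using h(4)[of i] 2 sE unfolding Nb_def CN_def by auto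
      then have "conn E (set [s i, f i, u i])" by (intro conn_walk[OF sy]) auto
      moreover have "set [s i, f i, u i] = C i" unfolding C_def Z_def using 2 by auto
      ultimately show ?thesis using CU[OF i] by simp
    next
      case 3
      then have "conn E (set [s i, u i])" using i unfolding P_def by (intro conn_walk[OF sy]) auto
      moreover have "set [s i, u i] = C i" unfolding C_def Z_def using 3 by auto
      ultimately show ?thesis using CU[OF i] by simp
    qed
    then show ?thesis unfolding C_def by simp
  qed
  moreover have "C i \<inter> C j = {}" if i: "i < t" and j: "j < t" and ij: "i \<noteq> j" for i j
  proof -
    have ZT: "Z i \<inter> T = {}" for i
      using a(2)[of i] b(2)[of i] h(4)[of i] unfolding Z_def R_def CN_def by auto
    have sT: "s i \<in> T" "u i \<in> T" if "i < t" for i using that unfolding T_def by auto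
    have ZM: "Z i \<subseteq> R" if "i \<in> D" for i using a(2)[OF that] b(2)[OF that] that unfolding Z_def by auto
    have ZM2: "Z i \<subseteq> M" if "i \<notin> D" for i using that unfolding Z_def M_def by auto
    have RM: "R \<inter> M = {}" unfolding R_def by blast
    have "Z i \<inter> Z j = {}"
    proof (cases "i \<in> D \<longleftrightarrow> j \<in> D")
      case False
      then show ?thesis using ZM[of i] ZM[of j] ZM2[of i] ZM2[of j] RM by blast
    next
      case True
      show ?thesis
      proof (cases "i \<in> D")
        case iD: True
        then have jD: "j \<in> D" using True by simp
        have "a i \<noteq> a j" "b i \<noteq> b j" using iD jD a(1) b(1) ij unfolding inj_on_def by auto
        moreover have "a x \<noteq> b y" if "x \<in> D" "y \<in> D" for x y
          using b(2)[OF that(2)] imageI[OF that(1), of a] by (metis DiffD2)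
        ultimately have "a i \<noteq> a j" "b i \<noteq> b j" "a i \<noteq> b j" "a j \<noteq> b i" using iD jD by simp_all
        then show ?thesis using True iD unfolding Z_def by auto
      next
        case iD: False
        then show ?thesis using True h(3) ij unfolding Z_def inj_on_def by auto
      qed
    qed
    moreover have "{s i, u i} \<inter> {s j, u j} = {}"       using tm'(3)[OF i j] tm'(4)[OF i j] tm'(5)[OF i j] tm'(5)[OF j i] ij by auto
    ultimately show ?thesis using ZT[of i] ZT[of j] sT[OF i] sT[OF j] unfolding C_def by blast
  qed
  ultimately show "\<exists>C. linkage E U t s u C" unfolding linkage_def by blast
qed

section \<open>Linking in graphs whose minimum degree is about half the order\<close>

lemma successively_take: "successively E xs \<Longrightarrow> successively E (take n xs)"
  by (metis append_take_drop_id successively_append_iff)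

lemma successively_drop: "successively E xs \<Longrightarrow> successively E (drop n xs)"
  by (metis append_take_drop_id successively_append_iff)

text \<open>A graph of minimum degree at least half its order in which the pairs \<open>(s i, u i)\<close> cannot be
  linked splits, after deleting a partial linkage, into two parts, one of which is much denser.\<close>

locale stuck_linkage =
  fixes E :: "'a \<Rightarrow> 'a \<Rightarrow> bool" and L :: "'a set" and D t :: nat and s u :: "nat \<Rightarrow> 'a"
  assumes sy: "symp E" and ir: "\<And>x. \<not> E x x" and fL: "finite L" and cL: "card L \<le> 2 * D + 1"
    and Dt: "6 * t \<le> D" and deg: "\<And>v. v \<in> L \<Longrightarrow> D \<le> card {w \<in> L. E v w}"
    and tm: "terminals L t s u" and no: "\<not> (\<exists>C. linkage E L t s u C)"
begin

definition Nb where "Nb v = {w \<in> L. E v w}"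

definition B where "B I q i = (if i \<in> I then set (q i) else {s i, u i})" for q :: "nat \<Rightarrow> 'a list"

definition J where "J I q = (\<Union>i<t. B I q i)"

definition R where "R I q = L - J I q"

definition valid where
  "valid I q \<longleftrightarrow> I \<subseteq> {..<t} \<and>
    (\<forall>i\<in>I. q i \<noteq> [] \<and> hd (q i) = s i \<and> last (q i) = u i \<and> distinct (q i) \<and>
       successively E (q i) \<and> set (q i) \<subseteq> L) \<and>
    (\<forall>i<t. \<forall>j<t. i \<noteq> j \<longrightarrow> B I q i \<inter> B I q j = {}) \<and> card (J I q) \<le> D + 3"

definition reach where "reach Z A = {r. \<exists>a\<in>A \<inter> Z. (ind E Z)\<^sup>*\<^sup>* a r}"

lemmas tmD = terminalsD[OF tm]

lemma sE: "E x y \<Longrightarrow> E y x"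
  using sy by (rule sympD)

lemma fNb: "finite (Nb v)"
  unfolding Nb_def using fL by simp

lemma validD:
  assumes "valid I q"
  shows "\<And>i. i \<in> I \<Longrightarrow> i < t" "\<And>i. i \<in> I \<Longrightarrow> q i \<noteq> []" "\<And>i. i \<in> I \<Longrightarrow> hd (q i) = s i"
    "\<And>i. i \<in> I \<Longrightarrow> last (q i) = u i" "\<And>i. i \<in> I \<Longrightarrow> distinct (q i)"
    "\<And>i. i \<in> I \<Longrightarrow> successively E (q i)" "\<And>i. i \<in> I \<Longrightarrow> set (q i) \<subseteq> L"
    "\<And>i j. i < t \<Longrightarrow> j < t \<Longrightarrow> i \<noteq> j \<Longrightarrow> B I q i \<inter> B I q j = {}" "card (J I q) \<le> D + 3"
    "finite I"
  using assms finite_subset[of I "{..<t}"] unfolding valid_def by auto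

lemma su_B: "valid I q \<Longrightarrow> i < t \<Longrightarrow> s i \<in> B I q i \<and> u i \<in> B I q i"
  using validD(2-4)[of I q i] hd_in_set[of "q i"] last_in_set[of "q i"] unfolding B_def
  by (cases "i \<in> I") (metis, simp)

lemma fB: "finite (B I q i)"
  unfolding B_def by simp

lemma fJ: "finite (J I q)"
  unfolding J_def by (simp add: fB)

lemma fR: "finite (R I q)"
  unfolding R_def using fL by simp

lemma BL: "valid I q \<Longrightarrow> i < t \<Longrightarrow> B I q i \<subseteq> L"
  using validD(7)[of I q i] tmD(1,2)[of i] unfolding B_def by auto

lemma BJ: "i < t \<Longrightarrow> B I q i \<subseteq> J I q"
  unfolding J_def by auto

lemma JL: "valid I q \<Longrightarrow> J I q \<subseteq> L"
  using BL unfolding J_def by auto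

lemma RJ: "R I q \<inter> J I q = {}" and RL: "R I q \<subseteq> L"
  unfolding R_def by auto

lemma cB: "valid I q \<Longrightarrow> i \<in> I \<Longrightarrow> card (B I q i) = length (q i)"
  using validD(5)[of I q i] unfolding B_def by (simp add: distinct_card)

lemma cJ: "valid I q \<Longrightarrow> card (J I q) = (\<Sum>i<t. card (B I q i))"
  unfolding J_def using validD(8) by (intro card_UN_disjoint) (auto simp: fB)

lemma cR: "valid I q \<Longrightarrow> card (R I q) + card (J I q) = card L"
  unfolding R_def using JL[of I q] card_Diff_subset[OF fJ, of I q L] card_mono[OF fL, of "J I q"] by simp

lemma reach_sub: "reach Z A \<subseteq> Z"
proof
  fix r assume "r \<in> reach Z A"
  then obtain a where "a \<in> Z" "(ind E Z)\<^sup>*\<^sup>* a r" unfolding reach_def by auto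
  from this(2,1) show "r \<in> Z" by (induction rule: rtranclp_induct) (auto simp: ind_def)
qed

lemma reach_start: "a \<in> A \<Longrightarrow> a \<in> Z \<Longrightarrow> a \<in> reach Z A"
  unfolding reach_def by auto

lemma reach_step: "r \<in> reach Z A \<Longrightarrow> E r r' \<Longrightarrow> r' \<in> Z \<Longrightarrow> r' \<in> reach Z A"
proof -
  assume a: "r \<in> reach Z A" "E r r'" "r' \<in> Z"
  then have "r \<in> Z" using reach_sub by auto
  then have "ind E Z r r'" using a unfolding ind_def by simp
  then show ?thesis using a(1) unfolding reach_def by (auto intro: rtranclp.rtrancl_into_rtrancl)
qed

lemma reach_induct:
  assumes "r \<in> reach Z A" "\<And>a. a \<in> A \<Longrightarrow> a \<in> Z \<Longrightarrow> P a"
    "\<And>x y. x \<in> reach Z A \<Longrightarrow> P x \<Longrightarrow> E x y \<Longrightarrow> y \<in> Z \<Longrightarrow> P y"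
  shows "P r"
proof -
  obtain a where a: "a \<in> A" "a \<in> Z" "(ind E Z)\<^sup>*\<^sup>* a r" using assms(1) unfolding reach_def by auto
  from a(3) have "r \<in> reach Z A \<and> P r"
  proof (induction rule: rtranclp_induct)
    case base then show ?case using a assms(2) reach_start by auto
  next
    case (step y z)
    then show ?case using assms(3)[of y z] reach_step[of y Z A z] unfolding ind_def by auto
  qed
  then show ?thesis by simp
qed

lemma reach_walk:
  assumes "r \<in> reach Z A"
  obtains w where "w \<noteq> []" "hd w \<in> A" "last w = r" "successively E w" "set w \<subseteq> Z"
proof -
  have "\<exists>w. w \<noteq> [] \<and> hd w \<in> A \<and> last w = r \<and> successively E w \<and> set w \<subseteq> Z"
    using assms
  proof (rule reach_induct)
    fix a assume "a \<in> A" "a \<in> Z" then show "\<exists>w. w \<noteq> [] \<and> hd w \<in> A \<and> last w = a \<and> successively E w \<and> set w \<subseteq> Z"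
      by (intro exI[of _ "[a]"]) simp
  next
    fix x y assume "\<exists>w. w \<noteq> [] \<and> hd w \<in> A \<and> last w = x \<and> successively E w \<and> set w \<subseteq> Z" "E x y" "y \<in> Z"
    then obtain w where "w \<noteq> []" "hd w \<in> A" "last w = x" "successively E w" "set w \<subseteq> Z" "E x y" "y \<in> Z" by blast
    then show "\<exists>w. w \<noteq> [] \<and> hd w \<in> A \<and> last w = y \<and> successively E w \<and> set w \<subseteq> Z"
      by (intro exI[of _ "w @ [y]"]) (simp add: successively_append_iff)
  qed
  then show ?thesis using that by blast
qed

definition opt where
  "opt I q \<longleftrightarrow> valid I q \<and> (\<forall>I' q'. valid I' q' \<longrightarrow> card I' \<le> card I) \<and>
     (\<forall>q'. valid I q' \<longrightarrow> card (J I q) \<le> card (J I q'))"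

lemma opt_valid: "opt I q \<Longrightarrow> valid I q"
  unfolding opt_def by blast

lemma replace_J:
  assumes v: "valid I q" and i: "i < t" "i \<in> I'" "I' = I \<or> I' = insert i I"
    and xs: "xs \<noteq> []" "hd xs = s i" "last xs = u i" "distinct xs" "successively E xs"
    "set xs \<subseteq> B I q i \<union> R I q" and q': "q' = q(i := xs)"
  shows "card (J I' q') + card (B I q i) = card (J I q) + length xs"
    "card (J I' q') \<le> D + 3 \<Longrightarrow> valid I' q'"
proof -
  have B1: "B I' q' i = set xs" using i q' unfolding B_def by simp
  have B2: "B I' q' j = B I q j" if "j \<noteq> i" for j using i q' that unfolding B_def by auto
  have dj: "B I' q' j \<inter> B I' q' k = {}" if "j < t" "k < t" "j \<noteq> k" for j k
  proof -
    have "set xs \<inter> B I q k = {}" if "k < t" "k \<noteq> i" for k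
      using validD(8)[OF v, of i k] i that xs(6) BJ[of k I q] RJ[of I q] by auto
    then show ?thesis using validD(8)[OF v that] that B1 B2 by (metis inf_commute)
  qed
  have "card (J I' q') = (\<Sum>j<t. card (B I' q' j))"
    unfolding J_def using dj by (intro card_UN_disjoint) (auto simp: fB)
  also have "\<dots> = card (set xs) + (\<Sum>j\<in>{..<t} - {i}. card (B I q j))"
    using i B1 B2 by (subst sum.remove[of _ i]) auto
  finally have 1: "card (J I' q') = length xs + (\<Sum>j\<in>{..<t} - {i}. card (B I q j))"
    using xs(4) by (simp add: distinct_card)
  have "card (J I q) = card (B I q i) + (\<Sum>j\<in>{..<t} - {i}. card (B I q j))"
    using i by (subst cJ[OF v], subst sum.remove[of _ i]) auto
  with 1 show "card (J I' q') + card (B I q i) = card (J I q) + length xs" by simp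
  assume c: "card (J I' q') \<le> D + 3"
  have "set xs \<subseteq> L" using xs(6) BL[OF v i(1)] RL[of I q] by (meson Un_least order_trans)
  moreover have "I \<subseteq> {..<t}" using v unfolding valid_def by blast
  moreover have "q' j = q j" if "j \<noteq> i" for j using q' that by simp
  moreover have "q' i = xs" using q' by simp
  ultimately show "valid I' q'" unfolding valid_def using c dj i xs validD(2-7)[OF v]
    by (metis insert_iff insert_subset lessThan_iff)
qed

lemma shorter_walk:
  assumes o: "opt I q" and i: "i \<in> I" and w: "w \<noteq> []" "hd w = s i" "last w = u i" "successively E w"
    "set w \<subseteq> B I q i \<union> R I q"
  shows "length (q i) \<le> length w"
proof (rule ccontr)
  assume a: "\<not> ?thesis"
  have v: "valid I q" using o by (rule opt_valid)
  obtain xs where xs: "xs \<noteq> []" "hd xs = s i" "last xs = u i" "distinct xs" "set xs \<subseteq> set w" "successively E xs"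
    using walk_path[OF sy w(4,1)] w(2,3) by metis
  have "length xs = card (set xs)" using xs(4) by (simp add: distinct_card)
  also have "\<dots> \<le> card (set w)" using xs(5) by (intro card_mono) auto
  also have "\<dots> \<le> length w" by (rule card_length)
  finally have lx: "length xs < length (q i)" using a by simp
  have sub: "set xs \<subseteq> B I q i \<union> R I q" using xs(5) w(5) by blast
  note rp = replace_J[OF v validD(1)[OF v i] i _ xs(1-4) xs(6) sub refl]
  have "card (J I (q(i := xs))) < card (J I q)" using rp(1) lx cB[OF v i] by simp
  then show False using rp(2) validD(9)[OF v] o unfolding opt_def by (metis leD le_trans less_imp_le)
qed

lemma window:
  assumes o: "opt I q" and i: "i \<in> I" and r: "r \<in> R I q" "a < b" "b < length (q i)" "E r (q i ! a)" "E r (q i ! b)"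
  shows "b \<le> a + 2"
proof (rule ccontr)
  assume n: "\<not> ?thesis"
  have v: "valid I q" using o by (rule opt_valid)
  define w where "w = take (Suc a) (q i) @ r # drop b (q i)"
  have ne: "take (Suc a) (q i) \<noteq> []" "drop b (q i) \<noteq> []" using r by auto
  have la: "last (take (Suc a) (q i)) = q i ! a" using r by (simp add: take_Suc_conv_app_nth)
  have hb: "hd (drop b (q i)) = q i ! b" using r by (simp add: hd_drop_conv_nth)
  have "successively E w" unfolding w_def
    using successively_take[OF validD(6)[OF v i]] successively_drop[OF validD(6)[OF v i]] ne la hb r sE
    by (auto simp: successively_append_iff successively_Cons)
  moreover have "hd w = s i" unfolding w_def using validD(2,3)[OF v i] by (cases "q i") auto
  moreover have "last w = u i" unfolding w_def using r validD(4)[OF v i] by (simp add: last_drop)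
  moreover have "set w \<subseteq> B I q i \<union> R I q" unfolding w_def B_def using i r(1)
    by (auto dest: in_set_takeD in_set_dropD)
  ultimately have "length (q i) \<le> length w" using shorter_walk[OF o i, of w] unfolding w_def by simp
  then show False using n r unfolding w_def by simp
qed

lemma seen_idx:
  assumes o: "opt I q" and i: "i \<in> I" and r: "r \<in> R I q"
  shows "card (Nb r \<inter> B I q i) \<le> 3"
    "3 \<le> card (Nb r \<inter> B I q i) \<Longrightarrow> \<exists>x. x + 2 < length (q i) \<and> E r (q i ! x) \<and> E r (q i ! (x + 1)) \<and> E r (q i ! (x + 2))"
proof -
  have v: "valid I q" using o by (rule opt_valid)
  define K where "K = {j. j < length (q i) \<and> E r (q i ! j)}"
  have fK: "finite K" unfolding K_def by simp
  have "Nb r \<inter> B I q i = {x \<in> set (q i). E r x}"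
    using validD(7)[OF v i] i unfolding Nb_def B_def by auto
  also have "\<dots> = (\<lambda>j. q i ! j) ` K" unfolding K_def by (auto simp: in_set_conv_nth)
  finally have "Nb r \<inter> B I q i = (\<lambda>j. q i ! j) ` K" .
  moreover have "inj_on (\<lambda>j. q i ! j) K" unfolding K_def inj_on_def using validD(5)[OF v i]
    by (auto simp: nth_eq_iff_index_eq)
  ultimately have c: "card (Nb r \<inter> B I q i) = card K" by (simp add: card_image)
  show "card (Nb r \<inter> B I q i) \<le> 3"
  proof (cases "K = {}")
    case False
    define a where "a = Min K"
    have "K \<subseteq> {a..a + 2}"
    proof
      fix b assume b: "b \<in> K"
      then have "a \<le> b" "a \<in> K" unfolding a_def using fK False by auto
      then show "b \<in> {a..a + 2}" using window[OF o i r, of a b] b unfolding K_def by (cases "a = b") auto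
    qed
    then have "card K \<le> card {a..a + 2}" by (rule card_mono[rotated]) simp
    then show ?thesis using c by simp
  qed (use c in simp)
  assume 3: "3 \<le> card (Nb r \<inter> B I q i)"
  then have ne: "K \<noteq> {}" using c by auto
  define a where "a = Min K"
  have "K \<subseteq> {a..a + 2}"
  proof
    fix b assume b: "b \<in> K"
    then have "a \<le> b" "a \<in> K" unfolding a_def using fK ne by auto
    then show "b \<in> {a..a + 2}" using window[OF o i r, of a b] b unfolding K_def by (cases "a = b") auto
  qed
  then have "K = {a..a + 2}" using 3 c by (intro card_seteq) auto
  then have "a \<in> K" "a + 1 \<in> K" "a + 2 \<in> K" by auto
  then show "\<exists>x. x + 2 < length (q i) \<and> E r (q i ! x) \<and> E r (q i ! (x + 1)) \<and> E r (q i ! (x + 2))"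
    unfolding K_def by blast
qed

lemma seen_unlinked: "i \<notin> I \<Longrightarrow> card (Nb r \<inter> B I q i) \<le> 2"
proof -
  assume "i \<notin> I"
  then have "Nb r \<inter> B I q i \<subseteq> {s i, u i}" unfolding B_def by auto
  then have "card (Nb r \<inter> B I q i) \<le> card {s i, u i}" by (intro card_mono) auto
  also have "\<dots> \<le> 2" by (simp add: card_insert_if)
  finally show ?thesis .
qed

text \<open>A second neighbour of an end on its own path would yield a chord that shortens the
  path.\<close>

lemma end_nbr:
  assumes o: "opt I q" and i: "i \<in> I"
  shows "card (Nb (s i) \<inter> B I q i) \<le> 1" "card (Nb (u i) \<inter> B I q i) \<le> 1"
proof -
  have v: "valid I q" using o by (rule opt_valid)
  define n where "n = length (q i)"
  have q0: "q i ! 0 = s i" using validD(2,3)[OF v i] by (metis hd_conv_nth)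
  have qn: "q i ! (n - 1) = u i" using validD(2,4)[OF v i] unfolding n_def by (metis last_conv_nth)
  have qE: "set (q i) \<subseteq> B I q i" using i unfolding B_def by simp
  have "Nb (s i) \<inter> B I q i \<subseteq> {q i ! 1}"
  proof
    fix x assume x: "x \<in> Nb (s i) \<inter> B I q i"
    then obtain b where b: "b < n" "x = q i ! b" using i unfolding B_def n_def by (auto simp: in_set_conv_nth)
    have "b \<noteq> 0" using x b ir q0 unfolding Nb_def by (metis (no_types, lifting) IntD1 mem_Collect_eq)
    moreover have "\<not> 2 \<le> b"
    proof
      assume 2: "2 \<le> b"
      have "length (q i) \<le> length (s i # drop b (q i))"
      proof (rule shorter_walk[OF o i])
        show "successively E (s i # drop b (q i))"
          using successively_drop[OF validD(6)[OF v i]] x b unfolding Nb_def n_def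
          by (auto simp: successively_Cons hd_drop_conv_nth)
        show "last (s i # drop b (q i)) = u i" using b validD(4)[OF v i] unfolding n_def by (simp add: last_drop)
        show "set (s i # drop b (q i)) \<subseteq> B I q i \<union> R I q"
          using su_B[OF v validD(1)[OF v i]] qE set_drop_subset[of b "q i"] by auto
      qed auto
      then show False using 2 b unfolding n_def by simp
    qed
    ultimately have "b = 1" by linarith
    then show "x \<in> {q i ! 1}" using b by simp
  qed
  then show "card (Nb (s i) \<inter> B I q i) \<le> 1" using card_mono[of "{q i ! 1}"] by fastforce
  have "Nb (u i) \<inter> B I q i \<subseteq> {q i ! (n - 2)}"
  proof
    fix x assume x: "x \<in> Nb (u i) \<inter> B I q i"
    then obtain b where b: "b < n" "x = q i ! b" using i unfolding B_def n_def by (auto simp: in_set_conv_nth)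
    have "b \<noteq> n - 1" using x b ir qn unfolding Nb_def by (metis (no_types, lifting) IntD1 mem_Collect_eq)
    moreover have "\<not> b + 3 \<le> n"
    proof
      assume 2: "b + 3 \<le> n"
      have "length (q i) \<le> length (take (Suc b) (q i) @ [u i])"
      proof (rule shorter_walk[OF o i])
        show "successively E (take (Suc b) (q i) @ [u i])"
          using successively_take[OF validD(6)[OF v i], of "Suc b"] x b sE[of "u i" x] unfolding Nb_def n_def
          by (simp add: successively_append_iff take_Suc_conv_app_nth)
        show "hd (take (Suc b) (q i) @ [u i]) = s i" using validD(2,3)[OF v i] by (cases "q i") auto
        show "set (take (Suc b) (q i) @ [u i]) \<subseteq> B I q i \<union> R I q"
          using su_B[OF v validD(1)[OF v i]] qE set_take_subset[of "Suc b" "q i"] by auto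
      qed auto
      then show False using 2 b unfolding n_def by simp
    qed
    ultimately have "b = n - 2" using b by linarith
    then show "x \<in> {q i ! (n - 2)}" using b by simp
  qed
  then show "card (Nb (u i) \<inter> B I q i) \<le> 1" using card_mono[of "{q i ! (n - 2)}"] by fastforce
qed

lemma degR: "v \<in> L \<Longrightarrow> D \<le> card (Nb v \<inter> R I q) + card (Nb v \<inter> J I q)"
proof -
  assume v: "v \<in> L"
  have "Nb v \<subseteq> (Nb v \<inter> R I q) \<union> (Nb v \<inter> J I q)" unfolding Nb_def R_def by auto
  then have "card (Nb v) \<le> card ((Nb v \<inter> R I q) \<union> (Nb v \<inter> J I q))" by (intro card_mono) (auto simp: fNb)
  then show ?thesis using deg[OF v] card_Un_le[of "Nb v \<inter> R I q" "Nb v \<inter> J I q"] unfolding Nb_def by simp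
qed

lemma seen_J: "valid I q \<Longrightarrow> card (Nb r \<inter> J I q) = (\<Sum>i<t. card (Nb r \<inter> B I q i))"
proof -
  assume v: "valid I q"
  have "Nb r \<inter> J I q = (\<Union>i<t. Nb r \<inter> B I q i)" unfolding J_def by auto
  also have "card \<dots> = (\<Sum>i<t. card (Nb r \<inter> B I q i))"
  proof (rule card_UN_disjoint)
    show "\<forall>i\<in>{..<t}. \<forall>j\<in>{..<t}. i \<noteq> j \<longrightarrow> (Nb r \<inter> B I q i) \<inter> (Nb r \<inter> B I q j) = {}"
      using validD(8)[OF v] by auto
  qed (auto simp: fB)
  finally show ?thesis .
qed

lemma seen_J_le:
  assumes o: "opt I q" and i0: "i0 < t" "i0 \<notin> I" and r: "r \<in> R I q"
  shows "card (Nb r \<inter> J I q) + 1 \<le> 3 * t"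
proof -
  have "card (Nb r \<inter> J I q) = card (Nb r \<inter> B I q i0) + (\<Sum>i\<in>{..<t} - {i0}. card (Nb r \<inter> B I q i))"
    using i0 by (subst seen_J[OF opt_valid[OF o]], subst sum.remove[of _ i0]) auto
  also have "\<dots> \<le> 2 + (\<Sum>i\<in>{..<t} - {i0}. 3)"
  proof (intro add_mono sum_mono)
    show "card (Nb r \<inter> B I q i0) \<le> 2" by (rule seen_unlinked[OF i0(2)])
    fix i show "card (Nb r \<inter> B I q i) \<le> 3"
      using seen_idx(1)[OF o _ r, of i] seen_unlinked[of i I r q] by (cases "i \<in> I") auto
  qed
  also have "\<dots> = 2 + 3 * (t - 1)" using i0 by simp
  finally show ?thesis using i0 by linarith
qed

text \<open>Outside its own block the end sees at most \<open>card (J I q) - card (B I q i)\<close>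
  used vertices, and inside at most one; together these are fewer than \<open>D\<close>.\<close>

lemma end_has_nbr:
  assumes o: "opt I q" and i: "i < t" and v: "v = s i \<or> v = u i" and c: "card (J I q) < D + card (B I q i) - 1"
    and x: "card (Nb v \<inter> B I q i) \<le> 1"
  shows "Nb v \<inter> R I q \<noteq> {}"
proof
  assume e: "Nb v \<inter> R I q = {}"
  have vL: "v \<in> L" using v tmD(1,2)[OF i] by auto
  have "Nb v \<inter> J I q \<subseteq> (J I q - B I q i) \<union> (Nb v \<inter> B I q i)" by auto
  then have "card (Nb v \<inter> J I q) \<le> card ((J I q - B I q i) \<union> (Nb v \<inter> B I q i))"
    by (intro card_mono) (auto simp: fB fJ)
  also have "\<dots> \<le> card (J I q - B I q i) + 1" using card_Un_le[of "J I q - B I q i" "Nb v \<inter> B I q i"] x by linarith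
  also have "card (J I q - B I q i) = card (J I q) - card (B I q i)" using BJ[OF i] by (intro card_Diff_subset) (auto simp: fB)
  finally have "card (Nb v \<inter> J I q) \<le> card (J I q) - card (B I q i) + 1" .
  moreover have "card (B I q i) \<le> card (J I q)" using BJ[OF i] by (intro card_mono) (auto simp: fJ)
  ultimately show False using degR[OF vL, of I q] e c by simp
qed

lemma J_bound:
  assumes o: "opt I q" and i0: "i0 < t" "i0 \<notin> I"
  shows "card (J I q) + 3 \<le> 6 * t"
proof (rule ccontr)
  assume n: "\<not> ?thesis"
  have v: "valid I q" using o by (rule opt_valid)
  have short: "length (q i) \<le> 5" if i: "i \<in> I" for i
  proof (rule ccontr)
    assume l: "\<not> length (q i) \<le> 5"
    have it: "i < t" using validD(1)[OF v i] .
    have c: "card (J I q) < D + card (B I q i) - 1" using validD(9)[OF v] l cB[OF v i] by linarith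
    obtain a where a: "a \<in> Nb (s i)" "a \<in> R I q" using end_has_nbr[OF o it _ c] end_nbr[OF o i] by blast
    obtain b where b: "b \<in> Nb (u i)" "b \<in> R I q" using end_has_nbr[OF o it _ c] end_nbr[OF o i] by blast
    define X where "X r = insert r (Nb r \<inter> R I q)" for r
    have cX: "D + 2 \<le> card (X r) + 3 * t" if r: "r \<in> R I q" for r
    proof -
      have "r \<notin> Nb r" using ir unfolding Nb_def by simp
      then have "card (X r) = Suc (card (Nb r \<inter> R I q))" unfolding X_def using fNb by simp
      moreover have "r \<in> L" using r RL by auto
      ultimately show ?thesis using degR[of r I q] seen_J_le[OF o i0 r] by linarith
    qed
    have XR: "X r \<subseteq> R I q" if "r \<in> R I q" for r using that unfolding X_def by auto
    have "X a \<inter> X b \<noteq> {}"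
    proof
      assume e: "X a \<inter> X b = {}"
      have "card (X a) + card (X b) = card (X a \<union> X b)"
        using e by (intro card_Un_disjoint[symmetric]) (auto simp: X_def fNb)
      also have "\<dots> \<le> card (R I q)" using XR a b by (intro card_mono fR) auto
      finally show False using cX[OF a(2)] cX[OF b(2)] cR[OF v] cL n by linarith
    qed
    then obtain x where x: "x = a \<or> (E a x \<and> x \<in> R I q)" "x = b \<or> (E b x \<and> x \<in> R I q)" unfolding X_def Nb_def by auto
    have ab: "E (s i) a" "E (u i) b" "E b (u i)" using a b sE unfolding Nb_def by auto
    have sB: "s i \<in> B I q i" "u i \<in> B I q i" using su_B[OF v it] by auto
    have "\<exists>w. w \<noteq> [] \<and> hd w = s i \<and> last w = u i \<and> successively E w \<and> set w \<subseteq> B I q i \<union> R I q \<and> length w \<le> 5"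
    proof -
      consider "x = a" "x = b" | "x = a" "E b x" | "E a x" "x = b" "x \<in> R I q" | "E a x" "E b x" "x \<in> R I q" using x by blast
      then show ?thesis
      proof cases
        case 1 then show ?thesis using ab a b sB by (intro exI[of _ "[s i, a, u i]"]) auto
      next
        case 2 then show ?thesis using ab a b sB sE by (intro exI[of _ "[s i, a, b, u i]"]) auto
      next
        case 3 then show ?thesis using ab a b sB sE by (intro exI[of _ "[s i, a, b, u i]"]) auto
      next
        case 4 then show ?thesis using ab a b sB sE by (intro exI[of _ "[s i, a, x, b, u i]"]) auto
      qed
    qed
    then obtain w where "w \<noteq> []" "hd w = s i" "last w = u i" "successively E w" "set w \<subseteq> B I q i \<union> R I q" "length w \<le> 5" by blast
    then show False using shorter_walk[OF o i, of w] l by linarith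
  qed
  have "card (J I q) = card (B I q i0) + (\<Sum>i\<in>{..<t} - {i0}. card (B I q i))"
    using i0 by (subst cJ[OF v], subst sum.remove[of _ i0]) auto
  also have "\<dots> \<le> 2 + (\<Sum>i\<in>{..<t} - {i0}. 5)"
  proof (intro add_mono sum_mono)
    show "card (B I q i0) \<le> 2" using i0 unfolding B_def by (simp add: card_insert_if)
    fix i show "card (B I q i) \<le> 5"
    proof (cases "i \<in> I")
      case True then show ?thesis using short cB[OF v] by simp
    next
      case False then show ?thesis unfolding B_def by (simp add: card_insert_if)
    qed
  qed
  also have "\<dots> = 2 + 5 * (t - 1)" using i0 by simp
  finally show False using n i0 by linarith
qed


abbreviation nbhd where "nbhd I q r \<equiv> insert r (Nb r \<inter> R I q)"

text \<open>Passing through a common element of the two neighbourhoods would skip at least two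
  vertices of a shortest connection and insert at most one.\<close>

lemma shortcut:
  assumes w: "w \<noteq> []" "hd w \<in> A" "last w \<in> A'" "successively E w" "set w \<subseteq> R I q"
    and mn: "\<And>w'. w' \<noteq> [] \<Longrightarrow> hd w' \<in> A \<Longrightarrow> last w' \<in> A' \<Longrightarrow> successively E w' \<Longrightarrow> set w' \<subseteq> R I q \<Longrightarrow> length w \<le> length w'"
    and ij: "i + 3 \<le> j" "j < length w"
  shows "nbhd I q (w ! i) \<inter> nbhd I q (w ! j) = {}"
proof (rule ccontr)
  assume "\<not> ?thesis"
  then obtain x where x: "x = w ! i \<or> (E (w ! i) x \<and> x \<in> R I q)" "x = w ! j \<or> (E (w ! j) x \<and> x \<in> R I q)"
    unfolding Nb_def by auto
  obtain xs where xs: "xs \<noteq> []" "hd xs = hd w" "last xs = last w" "distinct xs" "set xs \<subseteq> set w" "successively E xs"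
    using walk_path[OF sy w(4,1)] by metis
  have "length w \<le> length xs" using mn[of xs] xs w by auto
  also have "\<dots> = card (set xs)" using xs(4) by (simp add: distinct_card)
  also have "\<dots> \<le> card (set w)" using xs(5) by (intro card_mono) auto
  finally have dw: "distinct w" using card_length[of w] by (intro card_distinct) simp
  have ne: "w ! i \<noteq> w ! j" using dw ij by (simp add: nth_eq_iff_index_eq)
  define mid where "mid = (if x = w ! i \<or> x = w ! j then [] else [x])"
  define w' where "w' = take (Suc i) w @ mid @ drop j w"
  have t: "take (Suc i) w \<noteq> []" "drop j w \<noteq> []" "last (take (Suc i) w) = w ! i" "hd (drop j w) = w ! j"
    using ij by (auto simp: take_Suc_conv_app_nth hd_drop_conv_nth)
  have "successively E w'" unfolding w'_def mid_def
    using x ne t sE successively_take[OF w(4), of "Suc i"] successively_drop[OF w(4), of j]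
    by (auto simp: successively_append_iff successively_Cons)
  moreover have "hd w' = hd w" using w(1) unfolding w'_def by (cases w) auto
  moreover have "last w' = last w" using ij unfolding w'_def by (simp add: last_drop)
  moreover have "set w' \<subseteq> R I q" using w(5) x unfolding w'_def mid_def
    by (auto dest: in_set_takeD in_set_dropD split: if_splits)
  moreover have "w' \<noteq> []" unfolding w'_def using t by simp
  ultimately have "length w \<le> length w'" using mn[of w'] w by simp
  moreover have "length w' = length (take (Suc i) w) + length mid + (length w - j)" unfolding w'_def by simp
  moreover have "length (take (Suc i) w) \<le> Suc i" by simp
  moreover have "length mid \<le> 1" unfolding mid_def by simp
  ultimately show False using ij by linarith
qed

text \<open>A shortest connection of the two sides has at most 6 vertices, since the vertices 0, 3
  and 6 of a longer one would have disjoint neighbourhoods of total size exceeding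
  \<open>card (R I q)\<close>. With its two terminals it would link the pair \<open>i0\<close> on 8
  vertices and stay within the cap, as \<open>6 * t - 3 - 2 + 8 \<le> D + 3\<close>, against the
  maximality of \<open>I\<close>.\<close>

lemma sides_disjoint:
  assumes o: "opt I q" and i0: "i0 < t" "i0 \<notin> I"
  shows "reach (R I q) (Nb (s i0)) \<inter> reach (R I q) (Nb (u i0)) = {}"
proof (rule ccontr)
  have v: "valid I q" using o by (rule opt_valid)
  define A where "A = Nb (s i0)"
  define A' where "A' = Nb (u i0)"
  define P where "P w \<longleftrightarrow> w \<noteq> [] \<and> hd w \<in> A \<and> last w \<in> A' \<and> successively E w \<and> set w \<subseteq> R I q" for w
  assume "\<not> ?thesis"
  then obtain r where r: "r \<in> reach (R I q) A" "r \<in> reach (R I q) A'" unfolding A_def A'_def by auto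
  obtain w1 where w1: "w1 \<noteq> []" "hd w1 \<in> A" "last w1 = r" "successively E w1" "set w1 \<subseteq> R I q"
    using reach_walk[OF r(1)] .
  obtain w2 where w2: "w2 \<noteq> []" "hd w2 \<in> A'" "last w2 = r" "successively E w2" "set w2 \<subseteq> R I q"
    using reach_walk[OF r(2)] .
  have "r \<in> set w1 \<inter> set w2" using w1 w2 by (metis IntI last_in_set)
  then have cn: "conn E (set w1 \<union> set w2)" using conn_Un[OF conn_walk[OF sy w1(4,1)] conn_walk[OF sy w2(4,1)]] by blast
  have "hd w1 \<in> set w1 \<union> set w2" "hd w2 \<in> set w1 \<union> set w2" using w1(1) w2(1) by auto
  then obtain w0 where "w0 \<noteq> []" "hd w0 = hd w1" "last w0 = hd w2" "set w0 \<subseteq> set w1 \<union> set w2" "successively E w0"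
    using conn_path[OF cn] by metis
  then have "P w0" unfolding P_def using w1 w2 by auto
  then obtain w where w: "P w" "\<And>w'. P w' \<Longrightarrow> length w \<le> length w'"
    using ex_has_least_nat[of P w0 length] by blast
  have wR: "w ! k \<in> R I q" if "k < length w" for k using w(1) that unfolding P_def by auto
  have len: "length w \<le> 6"
  proof (rule ccontr)
    assume l: "\<not> length w \<le> 6"
    have sc: "nbhd I q (w ! i) \<inter> nbhd I q (w ! j) = {}" if "i + 3 \<le> j" "j < length w" for i j
      by (rule shortcut[of w A A']) (use w that in \<open>auto simp: P_def\<close>)
    define X where "X k = nbhd I q (w ! k)" for k
    have fX: "finite (X k)" for k unfolding X_def by (simp add: fNb)
    have cX: "D + 2 \<le> card (X k) + 3 * t" "D + 1 \<le> card (X k) + card (J I q)" "X k \<subseteq> R I q"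
      if k: "k < length w" for k
    proof -
      have "w ! k \<notin> Nb (w ! k)" using ir unfolding Nb_def by simp
      then have "card (X k) = Suc (card (Nb (w ! k) \<inter> R I q))" unfolding X_def using fNb by simp
      moreover have "w ! k \<in> L" using wR[OF k] RL[of I q] by blast
      moreover have "card (Nb (w ! k) \<inter> J I q) \<le> card (J I q)" by (intro card_mono fJ) auto
      ultimately show "D + 2 \<le> card (X k) + 3 * t" "D + 1 \<le> card (X k) + card (J I q)"
        using degR[of "w ! k" I q] seen_J_le[OF o i0 wR[OF k]] by linarith+
      show "X k \<subseteq> R I q" using wR[OF k] unfolding X_def by auto
    qed
    have d: "X 0 \<inter> X 3 = {}" "X 0 \<inter> X 6 = {}" "X 3 \<inter> X 6 = {}"
      using sc[of 0 3] sc[of 0 6] sc[of 3 6] l unfolding X_def by simp_all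
    have "card (X 0) + card (X 3) + card (X 6) = card (X 0 \<union> X 3 \<union> X 6)"
      using d fX card_Un_disjoint[of "X 0" "X 3"] card_Un_disjoint[of "X 0 \<union> X 3" "X 6"] by (simp add: Int_Un_distrib2)
    also have "\<dots> \<le> card (R I q)"
    proof (rule card_mono[OF fR])
      have "0 < length w" "3 < length w" "6 < length w" using l by linarith+
      then show "X 0 \<union> X 3 \<union> X 6 \<subseteq> R I q" using cX(3) by blast
    qed
    finally show False
      using cX(1)[of 0] cX(1)[of 3] cX(1)[of 6] cX(2)[of 0] cX(2)[of 3] cX(2)[of 6] l cR[OF v] cL Dt by linarith
  qed
  have su: "E (s i0) (hd w)" "E (last w) (u i0)" using w(1) sE unfolding P_def A_def A'_def Nb_def by auto
  have "successively E (s i0 # w @ [u i0])" using w(1) su unfolding P_def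
    by (auto simp: successively_append_iff successively_Cons)
  then obtain xs where xs: "xs \<noteq> []" "hd xs = s i0" "last xs = u i0" "distinct xs" "set xs \<subseteq> set (s i0 # w @ [u i0])" "successively E xs"
    using walk_path[OF sy, of "s i0 # w @ [u i0]"] by (metis last.simps last_snoc list.distinct(1) list.sel(1) append_is_Nil_conv)
  have B0: "B I q i0 = {s i0, u i0}" using i0 unfolding B_def by simp
  have B2: "card (B I q i0) = 2" using tmD(5)[OF i0(1) i0(1)] B0 by simp
  have "length xs = card (set xs)" using xs(4) by (simp add: distinct_card)
  also have "\<dots> \<le> card (set (s i0 # w @ [u i0]))" using xs(5) by (intro card_mono) auto
  also have "\<dots> \<le> length (s i0 # w @ [u i0])" by (rule card_length)
  finally have lx: "length xs \<le> 8" using len by simp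
  have sub: "set xs \<subseteq> B I q i0 \<union> R I q" using xs(5) w(1) B0 unfolding P_def by auto
  note rp = replace_J[OF v i0(1) insertI1 disjI2[OF refl] xs(1-4) xs(6) sub refl]
  have "card (J (insert i0 I) (q(i0 := xs))) \<le> D + 3" using rp(1) lx B2 J_bound[OF o i0] Dt by linarith
  then have "card (insert i0 I) \<le> card I" using rp(2) o unfolding opt_def by blast
  then show False using i0 validD(10)[OF v] by simp
qed

text \<open>On a path with at most 4 vertices the three vertices seen by \<open>r2\<close> include
  the middle one, \<open>b\<close>, of those seen by \<open>r1\<close>. Putting \<open>r1\<close> in
  the place of \<open>b\<close> sets \<open>b\<close> free next to \<open>r2\<close>, so
  \<open>b\<close> joins the side of \<open>u i0\<close>, while the side of \<open>s i0\<close>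
  loses \<open>r1\<close>, against the minimality of the latter.\<close>

lemma swap:
  assumes o: "opt I q" and i0: "i0 < t" "i0 \<notin> I"
    and mn: "\<And>q'. opt I q' \<Longrightarrow> card (reach (R I q) (Nb (s i0))) \<le> card (reach (R I q') (Nb (s i0)))"
    and i: "i \<in> I" "length (q i) \<le> 4"
    and r1: "r1 \<in> reach (R I q) (Nb (s i0))" "3 \<le> card (Nb r1 \<inter> B I q i)"
    and r2: "r2 \<in> reach (R I q) (Nb (u i0))" "3 \<le> card (Nb r2 \<inter> B I q i)"
  shows False
proof -
  have v: "valid I q" using o by (rule opt_valid)
  have it: "i < t" using validD(1)[OF v i(1)] .
  have r1R: "r1 \<in> R I q" and r2R: "r2 \<in> R I q" using r1 r2 reach_sub by blast+
  obtain x where x: "x + 2 < length (q i)" "E r1 (q i ! x)" "E r1 (q i ! (x + 1))" "E r1 (q i ! (x + 2))"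
    using seen_idx(2)[OF o i(1) r1R r1(2)] by blast
  obtain y where y: "y + 2 < length (q i)" "E r2 (q i ! y)" "E r2 (q i ! (y + 1))" "E r2 (q i ! (y + 2))"
    using seen_idx(2)[OF o i(1) r2R r2(2)] by blast
  define b where "b = q i ! Suc x"
  have "Suc x = y \<or> Suc x = y + 1 \<or> Suc x = y + 2" using x(1) y(1) i(2) by linarith
  then have r2b: "E r2 b" using y unfolding b_def by auto
  define xs where "xs = (q i)[Suc x := r1]"
  have dq: "distinct (q i)" using validD(5)[OF v i(1)] .
  have Bi: "B I q i = set (q i)" using i(1) unfolding B_def by simp
  have r1q: "r1 \<notin> set (q i)" using r1R BJ[OF it, of I q] RJ[of I q] Bi by auto
  have bq: "b \<in> set (q i)" unfolding b_def using x(1) by simp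
  have sx: "set xs = insert r1 (set (q i) - {b})" unfolding xs_def b_def
    using dq x(1) by (intro set_update_distinct) auto
  have lx: "length xs = length (q i)" unfolding xs_def by simp
  have c1: "xs \<noteq> []" using lx x(1) by auto
  have c2: "hd xs = s i" using validD(2,3)[OF v i(1)] c1 unfolding xs_def by (simp add: hd_conv_nth)
  have c3: "last xs = u i" using validD(2,4)[OF v i(1)] c1 x(1) unfolding xs_def by (simp add: last_conv_nth)
  have c4: "distinct xs" unfolding xs_def using dq r1q by (intro distinct_list_update) auto
  have c5: "successively E xs" unfolding successively_conv_nth
  proof (intro allI impI)
    fix k assume k: "Suc k < length xs"
    have qk: "E (q i ! k) (q i ! Suc k)" using validD(6)[OF v i(1)] k lx unfolding successively_conv_nth by simp
    consider "k = x" | "k = Suc x" | "k \<noteq> x" "k \<noteq> Suc x" by blast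
    then show "E (xs ! k) (xs ! Suc k)"
    proof cases
      case 1 then show ?thesis using x(2) sE k lx unfolding xs_def by simp
    next
      case 2 then show ?thesis using x(4) k lx unfolding xs_def by simp
    next
      case 3 then show ?thesis using qk k lx unfolding xs_def by simp
    qed
  qed
  have sub: "set xs \<subseteq> B I q i \<union> R I q" using sx r1R Bi by auto
  define q' where "q' = q(i := xs)"
  note rp = replace_J[OF v it i(1) disjI1[OF refl] c1 c2 c3 c4 c5 sub q'_def]
  have cJ': "card (J I q') = card (J I q)" using rp(1) cB[OF v i(1)] lx by simp
  have v': "valid I q'" using rp(2) cJ' validD(9)[OF v] by simp
  have o': "opt I q'" using o v' cJ' unfolding opt_def by simp
  have B1: "B I q' i = insert r1 (B I q i - {b})" using sx Bi i(1) unfolding B_def q'_def by simp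
  have B2: "B I q' j = B I q j" if "j \<noteq> i" for j using that unfolding B_def q'_def by simp
  have bB: "b \<notin> B I q j" if "j < t" "j \<noteq> i" for j using validD(8)[OF v it that(1)] that(2) bq Bi by auto
  have bL: "b \<in> L" using bq validD(7)[OF v i(1)] by auto
  have J': "z \<in> J I q' \<longleftrightarrow> z = r1 \<or> (z \<in> J I q \<and> z \<noteq> b)" for z
  proof -
    have "z \<in> J I q' \<longleftrightarrow> z \<in> B I q' i \<or> (\<exists>j<t. j \<noteq> i \<and> z \<in> B I q' j)" unfolding J_def using it by auto
    also have "\<dots> \<longleftrightarrow> z \<in> B I q' i \<or> (\<exists>j<t. j \<noteq> i \<and> z \<in> B I q j)" using B2 by auto
    also have "\<dots> \<longleftrightarrow> z = r1 \<or> (z \<in> B I q i \<and> z \<noteq> b) \<or> (\<exists>j<t. j \<noteq> i \<and> z \<in> B I q j \<and> z \<noteq> b)"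
      using B1 bB by auto
    also have "\<dots> \<longleftrightarrow> z = r1 \<or> (z \<in> J I q \<and> z \<noteq> b)" unfolding J_def using it by auto
    finally show ?thesis .
  qed
  have br: "b \<noteq> r1" using r1q bq by auto
  have bJ: "b \<in> J I q" using bq Bi BJ[OF it, of I q] by auto
  have R': "z \<in> R I q' \<longleftrightarrow> z = b \<or> (z \<in> R I q \<and> z \<noteq> r1)" for z
    unfolding R_def using J'[of z] bL br bJ by auto
  define U1 where "U1 = reach (R I q) (Nb (s i0))"
  define U2 where "U2 = reach (R I q) (Nb (u i0))"
  define U1' where "U1' = reach (R I q') (Nb (s i0))"
  define U2' where "U2' = reach (R I q') (Nb (u i0))"
  have dis: "U1 \<inter> U2 = {}" "U1' \<inter> U2' = {}"
    using sides_disjoint[OF o i0] sides_disjoint[OF o' i0] unfolding U1_def U2_def U1'_def U2'_def by auto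
  have U2sub: "z \<in> R I q'" if "z \<in> U2" for z
  proof -
    have "z \<in> R I q" using that reach_sub unfolding U2_def by blast
    moreover have "z \<noteq> r1" using that r1(1) dis unfolding U1_def by auto
    ultimately show ?thesis using R' by simp
  qed
  have "r2 \<in> U2'"
  proof (rule reach_induct[OF r2(1)])
    fix a assume a: "a \<in> Nb (u i0)" "a \<in> R I q"
    then have "a \<in> U2" unfolding U2_def by (rule reach_start)
    then show "a \<in> U2'" using a U2sub unfolding U2'_def by (intro reach_start) auto
  next
    fix z z' assume z: "z \<in> reach (R I q) (Nb (u i0))" "z \<in> U2'" "E z z'" "z' \<in> R I q"
    then have "z' \<in> U2" unfolding U2_def by (meson reach_step)
    then have "z' \<in> R I q'" by (rule U2sub)
    then show "z' \<in> U2'" using reach_step z(2,3) unfolding U2'_def by meson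
  qed
  then have r2': "r2 \<in> U2'" .
  have bU: "b \<notin> U1'"
  proof
    assume "b \<in> U1'"
    moreover have "r2 \<in> R I q'" using r2' reach_sub unfolding U2'_def by blast
    ultimately have "r2 \<in> U1'" using reach_step sE[OF r2b] unfolding U1'_def by meson
    then show False using r2' dis by auto
  qed
  have "z \<in> U1 \<and> z \<noteq> r1" if z: "z \<in> U1'" for z
    using z[unfolded U1'_def]
  proof (rule reach_induct)
    fix a assume a: "a \<in> Nb (s i0)" "a \<in> R I q'"
    then have "a \<in> U1'" unfolding U1'_def by (rule reach_start)
    then have "a \<noteq> b" using bU by auto
    then have "a \<in> R I q \<and> a \<noteq> r1" using R' a(2) by simp
    then show "a \<in> U1 \<and> a \<noteq> r1" using a(1) unfolding U1_def by (simp add: reach_start)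
  next
    fix z z' assume z: "z \<in> reach (R I q') (Nb (s i0))" "z \<in> U1 \<and> z \<noteq> r1" "E z z'" "z' \<in> R I q'"
    then have "z' \<in> U1'" unfolding U1'_def by (meson reach_step)
    then have "z' \<noteq> b" using bU by auto
    then have "z' \<in> R I q \<and> z' \<noteq> r1" using R' z(4) by simp
    then show "z' \<in> U1 \<and> z' \<noteq> r1" using z(2,3) reach_step unfolding U1_def by meson
  qed
  then have "U1' \<subseteq> U1 - {r1}" by auto
  moreover have fU1: "finite U1" unfolding U1_def by (rule finite_subset[OF reach_sub fR])
  ultimately have "card U1' \<le> card (U1 - {r1})" by (intro card_mono) auto
  also have "\<dots> < card U1" using r1(1) fU1 unfolding U1_def[symmetric] by (intro card_Diff1_less)
  finally show False using mn[OF o'] unfolding U1_def U1'_def by simp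
qed

text \<open>Three choices in turn: \<open>I\<close> is as large as possible, then \<open>q\<close>
  uses as few vertices as possible, and among these \<open>q\<close> the side of \<open>s i0\<close>
  is as small as possible.\<close>

lemma exists_opt:
  obtains I q i0 where "opt I q" "i0 < t" "i0 \<notin> I"
    "\<And>q'. opt I q' \<Longrightarrow> card (reach (R I q) (Nb (s i0))) \<le> card (reach (R I q') (Nb (s i0)))"
proof -
  have B0: "B {} q i = {s i, u i}" for q i unfolding B_def by simp
  have J0: "J {} q = s ` {..<t} \<union> u ` {..<t}" for q unfolding J_def B0 by auto
  have "B {} (\<lambda>_. []) i \<inter> B {} (\<lambda>_. []) j = {}" if "i < t" "j < t" "i \<noteq> j" for i j
    using tmD(3)[of i j] tmD(4)[of i j] tmD(5)[of i j] tmD(5)[of j i] that unfolding B0 by auto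
  then have "valid {} (\<lambda>_. [])" unfolding valid_def
    using terminals_card[OF tm] J0 Dt by simp
  then have "\<exists>p. valid (fst p) (snd p)" by (intro exI[of _ "({}, \<lambda>_. [])"]) simp
  moreover have "\<forall>p. valid (fst p) (snd p) \<longrightarrow> card (fst p) \<le> t"
  proof (intro allI impI)
    fix p assume "valid (fst p) (snd p)"
    then have "fst p \<subseteq> {..<t}" unfolding valid_def by blast
    then have "card (fst p) \<le> card {..<t}" by (intro card_mono) auto
    then show "card (fst p) \<le> t" by simp
  qed
  ultimately obtain p where p: "valid (fst p) (snd p)" "\<forall>p'. valid (fst p') (snd p') \<longrightarrow> card (fst p') \<le> card (fst p)"
    using ex_has_greatest_nat[of "\<lambda>p. valid (fst p) (snd p)" _ "\<lambda>p. card (fst p)" "Suc t"] by (metis less_Suc_eq_le)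
  define I where "I = fst p"
  obtain q1 where q1: "valid I q1" "\<And>q'. valid I q' \<Longrightarrow> card (J I q1) \<le> card (J I q')"
    using ex_has_least_nat[of "valid I" "snd p" "\<lambda>q. card (J I q)"] p(1) unfolding I_def by blast
  have mx: "card I' \<le> card I" if "valid I' q'" for I' q' using p(2) that unfolding I_def by (metis fst_conv snd_conv)
  have o1: "opt I q1" unfolding opt_def using q1 mx by blast
  have It: "I \<subseteq> {..<t}" using q1(1) unfolding valid_def by blast
  have "I \<noteq> {..<t}"
  proof
    assume e: "I = {..<t}"
    have "linkage E L t s u (\<lambda>i. set (q1 i))" unfolding linkage_def
    proof (intro conjI allI impI)
      fix i assume i: "i < t"
      then have iI: "i \<in> I" using e by simp
      show "conn E (set (q1 i))" using conn_walk[OF sy validD(6,2)[OF q1(1) iI]] .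
      show "set (q1 i) \<subseteq> L" using validD(7)[OF q1(1) iI] .
      show "s i \<in> set (q1 i)" "u i \<in> set (q1 i)" using su_B[OF q1(1) i] iI unfolding B_def by auto
      fix j assume j: "j < t" "i \<noteq> j"
      then have "j \<in> I" using e by simp
      then show "set (q1 i) \<inter> set (q1 j) = {}" using validD(8)[OF q1(1) i j] iI unfolding B_def by simp
    qed
    then show False using no by blast
  qed
  then obtain i0 where i0: "i0 < t" "i0 \<notin> I" using It by auto
  obtain q where q: "opt I q" "\<And>q'. opt I q' \<Longrightarrow> card (reach (R I q) (Nb (s i0))) \<le> card (reach (R I q') (Nb (s i0)))"
    using ex_has_least_nat[of "opt I" q1 "\<lambda>q. card (reach (R I q) (Nb (s i0)))"] o1 by blast
  show ?thesis by (rule that[OF q(1) i0 q(2)])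
qed

text \<open>A vertex of either side loses at most the used vertices it sees from its degree
  \<open>D\<close>, while both sides and \<open>J I q\<close> share at most \<open>2 * D + 1\<close>
  vertices. By \<open>swap\<close> the two sides cannot both lose 3 on a short path, so one of them
  is dense enough for \<open>pair_linked_dense\<close>.\<close>

lemma pair_linked_part: "\<exists>U\<subseteq>L. pair_linked E U t \<and> 2 * t \<le> card U"
proof -
  obtain I q i0 where o: "opt I q" and i0: "i0 < t" "i0 \<notin> I"
    and mn: "\<And>q'. opt I q' \<Longrightarrow> card (reach (R I q) (Nb (s i0))) \<le> card (reach (R I q') (Nb (s i0)))"
    using exists_opt by blast
  have v: "valid I q" using o by (rule opt_valid)
  define U1 where "U1 = reach (R I q) (Nb (s i0))"
  define U2 where "U2 = reach (R I q) (Nb (u i0))"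
  have U12: "U1 \<subseteq> R I q" "U2 \<subseteq> R I q" "U1 \<inter> U2 = {}"
    using reach_sub sides_disjoint[OF o i0] unfolding U1_def U2_def by blast+
  \<comment> \<open>The loss of degree on block \<open>i\<close> that has to be allowed for, rounded
    up to 2.\<close>
  define l where "l U i = (if i \<in> I \<and> (\<exists>r\<in>U. 3 \<le> card (Nb r \<inter> B I q i)) then 3 else 2 :: nat)" for U i
  have lb: "card (Nb r \<inter> B I q i) \<le> l U i" if "r \<in> U" "U \<subseteq> R I q" for r U i
  proof (cases "i \<in> I")
    case True
    have "r \<in> R I q" using that by auto
    then show ?thesis using seen_idx(1)[OF o True, of r] that(1) True unfolding l_def by force
  next
    case False then show ?thesis using seen_unlinked[of i I r q] unfolding l_def by simp
  qed
  have degU: "D \<le> card {w \<in> U. E r w} + (\<Sum>i<t. l U i)"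
    if r: "r \<in> U" and U: "U = reach (R I q) A" for r U A
  proof -
    have UR: "U \<subseteq> R I q" using reach_sub U by blast
    have "Nb r \<inter> R I q \<subseteq> {w \<in> U. E r w}" using r reach_step unfolding U Nb_def by auto
    then have "card (Nb r \<inter> R I q) \<le> card {w \<in> U. E r w}"
      using finite_subset[OF UR fR] by (intro card_mono) auto
    moreover have "card (Nb r \<inter> J I q) \<le> (\<Sum>i<t. l U i)"
      unfolding seen_J[OF v] by (intro sum_mono lb[OF r UR])
    moreover have "r \<in> L" using r UR RL[of I q] by blast
    ultimately show ?thesis using degR[of r I q] by linarith
  qed
  have l3: "(\<Sum>i<t. l U i) \<le> 3 * t" for U
  proof -
    have "(\<Sum>i<t. l U i) \<le> (\<Sum>i<t. 3)" by (intro sum_mono) (simp add: l_def)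
    then show ?thesis by simp
  qed
  \<comment> \<open>On 5 or more vertices both sides may lose 3, on 3 or 4 only one of them may, and
    on 2 neither. The constant 7 is the least that covers these cases; it is attained for 5 and for
    3 vertices, and the unlinked pair leaves a slack.\<close>
  have per: "2 * (l U1 i + l U2 i) \<le> card (B I q i) + 7" if i: "i < t" for i
  proof (cases "i \<in> I")
    case False
    then have "card (B I q i) = 2" using tmD(5)[OF i i] unfolding B_def by simp
    then show ?thesis using False unfolding l_def by simp
  next
    case True
    have "s i \<in> B I q i" "u i \<in> B I q i" "s i \<noteq> u i" using su_B[OF v i] tmD(5)[OF i i] by auto
    then have "card {s i, u i} \<le> card (B I q i)" by (intro card_mono fB) auto
    then have c2: "2 \<le> card (B I q i)" using \<open>s i \<noteq> u i\<close> by simp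
    show ?thesis
    proof (cases "card (B I q i) \<le> 4")
      case small: True
      have "\<not> ((\<exists>r\<in>U1. 3 \<le> card (Nb r \<inter> B I q i)) \<and> (\<exists>r\<in>U2. 3 \<le> card (Nb r \<inter> B I q i)))"
        using swap[OF o i0 mn True] small cB[OF v True] unfolding U1_def U2_def by force
      then have 5: "l U1 i + l U2 i \<le> 5" unfolding l_def by auto
      show ?thesis
      proof (cases "card (B I q i) = 2")
        case two: True
        have "\<not> 3 \<le> card (Nb r \<inter> B I q i)" for r
          using card_mono[OF fB, of "Nb r \<inter> B I q i" I q i] two by auto
        then show ?thesis using two unfolding l_def by auto
      next
        case False
        then have "3 \<le> card (B I q i)" using c2 by simp
        moreover have "2 * (l U1 i + l U2 i) \<le> 2 * 5" using 5 by (rule mult_le_mono2)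
        ultimately show ?thesis by simp
      qed
    next
      case False
      have "l U1 i \<le> 3" "l U2 i \<le> 3" unfolding l_def by auto
      then have "2 * (l U1 i + l U2 i) \<le> 2 * (3 + 3)" by (intro mult_le_mono2 add_mono)
      then show ?thesis using False by simp
    qed
  qed
  have "2 * ((\<Sum>i<t. l U1 i) + (\<Sum>i<t. l U2 i)) = (\<Sum>i<t. 2 * (l U1 i + l U2 i))"
    by (simp add: sum.distrib sum_distrib_left)
  also have "\<dots> < (\<Sum>i<t. card (B I q i) + 7)"
  proof (rule sum_strict_mono_ex1)
    have "card (B I q i0) = 2" using tmD(5)[OF i0(1) i0(1)] i0 unfolding B_def by simp
    then show "\<exists>a\<in>{..<t}. 2 * (l U1 a + l U2 a) < card (B I q a) + 7"
      using i0 unfolding l_def by (intro bexI[of _ i0]) auto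
  qed (use per in auto)
  also have "\<dots> = card (J I q) + 7 * t" using cJ[OF v] by (simp add: sum.distrib)
  finally have sm: "2 * ((\<Sum>i<t. l U1 i) + (\<Sum>i<t. l U2 i)) < card (J I q) + 7 * t" .
  have "card U1 + card U2 = card (U1 \<union> U2)" using U12 finite_subset[OF _ fR] by (intro card_Un_disjoint[symmetric]) blast+
  also have "\<dots> \<le> card (R I q)" using U12 by (intro card_mono fR) auto
  finally have cU: "card U1 + card U2 + card (J I q) \<le> 2 * D + 1" using cR[OF v] cL by linarith
  define d1 where "d1 = D - (\<Sum>i<t. l U1 i)"
  define d2 where "d2 = D - (\<Sum>i<t. l U2 i)"
  have d12: "d1 + (\<Sum>i<t. l U1 i) = D" "d2 + (\<Sum>i<t. l U2 i) = D" using l3[of U1] l3[of U2] Dt unfolding d1_def d2_def by linarith+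
  have dt: "3 * t \<le> d1" "3 * t \<le> d2" using d12 l3[of U1] l3[of U2] Dt by linarith+
  \<comment> \<open>Failure on both sides would give \<open>4 * D < 24 * t\<close>, against
    \<open>6 * t \<le> D\<close>; this is the origin of the constant 6.\<close>
  have choice: "5 * t + 2 * card U1 \<le> 4 * d1 \<or> 5 * t + 2 * card U2 \<le> 4 * d2"
  proof (rule ccontr)
    assume "\<not> ?thesis"
    then have "4 * d1 < 5 * t + 2 * card U1" "4 * d2 < 5 * t + 2 * card U2" by auto
    then show False using sm[unfolded add_mult_distrib2] cU d12 Dt by linarith
  qed
  have ne: "U1 \<noteq> {}" "U2 \<noteq> {}"
  proof -
    have c: "card (J I q) < D + card (B I q i0) - 1"
      using J_bound[OF o i0] Dt tmD(5)[OF i0(1) i0(1)] i0 unfolding B_def by simp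
    have seen1: "card (Nb v \<inter> B I q i0) \<le> 1" if vB: "v = s i0 \<or> v = u i0" for v
    proof -
      have "B I q i0 = {s i0, u i0}" using i0 unfolding B_def by simp
      then have "Nb v \<inter> B I q i0 \<subseteq> {s i0, u i0} - {v}" using ir unfolding Nb_def by auto
      then have "card (Nb v \<inter> B I q i0) \<le> card ({s i0, u i0} - {v})" by (intro card_mono) auto
      also have "\<dots> \<le> 1" using vB tmD(5)[OF i0(1) i0(1)] by (auto simp: card_insert_if)
      finally show ?thesis .
    qed
    show "U1 \<noteq> {}" using end_has_nbr[OF o i0(1) _ c seen1, of "s i0"] reach_start unfolding U1_def by fastforce
    show "U2 \<noteq> {}" using end_has_nbr[OF o i0(1) _ c seen1, of "u i0"] reach_start unfolding U2_def by fastforce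
  qed
  have main: "\<exists>U\<subseteq>L. pair_linked E U t \<and> 2 * t \<le> card U"
    if U: "U = reach (R I q) A" "U \<noteq> {}" and ch: "5 * t + 2 * card U \<le> 4 * d" and dd: "3 * t \<le> d" "d + (\<Sum>i<t. l U i) = D"
    for U A d
  proof -
    have UL: "U \<subseteq> L" using U reach_sub RL[of I q] by blast
    have fU: "finite U" using UL fL finite_subset by blast
    have dg: "d \<le> card {w \<in> U. E r w}" if "r \<in> U" for r using degU[OF that U(1)] dd(2) by linarith
    have "pair_linked E U t"
    proof (rule pair_linked_dense[OF sy ir fU dg _ _ dd(1)])
      \<comment> \<open>The surplus \<open>c\<close> of \<open>pair_linked_dense\<close> is taken to
        be \<open>2 * d - card U\<close>.\<close>
      show "card U + (2 * d - card U) \<le> 2 * d" using ch by linarith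
      show "5 * t \<le> 2 * (2 * d - card U)" using ch by linarith
    qed
    moreover have "2 * t \<le> card U"
    proof -
      obtain r where "r \<in> U" using U(2) by blast
      then have "d \<le> card U" using dg[of r] card_mono[OF fU, of "{w \<in> U. E r w}"] by force
      then show ?thesis using dd(1) by linarith
    qed
    ultimately show ?thesis using UL by blast
  qed
  show ?thesis using choice main[OF U1_def ne(1) _ dt(1) d12(1)] main[OF U2_def ne(2) _ dt(2) d12(2)] by blast
qed

end

theorem dense_has_pair_linked:
  assumes "symp E" "\<And>x. \<not> E x x" "finite L" "L \<noteq> {}" "card L \<le> 2 * D + 1" "6 * t \<le> D"
    "\<And>v. v \<in> L \<Longrightarrow> D \<le> card {w \<in> L. E v w}"
  shows "\<exists>U\<subseteq>L. pair_linked E U t \<and> 2 * t \<le> card U"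
proof (cases "pair_linked E L t")
  case True
  obtain r where "r \<in> L" using assms(4) by blast
  then have "D \<le> card L" using assms(7)[of r] card_mono[OF assms(3), of "{w \<in> L. E r w}"] by force
  then show ?thesis using True assms(6) by (intro exI[of _ L]) auto
next
  case False
  then obtain s u where su: "terminals L t s u" "\<not> (\<exists>C. linkage E L t s u C)" unfolding pair_linked_def by blast
  interpret stuck_linkage E L D t s u
    by unfold_locales (use assms su in auto)
  show ?thesis by (rule pair_linked_part)
qed

section \<open>Linked sets of vertices\<close>

definition invol :: "'a set \<Rightarrow> ('a \<Rightarrow> 'a) \<Rightarrow> bool" where
  "invol X p \<longleftrightarrow> (\<forall>x\<in>X. p x \<in> X \<and> p (p x) = x)"

definition links :: "('a \<Rightarrow> 'a \<Rightarrow> bool) \<Rightarrow> 'a set \<Rightarrow> 'a set \<Rightarrow> ('a \<Rightarrow> 'a) \<Rightarrow> ('a \<Rightarrow> 'a set) \<Rightarrow> bool" where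
  "links E V X p C \<longleftrightarrow> (\<forall>x\<in>X. x \<in> C x \<and> conn E (C x) \<and> C x \<subseteq> V \<and> C (p x) = C x \<and>
     (\<forall>y\<in>X. y \<noteq> x \<and> y \<noteq> p x \<longrightarrow> C x \<inter> C y = {}))"

definition lnkp :: "('a \<Rightarrow> 'a \<Rightarrow> bool) \<Rightarrow> 'a set \<Rightarrow> 'a set \<Rightarrow> ('a \<Rightarrow> 'a) \<Rightarrow> bool" where
  "lnkp E V X p \<longleftrightarrow> (\<exists>C. links E V X p C)"

text \<open>The partition of \<open>X\<close> to be realised by disjoint connected sets is given by an involution,
  whose fixed points are the vertices that must merely be avoided.\<close>

definition lnk :: "('a \<Rightarrow> 'a \<Rightarrow> bool) \<Rightarrow> 'a set \<Rightarrow> 'a set \<Rightarrow> bool" where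
  "lnk E V X \<longleftrightarrow> (\<forall>p. invol X p \<longrightarrow> lnkp E V X p)"

lemma involD: "invol X p \<Longrightarrow> x \<in> X \<Longrightarrow> p x \<in> X" "invol X p \<Longrightarrow> x \<in> X \<Longrightarrow> p (p x) = x"
  unfolding invol_def by auto

lemma lnkpI:
  assumes "\<And>x. x \<in> X \<Longrightarrow> x \<in> C x" "\<And>x. x \<in> X \<Longrightarrow> conn E (C x)" "\<And>x. x \<in> X \<Longrightarrow> C x \<subseteq> V"
    "\<And>x. x \<in> X \<Longrightarrow> C (p x) = C x" "\<And>x y. x \<in> X \<Longrightarrow> y \<in> X \<Longrightarrow> y \<noteq> x \<Longrightarrow> y \<noteq> p x \<Longrightarrow> C x \<inter> C y = {}"
  shows "lnkp E V X p"
  unfolding lnkp_def links_def using assms by (intro exI[of _ C]) simp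

lemma linksD:
  assumes "links E V X p C"
  shows "\<And>x. x \<in> X \<Longrightarrow> x \<in> C x" "\<And>x. x \<in> X \<Longrightarrow> conn E (C x)" "\<And>x. x \<in> X \<Longrightarrow> C x \<subseteq> V"
    "\<And>x. x \<in> X \<Longrightarrow> C (p x) = C x" "\<And>x y. x \<in> X \<Longrightarrow> y \<in> X \<Longrightarrow> y \<noteq> x \<Longrightarrow> y \<noteq> p x \<Longrightarrow> C x \<inter> C y = {}"
  using assms unfolding links_def by simp_all

lemma lnkp_conn_mono:
  assumes "lnkp E V X p" "\<And>x y. E x y \<Longrightarrow> F x y"
  shows "lnkp F V X p"
proof -
  obtain C where C0: "links E V X p C" using assms(1) unfolding lnkp_def by blast
  note C = linksD[OF C0]
  show ?thesis by (rule lnkpI[of X C]) (use C assms(2) conn_mono[of E _ F] in auto)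
qed

lemma lnk_indD: "lnk (ind E A) V X \<Longrightarrow> lnk E V X"
  unfolding lnk_def using lnkp_conn_mono[of "ind E A"] unfolding ind_def by blast

lemma lnk_indI: "lnk E V X \<Longrightarrow> lnk (ind E V) V X"
  unfolding lnk_def
proof (intro allI impI)
  fix p assume "\<forall>p. invol X p \<longrightarrow> lnkp E V X p" "invol X p"
  then have "lnkp E V X p" by blast
  then obtain C where C0: "links E V X p C" unfolding lnkp_def by blast
  note C = linksD[OF C0]
  have "conn (ind E V) (C x)" if "x \<in> X" for x using conn_indI[OF C(2)[OF that] C(3)[OF that]] .
  then show "lnkp (ind E V) V X p" by (intro lnkpI[of X C]) (use C in simp_all)
qed

section \<open>Operations that preserve linkedness\<close>

lemma lnk_empty: "lnk E V {}"
  unfolding lnk_def lnkp_def links_def by simp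

text \<open>The involution is extended by the identity, so that the additional vertices are merely
  avoided.\<close>

lemma lnk_subset:
  assumes "lnk E V X" "Y \<subseteq> X"
  shows "lnk E V Y"
  unfolding lnk_def
proof (intro allI impI)
  fix p assume p: "invol Y p"
  define r where "r x = (if x \<in> Y then p x else x)" for x
  have "invol X r" using p assms(2) unfolding invol_def r_def by auto
  then have "lnkp E V X r" using assms(1) unfolding lnk_def by blast
  then obtain C where C0: "links E V X r C" unfolding lnkp_def by blast
  note C = linksD[OF C0]
  show "lnkp E V Y p"
  proof (rule lnkpI[of Y C])
    fix x assume x: "x \<in> Y"
    then have xX: "x \<in> X" "r x = p x" using assms(2) unfolding r_def by auto
    show "x \<in> C x" "conn E (C x)" "C x \<subseteq> V" "C (p x) = C x" using C(1-4)[OF xX(1)] xX(2) by auto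
    fix y assume "y \<in> Y" "y \<noteq> x" "y \<noteq> p x"
    then show "C x \<inter> C y = {}" using C(5)[OF xX(1), of y] xX(2) assms(2) by auto
  qed
qed

text \<open>In a set of even size the fixed points are even in number and can be grouped into
  artificial pairs. This brings every involution into the form treated by
  \<open>pair_linked\<close>.\<close>

lemma pairs_of_invol:
  assumes "finite Y" "card Y = 2 * t" "invol Y p"
  shows "\<exists>s u. terminals Y t s u \<and> (\<forall>i<t. p (s i) = u i \<or> (p (s i) = s i \<and> p (u i) = u i))"
  using assms
proof (induction t arbitrary: Y)
  case 0
  then show ?case unfolding terminals_def by simp
next
  case (Suc n)
  have "\<exists>x y. x \<in> Y \<and> y \<in> Y \<and> x \<noteq> y \<and> (p x = y \<or> (p x = x \<and> p y = y))"
  proof (cases "\<exists>x\<in>Y. p x \<noteq> x")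
    case True
    then show ?thesis using involD(1)[OF Suc.prems(3)] by metis
  next
    case False
    have "1 < card Y" using Suc.prems by simp
    then obtain x y where "x \<in> Y" "y \<in> Y" "x \<noteq> y"
      by (metis One_nat_def card_le_Suc0_iff_eq linorder_not_le Suc.prems(1))
    then show ?thesis using False by blast
  qed
  then obtain x y where xy: "x \<in> Y" "y \<in> Y" "x \<noteq> y" "p x = y \<or> (p x = x \<and> p y = y)" by blast
  have "invol (Y - {x, y}) p" using Suc.prems(3) xy unfolding invol_def by (metis Diff_iff insert_iff singletonD)
  moreover have "card (Y - {x, y}) = 2 * n" using Suc.prems xy by (simp add: card_Diff_subset)
  ultimately obtain s u where su: "terminals (Y - {x, y}) n s u"
    "\<And>i. i < n \<Longrightarrow> p (s i) = u i \<or> (p (s i) = s i \<and> p (u i) = u i)"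
    using Suc.IH[of "Y - {x, y}"] Suc.prems(1) by auto
  note d = terminalsD[OF su(1)]
  have "terminals Y (Suc n) (s(n := x)) (u(n := y))"
    unfolding terminals_def
  proof (intro conjI)
    show "s(n := x) ` {..<Suc n} \<subseteq> Y" "u(n := y) ` {..<Suc n} \<subseteq> Y"
      using d(1,2) xy by (auto simp: less_Suc_eq)
    have nx: "s i \<noteq> x" "x \<noteq> s i" "s i \<noteq> y" "u i \<noteq> x" "x \<noteq> u i" "u i \<noteq> y" "y \<noteq> u i" "y \<noteq> s i" if "i < n" for i
      using d(1)[OF that] d(2)[OF that] by auto
    show "inj_on (s(n := x)) {..<Suc n}"
    proof (rule inj_onI)
      fix i j assume "i \<in> {..<Suc n}" "j \<in> {..<Suc n}" "(s(n := x)) i = (s(n := x)) j"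
      then show "i = j" using d(3)[of i j] nx(2)[of i] nx(2)[of j] by (cases "i = n"; cases "j = n") auto
    qed
    show "inj_on (u(n := y)) {..<Suc n}"
    proof (rule inj_onI)
      fix i j assume "i \<in> {..<Suc n}" "j \<in> {..<Suc n}" "(u(n := y)) i = (u(n := y)) j"
      then show "i = j" using d(4)[of i j] nx(7)[of i] nx(7)[of j] by (cases "i = n"; cases "j = n") auto
    qed
    show "s(n := x) ` {..<Suc n} \<inter> u(n := y) ` {..<Suc n} = {}"
    proof -
      have "(s(n := x)) i \<noteq> (u(n := y)) j" if "i < Suc n" "j < Suc n" for i j
        using d(5)[of i j] nx(3)[of i] nx(5)[of j] xy(3) that by (cases "i = n"; cases "j = n") auto
      then show ?thesis by blast
    qed
  qed
  moreover have "p ((s(n := x)) i) = (u(n := y)) i \<or> (p ((s(n := x)) i) = (s(n := x)) i \<and> p ((u(n := y)) i) = (u(n := y)) i)"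
    if "i < Suc n" for i using su(2)[of i] xy(4) that by (cases "i = n") auto
  ultimately show ?case by blast
qed

lemma pair_linked_lnk:
  assumes fU: "finite U" and pl: "pair_linked E U t" and Y: "Y \<subseteq> U" "card Y \<le> 2 * t" and cU: "2 * t \<le> card U"
  shows "lnk E U Y"
proof -
  obtain Y' where Y': "Y \<subseteq> Y'" "Y' \<subseteq> U" "card Y' = 2 * t"
    using exists_subset_between[OF Y(2) cU Y(1) fU] by blast
  have fY: "finite Y'" using Y' fU finite_subset by blast
  have "lnk E U Y'" unfolding lnk_def
  proof (intro allI impI)
    fix p assume p: "invol Y' p"
    obtain s u where su: "terminals Y' t s u" "\<And>i. i < t \<Longrightarrow> p (s i) = u i \<or> (p (s i) = s i \<and> p (u i) = u i)"
      using pairs_of_invol[OF fY Y'(3) p] by auto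
    have "terminals U t s u" using su(1) Y'(2) unfolding terminals_def by blast
    then obtain C where C: "linkage E U t s u C" using pl unfolding pair_linked_def by blast
    have cov: "s ` {..<t} \<union> u ` {..<t} = Y'"
      using terminals_card[OF su(1)] su(1) Y'(3) fY unfolding terminals_def by (intro card_subset_eq) auto
    define k where "k x = (SOME i. i < t \<and> (x = s i \<or> x = u i))" for x
    have k: "k x < t \<and> (x = s (k x) \<or> x = u (k x))" if "x \<in> Y'" for x
          proof -
      have "\<exists>i. i < t \<and> (x = s i \<or> x = u i)" using that cov by auto
      then show ?thesis unfolding k_def by (rule someI_ex)
    qed
    have cl: "conn E (C i)" "C i \<subseteq> U" "s i \<in> C i" "u i \<in> C i" if "i < t" for i
      using C that unfolding linkage_def by auto
    have dj: "C i \<inter> C j = {}" if "i < t" "j < t" "i \<noteq> j" for i j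
      using C that unfolding linkage_def by auto
    have xk: "x \<in> C (k x)" if "x \<in> Y'" for x using k[OF that] cl(3,4)[of "k x"] by metis
    have uniq: "k x = i" if "x \<in> C i" "i < t" "x \<in> Y'" for x i using dj[of i "k x"] that xk[OF that(3)] k[OF that(3)] by auto
    have pp: "k (p x) = k x" if x: "x \<in> Y'" "p x \<noteq> x" for x
    proof -
      have "p x = s (k x) \<or> p x = u (k x)" using k[OF x(1)] su(2)[of "k x"] involD(2)[OF p] x cov by (metis image_eqI lessThan_iff UnI1)
      then have "p x \<in> C (k x)" using cl(3,4)[of "k x"] k[OF x(1)] by metis
      then show ?thesis using uniq[of "p x" "k x"] k[OF x(1)] involD(1)[OF p x(1)] by simp
    qed
    show "lnkp E U Y' p"
    \<comment> \<open>The set that links an artificial pair is discarded in favour of the two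
      singletons.\<close>
    proof (rule lnkpI[of Y' "\<lambda>x. if p x = x then {x} else C (k x)"])
      fix x assume x: "x \<in> Y'"
      show "x \<in> (if p x = x then {x} else C (k x))" using xk[OF x] by auto
      show "conn E (if p x = x then {x} else C (k x))" using cl(1) k[OF x] conn_single by auto
      show "(if p x = x then {x} else C (k x)) \<subseteq> U" using cl(2) k[OF x] x Y'(2) by auto
      show "(if p (p x) = p x then {p x} else C (k (p x))) = (if p x = x then {x} else C (k x))"
        using pp[OF x] involD(2)[OF p x] by auto
      fix y assume y: "y \<in> Y'" "y \<noteq> x" "y \<noteq> p x"
      have in1: "(if p z = z then {z} else C (k z)) \<subseteq> C (k z)" if "z \<in> Y'" for z using xk[OF that] by auto
      show "(if p x = x then {x} else C (k x)) \<inter> (if p y = y then {y} else C (k y)) = {}"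
      proof (cases "k x = k y")
        case False
        then have "C (k x) \<inter> C (k y) = {}" using dj k[OF x] k[OF y(1)] by blast
        then show ?thesis using in1[OF x] in1[OF y(1)] by blast
      next
        case True
        then have "(x = s (k x) \<and> y = u (k x)) \<or> (x = u (k x) \<and> y = s (k x))" using k[OF x] k[OF y(1)] y(2) by auto
        moreover have "p y \<noteq> x" using y involD(2)[OF p y(1)] by metis
        ultimately have "p x = x \<and> p y = y" using su(2)[of "k x"] k[OF x] y(3) by metis
        then show ?thesis using y by auto
      qed
    qed
  qed
  then show ?thesis by (rule lnk_subset[OF _ Y'(1)])
qed

text \<open>Gluing: \<open>K\<close> is linked inside \<open>Q\<close> if it can be joined by disjoint sets to a linked set.\<close>

lemma lnk_glue:
  assumes D: "\<And>z. z \<in> K \<Longrightarrow> conn E (D z) \<and> D z \<subseteq> Q \<and> z \<in> D z \<and> D z \<inter> B = {f z}"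
    and dj: "\<And>z w. z \<in> K \<Longrightarrow> w \<in> K \<Longrightarrow> z \<noteq> w \<Longrightarrow> D z \<inter> D w = {}"
    and L: "lnk E B (f ` K)" and BQ: "B \<subseteq> Q"
  shows "lnk E Q K"
  unfolding lnk_def
proof (intro allI impI)
  fix p assume p: "invol K p"
  have fD: "f z \<in> D z" "f z \<in> B" if "z \<in> K" for z using D[OF that] by blast+
  have inj: "z = w" if "z \<in> K" "w \<in> K" "f z = f w" for z w
    using dj[OF that(1,2)] fD[OF that(1)] fD[OF that(2)] that(3) by auto
  define g where "g y = (SOME z. z \<in> K \<and> f z = y)" for y
  have g: "g (f z) = z" if "z \<in> K" for z
  proof -
    have "g (f z) \<in> K \<and> f (g (f z)) = f z" unfolding g_def by (rule someI_ex) (use that in blast)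
    then show ?thesis using inj that by blast
  qed
  define r where "r y = f (p (g y))" for y
  have rf: "r (f z) = f (p z)" if "z \<in> K" for z unfolding r_def using g[OF that] by simp
  have "invol (f ` K) r" unfolding invol_def using rf involD[OF p] by auto
  then have "lnkp E B (f ` K) r" using L unfolding lnk_def by blast
  then obtain C where C0: "links E B (f ` K) r C" unfolding lnkp_def by blast
  note C = linksD[OF C0]
  have Cz: "f z \<in> C (f z)" "conn E (C (f z))" "C (f z) \<subseteq> B" "C (f (p z)) = C (f z)" if "z \<in> K" for z
    using C(1-4)[of "f z"] rf[OF that] that by auto
  have Cd: "C (f z) \<inter> C (f w) = {}" if "z \<in> K" "w \<in> K" "w \<noteq> z" "w \<noteq> p z" for z w
    using C(5)[of "f z" "f w"] rf[OF that(1)] inj[of w z] inj[of w "p z"] that involD(1)[OF p that(1)] by auto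
  show "lnkp E Q K p"
  proof (rule lnkpI[of K "\<lambda>z. D z \<union> C (f z) \<union> D (p z)"])
    fix z assume z: "z \<in> K"
    have pz: "p z \<in> K" "p (p z) = z" using involD[OF p z] by auto
    show "z \<in> D z \<union> C (f z) \<union> D (p z)" using D[OF z] by blast
    have "conn E (D z \<union> C (f z))" using conn_Un[of E "D z" "C (f z)"] D[OF z] Cz[OF z] fD[OF z] by blast
    moreover have "f (p z) \<in> C (f z)" using Cz(1)[OF pz(1)] Cz(4)[OF z] by simp
    ultimately show "conn E (D z \<union> C (f z) \<union> D (p z))"
      using conn_Un[of E "D z \<union> C (f z)" "D (p z)"] D[OF pz(1)] fD[OF pz(1)] by blast
    show "D z \<union> C (f z) \<union> D (p z) \<subseteq> Q" using D[OF z] D[OF pz(1)] Cz(3)[OF z] BQ by blast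
    show "D (p z) \<union> C (f (p z)) \<union> D (p (p z)) = D z \<union> C (f z) \<union> D (p z)" using pz Cz(4)[OF z] by auto
    fix w assume w: "w \<in> K" "w \<noteq> z" "w \<noteq> p z"
    have pw: "p w \<in> K" "p (p w) = w" using involD[OF p w(1)] by auto
    have ne: "p w \<noteq> z" "p w \<noteq> p z" using w pw pz by metis+
    have d1: "D z \<inter> D w = {}" "D z \<inter> D (p w) = {}" "D (p z) \<inter> D w = {}" "D (p z) \<inter> D (p w) = {}"
      using dj[OF z w(1)] dj[OF z pw(1)] dj[OF pz(1) w(1)] dj[OF pz(1) pw(1)] w ne by auto
    have d2: "C (f z) \<inter> C (f w) = {}" by (rule Cd[OF z w])
    have d3: "D a \<inter> C (f b) = {}" if a: "a \<in> K" and b: "b \<in> K" and ab: "b \<noteq> a" "b \<noteq> p a" for a b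
    proof -
      have "D a \<inter> C (f b) \<subseteq> {f a}" using Cz(3)[OF b] D[OF a] by blast
      moreover have "f a \<notin> C (f b)" using Cd[OF a b ab] Cz(1)[OF a] by blast
      ultimately show ?thesis by blast
    qed
    have d4: "D z \<inter> C (f w) = {}" "D (p z) \<inter> C (f w) = {}" "D w \<inter> C (f z) = {}" "D (p w) \<inter> C (f z) = {}"
      using d3[OF z w(1)] d3[OF pz(1) w(1)] d3[OF w(1) z] d3[OF pw(1) z] w ne pz(2) pw(2) by auto
    show "(D z \<union> C (f z) \<union> D (p z)) \<inter> (D w \<union> C (f w) \<union> D (p w)) = {}"
      using d1 d2 d4 by (simp add: Int_Un_distrib Int_Un_distrib2 Int_commute)
  qed
qed

text \<open>Among the separations of \<open>X\<close> from \<open>B\<close> with first side inside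
  \<open>A\<close>, take one of least order. By Menger's theorem its separator is joined to
  \<open>A \<inter> B\<close> by disjoint connected sets within \<open>Q\<close>, so
  \<open>lnk_glue\<close> links it there. If the least order is \<open>card X\<close>, this applies
  to the separation \<open>(X, V)\<close> and links \<open>X\<close> itself.\<close>

lemma lnk_push_out:
  assumes g: "simple_graph V E" and AB: "A \<union> B = V" "sep E A B" "X \<subseteq> A"
    and L: "\<And>Y. Y \<subseteq> A \<inter> B \<Longrightarrow> card Y \<le> card X \<Longrightarrow> lnk E B Y"
  obtains "lnk E V X" | P Q where "P \<union> Q = V" "sep E P Q" "X \<subseteq> P" "B \<subseteq> Q" "P \<subseteq> A" "card (P \<inter> Q) < card X"
    "lnk E Q (P \<inter> Q)"
proof -
  note gd = simple_graphD[OF g]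
  define cand where "cand PQ \<longleftrightarrow> fst PQ \<union> snd PQ = V \<and> sep E (fst PQ) (snd PQ) \<and> X \<subseteq> fst PQ \<and> B \<subseteq> snd PQ \<and> fst PQ \<subseteq> A" for PQ
  have c0: "cand (X, V)" unfolding cand_def sep_def using AB gd by auto
  have key: "lnk E Q (P \<inter> Q)"
    if c: "cand (P, Q)" and mn: "\<And>PQ'. cand PQ' \<Longrightarrow> card (P \<inter> Q) \<le> card (fst PQ' \<inter> snd PQ')" for P Q
  proof -
    have PQ: "P \<union> Q = V" "sep E P Q" "X \<subseteq> P" "B \<subseteq> Q" "P \<subseteq> A" using c unfolding cand_def by auto
    have XV: "X \<inter> V = X" using AB by auto
    have "card (P \<inter> Q) \<le> card X" using mn[OF c0] XV by simp
    define K where "K = A \<inter> B"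
    define H where "H = Q \<inter> A"
    have gH: "simple_graph H (ind E H)" using simple_graph_ind[OF g] AB unfolding H_def by auto
    obtain C where C: "\<And>z. z \<in> P \<inter> Q \<Longrightarrow> conn (ind E H) (C z) \<and> C z \<subseteq> H \<and> C z \<inter> (P \<inter> Q) = {z} \<and> C z \<inter> K \<noteq> {}"
      "\<And>z y. z \<in> P \<inter> Q \<Longrightarrow> y \<in> P \<inter> Q \<Longrightarrow> z \<noteq> y \<Longrightarrow> C z \<inter> C y = {}"
    proof (rule menger_indexed[OF gH, of "P \<inter> Q" K])
      show "P \<inter> Q \<subseteq> H" "K \<subseteq> H" using PQ unfolding H_def K_def by auto
    next
      fix P1 Q1 assume 1: "P1 \<union> Q1 = H" "P \<inter> Q \<subseteq> P1" "K \<subseteq> Q1" "sep (ind E H) P1 Q1"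
      \<comment> \<open>A cut between the two separators inside \<open>Q \<inter> A\<close> is
        turned into a candidate of the same order, so it cannot be smaller than
        \<open>P \<inter> Q\<close>.\<close>
      have "cand (P \<union> P1, Q1 \<union> B)" unfolding cand_def fst_conv snd_conv
      proof (intro conjI)
        show "P \<union> P1 \<union> (Q1 \<union> B) = V" using 1(1) PQ(1) AB(1) unfolding H_def by auto
        show "sep E (P \<union> P1) (Q1 \<union> B)" unfolding sep_def
        proof (intro allI impI)
          fix a b assume ab: "E a b"
          show "a \<in> P \<union> P1 \<and> b \<in> P \<union> P1 \<or> a \<in> Q1 \<union> B \<and> b \<in> Q1 \<union> B"
          proof (cases "a \<in> P \<and> b \<in> P \<or> a \<in> B \<and> b \<in> B")
            case False
            then have "a \<in> Q \<and> b \<in> Q" "a \<in> A \<and> b \<in> A" using PQ(2) AB(2) ab unfolding sep_def by blast+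
            then have "ind E H a b" using ab unfolding ind_def H_def by auto
            then show ?thesis using 1(4) unfolding sep_def by blast
          qed auto
        qed
        show "P \<union> P1 \<subseteq> A" using 1(1) PQ(5) unfolding H_def by auto
      qed (use PQ in auto)
      then have "card (P \<inter> Q) \<le> card ((P \<union> P1) \<inter> (Q1 \<union> B))" using mn by fastforce
      also have "(P \<union> P1) \<inter> (Q1 \<union> B) = P1 \<inter> Q1"
      proof
        have "P \<inter> Q1 \<subseteq> P1" using 1(1,2) unfolding H_def by auto
        moreover have "P \<inter> B \<subseteq> P1" "P \<inter> B \<subseteq> Q1" using 1(2,3) PQ unfolding K_def by auto
        moreover have "P1 \<inter> B \<subseteq> Q1" using 1(1,3) unfolding K_def H_def by auto
        ultimately show "(P \<union> P1) \<inter> (Q1 \<union> B) \<subseteq> P1 \<inter> Q1" by blast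
      qed auto
      finally show "card (P \<inter> Q) \<le> card (P1 \<inter> Q1)" .
    qed blast
    have "\<exists>D y. D \<subseteq> C z \<and> conn E D \<and> z \<in> D \<and> y \<in> K \<and> D \<inter> K = {y}" if z: "z \<in> P \<inter> Q" for z
    proof -
      have "conn E (C z)" "z \<in> C z" "C z \<inter> K \<noteq> {}" using C(1)[OF z] conn_indD by auto
      then show ?thesis using conn_to_set[OF gd(2)] by metis
    qed
    then obtain D f where D: "\<And>z. z \<in> P \<inter> Q \<Longrightarrow> D z \<subseteq> C z \<and> conn E (D z) \<and> z \<in> D z \<and> f z \<in> K \<and> D z \<inter> K = {f z}"
      by metis
    have DA: "D z \<subseteq> H" if "z \<in> P \<inter> Q" for z using D[OF that] C(1)[OF that] by blast
    show ?thesis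
    proof (rule lnk_glue[of "P \<inter> Q" E D Q B f])
      fix z assume z: "z \<in> P \<inter> Q"
      have "D z \<inter> B = D z \<inter> K" using DA[OF z] unfolding H_def K_def by auto
      then show "conn E (D z) \<and> D z \<subseteq> Q \<and> z \<in> D z \<and> D z \<inter> B = {f z}" using D[OF z] DA[OF z] unfolding H_def by auto
    next
      fix z w assume "z \<in> P \<inter> Q" "w \<in> P \<inter> Q" "z \<noteq> w"
      then show "D z \<inter> D w = {}" using C(2)[of z w] D[of z] D[of w] by blast
    next
      have "finite (P \<inter> Q)" using PQ(1) gd(1) by auto
      then have "card (f ` (P \<inter> Q)) \<le> card X" using \<open>card (P \<inter> Q) \<le> card X\<close> card_image_le order_trans by blast
      moreover have "f ` (P \<inter> Q) \<subseteq> A \<inter> B" using D unfolding K_def by blast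
      ultimately show "lnk E B (f ` (P \<inter> Q))" using L by blast
    qed (rule PQ(4))
  qed
  obtain PQ where PQ: "cand PQ" "\<And>PQ'. cand PQ' \<Longrightarrow> card (fst PQ \<inter> snd PQ) \<le> card (fst PQ' \<inter> snd PQ')"
    using ex_has_least_nat[of cand "(X, V)" "\<lambda>PQ. card (fst PQ \<inter> snd PQ)"] c0 by blast
  have XV: "X \<inter> V = X" using AB by auto
  show ?thesis
  proof (cases "card (fst PQ \<inter> snd PQ) < card X")
    case True
    have "lnk E (snd PQ) (fst PQ \<inter> snd PQ)" by (rule key) (use PQ in auto)
    then show ?thesis using that(2)[of "fst PQ" "snd PQ"] True PQ(1) unfolding cand_def by blast
  next
    case False
    have "lnk E V (X \<inter> V)" by (rule key[OF c0]) (use PQ(2) False XV in \<open>metis fst_conv le_trans linorder_not_le snd_conv\<close>)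
    then show ?thesis using that(1) XV by simp
  qed
qed

text \<open>A side that is linked across the separator may be replaced by a clique on the separator.\<close>

lemma lnkp_replace_clique:
  assumes g: "simple_graph V E" and AB: "A \<union> B = V" "sep E A B" "X \<subseteq> A" and KL: "lnk E B (A \<inter> B)"
    and F: "\<And>x y. F x y \<Longrightarrow> ind E A x y \<or> (x \<in> A \<inter> B \<and> y \<in> A \<inter> B \<and> x \<noteq> y)" and syF: "symp F"
    and p: "invol X p" and LF: "lnkp F A X p"
  shows "lnkp E V X p"
proof -
  note gd = simple_graphD[OF g]
  define K where "K = A \<inter> B"
  obtain C where C0: "links F A X p C" using LF unfolding lnkp_def by blast
  note C = linksD[OF C0]
  note pD = involD[OF p]
  \<comment> \<open>A connected set with at most one vertex in the separator uses none of the clique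
    edges.\<close>
  have FE: "conn E T" if "conn F T" "T \<inter> K = {} \<or> (\<exists>a. T \<inter> K = {a})" for T
    using that(1)
  proof (rule conn_mono)
    fix x y assume "x \<in> T" "y \<in> T" "F x y"
    moreover from this have "\<not> (x \<in> K \<and> y \<in> K \<and> x \<noteq> y)" using that(2) by (metis IntI empty_iff singletonD)
    ultimately show "E x y" using F[of x y] unfolding K_def ind_def by blast
  qed
  define X1 where "X1 = {x \<in> X. C x \<inter> K \<noteq> {}}"
  have "\<exists>D a. D \<subseteq> C x \<and> conn E D \<and> x \<in> D \<and> a \<in> K \<and> D \<inter> K = {a}" if x: "x \<in> X1" for x
  proof -
    have "conn F (C x)" "x \<in> C x" "C x \<inter> K \<noteq> {}" using x C(1,2) unfolding X1_def by auto
    then obtain D a where "D \<subseteq> C x" "conn F D" "x \<in> D" "a \<in> K" "D \<inter> K = {a}" using conn_to_set[OF syF] by metis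
    then show ?thesis using FE[of D] by blast
  qed
  then obtain D a where D: "\<And>x. x \<in> X1 \<Longrightarrow> D x \<subseteq> C x \<and> conn E (D x) \<and> x \<in> D x \<and> a x \<in> K \<and> D x \<inter> K = {a x}"
    by metis
  have pX1: "p x \<in> X1" if "x \<in> X1" for x using that pD(1)[of x] C(4)[of x] unfolding X1_def by simp
  have X1X: "x \<in> X" if "x \<in> X1" for x using that unfolding X1_def by simp
  have aC: "a x \<in> C x" if "x \<in> X1" for x using D[OF that] by blast
  have same: "y = x \<or> y = p x" if "x \<in> X1" "y \<in> X1" "k \<in> C x" "k \<in> C y" for x y k
    using C(5)[OF X1X[OF that(1)] X1X[OF that(2)]] that(3,4) by blast
  \<comment> \<open>Each set is cut at its first vertex \<open>a x\<close> in the separator, and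
    \<open>r\<close> pairs these entry points as \<open>p\<close> pairs the vertices they come from.
    The linkage on the other side realises \<open>r\<close>.\<close>
  define r where "r k = (if \<exists>x\<in>X1. a x = k then a (p (SOME x. x \<in> X1 \<and> a x = k)) else k)" for k
  have ra: "r (a x) = a (p x)" if x: "x \<in> X1" for x
  proof -
    define y where "y = (SOME y. y \<in> X1 \<and> a y = a x)"
    have y: "y \<in> X1 \<and> a y = a x" unfolding y_def by (rule someI_ex) (use x in blast)
    have "r (a x) = a (p y)" unfolding r_def y_def using x by auto
    moreover have "y = x \<or> y = p x" using same[OF x, of y "a x"] y aC[OF x] aC[of y] by simp
    ultimately show ?thesis using y pD(2)[OF X1X[OF x]] by auto
  qed
  have "invol K r" unfolding invol_def
  proof
    fix k assume k: "k \<in> K"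
    show "r k \<in> K \<and> r (r k) = k"
    proof (cases "\<exists>x\<in>X1. a x = k")
      case True
      then obtain x where x: "x \<in> X1" "a x = k" by blast
      then show ?thesis using ra[OF x(1)] ra[OF pX1[OF x(1)]] D[OF pX1[OF x(1)]] pD(2)[OF X1X[OF x(1)]] by simp
    next
      case False then show ?thesis using k unfolding r_def by simp
    qed
  qed
  then have "lnkp E B K r" using KL unfolding lnk_def K_def by blast
  then obtain G where G0: "links E B K r G" unfolding lnkp_def by blast
  note G = linksD[OF G0]
  have aK: "a x \<in> K" if "x \<in> X1" for x using D[OF that] by blast
  define T where "T x = (if x \<in> X1 then D x \<union> G (a x) \<union> D (p x) else C x)" for x
  have Gp: "G (a (p x)) = G (a x)" if "x \<in> X1" for x using G(4)[OF aK[OF that]] ra[OF that] by simp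
  have CK: "C x \<inter> K = {}" if "x \<in> X" "x \<notin> X1" for x using that unfolding X1_def by auto
  show ?thesis
  proof (rule lnkpI[of X T])
    fix x assume x: "x \<in> X"
    show "x \<in> T x" using D[of x] C(1)[OF x] unfolding T_def by auto
    show "conn E (T x)"
    proof (cases "x \<in> X1")
      case True
      have "conn E (D x \<union> G (a x))" using conn_Un[of E "D x" "G (a x)"] D[OF True] G(1,2)[OF aK[OF True]] by blast
      moreover have "a (p x) \<in> G (a x)" using G(1)[OF aK[OF pX1[OF True]]] Gp[OF True] by simp
      ultimately have "conn E (D x \<union> G (a x) \<union> D (p x))"
        using conn_Un[of E "D x \<union> G (a x)" "D (p x)"] D[OF pX1[OF True]] by blast
      then show ?thesis using True unfolding T_def by simp
    next
      case False then show ?thesis using FE[OF C(2)[OF x]] CK[OF x] unfolding T_def by simp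
    qed
    show "T x \<subseteq> V"
    proof (cases "x \<in> X1")
      case True
      have "D x \<subseteq> A" "D (p x) \<subseteq> A" using D[OF True] D[OF pX1[OF True]] C(3)[OF x] C(3)[OF pD(1)[OF x]] by blast+
      then show ?thesis using G(3)[OF aK[OF True]] True AB(1) unfolding T_def by auto
    next
      case False then show ?thesis using C(3)[OF x] AB(1) unfolding T_def by auto
    qed
    show "T (p x) = T x"
    proof (cases "x \<in> X1")
      case True
      then show ?thesis using pX1[OF True] Gp[OF True] pD(2)[OF x] unfolding T_def by auto
    next
      case False
      have "p x \<notin> X1" using False pX1[of "p x"] pD(2)[OF x] by auto
      then show ?thesis using False C(4)[OF x] unfolding T_def by simp
    qed
    fix y assume y: "y \<in> X" "y \<noteq> x" "y \<noteq> p x"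
    have dC: "C x \<inter> C y = {}" by (rule C(5)[OF x y])
    \<comment> \<open>\<open>T z\<close> exceeds \<open>C z\<close> only inside a linking set of the
      other side, so only intersections with such sets need an argument.\<close>
    have part: "T z \<subseteq> C z \<union> (if z \<in> X1 then G (a z) else {})" if "z \<in> X" for z
      using D[of z] D[OF pX1, of z] C(4)[OF that] unfolding T_def by auto
    have GC: "G (a z) \<inter> T w \<inter> C w = {}" if z: "z \<in> X1" and w: "w \<in> X" and d: "C z \<inter> C w = {}" for z w
    proof -
      have GB: "G (a z) \<subseteq> B" using G(3)[OF aK[OF z]] .
      have GK: "G (a z) \<inter> C w \<subseteq> K" using GB C(3)[OF w] unfolding K_def by auto
      show ?thesis
      proof (cases "w \<in> X1")
        case False
        then show ?thesis using GK CK[OF w] by blast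
      next
        case w1: True
        have az: "a z \<in> C z" "a (p z) \<in> C z" using aC[OF z] aC[OF pX1[OF z]] C(4)[OF X1X[OF z]] by auto
        have dis: "G (a z) \<inter> G (a v) = {}" if "v \<in> X1" "a v \<in> C w" for v
        proof (rule G(5)[OF aK[OF z] aK[OF that(1)]])
          show "a v \<noteq> a z" "a v \<noteq> r (a z)" using that az d ra[OF z] by auto
        qed
        have aw: "a w \<in> C w" "a (p w) \<in> C w" using aC[OF w1] aC[OF pX1[OF w1]] C(4)[OF w] by auto
        have e1: "G (a z) \<inter> G (a w) = {}" by (rule dis[OF w1 aw(1)])
        have e2: "G (a z) \<inter> G (a (p w)) = {}" by (rule dis[OF pX1[OF w1] aw(2)])
        have "G (a z) \<inter> D w = {}"
        proof -
          have "G (a z) \<inter> D w \<subseteq> K" using GK D[OF w1] by blast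
          then have "G (a z) \<inter> D w \<subseteq> {a w}" using D[OF w1] by blast
          then show ?thesis using e1 G(1)[OF aK[OF w1]] by blast
        qed
        moreover have "G (a z) \<inter> D (p w) = {}"
        proof -
          have "G (a z) \<inter> D (p w) \<subseteq> K" using GK D[OF pX1[OF w1]] C(4)[OF w] by blast
          then have "G (a z) \<inter> D (p w) \<subseteq> {a (p w)}" using D[OF pX1[OF w1]] by blast
          then show ?thesis using e2 G(1)[OF aK[OF pX1[OF w1]]] by blast
        qed
        ultimately show ?thesis using e1 w1 unfolding T_def by auto
      qed
    qed
    have GG: "G (a x) \<inter> G (a y) = {}" if "x \<in> X1" "y \<in> X1"
    proof (rule G(5)[OF aK[OF that(1)] aK[OF that(2)]])
      have "a x \<in> C x" "a (p x) \<in> C x" using aC[OF that(1)] aC[OF pX1[OF that(1)]] C(4)[OF x] by auto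
      then show "a y \<noteq> a x" "a y \<noteq> r (a x)" using aC[OF that(2)] dC ra[OF that(1)] by auto
    qed
    show "T x \<inter> T y = {}"
    proof (rule ccontr)
      assume "T x \<inter> T y \<noteq> {}"
      then obtain z where z: "z \<in> T x" "z \<in> T y" by blast
      consider "z \<in> C x" "z \<in> C y" | "z \<in> C x" "y \<in> X1" "z \<in> G (a y)" | "x \<in> X1" "z \<in> G (a x)" "z \<in> C y"
        | "x \<in> X1" "z \<in> G (a x)" "y \<in> X1" "z \<in> G (a y)"
        using part[OF x] part[OF y(1)] z by (auto split: if_splits)
      then show False
      proof cases
        case 1 then show ?thesis using dC by blast
      next
        case 2 then show ?thesis using GC[OF 2(2) x] dC z by blast
      next
        case 3 then show ?thesis using GC[OF 3(1) y(1)] dC z by blast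
      next
        case 4 then show ?thesis using GG by blast
      qed
    qed
  qed
qed

text \<open>The vertex \<open>w\<close> stands for the contracted edge, so no new vertex is needed;
  \<open>v\<close> is left isolated.\<close>

definition contract :: "('a \<Rightarrow> 'a \<Rightarrow> bool) \<Rightarrow> 'a \<Rightarrow> 'a \<Rightarrow> 'a \<Rightarrow> 'a \<Rightarrow> bool" where
  "contract E v w x y \<longleftrightarrow> x \<noteq> y \<and> x \<noteq> v \<and> y \<noteq> v \<and> (E x y \<or> (x = w \<and> E v y) \<or> (y = w \<and> E x v))"

text \<open>The linking set that contains \<open>w\<close>, if there is one, absorbs
  \<open>v\<close>; no other set is affected.\<close>

lemma lnkp_contract:
  assumes sy: "symp E" and vw: "E v w" and v: "v \<notin> V" and L: "lnkp (contract E v w) V X p"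
  shows "lnkp E (insert v V) X p"
proof -
  obtain C where C0: "links (contract E v w) V X p C" using L unfolding lnkp_def by blast
  note C = linksD[OF C0]
  define T where "T x = (if w \<in> C x then insert v (C x) else C x)" for x
  show ?thesis
  proof (rule lnkpI[of X T])
    fix x assume x: "x \<in> X"
    show "x \<in> T x" using C(1)[OF x] unfolding T_def by simp
    show "T x \<subseteq> insert v V" using C(3)[OF x] unfolding T_def by auto
    show "T (p x) = T x" using C(4)[OF x] unfolding T_def by simp
    show "conn E (T x)"
    proof (cases "w \<in> C x")
      case False
      then have "conn E (C x)" using C(2)[OF x]
        by (elim conn_mono) (auto simp: contract_def)
      then show ?thesis using False unfolding T_def by simp
    next
      case True
      have vC: "v \<notin> C x" using C(3)[OF x] v by blast
      have "conn E (insert v (C x))"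
      proof (rule connI)
        fix D assume D: "D \<subseteq> insert v (C x)" "D \<noteq> {}" "D \<noteq> insert v (C x)"
        show "\<exists>a\<in>D. \<exists>b\<in>insert v (C x) - D. E a b"
        proof (cases "v \<in> D \<longleftrightarrow> w \<in> D")
          case False
          then show ?thesis using vw sympD[OF sy vw] True by blast
        next
          case same: True
          have "D - {v} \<subseteq> C x" "D - {v} \<noteq> {}" "D - {v} \<noteq> C x" using D same True vC by auto
          then obtain a b where ab: "a \<in> D - {v}" "b \<in> C x" "b \<notin> D - {v}" "contract E v w a b"
            using connD[OF C(2)[OF x]] by metis
          have "b \<notin> D" using ab vC by blast
          consider "E a b" | "a = w" "E v b" | "b = w" "E a v" using ab(4) unfolding contract_def by blast
          then show ?thesis
          proof cases
            case 1 then show ?thesis using ab \<open>b \<notin> D\<close> by blast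
          next
            case 2 then show ?thesis using ab \<open>b \<notin> D\<close> same by blast
          next
            case 3 then show ?thesis using ab \<open>b \<notin> D\<close> same by blast
          qed
        qed
      qed simp
      then show ?thesis using True unfolding T_def by simp
    qed
    fix y assume y: "y \<in> X" "y \<noteq> x" "y \<noteq> p x"
    have "C x \<inter> C y = {}" by (rule C(5)[OF x y])
    then show "T x \<inter> T y = {}" using C(3)[OF x] C(3)[OF y(1)] v unfolding T_def by auto
  qed
qed

section \<open>Massed graphs are linked\<close>

text \<open>Edges are counted as ordered pairs, so \<open>rho\<close> is twice the number of edges meeting \<open>S\<close>.\<close>

definition rho :: "('a \<Rightarrow> 'a \<Rightarrow> bool) \<Rightarrow> 'a set \<Rightarrow> nat" where
  "rho E S = card {(x, y). E x y \<and> (x \<in> S \<or> y \<in> S)}"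

text \<open>The massed pairs of Thomas and Wollan with density \<open>6 * t\<close>: more than
  \<open>6 * t\<close> edges per vertex outside \<open>X\<close>, and no part as dense as this
  behind a separation of order less than \<open>card X\<close>. The factor is 12 because
  \<open>rho\<close> counts every edge twice.\<close>

definition massed :: "nat \<Rightarrow> 'a set \<Rightarrow> ('a \<Rightarrow> 'a \<Rightarrow> bool) \<Rightarrow> 'a set \<Rightarrow> bool" where
  "massed t V E X \<longleftrightarrow> 12 * t * card (V - X) < rho E (V - X) \<and>
     (\<forall>A B. A \<union> B = V \<and> sep E A B \<and> X \<subseteq> A \<and> card (A \<inter> B) < card X \<longrightarrow>
        rho E (B - A) \<le> 12 * t * card (B - A))"

lemma finite_arcs: "simple_graph V E \<Longrightarrow> finite {(x, y). E x y \<and> P x y}"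
  by (rule finite_subset[of _ "V \<times> V"]) (auto dest: simple_graphD)

lemma rho_mono:
  assumes "simple_graph V E" "\<And>x y. F x y \<Longrightarrow> x \<in> S \<or> y \<in> S \<Longrightarrow> E x y"
  shows "rho F S \<le> rho E S"
  unfolding rho_def by (rule card_mono[OF finite_arcs[OF assms(1)]]) (use assms(2) in auto)

lemma rho_empty: "rho E {} = 0"
  unfolding rho_def by simp

lemma rho_gt_nonempty: "n < rho E S \<Longrightarrow> S \<noteq> {}"
  by (auto simp: rho_empty)

lemma rho_cong:
  assumes "\<And>x y. x \<in> S \<or> y \<in> S \<Longrightarrow> E x y = F x y"
  shows "rho E S = rho F S"
proof -
  have "{(x, y). E x y \<and> (x \<in> S \<or> y \<in> S)} = {(x, y). F x y \<and> (x \<in> S \<or> y \<in> S)}" using assms by auto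
  then show ?thesis unfolding rho_def by simp
qed

lemma massedD:
  assumes "massed t V E X"
  shows "12 * t * card (V - X) < rho E (V - X)"
    "\<And>A B. A \<union> B = V \<Longrightarrow> sep E A B \<Longrightarrow> X \<subseteq> A \<Longrightarrow> card (A \<inter> B) < card X \<Longrightarrow> rho E (B - A) \<le> 12 * t * card (B - A)"
  using assms unfolding massed_def by blast+

lemma sepD: "sep E A B \<Longrightarrow> E x y \<Longrightarrow> (x \<in> A \<and> y \<in> A) \<or> (x \<in> B \<and> y \<in> B)"
  unfolding sep_def by blast

lemma rho_side:
  assumes "sep E A B"
  shows "rho (ind E B) (B - A) = rho E (B - A)"
  by (rule rho_cong) (use sepD[OF assms] in \<open>auto simp: ind_def\<close>)

text \<open>If the second condition of massed graphs fails, it fails across a massed piece: take a violating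
  separation of least order.\<close>

lemma not_massed_piece:
  assumes g: "simple_graph V E" and v: "A0 \<union> B0 = V" "sep E A0 B0" "X \<subseteq> A0" "card (A0 \<inter> B0) < card X"
    "12 * t * card (B0 - A0) < rho E (B0 - A0)"
  obtains A B where "A \<union> B = V" "sep E A B" "X \<subseteq> A" "card (A \<inter> B) < card X"
    "12 * t * card (B - A) < rho E (B - A)" "massed t B (ind E B) (A \<inter> B)"
proof -
  define bad where "bad AB \<longleftrightarrow> fst AB \<union> snd AB = V \<and> sep E (fst AB) (snd AB) \<and> X \<subseteq> fst AB \<and>
    card (fst AB \<inter> snd AB) < card X \<and> 12 * t * card (snd AB - fst AB) < rho E (snd AB - fst AB)" for AB
  have "bad (A0, B0)" unfolding bad_def using v by simp
  then obtain AB where AB: "bad AB" "\<And>AB'. bad AB' \<Longrightarrow> card (fst AB \<inter> snd AB) \<le> card (fst AB' \<inter> snd AB')"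
    using ex_has_least_nat[of bad "(A0, B0)" "\<lambda>AB. card (fst AB \<inter> snd AB)"] by blast
  define A where "A = fst AB"
  define B where "B = snd AB"
  have 1: "A \<union> B = V" "sep E A B" "X \<subseteq> A" "card (A \<inter> B) < card X" "12 * t * card (B - A) < rho E (B - A)"
    using AB(1) unfolding bad_def A_def B_def by auto
  have "massed t B (ind E B) (A \<inter> B)" unfolding massed_def
  proof (intro conjI allI impI)
    have "B - A \<inter> B = B - A" by auto
    then show "12 * t * card (B - A \<inter> B) < rho (ind E B) (B - A \<inter> B)" using 1(5) rho_side[OF 1(2)] by simp
  next
    fix C D assume CD: "C \<union> D = B \<and> sep (ind E B) C D \<and> A \<inter> B \<subseteq> C \<and> card (C \<inter> D) < card (A \<inter> B)"
    have e: "(A \<union> C) \<inter> D = C \<inter> D" "D - (A \<union> C) = D - C" using CD by auto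
    have "sep E (A \<union> C) D" unfolding sep_def
    proof (intro allI impI)
      fix x y assume xy: "E x y"
      show "x \<in> A \<union> C \<and> y \<in> A \<union> C \<or> x \<in> D \<and> y \<in> D"
      proof (cases "x \<in> A \<and> y \<in> A")
        case False
        then have "ind E B x y" using sepD[OF 1(2) xy] xy unfolding ind_def by auto
        then show ?thesis using CD sepD[of "ind E B" C D x y] by blast
      qed auto
    qed
    moreover have "A \<union> C \<union> D = V" using CD 1(1) by auto
    moreover have lt: "card (C \<inter> D) < card (A \<inter> B)" using CD by blast
    ultimately have "\<not> bad (A \<union> C, D) \<Longrightarrow> rho E (D - C) \<le> 12 * t * card (D - C)"
      unfolding bad_def fst_conv snd_conv e using 1(3,4) by auto
    moreover have "\<not> bad (A \<union> C, D)" using AB(2)[of "(A \<union> C, D)"] lt e unfolding A_def B_def by auto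
    moreover have "rho (ind E B) (D - C) \<le> rho E (D - C)" by (rule rho_mono[OF g]) (simp add: ind_def)
    ultimately show "rho (ind E B) (D - C) \<le> 12 * t * card (D - C)" by linarith
  qed
  then show ?thesis using that 1 by blast
qed

section \<open>Reductions available in a smallest counterexample\<close>

locale massed_step =
  fixes t :: nat and V :: "'a set" and E :: "'a \<Rightarrow> 'a \<Rightarrow> bool" and X :: "'a set"
  assumes g: "simple_graph V E" and XV: "X \<subseteq> V" and cX: "card X \<le> 2 * t" and ms: "massed t V E X"
    and IH: "\<And>(V' :: 'a set) E' X'. card V' < card V \<Longrightarrow> simple_graph V' E' \<Longrightarrow> X' \<subseteq> V' \<Longrightarrow> card X' \<le> 2 * t \<Longrightarrow>
      massed t V' E' X' \<Longrightarrow> lnk E' V' X'"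
begin

lemmas gd = simple_graphD[OF g]

lemma fin: "A \<subseteq> V \<Longrightarrow> finite A"
  using gd(1) finite_subset by blast

text \<open>A side that is linked across its separator can do all that a clique on the separator
  can, and may be replaced by one.\<close>

definition rigid where
  "rigid A B \<longleftrightarrow> A \<union> B = V \<and> sep E A B \<and> X \<subseteq> A \<and> B - A \<noteq> {} \<and> lnk E B (A \<inter> B)"

text \<open>Take such a separation with \<open>card A\<close> least and replace \<open>B\<close> by
  a clique on the separator. If the resulting graph on \<open>A\<close> is massed, induction
  finishes. Otherwise it has a massed piece \<open>D\<close> behind a separation
  \<open>(C, D)\<close> of small order, and the clique lies in \<open>C\<close> or in
  \<open>D\<close>. In the first case \<open>D\<close> violates the massedness of the original
  graph; in the second \<open>D\<close> is linked by induction, and \<open>(C, D \<union> B)\<close>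
  is a rigid separation with a smaller first side.\<close>

lemma small_rigid_lnk:
  assumes r0: "rigid A0 B0" "card (A0 \<inter> B0) < card X"
  shows "lnk E V X"
proof -
  obtain AB where AB: "rigid (fst AB) (snd AB) \<and> card (fst AB \<inter> snd AB) < card X"
    "\<And>AB'. rigid (fst AB') (snd AB') \<and> card (fst AB' \<inter> snd AB') < card X \<Longrightarrow> card (fst AB) \<le> card (fst AB')"
    using ex_has_least_nat[of "\<lambda>AB. rigid (fst AB) (snd AB) \<and> card (fst AB \<inter> snd AB) < card X" "(A0, B0)" "\<lambda>AB. card (fst AB)"] r0
    by (metis fst_conv snd_conv)
  define A where "A = fst AB"
  define B where "B = snd AB"
  have 1: "A \<union> B = V" "sep E A B" "X \<subseteq> A" "B - A \<noteq> {}" "lnk E B (A \<inter> B)" "card (A \<inter> B) < card X"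
    using AB(1) unfolding rigid_def A_def B_def by auto
  have mn: "card A \<le> card C" if "rigid C D" "card (C \<inter> D) < card X" for C D
    using AB(2)[of "(C, D)"] that unfolding A_def by simp
  define K where "K = A \<inter> B"
  define F where "F x y \<longleftrightarrow> ind E A x y \<or> (x \<in> K \<and> y \<in> K \<and> x \<noteq> y)" for x y
  have fA: "finite A" "finite B" using 1(1) fin by auto
  have gF: "simple_graph A F" by (rule simple_graphI[OF fA(1)]) (use gd in \<open>auto simp: F_def ind_def K_def\<close>)
  have cA: "card A < card V" by (rule psubset_card_mono[OF gd(1)]) (use 1(1,4) in auto)
  have "massed t A F X" unfolding massed_def
  proof (intro conjI allI impI)
    have "{(x, y). E x y \<and> (x \<in> V - X \<or> y \<in> V - X)} \<subseteq>
        {(x, y). F x y \<and> (x \<in> A - X \<or> y \<in> A - X)} \<union> {(x, y). E x y \<and> (x \<in> B - A \<or> y \<in> B - A)}"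
      using sepD[OF 1(2)] unfolding F_def ind_def by blast
    then have "rho E (V - X) \<le> card ({(x, y). F x y \<and> (x \<in> A - X \<or> y \<in> A - X)} \<union> {(x, y). E x y \<and> (x \<in> B - A \<or> y \<in> B - A)})"
      unfolding rho_def by (rule card_mono[rotated]) (intro finite_UnI finite_arcs[OF gF] finite_arcs[OF g])
    also have "\<dots> \<le> rho F (A - X) + rho E (B - A)" unfolding rho_def by (rule card_Un_le)
    also have "rho E (B - A) \<le> 12 * t * card (B - A)" by (rule massedD(2)[OF ms 1(1-3) 1(6)])
    finally have "12 * t * card (V - X) < rho F (A - X) + 12 * t * card (B - A)" using massedD(1)[OF ms] by linarith
    moreover have "card (V - X) = card (A - X) + card (B - A)"
    proof -
      have "V - X = (A - X) \<union> (B - A)" using 1(1,3) by auto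
      then show ?thesis using fA by (simp add: card_Un_disjoint disjoint_iff)
    qed
    ultimately show "12 * t * card (A - X) < rho F (A - X)" by (simp add: add_mult_distrib2)
  next
    fix C D assume CD: "C \<union> D = A \<and> sep F C D \<and> X \<subseteq> C \<and> card (C \<inter> D) < card X"
    show "rho F (D - C) \<le> 12 * t * card (D - C)"
    proof (rule ccontr)
      assume "\<not> ?thesis"
      then have "12 * t * card (D - C) < rho F (D - C)" by simp
      then obtain C D where CD: "C \<union> D = A" "sep F C D" "X \<subseteq> C" "card (C \<inter> D) < card X"
        "12 * t * card (D - C) < rho F (D - C)" "massed t D (ind F D) (C \<inter> D)"
        using not_massed_piece[OF gF, of C D X t] CD by metis
      have "K \<subseteq> C \<or> K \<subseteq> D"
      proof (rule ccontr)
        assume "\<not> ?thesis"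
        then obtain x y where xy: "x \<in> K" "x \<notin> C" "y \<in> K" "y \<notin> D" by blast
        have KA: "K \<subseteq> C \<union> D" using CD(1) unfolding K_def by auto
        have "x \<noteq> y" using xy KA by auto
        then have "F x y" using xy unfolding F_def by auto
        then show False using sepD[OF CD(2)] xy by blast
      qed
      then show False
      proof
        assume KC: "K \<subseteq> C"
        have "sep E (C \<union> B) D" unfolding sep_def
        proof (intro allI impI)
          fix x y assume xy: "E x y"
          show "x \<in> C \<union> B \<and> y \<in> C \<union> B \<or> x \<in> D \<and> y \<in> D"
          proof (cases "x \<in> B \<and> y \<in> B")
            case False
            then have "F x y" using sepD[OF 1(2) xy] xy unfolding F_def ind_def by auto
            then show ?thesis using sepD[OF CD(2)] by blast
          qed auto
        qed
        moreover have e: "(C \<union> B) \<inter> D = C \<inter> D" "D - (C \<union> B) = D - C" using CD(1) KC unfolding K_def by auto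
        moreover have "(C \<union> B) \<union> D = V" "X \<subseteq> C \<union> B" using CD 1(1) by auto
        ultimately have "rho E (D - C) \<le> 12 * t * card (D - C)" using massedD(2)[OF ms, of "C \<union> B" D] CD(4) by simp
        moreover have "rho F (D - C) \<le> rho E (D - C)"
          by (rule rho_mono[OF g]) (use KC in \<open>auto simp: F_def ind_def\<close>)
        ultimately show False using CD(5) by linarith
      next
        assume KD: "K \<subseteq> D"
        have gD: "simple_graph D (ind F D)" using simple_graph_ind[OF gF] CD(1) by blast
        have "card D \<le> card A" using CD(1) fA(1) by (intro card_mono) auto
        then have L: "lnk (ind F D) D (C \<inter> D)" using IH[of D "ind F D" "C \<inter> D"] gD CD(4,6) cA cX by simp
        define V' where "V' = D \<union> B"
        have V'V: "V' \<subseteq> V" using CD(1) 1(1) unfolding V'_def by auto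
        have DB: "D \<inter> B = K" using CD(1) KD unfolding K_def by auto
        have L2: "lnk (ind E V') V' (C \<inter> D)" unfolding lnk_def
        proof (intro allI impI)
          fix p assume p: "invol (C \<inter> D) p"
          show "lnkp (ind E V') V' (C \<inter> D) p"
          proof (rule lnkp_replace_clique[of V' _ D B _ "ind F D"])
            show "simple_graph V' (ind E V')" by (rule simple_graph_ind[OF g V'V])
            show "D \<union> B = V'" unfolding V'_def ..
            show "sep (ind E V') D B" unfolding sep_def
            proof (intro allI impI)
              fix x y assume xy: "ind E V' x y"
              show "x \<in> D \<and> y \<in> D \<or> x \<in> B \<and> y \<in> B"
                using sepD[OF 1(2), of x y] xy KD unfolding ind_def V'_def K_def by blast
            qed
            have "lnk (ind E B) B K" using lnk_indI[OF 1(5)] unfolding K_def .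
            then have "lnk (ind (ind E V') B) B K"
              by (rule back_subst[of "\<lambda>E. lnk E B K"]) (auto simp: ind_def V'_def fun_eq_iff)
            then show "lnk (ind E V') B (D \<inter> B)" unfolding DB by (rule lnk_indD)
            show "lnkp (ind F D) D (C \<inter> D) p" using L p unfolding lnk_def by blast
            show "symp (ind F D)" using simple_graphD(2)[OF gD] .
            fix x y assume "ind F D x y"
            then show "ind (ind E V') D x y \<or> x \<in> D \<inter> B \<and> y \<in> D \<inter> B \<and> x \<noteq> y"
              unfolding ind_def F_def V'_def K_def by auto
          qed (use p in auto)
        qed
        have "rigid C V'" unfolding rigid_def
        proof (intro conjI)
          show "C \<union> V' = V" using CD(1) 1(1) unfolding V'_def by auto
          show "sep E C V'" unfolding sep_def
          proof (intro allI impI)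
            fix x y assume xy: "E x y"
            show "x \<in> C \<and> y \<in> C \<or> x \<in> V' \<and> y \<in> V'"
            proof (cases "x \<in> B \<and> y \<in> B")
              case False
              then have "F x y" using sepD[OF 1(2) xy] xy unfolding F_def ind_def by auto
              then show ?thesis using sepD[OF CD(2)] unfolding V'_def by blast
            qed (auto simp: V'_def)
          qed
          show "V' - C \<noteq> {}"
            using rho_gt_nonempty[OF CD(5)] unfolding V'_def by blast
          have "C \<inter> V' = C \<inter> D" using CD(1) KD unfolding V'_def K_def by auto
          then show "lnk E V' (C \<inter> V')" using lnk_indD[OF L2] by simp
        qed (rule CD(3))
        moreover have "C \<inter> V' = C \<inter> D" using CD(1) KD unfolding V'_def K_def by auto
        ultimately have "card A \<le> card C" using mn[of C V'] CD(4) by simp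
        moreover have "card C < card A"
        proof (rule psubset_card_mono[OF fA(1)])
          have "D - C \<noteq> {}" by (rule rho_gt_nonempty[OF CD(5)])
          then show "C \<subset> A" using CD(1) by auto
        qed
        ultimately show False by simp
      qed
    qed
  qed
  then have L: "lnk F A X" using IH[OF cA gF 1(3) cX] by blast
  show ?thesis unfolding lnk_def
  proof (intro allI impI)
    fix p assume p: "invol X p"
    show "lnkp E V X p"
      by (rule lnkp_replace_clique[OF g 1(1-3) 1(5), of F])
        (use p L simple_graphD(2)[OF gF] in \<open>auto simp: F_def K_def lnk_def\<close>)
  qed
qed

text \<open>Pushing the separator towards \<open>X\<close> either links \<open>X\<close> or produces
  a rigid separation of order less than \<open>card X\<close>.\<close>

lemma rigid_lnk:
  assumes r: "rigid A B" and K: "\<And>Y. Y \<subseteq> A \<inter> B \<Longrightarrow> card Y \<le> card X \<Longrightarrow> lnk E B Y"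
  shows "lnk E V X"
proof -
  have 1: "A \<union> B = V" "sep E A B" "X \<subseteq> A" "B - A \<noteq> {}" using r unfolding rigid_def by auto
  show ?thesis
  proof (rule lnk_push_out[OF g 1(1-3) K])
    fix P Q assume PQ: "P \<union> Q = V" "sep E P Q" "X \<subseteq> P" "B \<subseteq> Q" "P \<subseteq> A" "card (P \<inter> Q) < card X" "lnk E Q (P \<inter> Q)"
    have "rigid P Q" unfolding rigid_def using PQ 1(4) by auto
    then show ?thesis using small_rigid_lnk PQ(6) by blast
  qed auto
qed

lemma rigid_lnk': "rigid A B \<Longrightarrow> lnk E V X"
  by (rule rigid_lnk) (auto simp: rigid_def intro: lnk_subset)

text \<open>The side \<open>B\<close> with terminals \<open>A \<inter> B\<close> inherits
  massedness, because a separation of \<open>B\<close> of smaller order extends by \<open>A\<close>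
  to one of the whole graph. Having fewer vertices, \<open>B\<close> is linked by induction, and the
  separation is rigid.\<close>

lemma dense_sep_lnk:
  assumes 1: "A \<union> B = V" "sep E A B" "X \<subseteq> A" "card (A \<inter> B) \<le> card X" "B \<noteq> V"
    and d: "12 * t * card (B - A) < rho E (B - A)"
  shows "lnk E V X"
proof -
  have gB: "simple_graph B (ind E B)" using simple_graph_ind[OF g] 1(1) by blast
  have "massed t B (ind E B) (A \<inter> B)" unfolding massed_def
  proof (intro conjI allI impI)
    have "B - A \<inter> B = B - A" by auto
    then show "12 * t * card (B - A \<inter> B) < rho (ind E B) (B - A \<inter> B)" using d rho_side[OF 1(2)] by simp
  next
    fix C D assume CD: "C \<union> D = B \<and> sep (ind E B) C D \<and> A \<inter> B \<subseteq> C \<and> card (C \<inter> D) < card (A \<inter> B)"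
    have e: "(A \<union> C) \<inter> D = C \<inter> D" "D - (A \<union> C) = D - C" using CD by auto
    have "sep E (A \<union> C) D" unfolding sep_def
    proof (intro allI impI)
      fix x y assume xy: "E x y"
      show "x \<in> A \<union> C \<and> y \<in> A \<union> C \<or> x \<in> D \<and> y \<in> D"
      proof (cases "x \<in> A \<and> y \<in> A")
        case False
        then have "ind E B x y" using sepD[OF 1(2) xy] xy unfolding ind_def by auto
        then show ?thesis using CD sepD[of "ind E B" C D x y] by blast
      qed auto
    qed
    then have "rho E (D - C) \<le> 12 * t * card (D - C)"
      using massedD(2)[OF ms, of "A \<union> C" D] e CD 1 by auto
    moreover have "rho (ind E B) (D - C) \<le> rho E (D - C)" by (rule rho_mono[OF g]) (simp add: ind_def)
    ultimately show "rho (ind E B) (D - C) \<le> 12 * t * card (D - C)" by linarith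
  qed
  moreover have "card B < card V" by (rule psubset_card_mono[OF gd(1)]) (use 1 in auto)
  ultimately have "lnk (ind E B) B (A \<inter> B)" using IH[of B "ind E B" "A \<inter> B"] gB 1(4) cX by auto
  moreover have "B - A \<noteq> {}" by (rule rho_gt_nonempty[OF d])
  ultimately have "rigid A B" unfolding rigid_def using 1 lnk_indD by blast
  then show ?thesis by (rule rigid_lnk')
qed


text \<open>A new small separation that violates massedness must be crossed by the deleted edge.
  Moving the end \<open>d'\<close> into \<open>A\<close> raises the order to at most
  \<open>card X\<close> and costs \<open>B - A\<close> one vertex and at most
  \<open>2 * card (A \<inter> B) < 12 * t\<close> arcs, so the rest of \<open>B - A\<close> is still
  dense and \<open>dense_sep_lnk\<close> applies.\<close>

lemma delete_edge_massed:
  assumes nl: "\<not> lnk E V X" and ab: "E a b" and F: "\<And>x y. F x y \<longleftrightarrow> E x y \<and> {x, y} \<noteq> {a, b}"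
    and M1: "12 * t * card (V - X) < rho F (V - X)"
  shows "massed t V F X"
  unfolding massed_def
proof (intro conjI allI impI)
  fix A B assume AB0: "A \<union> B = V \<and> sep F A B \<and> X \<subseteq> A \<and> card (A \<inter> B) < card X"
  then have AB: "A \<union> B = V" "sep F A B" "X \<subseteq> A" "card (A \<inter> B) < card X" by auto
  have fAB: "finite A" "finite B" using AB(1) fin by auto
  show "rho F (B - A) \<le> 12 * t * card (B - A)"
  proof (rule ccontr)
    assume n: "\<not> ?thesis"
    show False
    proof (cases "sep E A B")
      case True
      have "rho F (B - A) \<le> rho E (B - A)" by (rule rho_mono[OF g]) (simp add: F)
      then show ?thesis using massedD(2)[OF ms AB(1) True AB(3,4)] n by simp
    next
      case False
      then obtain c d where cd: "E c d" "\<not> (c \<in> A \<and> d \<in> A)" "\<not> (c \<in> B \<and> d \<in> B)" unfolding sep_def by blast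
      have cdV: "c \<in> V" "d \<in> V" using gd cd(1) by auto
      have "\<not> F c d" using sepD[OF AB(2)] cd by blast
      then have e1: "{c, d} = {a, b}" using cd(1) F by simp
      obtain c' d' where e: "{c', d'} = {a, b}" "c' \<in> A - B" "d' \<in> B - A" "E c' d'"
      proof (cases "c \<in> A")
        case True
        then show ?thesis using that[of c d] cd cdV AB(1) e1 by auto
      next
        case False
        then show ?thesis using that[of d c] cd cdV AB(1) e1 gd(6)[OF cd(1)] by auto
      qed
      have EF: "E x y \<Longrightarrow> F x y \<or> {x, y} = {c', d'}" for x y using F e(1) by auto
      have 1: "insert d' A \<union> B = V" using AB(1) e by auto
      have 2: "sep E (insert d' A) B" unfolding sep_def
      proof (intro allI impI)
        fix x y assume "E x y"
        then show "x \<in> insert d' A \<and> y \<in> insert d' A \<or> x \<in> B \<and> y \<in> B"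
          using EF[of x y] sepD[OF AB(2), of x y] e(2,3) by (auto simp: doubleton_eq_iff)
      qed
      have 3: "insert d' A \<inter> B = insert d' (A \<inter> B)" using e(3) by auto
      have 4: "card (insert d' A \<inter> B) \<le> card X" unfolding 3 using AB(4) fAB by (simp add: card_insert_if)
      have 5: "B \<noteq> V" using e(2) AB(1) by auto
      have "{(x, y). F x y \<and> (x \<in> B - A \<or> y \<in> B - A)} \<subseteq>
        {(x, y). E x y \<and> (x \<in> B - insert d' A \<or> y \<in> B - insert d' A)} \<union> ({d'} \<times> (A \<inter> B) \<union> (A \<inter> B) \<times> {d'})"
        using sepD[OF AB(2)] F gd(7) by blast
      then have "rho F (B - A) \<le> card ({(x, y). E x y \<and> (x \<in> B - insert d' A \<or> y \<in> B - insert d' A)} \<union> ({d'} \<times> (A \<inter> B) \<union> (A \<inter> B) \<times> {d'}))"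
        unfolding rho_def using fAB by (intro card_mono finite_UnI finite_arcs[OF g]) auto
      also have "\<dots> \<le> rho E (B - insert d' A) + card ({d'} \<times> (A \<inter> B) \<union> (A \<inter> B) \<times> {d'})"
        unfolding rho_def by (rule card_Un_le)
      also have "card ({d'} \<times> (A \<inter> B) \<union> (A \<inter> B) \<times> {d'}) \<le> 2 * card (A \<inter> B)"
        by (rule order_trans[OF card_Un_le]) (simp add: card_cartesian_product)
      finally have 6: "rho F (B - A) \<le> rho E (B - insert d' A) + 2 * card (A \<inter> B)" by simp
      have 7: "card (B - A) = Suc (card (B - insert d' A))"
      proof -
        have "B - insert d' A = (B - A) - {d'}" by auto
        then show ?thesis using card_Suc_Diff1[of "B - A" d'] e(3) fAB by simp
      qed
      have "12 * t * card (B - insert d' A) < rho E (B - insert d' A)"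
        using 6 n AB(4) cX unfolding 7 by simp
      then have "lnk E V X" by (intro dense_sep_lnk[OF 1 2 _ 4 5]) (use AB(3) in auto)
      then show False using nl by simp
    qed
  qed
qed (rule M1)

text \<open>If the contraction were dense enough, either it would be massed, and a linkage in it
  lifts, or it would have a massed piece behind a small separation. In the latter case
  \<open>v\<close> is put wherever \<open>w\<close> is. If \<open>w\<close> lies in the separator,
  the order grows by one, to at most \<open>card X\<close>, and \<open>dense_sep_lnk\<close>
  applies; otherwise the piece is linked by induction and becomes the far side of a rigid
  separation.\<close>

lemma contract_light:
  assumes nl: "\<not> lnk E V X" and v: "v \<in> V - X" and vw: "E v w"
  shows "rho (contract E v w) (V - {v} - X) \<le> 12 * t * card (V - {v} - X)"
proof (rule ccontr)
  assume M1: "\<not> ?thesis"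
  define E' where "E' = contract E v w"
  define V' where "V' = V - {v}"
  have w: "w \<in> V'" "w \<noteq> v" using gd(5,7)[OF vw] unfolding V'_def by auto
  have gE': "simple_graph V' E'"
    by (rule simple_graphI) (use gd w in \<open>auto simp: V'_def E'_def contract_def\<close>)
  have cV: "card V' < card V" unfolding V'_def using v gd(1) by (intro card_Diff1_less) auto
  have XV': "X \<subseteq> V'" using XV v unfolding V'_def by auto
  have iV: "insert v V' = V" using v unfolding V'_def by auto
  have "\<not> massed t V' E' X"
  proof
    assume "massed t V' E' X"
    then have L: "lnk E' V' X" using IH[of V' E' X] cV gE' XV' cX by blast
    have "lnk E V X" unfolding lnk_def
    proof (intro allI impI)
      fix p assume p: "invol X p"
      have "lnkp E (insert v V') X p"
        by (rule lnkp_contract[OF gd(2) vw]) (use L p involD(1)[OF p] in \<open>auto simp: V'_def E'_def lnk_def\<close>)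
      then show "lnkp E V X p" using iV by simp
    qed
    then show False using nl by simp
  qed
  then obtain A0 B0 where "A0 \<union> B0 = V'" "sep E' A0 B0" "X \<subseteq> A0" "card (A0 \<inter> B0) < card X"
    "12 * t * card (B0 - A0) < rho E' (B0 - A0)"
    using M1 unfolding massed_def E'_def V'_def by (auto simp: not_le)
  then obtain A' B' where AB: "A' \<union> B' = V'" "sep E' A' B'" "X \<subseteq> A'" "card (A' \<inter> B') < card X"
    "12 * t * card (B' - A') < rho E' (B' - A')" "massed t B' (ind E' B') (A' \<inter> B')"
    using not_massed_piece[OF gE'] by metis
  have fAB: "finite A'" "finite B'" using AB(1) simple_graphD(1)[OF gE'] by auto
  have vAB: "v \<notin> A'" "v \<notin> B'" using AB(1) unfolding V'_def by auto
  have "card B' \<le> card V'" using AB(1) simple_graphD(1)[OF gE'] by (intro card_mono) auto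
  then have L: "lnk (ind E' B') B' (A' \<inter> B')"
    using IH[of B' "ind E' B'" "A' \<inter> B'"] cV simple_graph_ind[OF gE', of B'] AB cX by auto
  define A where "A = (if w \<in> A' then insert v A' else A')"
  define B where "B = (if w \<in> B' then insert v B' else B')"
  have ABV: "A \<union> B = V" using AB(1) iV w(1) unfolding A_def B_def by auto
  have sAB: "sep E A B" unfolding sep_def
  proof (intro allI impI)
    have main: "x \<in> A \<and> y \<in> A \<or> x \<in> B \<and> y \<in> B" if xy: "E x y" "y \<noteq> v" for x y
    proof (cases "x = v")
      case True
      show ?thesis
      proof (cases "y = w")
        case yw: True
        then show ?thesis using True w(1) AB(1) unfolding A_def B_def by auto
      next
        case False
        then have "E' w y" using xy True w(2) unfolding E'_def contract_def by auto
        then show ?thesis using sepD[OF AB(2)] True unfolding A_def B_def by auto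
      qed
    next
      case False
      then have "E' x y" using xy gd(7)[OF xy(1)] unfolding E'_def contract_def by auto
      then show ?thesis using sepD[OF AB(2)] unfolding A_def B_def by auto
    qed
    fix x y assume xy: "E x y"
    show "x \<in> A \<and> y \<in> A \<or> x \<in> B \<and> y \<in> B"
    proof (cases "y = v")
      case True
      then have "x \<noteq> v" using gd(7)[OF xy] by auto
      then show ?thesis using main[of y x] gd(6)[OF xy] by auto
    next
      case False then show ?thesis using main xy by blast
    qed
  qed
  have XA: "X \<subseteq> A" using AB(3) unfolding A_def by auto
  have ne: "B' - A' \<noteq> {}" by (rule rho_gt_nonempty[OF AB(5)])
  have "lnk E V X"
  proof (cases "w \<in> A' \<and> w \<in> B'")
    case True
    have AB': "A = insert v A'" "B = insert v B'" using True unfolding A_def B_def by auto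
    have e: "A \<inter> B = insert v (A' \<inter> B')" "B - A = B' - A'" using AB' vAB by auto
    show ?thesis
    proof (rule dense_sep_lnk[OF ABV sAB XA])
      show "card (A \<inter> B) \<le> card X" unfolding e using AB(4) fAB vAB by simp
      show "B \<noteq> V"
      proof
        assume "B = V"
        then have "B' = V'" using AB' vAB iV unfolding V'_def by auto
        then have "X \<subseteq> A' \<inter> B'" using AB(3) XV' by auto
        then have "card X \<le> card (A' \<inter> B')" using fAB by (intro card_mono) auto
        then show False using AB(4) by simp
      qed
      \<comment> \<open>The arcs of the contraction are images of arcs of the graph under the
        identification of \<open>v\<close> with \<open>w\<close>, so the piece is no denser after
        contraction than before.\<close>
      define f where "f z = (if z = v then w else z)" for z
      have "{(x, y). E' x y \<and> (x \<in> B' - A' \<or> y \<in> B' - A')} \<subseteq>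
          (\<lambda>(x, y). (f x, f y)) ` {(x, y). E x y \<and> (x \<in> B' - A' \<or> y \<in> B' - A')}"
      proof (rule subsetI)
        fix z assume z: "z \<in> {(x, y). E' x y \<and> (x \<in> B' - A' \<or> y \<in> B' - A')}"
        obtain x y where xy: "z = (x, y)" by force
        have h: "E' x y" "x \<in> B' - A' \<or> y \<in> B' - A'" using z xy by auto
        have nv: "x \<noteq> v" "y \<noteq> v" using h(1) unfolding E'_def contract_def by auto
        consider "E x y" | "x = w" "E v y" | "y = w" "E x v" using h(1) unfolding E'_def contract_def by blast
        then show "z \<in> (\<lambda>(x, y). (f x, f y)) ` {(x, y). E x y \<and> (x \<in> B' - A' \<or> y \<in> B' - A')}"
        proof cases
          case 1 then show ?thesis using h nv xy by (intro image_eqI[of _ _ "(x, y)"]) (auto simp: f_def)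
        next
          case 2 then show ?thesis using h nv xy True by (intro image_eqI[of _ _ "(v, y)"]) (auto simp: f_def)
        next
          case 3 then show ?thesis using h nv xy True by (intro image_eqI[of _ _ "(x, v)"]) (auto simp: f_def)
        qed
      qed
      then have "rho E' (B' - A') \<le> rho E (B' - A')" unfolding rho_def
        by (rule surj_card_le[OF finite_arcs[OF g]])
      then show "12 * t * card (B - A) < rho E (B - A)" using AB(5) e by simp
    qed
  next
    case False
    have e: "A \<inter> B = A' \<inter> B'" "B - A \<noteq> {}" using False vAB ne w(1) AB(1) unfolding A_def B_def by auto
    have "lnk E B (A' \<inter> B')"
    proof (cases "w \<in> B'")
      case False
      have "ind E' B' x y \<Longrightarrow> E x y" for x y
        using False vAB unfolding E'_def ind_def contract_def by auto
      moreover have "B = B'" using False unfolding B_def by simp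
      ultimately show ?thesis using L lnkp_conn_mono[of "ind E' B'"] unfolding lnk_def by blast
    next
      case True
      have Bv: "B = insert v B'" using True unfolding B_def by simp
      show ?thesis unfolding lnk_def
      proof (intro allI impI)
        fix p assume p: "invol (A' \<inter> B') p"
        have "ind E' B' = contract (ind E B) v w"
          using True vAB w(2) unfolding Bv by (auto simp: fun_eq_iff ind_def E'_def contract_def)
        then have "lnkp (contract (ind E B) v w) B' (A' \<inter> B') p" using L p unfolding lnk_def by simp
        then have "lnkp (ind E B) (insert v B') (A' \<inter> B') p"
        proof (rule lnkp_contract[rotated 3])
          show "symp (ind E B)" using gd(6) unfolding symp_def ind_def by blast
          show "ind E B v w" using vw True unfolding Bv ind_def by simp
        qed (use vAB involD(1)[OF p] in auto)
        then show "lnkp E B (A' \<inter> B') p" unfolding Bv[symmetric]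
          by (rule lnkp_conn_mono) (simp add: ind_def)
      qed
    qed
    then have "rigid A B" unfolding rigid_def using ABV sAB XA e by simp
    then show ?thesis by (rule rigid_lnk')
  qed
  then show False using nl by simp
qed

text \<open>It does not matter where the linked part \<open>U\<close> lies: it is too large to be
  contained in a separator of order less than \<open>card X\<close>, so pushing out from it links
  \<open>X\<close> or leaves a rigid separation.\<close>

lemma pair_linked_sub_lnk:
  assumes U: "U \<subseteq> V" "pair_linked E U t" "2 * t \<le> card U" and X: "X \<noteq> V"
  shows "lnk E V X"
proof -
  have LU: "lnk E U Y" if "Y \<subseteq> V \<inter> U" "card Y \<le> card X" for Y
    by (rule pair_linked_lnk[OF fin[OF U(1)] U(2) _ _ U(3)]) (use that cX in auto)
  show ?thesis
  proof (rule lnk_push_out[OF g, of V U X])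
    show "sep E V U" using gd unfolding sep_def by auto
  next
    fix P Q assume PQ: "P \<union> Q = V" "sep E P Q" "X \<subseteq> P" "U \<subseteq> Q" "P \<subseteq> V" "card (P \<inter> Q) < card X" "lnk E Q (P \<inter> Q)"
    have "Q - P \<noteq> {}"
    proof
      assume "Q - P = {}"
      then have "U \<subseteq> P \<inter> Q" using PQ(4) by auto
      then have "card U \<le> card (P \<inter> Q)" using PQ(1) gd(1) by (intro card_mono) auto
      then show False using PQ(6) U(3) cX by linarith
    qed
    then have "rigid P Q" unfolding rigid_def using PQ by auto
    then show ?thesis by (rule rigid_lnk')
  qed (use U XV LU in auto)
qed

end

section \<open>The induction for massed graphs\<close>

lemma rho_le_degrees:
  assumes "simple_graph V E" "S \<subseteq> V"
  shows "(\<Sum>v\<in>S. card {w. E v w}) \<le> rho E S" "rho E S \<le> 2 * (\<Sum>v\<in>S. card {w. E v w})"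
proof -
  note gd = simple_graphD[OF assms(1)]
  have fS: "finite S" using assms gd(1) finite_subset by blast
  have fN: "finite {w. E v w}" for v by (rule finite_subset[OF _ gd(1)]) (use gd in auto)
  have c: "(\<Sum>v\<in>S. card {w. E v w}) = card (SIGMA v:S. {w. E v w})" using fS fN by simp
  also have "\<dots> \<le> rho E S" unfolding rho_def
    by (rule card_mono[OF finite_arcs[OF assms(1)]]) auto
  finally show "(\<Sum>v\<in>S. card {w. E v w}) \<le> rho E S" .
  have "{(x, y). E x y \<and> (x \<in> S \<or> y \<in> S)} \<subseteq> (SIGMA v:S. {w. E v w}) \<union> prod.swap ` (SIGMA v:S. {w. E v w})"
    using gd(6) by (auto simp: image_iff)
  then have "rho E S \<le> card ((SIGMA v:S. {w. E v w}) \<union> prod.swap ` (SIGMA v:S. {w. E v w}))"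
    unfolding rho_def using fS fN by (intro card_mono) auto
  also have "\<dots> \<le> card (SIGMA v:S. {w. E v w}) + card (SIGMA v:S. {w. E v w})"
    by (rule order_trans[OF card_Un_le]) (intro add_left_mono card_image_le, simp add: fS fN)
  finally show "rho E S \<le> 2 * (\<Sum>v\<in>S. card {w. E v w})" using c by simp
qed

text \<open>In a smallest counterexample the deletion of edges forces a vertex \<open>v\<close>
  outside \<open>X\<close> of degree at most \<open>12 * t\<close>, while contractions force each
  neighbour of \<open>v\<close> to have about \<open>6 * t\<close> of the other neighbours adjacent
  to it. The closed neighbourhood of \<open>v\<close> then meets the conditions of
  \<open>dense_has_pair_linked\<close> and contains a linked part.\<close>

theorem massed_linked:
  assumes "simple_graph V E" "X \<subseteq> V" "card X \<le> 2 * t" "massed t V E X"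
  shows "lnk E V X"
  using assms
proof (induction "card V" arbitrary: V E X rule: less_induct)
  case less
  show ?case
  proof (cases "t = 0")
    case True
    then have "X = {}" using less.prems(2,3) simple_graphD(1)[OF less.prems(1)] finite_subset by fastforce
    then show ?thesis by (simp add: lnk_empty)
  next
    case t0: False
    show ?thesis unfolding lnk_def
    proof (intro allI impI, rule ccontr)
      fix p assume p: "invol X p" and np: "\<not> lnkp E V X p"
      \<comment> \<open>Minimality is taken among graphs that fail for the same \<open>p\<close>,
        because the edges added inside \<open>X\<close> below depend on \<open>p\<close>.\<close>
      define bad where "bad F \<longleftrightarrow> simple_graph V F \<and> massed t V F X \<and> \<not> lnkp F V X p" for F
      have "bad E" unfolding bad_def using less.prems np by simp
      then obtain E0 where E0: "bad E0" "\<And>F. bad F \<Longrightarrow> rho E0 (V - X) \<le> rho F (V - X)"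
        using ex_has_least_nat[of bad E "\<lambda>F. rho F (V - X)"] by blast
      have b0: "simple_graph V E0" "massed t V E0 X" "\<not> lnkp E0 V X p" using E0(1) unfolding bad_def by auto
      note g0 = simple_graphD[OF b0(1)]
      txt \<open>Edges inside \<open>X\<close> other than those joining the pairs to be linked are irrelevant, so they
        may be assumed present.\<close>
      define G where "G x y \<longleftrightarrow> E0 x y \<or> (x \<in> X \<and> y \<in> X \<and> x \<noteq> y \<and> y \<noteq> p x)" for x y
      have gG: "simple_graph V G"
        by (rule simple_graphI[OF g0(1)]) (use g0 less.prems(2) involD[OF p] in \<open>auto simp: G_def\<close>)
      note gd = simple_graphD[OF gG]
      have rG: "rho G S = rho E0 S" if "S \<inter> X = {}" for S
        by (rule rho_cong) (use that in \<open>auto simp: G_def\<close>)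
      have mG: "massed t V G X" unfolding massed_def
      proof (intro conjI allI impI)
        show "12 * t * card (V - X) < rho G (V - X)" using massedD(1)[OF b0(2)] rG[of "V - X"] by (simp add: Int_commute)
        fix A B assume AB: "A \<union> B = V \<and> sep G A B \<and> X \<subseteq> A \<and> card (A \<inter> B) < card X"
        then have "sep E0 A B" unfolding sep_def G_def by blast
        then have "rho E0 (B - A) \<le> 12 * t * card (B - A)" using massedD(2)[OF b0(2), of A B] AB by blast
        moreover have "(B - A) \<inter> X = {}" using AB by auto
        ultimately show "rho G (B - A) \<le> 12 * t * card (B - A)" using rG by simp
      qed
      have npG: "\<not> lnkp G V X p"
      proof
        assume "lnkp G V X p"
        then obtain C where C0: "links G V X p C" unfolding lnkp_def by blast
        note C = linksD[OF C0]
        have "lnkp E0 V X p"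
        proof (rule lnkpI[of X C])
          fix x assume x: "x \<in> X"
          show "conn E0 (C x)" using C(2)[OF x]
          proof (rule conn_mono)
            fix a b assume ab: "a \<in> C x" "b \<in> C x" "G a b"
            \<comment> \<open>A linking set meets \<open>X\<close> in \<open>x\<close> and
              \<open>p x\<close> only, so no added edge runs inside it.\<close>
            have in_x: "c = x \<or> c = p x" if "c \<in> X" "c \<in> C x" for c using C(5)[OF x that(1)] C(1)[OF that(1)] that(2) by blast
            show "E0 a b" using ab in_x[of a] in_x[of b] involD[OF p x] unfolding G_def by metis
          qed
        qed (use C in auto)
        then show False using b0(3) by simp
      qed
      then have nG: "\<not> lnk G V X" using p unfolding lnk_def by blast
      interpret massed_step t V G X
        by unfold_locales (use gG less.prems(2,3) mG less.hyps in auto)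
      define n where "n = card (V - X)"
      have M1: "12 * t * n < rho G (V - X)" using massedD(1)[OF mG] unfolding n_def .
      have fV: "finite V" by (rule gd(1))
      have n0: "V - X \<noteq> {}" by (rule rho_gt_nonempty[OF M1])
      have npos: "0 < n" unfolding n_def using n0 fV by (simp add: card_gt_0_iff)
      define N where "N v = {w. G v w}" for v
      have NV: "N v \<subseteq> V" for v using gd unfolding N_def by auto
      have fN: "finite (N v)" for v using NV fV finite_subset by blast
      \<comment> \<open>Deleting an edge costs two arcs; with a larger surplus a counterexample with
        fewer arcs would remain.\<close>
      have rho_le: "rho G (V - X) \<le> 12 * t * n + 2"
      proof -
        have "0 < rho G (V - X)" using M1 by simp
        then have "{(x, y). G x y \<and> (x \<in> V - X \<or> y \<in> V - X)} \<noteq> {}" unfolding rho_def using card_gt_0_iff by metis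
        then obtain a b where ab: "G a b" "a \<in> V - X" using gd(6) by blast
        define F where "F x y \<longleftrightarrow> G x y \<and> {x, y} \<noteq> {a, b}" for x y
        have gF: "simple_graph V F" by (rule simple_graphI[OF fV]) (use gd in \<open>auto simp: F_def insert_commute\<close>)
        have eq: "{(x, y). G x y \<and> (x \<in> V - X \<or> y \<in> V - X)} = {(x, y). F x y \<and> (x \<in> V - X \<or> y \<in> V - X)} \<union> {(a, b), (b, a)}"
          using ab gd(6) unfolding F_def by (auto simp: doubleton_eq_iff)
        have "rho G (V - X) \<le> rho F (V - X) + card {(a, b), (b, a)}" unfolding rho_def eq by (rule card_Un_le)
        moreover have "card {(a, b), (b, a)} \<le> Suc (card {(b, a)})" by (rule card_insert_le_m1) simp_all
        ultimately have 1: "rho G (V - X) \<le> rho F (V - X) + 2" by simp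
        show ?thesis
        proof (rule ccontr)
          assume "\<not> ?thesis"
          then have M1F: "12 * t * card (V - X) < rho F (V - X)" using 1 unfolding n_def by linarith
          have mF: "massed t V F X" by (rule delete_edge_massed[OF nG ab(1) F_def M1F])
          have "\<not> lnkp F V X p" using npG lnkp_conn_mono[of F V X p G] unfolding F_def by blast
          then have "bad F" unfolding bad_def using gF mF by simp
          then have "rho E0 (V - X) \<le> rho F (V - X)" by (rule E0(2))
          moreover have "rho G (V - X) = rho E0 (V - X)" by (rule rG) auto
          moreover have "rho F (V - X) < rho G (V - X)" unfolding rho_def
          proof (rule psubset_card_mono[OF finite_arcs[OF gG]])
            have "(a, b) \<in> {(x, y). G x y \<and> (x \<in> V - X \<or> y \<in> V - X)}" "(a, b) \<notin> {(x, y). F x y \<and> (x \<in> V - X \<or> y \<in> V - X)}"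
              using ab unfolding F_def by auto
            moreover have "{(x, y). F x y \<and> (x \<in> V - X \<or> y \<in> V - X)} \<subseteq> {(x, y). G x y \<and> (x \<in> V - X \<or> y \<in> V - X)}"
              unfolding F_def by auto
            ultimately show "{(x, y). F x y \<and> (x \<in> V - X \<or> y \<in> V - X)} \<subset> {(x, y). G x y \<and> (x \<in> V - X \<or> y \<in> V - X)}" by blast
          qed
          ultimately show False by linarith
        qed
      qed
      note dg = rho_le_degrees[OF gG Diff_subset[of V X]]
      have "\<exists>v\<in>V - X. card (N v) \<le> 12 * t"
      proof (rule ccontr)
        assume "\<not> ?thesis"
        then have "12 * t + 1 \<le> card (N v)" if "v \<in> V - X" for v using that by force
        then have "(\<Sum>v\<in>V - X. 12 * t + 1) \<le> (\<Sum>v\<in>V - X. card (N v))" by (intro sum_mono) auto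
        then have "n * (12 * t + 1) \<le> rho G (V - X)" using dg(1) unfolding n_def N_def by simp
        then have "n * (12 * t + 1) \<le> 12 * t * n + 2" using rho_le by (rule order_trans)
        \<comment> \<open>If all degrees outside \<open>X\<close> exceeded \<open>12 * t\<close>, a
          surplus of at most 2 arcs would allow at most two vertices outside \<open>X\<close>, and
          so few vertices cannot have such degrees.\<close>
        then have n2: "n \<le> 2" by (simp add: algebra_simps)
        have "card V = n + card X" unfolding n_def using less.prems(2) fV
          by (metis card_Diff_subset card_mono finite_subset le_add_diff_inverse2)
        then have cV: "card V \<le> 2 * t + 2" using n2 less.prems(3) by linarith
        have "card (N v) \<le> 2 * t + 1" if "v \<in> V - X" for v
        proof -
          have "N v \<subseteq> V - {v}" using NV gd(3) unfolding N_def by auto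
          then have "card (N v) \<le> card (V - {v})" using fV by (intro card_mono) auto
          also have "\<dots> = card V - 1" using that by simp
          finally show ?thesis using cV by simp
        qed
        then have "(\<Sum>v\<in>V - X. card (N v)) \<le> (\<Sum>v\<in>V - X. 2 * t + 1)" by (intro sum_mono) auto
        also have "\<dots> = n * (2 * t + 1)" unfolding n_def by simp
        finally have "2 * (\<Sum>v\<in>V - X. card {w. G v w}) \<le> 2 * (n * (2 * t + 1))" unfolding N_def by (rule mult_le_mono2)
        then have "rho G (V - X) \<le> 2 * (n * (2 * t + 1))" using dg(2) by (rule order_trans[rotated])
        then have "12 * t * n < 2 * (n * (2 * t + 1))" using M1 by linarith
        then have "n * (12 * t) < n * (4 * t + 2)" by (simp add: algebra_simps)
        then have "12 * t < 4 * t + 2" by simp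
        then show False using t0 by simp
      qed
      then obtain v where v: "v \<in> V - X" "card (N v) \<le> 12 * t" by blast
      have "N v \<noteq> {}"
      proof
        assume e: "N v = {}"
        have "rigid (V - {v}) {v}" unfolding rigid_def
        proof (intro conjI)
          show "sep G (V - {v}) {v}" using gd e unfolding sep_def N_def by blast
          show "lnk G {v} ((V - {v}) \<inter> {v})" using lnk_empty[of G "{v}"] by (simp add: Int_commute)
        qed (use v less.prems(2) in auto)
        then show False using rigid_lnk' nG by blast
      qed
      \<comment> \<open>The neighbours of \<open>v\<close> in \<open>good\<close> become new
        neighbours of \<open>w\<close>, so their two arcs to \<open>v\<close> are replaced. By
        \<open>contract_light\<close> the contraction loses more than \<open>12 * t\<close> arcs,
        hence at least \<open>6 * t + 1\<close> neighbours of \<open>v\<close> are not in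
        \<open>good\<close>.\<close>
      have common: "6 * t + 1 \<le> card {z \<in> N v. z = w \<or> G w z \<or> (w \<in> X \<and> z \<in> X)}" if w: "w \<in> N v" for w
      proof -
        have vw: "G v w" using w unfolding N_def by simp
        have wv: "w \<noteq> v" "w \<in> V" using gd(5,7)[OF vw] by auto
        define F where "F = contract G v w"
        define good where "good = {z \<in> N v. z \<noteq> w \<and> \<not> G w z \<and> \<not> (w \<in> X \<and> z \<in> X)}"
        define Sn where "Sn = {(x, y). G x y \<and> x \<noteq> v \<and> y \<noteq> v \<and> (x \<in> V - X \<or> y \<in> V - X)}"
        have fSn: "finite Sn" unfolding Sn_def by (rule finite_subset[OF _ finite_arcs[OF gG, of "\<lambda>_ _. True"]]) auto
        have fg: "finite good" unfolding good_def using fN by simp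
        have "{(x, y). G x y \<and> (x \<in> V - X \<or> y \<in> V - X)} \<subseteq> Sn \<union> ({v} \<times> N v \<union> N v \<times> {v})"
          using gd(6) unfolding Sn_def N_def by auto
        then have "rho G (V - X) \<le> card (Sn \<union> ({v} \<times> N v \<union> N v \<times> {v}))"
          unfolding rho_def using fSn fN by (intro card_mono) auto
        also have "\<dots> \<le> card Sn + (card ({v} \<times> N v) + card (N v \<times> {v}))"
          by (rule order_trans[OF card_Un_le]) (intro add_left_mono card_Un_le)
        finally have 1: "rho G (V - X) \<le> card Sn + 2 * card (N v)" by (simp add: card_cartesian_product)
        have gF: "simple_graph V F" by (rule simple_graphI[OF fV]) (use gd wv in \<open>auto simp: F_def contract_def\<close>)
        have vg: "v \<notin> good" using gd(3) unfolding good_def N_def by auto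
        have goodV: "z \<in> V" "G v z" if "z \<in> good" for z using that NV[of v] unfolding good_def N_def by auto
        have sub: "Sn \<union> ({w} \<times> good \<union> good \<times> {w}) \<subseteq> {(x, y). F x y \<and> (x \<in> V - {v} - X \<or> y \<in> V - {v} - X)}"
        proof -
          have "Sn \<subseteq> {(x, y). F x y \<and> (x \<in> V - {v} - X \<or> y \<in> V - {v} - X)}"
            unfolding Sn_def F_def contract_def using gd(7) by auto
          moreover have "F w z \<and> F z w \<and> (w \<in> V - {v} - X \<or> z \<in> V - {v} - X)" if z: "z \<in> good" for z
          proof -
            have "z \<noteq> v" "z \<noteq> w" using z vg unfolding good_def by auto
            moreover have "G v z" "G z v" using goodV(2)[OF z] gd(6) by auto
            ultimately have "F w z" "F z w" unfolding F_def contract_def using wv by auto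
            moreover have "\<not> (w \<in> X \<and> z \<in> X)" using z unfolding good_def by simp
            ultimately show ?thesis using wv goodV(1)[OF z] \<open>z \<noteq> v\<close> by auto
          qed
          ultimately show ?thesis by auto
        qed
        have dj: "Sn \<inter> ({w} \<times> good \<union> good \<times> {w}) = {}" "({w} \<times> good) \<inter> (good \<times> {w}) = {}"
          unfolding Sn_def good_def using gd(6) by auto
        have "card Sn + 2 * card good = card (Sn \<union> ({w} \<times> good \<union> good \<times> {w}))"
          using dj fSn fg by (simp add: card_Un_disjoint card_cartesian_product)
        also have "\<dots> \<le> rho F (V - {v} - X)" unfolding rho_def by (rule card_mono[OF finite_arcs[OF gF] sub])
        also have "\<dots> \<le> 12 * t * card (V - {v} - X)" unfolding F_def by (rule contract_light[OF nG v(1) vw])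
        also have "card (V - {v} - X) = n - 1"
        proof -
          have "V - {v} - X = (V - X) - {v}" by auto
          then show ?thesis using v(1) unfolding n_def by simp
        qed
        finally have "card Sn + 2 * card good \<le> 12 * t * (n - 1)" .
        moreover have "12 * t * n = 12 * t * (n - 1) + 12 * t" using npos by (cases n) auto
        ultimately have "12 * t + 1 + 2 * card good \<le> 2 * card (N v)" using 1 M1 by linarith
        moreover have "card (N v) = card good + card (N v - good)"
          using card_Diff_subset[OF fg, of "N v"] card_mono[OF fN, of good v] unfolding good_def by auto
        ultimately have "6 * t + 1 \<le> card (N v - good)" by linarith
        moreover have "N v - good = {z \<in> N v. z = w \<or> G w z \<or> (w \<in> X \<and> z \<in> X)}" unfolding good_def by auto
        ultimately show ?thesis by simp
      qed
      have Nv: "6 * t + 1 \<le> card (N v)"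
      proof -
        obtain w where w: "w \<in> N v" using \<open>N v \<noteq> {}\<close> by blast
        have "card {z \<in> N v. z = w \<or> G w z \<or> (w \<in> X \<and> z \<in> X)} \<le> card (N v)" using fN by (intro card_mono) auto
        then show ?thesis using common[OF w] by linarith
      qed
      define L where "L = insert v (N v)"
      have vN: "v \<notin> N v" using gd(3) unfolding N_def by simp
      have "\<exists>U\<subseteq>L. pair_linked G U t \<and> 2 * t \<le> card U"
      proof (rule dense_has_pair_linked[of G L "6 * t" t])
        show "symp G" by (rule gd(2))
        show "\<And>x. \<not> G x x" by (rule gd(3))
        show "finite L" "L \<noteq> {}" unfolding L_def using fN by auto
        show "card L \<le> 2 * (6 * t) + 1" unfolding L_def using v(2) vN fN by simp
        show "6 * t \<le> 6 * t" ..
        fix w assume w: "w \<in> L"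
        show "6 * t \<le> card {z \<in> L. G w z}"
        proof (cases "w = v")
          case True
          have "{z \<in> L. G w z} = N v" using True gd(3) unfolding L_def N_def by auto
          then show ?thesis using Nv by simp
        next
          case False
          then have wN: "w \<in> N v" using w unfolding L_def by simp
          \<comment> \<open>Inside \<open>X\<close> the only vertex that can fail to be adjacent to
            \<open>w\<close> is \<open>p w\<close>. So at most two vertices are lost,
            \<open>w\<close> and \<open>p w\<close>, and the neighbour \<open>v\<close> makes up for
            one of them.\<close>
          have "{z \<in> N v. z = w \<or> G w z \<or> (w \<in> X \<and> z \<in> X)} \<subseteq> {z \<in> N v. G w z} \<union> {w, p w}"
            unfolding G_def by auto
          then have "card {z \<in> N v. z = w \<or> G w z \<or> (w \<in> X \<and> z \<in> X)} \<le> card ({z \<in> N v. G w z} \<union> {w, p w})"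
            using fN by (intro card_mono) auto
          also have "\<dots> \<le> card {z \<in> N v. G w z} + card {w, p w}" by (rule card_Un_le)
          also have "card {w, p w} \<le> 2" by (simp add: card_insert_if)
          finally have "6 * t + 1 \<le> card {z \<in> N v. G w z} + 2" using common[OF wN] by simp
          moreover have "{z \<in> L. G w z} = insert v {z \<in> N v. G w z}" using wN gd(6) unfolding L_def N_def by auto
          ultimately show ?thesis using vN fN by simp
        qed
      qed
      then obtain U where U: "U \<subseteq> L" "pair_linked G U t" "2 * t \<le> card U" by blast
      have "U \<subseteq> V" using U(1) v(1) NV unfolding L_def by auto
      then have "lnk G V X" by (rule pair_linked_sub_lnk[OF _ U(2,3)]) (use n0 in auto)
      then show False using nG by simp
    qed
  qed
qed

section \<open>The Tutte-Berge formula\<close>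

text \<open>A matching is an involution moving vertices along edges only; its fixed points are the
  unmatched vertices.\<close>

definition matching :: "'b set \<Rightarrow> ('b \<Rightarrow> 'b \<Rightarrow> bool) \<Rightarrow> ('b \<Rightarrow> 'b) \<Rightarrow> bool" where
  "matching V E m \<longleftrightarrow> invol V m \<and> (\<forall>v\<in>V. m v = v \<or> E v (m v))"

definition fx :: "'b set \<Rightarrow> ('b \<Rightarrow> 'b) \<Rightarrow> 'b set" where
  "fx V m = {v \<in> V. m v = v}"

text \<open>The component of \<open>v\<close> in the union of two matchings, walked from
  \<open>v\<close>, which is to be unmatched by \<open>n\<close>: \<open>m\<close> and
  \<open>n\<close> are applied in turn until the next one fixes the current vertex. With an even
  number of vertices the walk stops at a fixed point of \<open>n\<close>, with an odd number at one
  of \<open>m\<close>.\<close>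

definition alt_orbit :: "'b set \<Rightarrow> ('b \<Rightarrow> 'b) \<Rightarrow> ('b \<Rightarrow> 'b) \<Rightarrow> 'b \<Rightarrow> 'b list \<Rightarrow> bool" where
  "alt_orbit V m n v xs \<longleftrightarrow> xs \<noteq> [] \<and> xs ! 0 = v \<and> distinct xs \<and> set xs \<subseteq> V \<and>
     (\<forall>i. Suc i < length xs \<longrightarrow> xs ! Suc i = (if even i then m else n) (xs ! i)) \<and>
     (if odd (length xs) then m else n) (last xs) = last xs"

lemma even_fixpoint_free:
  assumes "finite A" "invol A p" "\<And>x. x \<in> A \<Longrightarrow> p x \<noteq> x"
  shows "even (card A)"
  using assms
proof (induction "card A" arbitrary: A rule: less_induct)
  case less
  show ?case
  proof (cases "A = {}")
    case False
    then obtain x where x: "x \<in> A" by blast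
    have px: "p x \<in> A" "p x \<noteq> x" using involD(1)[OF less.prems(2) x] less.prems(3)[OF x] by auto
    define B where "B = A - {x, p x}"
    have "invol B p" unfolding invol_def
    proof
      fix y assume y: "y \<in> B"
      then have yA: "y \<in> A" unfolding B_def by simp
      note i = involD[OF less.prems(2)]
      have "p y \<noteq> x" "p y \<noteq> p x" using y i(2)[OF yA] i(2)[OF x] unfolding B_def by auto
      then show "p y \<in> B \<and> p (p y) = y" using i[OF yA] unfolding B_def by simp
    qed
    moreover have cB: "card A = card B + 2"
      using x px less.prems(1) card_mono[OF less.prems(1), of "{x, p x}"] unfolding B_def by (simp add: card_Diff_subset)
    ultimately have "even (card B)" using less.hyps[of B] less.prems(1,3) unfolding B_def by auto
    then show ?thesis using cB by simp
  qed simp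
qed

lemma invol_parity:
  assumes "finite V" "invol V m"
  shows "even (card V) \<longleftrightarrow> even (card (fx V m))"
proof -
  have "invol (V - fx V m) m" unfolding invol_def
  proof
    fix x assume "x \<in> V - fx V m"
    then show "m x \<in> V - fx V m \<and> m (m x) = x" using involD[OF assms(2), of x] unfolding fx_def by auto
  qed
  then have "even (card (V - fx V m))" using assms(1) by (intro even_fixpoint_free[where p = m]) (auto simp: fx_def)
  moreover have "card V = card (V - fx V m) + card (fx V m)"
    using assms(1) card_Diff_subset[of "fx V m" V] card_mono[of V "fx V m"] unfolding fx_def by auto
  ultimately show ?thesis by simp
qed

lemma alt_orbitD:
  assumes "alt_orbit V m n v xs"
  shows "xs \<noteq> []" "xs ! 0 = v" "distinct xs" "set xs \<subseteq> V"
    "\<And>i. Suc i < length xs \<Longrightarrow> xs ! Suc i = (if even i then m else n) (xs ! i)"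
    "(if odd (length xs) then m else n) (last xs) = last xs"
  using assms unfolding alt_orbit_def by auto

text \<open>A longest alternating sequence cannot run back into itself: the partners of its earlier
  vertices are already in it, and \<open>v\<close> has no partner under \<open>n\<close>.\<close>

lemma alt_orbit_exists:
  assumes fV: "finite V" and m: "invol V m" and n: "invol V n" and v: "v \<in> V" "n v = v"
  obtains xs where "alt_orbit V m n v xs"
proof -
  define P where "P xs \<longleftrightarrow> xs \<noteq> [] \<and> xs ! 0 = v \<and> distinct xs \<and> set xs \<subseteq> V \<and>
     (\<forall>i. Suc i < length xs \<longrightarrow> xs ! Suc i = (if even i then m else n) (xs ! i))" for xs
  have "P [v]" unfolding P_def using v by simp
  moreover have bd: "\<forall>xs. P xs \<longrightarrow> length xs \<le> card V"
  proof (intro allI impI)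
    fix xs assume "P xs"
    then have d: "distinct xs" "set xs \<subseteq> V" unfolding P_def by auto
    show "length xs \<le> card V" using card_mono[OF fV d(2)] distinct_card[OF d(1)] by simp
  qed
  ultimately obtain xs where xs: "P xs" "\<And>ys. P ys \<Longrightarrow> length ys \<le> length xs"
    using ex_has_greatest_nat[of P "[v]" length "Suc (card V)"] by (metis le_imp_less_Suc)
  define N where "N = length xs - 1"
  have ne: "xs \<noteq> []" and d: "distinct xs" and sub: "set xs \<subseteq> V" and x0: "xs ! 0 = v"
    and step: "\<And>i. Suc i < length xs \<Longrightarrow> xs ! Suc i = (if even i then m else n) (xs ! i)"
    using xs(1) unfolding P_def by auto
  have len: "length xs = Suc N" unfolding N_def using ne by (cases xs) auto
  have la: "last xs = xs ! N" unfolding N_def using ne by (rule last_conv_nth)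
  have inV: "xs ! i \<in> V" if "i \<le> N" for i using sub len that by auto
  define f where "f = (if even N then m else n)"
  have ff: "f (f z) = z" "f z \<in> V" if "z \<in> V" for z using involD[OF m that] involD[OF n that] unfolding f_def by auto
  have mm: "m (m z) = z" "n (n z) = z" if "z \<in> V" for z using involD[OF m that] involD[OF n that] by auto
  have "f (xs ! N) = xs ! N"
  proof (rule ccontr)
    assume nf: "f (xs ! N) \<noteq> xs ! N"
    have "f (xs ! N) \<notin> set xs"
    proof
      assume "f (xs ! N) \<in> set xs"
      then obtain j where j: "j \<le> N" "xs ! j = f (xs ! N)" using len by (auto simp: in_set_conv_nth less_Suc_eq_le)
      have jN: "j < N" using j nf by (cases "j = N") auto
      have fj: "f (xs ! j) = xs ! N" using j(2) ff(1)[OF inV] by simp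
      show False
      proof (cases "even j \<longleftrightarrow> even N")
        case True
        then have "f (xs ! j) = xs ! Suc j" using step[of j] jN len unfolding f_def by simp
        then have "Suc j = N" using fj d jN len by (simp add: nth_eq_iff_index_eq)
        then show ?thesis using True by auto
      next
        case False
        show ?thesis
        proof (cases j)
          case 0
          then have "f (xs ! j) = xs ! j" using False v x0 unfolding f_def by simp
          then show ?thesis using fj d jN len by (simp add: nth_eq_iff_index_eq)
        next
          case (Suc i)
          then have "xs ! j = f (xs ! i)" using step[of i] jN len False unfolding f_def by auto
          then have "f (xs ! j) = xs ! i" using ff(1)[OF inV, of i] Suc jN by simp
          then show ?thesis using fj d jN Suc len by (simp add: nth_eq_iff_index_eq)
        qed
      qed
    qed
    then have "P (xs @ [f (xs ! N)])" unfolding P_def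
      using ne d sub x0 step ff(2)[OF inV, of N] len f_def by (auto simp: nth_append less_Suc_eq)
    then show False using xs(2) by fastforce
  qed
  then have "alt_orbit V m n v xs" unfolding alt_orbit_def using ne d sub x0 step la len f_def by auto
  then show ?thesis by (rule that)
qed

lemma alt_orbit_prev:
  assumes o: "alt_orbit V m n v xs" and m: "invol V m" and n: "invol V n" and i: "Suc i < length xs"
  shows "(if even i then m else n) (xs ! Suc i) = xs ! i"
proof -
  have "xs ! i \<in> V" using alt_orbitD(4)[OF o] i by auto
  then show ?thesis using alt_orbitD(5)[OF o i] involD(2)[OF m] involD(2)[OF n] by auto
qed

lemma alt_orbit_closed:
  assumes o: "alt_orbit V m n v xs" and m: "invol V m" and n: "invol V n" and v: "n v = v" and x: "x \<in> set xs"
  shows "m x \<in> set xs" "n x \<in> set xs"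
proof -
  note d = alt_orbitD[OF o]
  obtain i where i: "i < length xs" "x = xs ! i" using x by (auto simp: in_set_conv_nth)
  define f where "f = (if even i then m else n)"
  define h where "h = (if even i then n else m)"
  have "f x \<in> set xs"
  proof (cases "Suc i < length xs")
    case True
    then show ?thesis using d(5)[OF True] i unfolding f_def by (metis nth_mem)
  next
    case False
    then have "length xs = Suc i" using i by simp
    then have "x = last xs" "odd (length xs) = even i" using i d(1) by (auto simp: last_conv_nth)
    then show ?thesis using d(6) x unfolding f_def by auto
  qed
  moreover have "h x \<in> set xs"
  proof (cases i)
    case 0
    then show ?thesis using i d(2) v x unfolding h_def by simp
  next
    case (Suc k)
    then have "h x = xs ! k" using alt_orbit_prev[OF o m n, of k] i unfolding h_def by auto
    then show ?thesis using i Suc by simp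
  qed
  ultimately show "m x \<in> set xs" "n x \<in> set xs" unfolding f_def h_def by (auto split: if_splits)
qed

lemma alt_orbit_interior:
  assumes o: "alt_orbit V m n v xs" and m: "invol V m" and n: "invol V n" and i: "0 < i" "Suc i < length xs"
  shows "m (xs ! i) \<noteq> xs ! i" "n (xs ! i) \<noteq> xs ! i"
proof -
  note d = alt_orbitD[OF o]
  obtain k where k: "i = Suc k" using i by (cases i) auto
  have "(if even i then m else n) (xs ! i) = xs ! Suc i" using d(5)[OF i(2)] by simp
  moreover have "(if even k then m else n) (xs ! i) = xs ! k" using alt_orbit_prev[OF o m n, of k] k i by simp
  moreover have "xs ! Suc i \<noteq> xs ! i" "xs ! k \<noteq> xs ! i" using d(3) i k by (auto simp: nth_eq_iff_index_eq)
  ultimately show "m (xs ! i) \<noteq> xs ! i" "n (xs ! i) \<noteq> xs ! i" using k by (auto split: if_splits)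
qed

lemma alt_orbit_fixed:
  assumes o: "alt_orbit V m n v xs" and m: "invol V m" and n: "invol V n" and x: "x \<in> set xs" "m x = x \<or> n x = x"
  shows "x = v \<or> x = last xs"
proof -
  note d = alt_orbitD[OF o]
  obtain i where i: "i < length xs" "x = xs ! i" using x by (auto simp: in_set_conv_nth)
  show ?thesis
  proof (cases "0 < i \<and> Suc i < length xs")
    case True then show ?thesis using alt_orbit_interior[OF o m n, of i] i x(2) by auto
  next
    case False
    then have "i = 0 \<or> i = length xs - 1" using i by auto
    then show ?thesis using i d(1,2) by (auto simp: last_conv_nth)
  qed
qed

text \<open>Together with \<open>alt_orbit_closed\<close> this makes any two orbits equal or
  disjoint.\<close>

lemma alt_orbit_minimal:
  assumes o: "alt_orbit V m n v xs" and m: "invol V m" and n: "invol V n"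
    and T: "\<And>x. x \<in> T \<Longrightarrow> m x \<in> T" "\<And>x. x \<in> T \<Longrightarrow> n x \<in> T" and ne: "x \<in> set xs" "x \<in> T"
  shows "set xs \<subseteq> T"
proof -
  note d = alt_orbitD[OF o]
  have fwd: "xs ! Suc i \<in> T" if "Suc i < length xs" "xs ! i \<in> T" for i using d(5)[OF that(1)] T that(2) by auto
  have bwd: "xs ! i \<in> T" if "Suc i < length xs" "xs ! Suc i \<in> T" for i
    using alt_orbit_prev[OF o m n that(1)] T that(2) by (metis (full_types))
  obtain k where k: "k < length xs" "x = xs ! k" using ne by (auto simp: in_set_conv_nth)
  have down: "xs ! 0 \<in> T" if "i < length xs" "xs ! i \<in> T" for i using that
  proof (induction i)
    case (Suc i) then show ?case using bwd[of i] by auto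
  qed simp
  have up: "xs ! i \<in> T" if "i < length xs" for i using that
  proof (induction i)
    case 0 then show ?case using down[OF k(1)] k ne by simp
  next
    case (Suc i) then show ?case using fwd[of i] by auto
  qed
  then show ?thesis by (auto simp: in_set_conv_nth)
qed

lemma matching_splice:
  assumes "matching V E m" "matching V E n" "\<And>x. x \<in> S \<Longrightarrow> m x \<in> S" "\<And>x. x \<in> S \<Longrightarrow> n x \<in> S" "S \<subseteq> V"
  shows "matching V E (\<lambda>x. if x \<in> S then n x else m x)"
proof -
  have im: "invol V m" "invol V n" using assms unfolding matching_def by auto
  have out: "m x \<notin> S" if "x \<in> V" "x \<notin> S" for x
    using assms(3)[of "m x"] involD(2)[OF im(1) that(1)] that(2) by auto
  show ?thesis unfolding matching_def invol_def
    using assms im[unfolded invol_def] out unfolding matching_def by auto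
qed

text \<open>Gallai's argument. A vertex matched by all maximum matchings is put into the barrier and
  removed. If there is none, being missed together by no maximum matching is an equivalence
  relation; adjacent vertices are related, every class is odd and contains at most one unmatched
  vertex, and the empty barrier serves. The parts are only required to be closed under adjacency in
  \<open>V - U\<close>.\<close>

theorem tutte_berge:
  assumes "simple_graph V E"
  shows "\<exists>m U KK. matching V E m \<and> U \<subseteq> V \<and> pairwise disjnt KK \<and> \<Union>KK = V - U \<and>
    (\<forall>K\<in>KK. \<forall>x\<in>K. \<forall>y\<in>V - U. E x y \<longrightarrow> y \<in> K) \<and>
    card (fx V m) + card U \<le> card {K \<in> KK. odd (card K)}"
  using assms
proof (induction "card V" arbitrary: V E rule: less_induct)
  case less
  note gd = simple_graphD[OF less.prems]
  have "matching V E id" unfolding matching_def invol_def by simp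
  then obtain m where m: "matching V E m" "\<And>m'. matching V E m' \<Longrightarrow> card (fx V m) \<le> card (fx V m')"
    using ex_has_least_nat[of "matching V E" id "\<lambda>m. card (fx V m)"] by blast
  define optm where "optm n \<longleftrightarrow> matching V E n \<and> card (fx V n) = card (fx V m)" for n
  have om: "optm m" unfolding optm_def using m by simp
  have iv: "invol V n" if "optm n" for n using that unfolding optm_def matching_def by simp
  show ?case
  proof (cases "\<exists>v\<in>V. \<forall>n. optm n \<longrightarrow> n v \<noteq> v")
    case True
    then obtain v where v: "v \<in> V" "\<And>n. optm n \<Longrightarrow> n v \<noteq> v" by blast
    define W where "W = V - {v}"
    have gW: "simple_graph W (ind E W)" using simple_graph_ind[OF less.prems] unfolding W_def by blast
    have "card W < card V" unfolding W_def using v(1) gd(1) by (rule card_Diff1_less[rotated])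
    from less.hyps[OF this gW] obtain m' U KK where h: "matching W (ind E W) m'" "U \<subseteq> W" "pairwise disjnt KK" "\<Union>KK = W - U"
      "\<forall>K\<in>KK. \<forall>x\<in>K. \<forall>y\<in>W - U. ind E W x y \<longrightarrow> y \<in> K"
      "card (fx W m') + card U \<le> card {K \<in> KK. odd (card K)}" by (elim exE conjE)
    define n where "n x = (if x = v then v else m' x)" for x
    have mn: "matching V E n" using h(1) unfolding matching_def invol_def n_def W_def ind_def by auto
    have "fx V n = insert v (fx W m')" unfolding fx_def n_def W_def using v(1) by auto
    moreover have "finite (fx W m')" "v \<notin> fx W m'" using gd(1) unfolding fx_def W_def by auto
    ultimately have cn: "card (fx V n) = Suc (card (fx W m'))" by simp
    have "n v = v" unfolding n_def by simp
    then have "\<not> optm n" using v(2) by blast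
    then have "card (fx V m) < card (fx V n)" using m(2)[OF mn] mn unfolding optm_def by auto
    moreover have "even (card (fx V m)) \<longleftrightarrow> even (card (fx V n))"
      using invol_parity[OF gd(1)] mn m(1) unfolding matching_def by blast
    \<comment> \<open>The number of unmatched vertices, counting \<open>v\<close>, goes up when
      \<open>v\<close> is removed, and by parity it goes up by at least 2.\<close>
    ultimately have le: "card (fx V m) + 1 \<le> card (fx W m')" using cn by (metis Suc_leI add.commute le_antisym even_Suc less_Suc_eq_le not_less_eq_eq plus_1_eq_Suc)
    have fU: "finite U" using h(2) gd(1) finite_subset unfolding W_def by blast
    have vU: "v \<notin> U" using h(2) unfolding W_def by auto
    show ?thesis
    proof (intro exI conjI)
      show "matching V E m" by (rule m(1))
      show "insert v U \<subseteq> V" using h(2) v(1) unfolding W_def by auto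
      show "pairwise disjnt KK" by (rule h(3))
      show "\<Union>KK = V - insert v U" using h(4) unfolding W_def by auto
      show "\<forall>K\<in>KK. \<forall>x\<in>K. \<forall>y\<in>V - insert v U. E x y \<longrightarrow> y \<in> K"
      proof (intro ballI impI)
        fix K x y assume a: "K \<in> KK" "x \<in> K" "y \<in> V - insert v U" "E x y"
        have "x \<in> W - U" using a(1,2) h(4) by blast
        then have "ind E W x y" "y \<in> W - U" using a unfolding ind_def W_def by auto
        then show "y \<in> K" using h(5) a(1,2) by blast
      qed
      show "card (fx V m) + card (insert v U) \<le> card {K \<in> KK. odd (card K)}"
        using le h(6) fU vU by simp
    qed
  next
    case False
    then have ex: "\<exists>n. optm n \<and> n v = v" if "v \<in> V" for v using that by blast
    define rel where "rel u w \<longleftrightarrow> u = w \<or> \<not> (\<exists>n. optm n \<and> n u = u \<and> n w = w)" for u w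
    have rsym: "rel u w \<Longrightarrow> rel w u" for u w unfolding rel_def by blast
    have adj: "rel u w" if e: "E u w" for u w
    proof (rule ccontr)
      assume "\<not> rel u w"
      then obtain n where n: "optm n" "n u = u" "n w = w" unfolding rel_def by blast
      define n' where "n' x = (if x = u then w else if x = w then u else n x)" for x
      have uw: "u \<in> V" "w \<in> V" "u \<noteq> w" using gd e by blast+
      have ninj: "n x \<noteq> u" "n x \<noteq> w" if "x \<in> V" "x \<noteq> u" "x \<noteq> w" for x
        using involD(2)[OF iv[OF n(1)] that(1)] n(2,3) that by metis+
      have "matching V E n'" unfolding matching_def invol_def
      proof (intro conjI ballI)
        fix x assume x: "x \<in> V"
        have mx: "n x \<in> V" "n (n x) = x" "n x = x \<or> E x (n x)" using n(1) x unfolding optm_def matching_def invol_def by auto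
        show "n' x \<in> V" "n' (n' x) = x" "n' x = x \<or> E x (n' x)"
          using mx uw ninj[OF x] e gd(6)[OF e] unfolding n'_def by auto
      qed
      moreover have "fx V n' = fx V n - {u, w}" using uw unfolding fx_def n'_def by auto
      moreover have "u \<in> fx V n" "w \<in> fx V n" "finite (fx V n)" using n uw gd(1) unfolding fx_def by auto
      ultimately have "card (fx V n') < card (fx V n)" "matching V E n'"
        by (auto intro!: psubset_card_mono)
      then show False using m(2) n(1) unfolding optm_def by (metis not_le)
    qed
    \<comment> \<open>Let \<open>M\<close> miss \<open>u\<close> and \<open>w\<close>, and let
      \<open>N\<close> miss \<open>v\<close>. The orbit of \<open>v\<close> contains at most one of
      \<open>u\<close> and \<open>w\<close>, as its far end. Exchanging \<open>M\<close> and
      \<open>N\<close> along the orbit gives a maximum matching that misses \<open>v\<close> and the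
      other of the two.\<close>
    have trans: "rel u w" if uv: "rel u v" and vw: "rel v w" and V: "u \<in> V" "v \<in> V" "w \<in> V" for u v w
    proof (rule ccontr)
      assume nr: "\<not> rel u w"
      then obtain M where M: "optm M" "M u = u" "M w = w" and uw: "u \<noteq> w" unfolding rel_def by blast
      have d: "u \<noteq> v" "v \<noteq> w" using nr uv vw by auto
      obtain N where N: "optm N" "N v = v" using ex[OF V(2)] by blast
      obtain xs where o: "alt_orbit V M N v xs"
        using alt_orbit_exists[OF gd(1) iv[OF M(1)] iv[OF N(1)] V(2) N(2)] .
      define S where "S = set xs"
      have SV: "S \<subseteq> V" using alt_orbitD(4)[OF o] unfolding S_def .
      have cl: "M x \<in> S" "N x \<in> S" if "x \<in> S" for x
        using alt_orbit_closed[OF o iv[OF M(1)] iv[OF N(1)] N(2), of x] that unfolding S_def by auto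
      have vS: "v \<in> S" using alt_orbitD(1,2)[OF o] unfolding S_def by (metis length_greater_0_conv nth_mem)
      have "u \<in> S \<Longrightarrow> u = last xs" "w \<in> S \<Longrightarrow> w = last xs"
        using alt_orbit_fixed[OF o iv[OF M(1)] iv[OF N(1)]] M d unfolding S_def by blast+
      then have "u \<notin> S \<or> w \<notin> S" using uw by blast
      then obtain z where z: "z \<notin> S" "M z = z" "rel z v" "z \<noteq> v" using M(2,3) uv vw rsym d by blast
      define M' where "M' x = (if x \<in> S then N x else M x)" for x
      define N' where "N' x = (if x \<in> S then M x else N x)" for x
      have mM: "matching V E M" "matching V E N" using M(1) N(1) unfolding optm_def by auto
      have mM': "matching V E M'" unfolding M'_def by (rule matching_splice[OF mM cl SV])
      have mN': "matching V E N'" unfolding N'_def by (rule matching_splice[OF mM(2,1) cl(2,1) SV])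
      have f1: "fx V M' = (fx V N \<inter> S) \<union> (fx V M - S)" unfolding fx_def M'_def by auto
      have f2: "fx V N' = (fx V M \<inter> S) \<union> (fx V N - S)" unfolding fx_def N'_def by auto
      have fin: "finite (fx V M)" "finite (fx V N)" using gd(1) unfolding fx_def by auto
      have c1: "card (fx V M') = card (fx V N \<inter> S) + card (fx V M - S)"
        unfolding f1 using fin by (intro card_Un_disjoint) auto
      have c2: "card (fx V N') = card (fx V M \<inter> S) + card (fx V N - S)"
        unfolding f2 using fin by (intro card_Un_disjoint) auto
      have c3: "card (fx V M) = card (fx V M \<inter> S) + card (fx V M - S)" "card (fx V N) = card (fx V N \<inter> S) + card (fx V N - S)"
        using fin by (simp_all add: card_Int_Diff)
      \<comment> \<open>The exchange redistributes the unmatched vertices between \<open>M'\<close>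
        and \<open>N'\<close> without changing their total, so both matchings stay maximum.\<close>
      have "card (fx V M') = card (fx V m)"
        using c1 c2 c3 m(2)[OF mM'] m(2)[OF mN'] M(1) N(1) unfolding optm_def by linarith
      then have "optm M'" unfolding optm_def using mM' by simp
      moreover have "M' v = v" "M' z = z" using N(2) vS z unfolding M'_def by auto
      ultimately show False using z(3,4) unfolding rel_def by blast
    qed
    define cls where "cls x = {y \<in> V. rel x y}" for x
    define KK where "KK = cls ` V"
    have clsI: "x \<in> cls x" if "x \<in> V" for x using that unfolding cls_def rel_def by auto
    have clseq: "cls x = cls y" if "rel x y" "x \<in> V" "y \<in> V" for x y
      unfolding cls_def using that trans rsym by blast
    have one: "y = z" if "optm n" "y \<in> cls x" "z \<in> cls x" "x \<in> V" "n y = y" "n z = z" for n x y z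
    proof -
      have "rel y z" using trans[of y x z] rsym that unfolding cls_def by blast
      then show ?thesis using that unfolding rel_def by blast
    qed
    have pres: "invol (cls x) n" if "optm n" "x \<in> V" for n x
      unfolding invol_def
    proof
      fix y assume y: "y \<in> cls x"
      then have yV: "y \<in> V" "rel x y" unfolding cls_def by auto
      have "n y = y \<or> E y (n y)" using that(1) yV unfolding optm_def matching_def by blast
      then have "rel y (n y)" using adj unfolding rel_def by auto
      moreover have "n y \<in> V" "n (n y) = y" using involD[OF iv[OF that(1)] yV(1)] by auto
      ultimately show "n y \<in> cls x \<and> n (n y) = y" using trans[of x y "n y"] yV that(2) unfolding cls_def by auto
    qed
    have fcls: "finite (cls x)" for x using gd(1) unfolding cls_def by simp
    \<comment> \<open>A maximum matching that misses \<open>x\<close> acts on the class of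
      \<open>x\<close> with \<open>x\<close> as its only fixed point.\<close>
    have oddc: "odd (card (cls x))" if x: "x \<in> V" for x
    proof -
      obtain n where n: "optm n" "n x = x" using ex[OF x] by blast
      have "fx (cls x) n = {x}" using one[OF n(1) _ clsI[OF x] x _ n(2)] clsI[OF x] n(2) unfolding fx_def by auto
      then show ?thesis using invol_parity[OF fcls pres[OF n(1) x]] by simp
    qed
    have "inj_on cls (fx V m)"
    proof (rule inj_onI)
      fix y z assume yz: "y \<in> fx V m" "z \<in> fx V m" "cls y = cls z"
      then have "y \<in> V" "z \<in> V" "m y = y" "m z = z" unfolding fx_def by auto
      then show "y = z" using one[OF om clsI _ _ , of y z] clsI[of z] yz(3) by auto
    qed
    then have "card (fx V m) = card (cls ` fx V m)" by (simp add: card_image)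
    also have "\<dots> \<le> card KK" unfolding KK_def using gd(1) by (intro card_mono) (auto simp: fx_def)
    also have "KK = {K \<in> KK. odd (card K)}" unfolding KK_def using oddc by auto
    finally have cc: "card (fx V m) \<le> card {K \<in> KK. odd (card K)}" .
    show ?thesis
    proof (intro exI conjI)
      show "matching V E m" by (rule m(1))
      show "{} \<subseteq> V" by simp
      show "pairwise disjnt KK" unfolding pairwise_def disjnt_def
      proof (intro ballI impI)
        fix K L assume KL: "K \<in> KK" "L \<in> KK" "K \<noteq> L"
        then obtain x y where xy: "x \<in> V" "y \<in> V" "K = cls x" "L = cls y" unfolding KK_def by auto
        show "K \<inter> L = {}"
        proof (rule ccontr)
          assume "K \<inter> L \<noteq> {}"
          then obtain z where "z \<in> V" "rel x z" "rel y z" unfolding xy cls_def by auto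
          then have "cls x = cls y" using clseq[of x z] clseq[of y z] xy by simp
          then show False using KL(3) xy by simp
        qed
      qed
      show "\<Union>KK = V - {}" unfolding KK_def using clsI by (auto simp: cls_def)
      show "\<forall>K\<in>KK. \<forall>x\<in>K. \<forall>y\<in>V - {}. E x y \<longrightarrow> y \<in> K"
      proof (intro ballI impI)
        fix K x y assume a: "K \<in> KK" "x \<in> K" "y \<in> V - {}" "E x y"
        then obtain w where w: "w \<in> V" "K = cls w" unfolding KK_def by auto
        then show "y \<in> K" using a trans[of w x y] adj[OF a(4)] unfolding cls_def by auto
      qed
      show "card (fx V m) + card {} \<le> card {K \<in> KK. odd (card K)}" using cc by simp
    qed
  qed
qed

section \<open>Packing odd paths\<close>

text \<open>Closing up an odd path outside \<open>A\<close> by a properly coloured path gives an odd cycle.\<close>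

definition odd_path :: "('a \<Rightarrow> 'a \<Rightarrow> bool) \<Rightarrow> 'a set \<Rightarrow> ('a \<Rightarrow> bool) \<Rightarrow> 'a list \<Rightarrow> bool" where
  "odd_path E A \<phi> p \<longleftrightarrow> distinct p \<and> successively E p \<and> 2 \<le> length p \<and>
     set p \<inter> A = {hd p, last p} \<and> (odd (length p) \<longleftrightarrow> \<phi> (hd p) \<noteq> \<phi> (last p))"

text \<open>The graph is doubled, with an edge joining the two copies of each vertex outside \<open>A\<close>; a vertex
  of \<open>A\<close> is kept in the copy of its colour only. Alternating paths of this graph project to
  \<open>A\<close>-paths whose parity disagrees with the colours of their ends.\<close>

locale doubled =
  fixes V :: "'a set" and E :: "'a \<Rightarrow> 'a \<Rightarrow> bool" and A :: "'a set" and \<phi> :: "'a \<Rightarrow> bool"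
  assumes g: "simple_graph V E" and AV: "A \<subseteq> V"
begin

definition VV where "VV = {x :: 'a \<times> bool. fst x \<in> V \<and> (fst x \<in> A \<longrightarrow> snd x = \<phi> (fst x))}"

definition EE where "EE x y \<longleftrightarrow> x \<in> VV \<and> y \<in> VV \<and>
  (snd x = snd y \<and> E (fst x) (fst y) \<or> fst x = fst y \<and> snd x \<noteq> snd y)"

text \<open>The matching of all edges between the two sheets; it leaves exactly the copies of
  \<open>A\<close> unmatched, and odd paths arise by comparing it with a maximum matching.\<close>

definition flip where "flip x = (if fst x \<in> A then x else (fst x, \<not> snd x))" for x :: "'a \<times> bool"

lemmas gd = simple_graphD[OF g]

lemma finVV: "finite VV"
  by (rule finite_subset[of _ "V \<times> UNIV"]) (use gd(1) in \<open>auto simp: VV_def\<close>)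

lemma gEE: "simple_graph VV EE"
proof (rule simple_graphI[OF finVV])
  fix x y assume "EE x y"
  then show "x \<in> VV \<and> x \<noteq> y \<and> EE y x" using gd(3,6) unfolding EE_def by auto
qed

lemma invol_flip: "invol VV flip"
  unfolding invol_def flip_def VV_def by auto

lemma flip_flip: "flip (flip x) = x"
  unfolding flip_def by auto

lemma fst_flip: "fst (flip x) = fst x"
  unfolding flip_def by auto

lemma flip_VV: "x \<in> VV \<Longrightarrow> flip x \<in> VV"
  using involD(1)[OF invol_flip] .

lemma flip_edge: "x \<in> VV \<Longrightarrow> flip x \<noteq> x \<Longrightarrow> EE x (flip x)"
  using flip_VV[of x] unfolding EE_def flip_def by (auto split: if_splits)

lemma flip_fix: "flip x = x \<longleftrightarrow> fst x \<in> A"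
  unfolding flip_def by (cases x) auto

lemma same_fst: "x \<in> VV \<Longrightarrow> y \<in> VV \<Longrightarrow> fst x = fst y \<Longrightarrow> y = x \<or> y = flip x"
  unfolding flip_def VV_def by (cases x; cases y) auto

text \<open>An odd part contains a vertex of \<open>T\<close>, one without a different partner
  outside \<open>U\<close>, as \<open>flip\<close> would otherwise pair off the part. One vertex of
  \<open>T\<close> is kept in every part that has any; \<open>Z\<close> consists of the vertices
  below the rest of \<open>T\<close> and below the pairs contained in \<open>U\<close>. What remains
  has kept copies, and the sheet of such a copy serves as colour: since a part keeps only one
  vertex, adjacent vertices get different colours.\<close>

lemma cover_of_barrier:
  assumes U: "U \<subseteq> VV" and dis: "pairwise disjnt KK" and un: "\<Union>KK = VV - U"
    and cl: "\<And>K x y. K \<in> KK \<Longrightarrow> x \<in> K \<Longrightarrow> y \<in> VV - U \<Longrightarrow> EE x y \<Longrightarrow> y \<in> K"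
    and tb: "f + card U \<le> card {K \<in> KK. odd (card K)}" and f: "card A < f + r" and r: "r < card A"
    and two: "\<And>Z P Q. Z \<subseteq> V \<Longrightarrow> card Z < r \<Longrightarrow> P \<union> Q = V - Z \<Longrightarrow> sep (ind E (V - Z)) P Q \<Longrightarrow>
      P - Q \<noteq> {} \<Longrightarrow> Q - P \<noteq> {} \<Longrightarrow> 2 \<le> card (P \<inter> Q)"
  shows "\<exists>Z \<psi>. Z \<subseteq> V \<and> card Z < r \<and> (\<forall>x\<in>V - Z. \<forall>y\<in>V - Z. E x y \<longrightarrow> \<psi> x \<noteq> (\<psi> y :: bool))"
proof -
  have fU: "finite U" using finite_subset[OF U finVV] .
  define T where "T = {x \<in> VV - U. flip x = x \<or> flip x \<in> U}"
  define U1 where "U1 = {x \<in> U. flip x \<notin> U}"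
  define U2 where "U2 = {x \<in> U. flip x \<in> U}"
  have fT: "finite T" using finVV unfolding T_def by simp
  have cU: "card U = card U1 + card U2"
  proof -
    have "U = U1 \<union> U2" "U1 \<inter> U2 = {}" unfolding U1_def U2_def by auto
    then show ?thesis using fU card_Un_disjoint[of U1 U2] by (metis finite_Un)
  qed
  have cT: "card T \<le> card A + card U1"
  proof -
    have fA: "finite A" using finite_subset[OF AV gd(1)] .
    have "T \<subseteq> (\<lambda>a. (a, \<phi> a)) ` A \<union> flip ` U1"
    proof
      fix x assume x: "x \<in> T"
      show "x \<in> (\<lambda>a. (a, \<phi> a)) ` A \<union> flip ` U1"
      proof (cases "flip x = x")
        case True
        then have a: "fst x \<in> A" using flip_fix by simp
        then have "x = (fst x, \<phi> (fst x))" using x unfolding T_def VV_def by (cases x) auto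
        then show ?thesis using a by blast
      next
        case False
        then have "flip x \<in> U1" using x flip_flip unfolding T_def U1_def by auto
        then show ?thesis using flip_flip[of x] by (metis UnCI image_eqI)
      qed
    qed
    moreover have "finite U1" unfolding U1_def using fU by simp
    ultimately have "card T \<le> card ((\<lambda>a. (a, \<phi> a)) ` A \<union> flip ` U1)" using fA by (intro card_mono) auto
    also have "\<dots> \<le> card ((\<lambda>a. (a, \<phi> a)) ` A) + card (flip ` U1)" by (rule card_Un_le)
    also have "\<dots> \<le> card A + card U1" using card_image_le[OF fA] card_image_le[OF \<open>finite U1\<close>] by (intro add_mono) auto
    finally show ?thesis .
  qed
  define TK where "TK = {K \<in> KK. K \<inter> T \<noteq> {}}"
  have fKK: "finite KK" using finVV un by (metis finite_Diff finite_UnionD)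
  have oddT: "{K \<in> KK. odd (card K)} \<subseteq> TK"
  proof
    fix K assume "K \<in> {K \<in> KK. odd (card K)}"
    then have K: "K \<in> KK" "odd (card K)" by auto
    have KV: "K \<subseteq> VV - U" using K un by auto
    have "K \<inter> T \<noteq> {}"
    proof
      assume e: "K \<inter> T = {}"
      have nf: "flip x \<noteq> x \<and> flip x \<in> K" if x: "x \<in> K" for x
      proof -
        have "x \<in> VV - U" "x \<notin> T" using x KV e by auto
        then have n: "flip x \<noteq> x" "flip x \<notin> U" unfolding T_def by auto
        moreover have "EE x (flip x)" using flip_edge \<open>x \<in> VV - U\<close> n by auto
        ultimately show ?thesis using cl[OF K(1) x] flip_VV[of x] \<open>x \<in> VV - U\<close> by auto
      qed
      have "finite K" using finite_subset[OF KV] finVV by auto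
      moreover have "invol K flip" unfolding invol_def using nf flip_flip by simp
      ultimately have "even (card K)" using nf by (intro even_fixpoint_free[of K flip]) auto
      then show False using K by simp
    qed
    then show "K \<in> TK" using K unfolding TK_def by simp
  qed
  define \<kappa> where "\<kappa> K = (SOME x. x \<in> K \<inter> T)" for K
  have \<kappa>: "\<kappa> K \<in> K \<inter> T" if "K \<in> TK" for K
  proof -
    have "\<exists>x. x \<in> K \<inter> T" using that unfolding TK_def by blast
    then show ?thesis unfolding \<kappa>_def by (rule someI_ex)
  qed
  have uniq: "K = L" if "K \<in> KK" "L \<in> KK" "x \<in> K" "x \<in> L" for K L x
    using dis that unfolding pairwise_def disjnt_def by auto
  have "inj_on \<kappa> TK"
  proof (rule inj_onI)
    fix K L assume "K \<in> TK" "L \<in> TK" "\<kappa> K = \<kappa> L"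
    then show "K = L" using \<kappa>[of K] \<kappa>[of L] uniq[of K L "\<kappa> K"] unfolding TK_def by auto
  qed
  then have ckeep: "card (\<kappa> ` TK) = card TK" by (rule card_image)
  have keepT: "\<kappa> ` TK \<subseteq> T" using \<kappa> by auto
  have keep_eq: "x = \<kappa> K" if xk: "x \<in> \<kappa> ` TK" "x \<in> K" "K \<in> KK" for x K
  proof -
    obtain L where L: "L \<in> TK" "x = \<kappa> L" using xk(1) by auto
    then have "x \<in> L" "L \<in> KK" using \<kappa>[OF L(1)] unfolding TK_def by auto
    then show ?thesis using uniq[of K L x] that L by simp
  qed
  define Z where "Z = fst ` (T - \<kappa> ` TK) \<union> fst ` U2"
  have ZV: "Z \<subseteq> V" unfolding Z_def T_def U2_def using U unfolding VV_def by auto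
  have "card Z \<le> card (fst ` (T - \<kappa> ` TK)) + card (fst ` U2)" unfolding Z_def by (rule card_Un_le)
  also have "\<dots> \<le> card (T - \<kappa> ` TK) + card U2"
    using fT fU by (intro add_mono card_image_le) (auto simp: U2_def)
  also have "\<dots> = card T - card TK + card U2"
    using keepT fT ckeep card_Diff_subset[of "\<kappa> ` TK" T] finite_subset[OF keepT fT] by simp
  finally have cZ0: "card Z \<le> card T - card TK + card U2" .
  have "card {K \<in> KK. odd (card K)} \<le> card TK"
    using oddT fKK by (intro card_mono) (auto simp: TK_def)
  moreover have "card TK \<le> card T" using card_mono[OF fT keepT] ckeep by simp
  \<comment> \<open>In sum, \<open>card Z\<close> is at most
    \<open>card A + card U1 + card U2\<close> minus the number of odd parts, and the barrier
    inequality turns this into \<open>card A - f < r\<close>.\<close>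
  ultimately have cZ: "card Z < r" using cZ0 cT cU tb f by linarith
  have clK: "flip x \<in> K" if "K \<in> KK" "x \<in> K" "flip x \<notin> U" for K x
  proof (cases "flip x = x")
    case False
    have "x \<in> \<Union>KK" using that by auto
    then have "x \<in> VV" unfolding un by simp
    then show ?thesis using cl[OF that(1,2)] flip_edge[of x] flip_VV[of x] that(3) False by simp
  qed (use that in simp)
  have dich: "(\<exists>c. (v, c) \<in> \<kappa> ` TK) \<or> (v \<notin> A \<and> (\<forall>c. (v, c) \<in> VV - U))" if v: "v \<in> V - Z" for v
  proof (rule ccontr)
    assume n: "\<not> ((\<exists>c. (v, c) \<in> \<kappa> ` TK) \<or> (v \<notin> A \<and> (\<forall>c. (v, c) \<in> VV - U)))"
    then have n1: "(v, c) \<notin> \<kappa> ` TK" for c by simp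
    have nT: "(v, c) \<notin> T" for c
    proof
      assume "(v, c) \<in> T"
      then have "(v, c) \<in> T - \<kappa> ` TK" using n1 by simp
      from imageI[OF this, of fst] have "v \<in> Z" unfolding Z_def by simp
      then show False using v by simp
    qed
    have nU: "(v, c) \<notin> U2" for c
    proof
      assume "(v, c) \<in> U2"
      from imageI[OF this, of fst] have "v \<in> Z" unfolding Z_def by simp
      then show False using v by simp
    qed
    show False
    proof (cases "v \<in> A")
      case True
      then have "(v, \<phi> v) \<in> VV" "flip (v, \<phi> v) = (v, \<phi> v)" using v unfolding VV_def flip_def by auto
      then show False using nT[of "\<phi> v"] nU[of "\<phi> v"] unfolding T_def U2_def by auto
    next
      case False
      then have a: "(v, c) \<in> VV" "flip (v, c) = (v, \<not> c)" for c using v unfolding VV_def flip_def by auto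
      have iff: "(v, c) \<in> U \<longleftrightarrow> (v, \<not> c) \<in> U" for c
        using nT[of c] nT[of "\<not> c"] a unfolding T_def by auto
      have "\<not> (\<forall>c. (v, c) \<in> VV - U)" using n False by simp
      then obtain c where "(v, c) \<in> U" using a(1) by blast
      then have "(v, c) \<in> U2" using iff[of c] a unfolding U2_def by auto
      then show False using nU by simp
    qed
  qed
  have nbr_in: "(w, c) \<in> K" if "K \<in> KK" "(v, c) \<in> K" "E v w" "(w, c) \<in> VV - U" for K v w c
    using cl[OF that(1,2,4)] that un unfolding EE_def by auto
  \<comment> \<open>Such a vertex has both copies in one part \<open>K\<close>. The vertices of this
    kind over \<open>K\<close> are cut off from the rest of \<open>V - Z\<close> by the single
    vertex below the one kept in \<open>K\<close>, which contradicts the assumption on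
    separations.\<close>
  have nD: "\<not> (v \<notin> A \<and> (\<forall>c. (v, c) \<in> VV - U))" if v: "v \<in> V - Z" for v
  proof
    assume D: "v \<notin> A \<and> (\<forall>c. (v, c) \<in> VV - U)"
    then have "(v, True) \<in> \<Union>KK" using un by simp
    then obtain K where K: "K \<in> KK" "(v, True) \<in> K" by (rule UnionE)
    have "flip (v, True) \<in> K" using clK[OF K] D unfolding flip_def by auto
    then have vF: "(v, False) \<in> K" using D unfolding flip_def by simp
    define W where "W = {w \<in> V - Z. w \<notin> A \<and> (\<forall>c. (w, c) \<in> K)}"
    have vW: "v \<in> W" unfolding W_def using v D K vF by (auto simp: all_bool_eq)
    define z where "z = fst (\<kappa> K)"
    define P where "P = W \<union> ({z} \<inter> (V - Z))"
    define Q where "Q = V - Z - W"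
    have step: "w' \<in> P" if w: "w \<in> W" "w' \<in> V - Z" "E w w'" for w w'
      using dich[OF w(2)]
    proof
      assume "\<exists>c. (w', c) \<in> \<kappa> ` TK"
      then obtain c where c: "(w', c) \<in> \<kappa> ` TK" by blast
      then have "(w', c) \<in> VV - U" using keepT unfolding T_def by auto
      then have "(w', c) \<in> K" using nbr_in[OF K(1) _ w(3)] w(1) unfolding W_def by auto
      then have "z = w'" unfolding z_def using keep_eq[OF c _ K(1)] by (metis fst_conv)
      then show ?thesis unfolding P_def using w by simp
    next
      assume d: "w' \<notin> A \<and> (\<forall>c. (w', c) \<in> VV - U)"
      then have "(w', c) \<in> K" for c using nbr_in[OF K(1) _ w(3), of c] w(1) unfolding W_def by auto
      then show ?thesis using d w unfolding P_def W_def by auto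
    qed
    have sp: "sep (ind E (V - Z)) P Q" unfolding sep_def
    proof (intro allI impI)
      fix x y assume "ind E (V - Z) x y"
      then have e: "x \<in> V - Z" "y \<in> V - Z" "E x y" "E y x" using gd(6) unfolding ind_def by auto
      show "(x \<in> P \<and> y \<in> P) \<or> (x \<in> Q \<and> y \<in> Q)"
      proof (cases "x \<in> W \<or> y \<in> W")
        case True
        then show ?thesis using step[of x y] step[of y x] e unfolding P_def by auto
      next
        case False
        then show ?thesis using e unfolding Q_def by auto
      qed
    qed
    \<comment> \<open>As \<open>card Z < r < card A\<close>, a vertex of \<open>A\<close> other than
      \<open>z\<close> survives, and it lies on the far side because members of \<open>W\<close> are
      outside \<open>A\<close>.\<close>
    have "card (A - Z) \<ge> 2"
      using cZ r diff_card_le_card_Diff[of Z A] finite_subset[OF ZV gd(1)] by linarith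
    then have "\<not> A - Z \<subseteq> {z}" using card_mono[of "{z}" "A - Z"] by auto
    then obtain a where "a \<in> A - Z" "a \<noteq> z" by auto
    then have "a \<in> Q - P" using AV unfolding Q_def P_def W_def by auto
    moreover have "v \<in> P - Q" using vW unfolding P_def Q_def by auto
    moreover have "P \<union> Q = V - Z" unfolding P_def Q_def W_def by auto
    ultimately have "2 \<le> card (P \<inter> Q)" using two[OF ZV cZ _ sp] by blast
    moreover have "card (P \<inter> Q) \<le> 1" using card_mono[of "{z}" "P \<inter> Q"] unfolding P_def Q_def by auto
    ultimately show False by simp
  qed
  define \<psi> where "\<psi> v = (SOME c. (v, c) \<in> \<kappa> ` TK)" for v
  have \<psi>: "(v, \<psi> v) \<in> \<kappa> ` TK" if "v \<in> V - Z" for v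
  proof -
    have "\<exists>c. (v, c) \<in> \<kappa> ` TK" using dich[OF that] nD[OF that] by blast
    then show ?thesis unfolding \<psi>_def by (rule someI_ex)
  qed
  have "\<psi> x \<noteq> \<psi> y" if xy: "x \<in> V - Z" "y \<in> V - Z" "E x y" for x y
  proof
    assume e: "\<psi> x = \<psi> y"
    have k: "(x, \<psi> x) \<in> \<kappa> ` TK" "(y, \<psi> x) \<in> \<kappa> ` TK" using \<psi>[OF xy(1)] \<psi>[OF xy(2)] e by auto
    then have u: "(x, \<psi> x) \<in> VV - U" "(y, \<psi> x) \<in> VV - U" using keepT unfolding T_def by auto
    then have "(x, \<psi> x) \<in> \<Union>KK" unfolding un by simp
    then obtain K where K: "K \<in> KK" "(x, \<psi> x) \<in> K" by (rule UnionE)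
    have "(y, \<psi> x) \<in> K" using nbr_in[OF K xy(3) u(2)] .
    then have "(x, \<psi> x) = (y, \<psi> x)" using keep_eq[OF k(1) K(2,1)] keep_eq[OF k(2) _ K(1)] by simp
    then show False using gd(7)[OF xy(3)] by simp
  qed
  then show ?thesis using ZV cZ by blast
qed

text \<open>Even length means that the orbit stops at a fixed point of \<open>flip\<close>, that is
  over \<open>A\<close>. Its steps under \<open>m\<close> stay within a sheet, since a vertical step
  would coincide with the preceding or following step of \<open>flip\<close>. The sheet therefore
  changes once at every inner vertex of the projection, and the sheets at both ends are the colours
  of the ends.\<close>

lemma orbit_odd_path:
  assumes o: "alt_orbit VV m flip (a, \<phi> a) xs" and mm: "matching VV EE m" and a: "a \<in> A" and ev: "even (length xs)"
  obtains p where "odd_path E A \<phi> p" "set p \<subseteq> fst ` set xs"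
proof -
  note d = alt_orbitD[OF o]
  have m: "invol VV m" using mm unfolding matching_def by simp
  obtain l0 where l0: "length xs = 2 * l0" using ev by blast
  then obtain l where l: "length xs = 2 * Suc l" using d(1) by (cases l0) auto
  have la: "last xs = xs ! Suc (2 * l)" using l d(1) by (simp add: last_conv_nth)
  have inV: "xs ! i \<in> VV" if "i < length xs" for i using d(4) that by auto
  have dx: "xs ! i \<noteq> xs ! j" if "i < length xs" "j < length xs" "i \<noteq> j" for i j
    using d(3) that by (simp add: nth_eq_iff_index_eq)
  have flE: "flip (xs ! (2 * i)) = (if i = 0 then xs ! 0 else xs ! (2 * i - 1))" if "i \<le> l" for i
  proof (cases i)
    case 0
    then show ?thesis using d(2) a flip_fix by simp
  next
    case (Suc k)
    then show ?thesis using alt_orbit_prev[OF o m invol_flip, of "Suc (2 * k)"] l that by simp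
  qed
  have flL: "flip (last xs) = last xs" using d(6) ev by simp
  have mE: "xs ! Suc (2 * i) = m (xs ! (2 * i))" if "i \<le> l" for i using d(5)[of "2 * i"] that l by simp
  have fS: "xs ! (2 * Suc i) = flip (xs ! Suc (2 * i))" if "i < l" for i using d(5)[of "Suc (2 * i)"] that l by simp
  have edge: "E (fst (xs ! (2 * i))) (fst (xs ! Suc (2 * i))) \<and> snd (xs ! (2 * i)) = snd (xs ! Suc (2 * i))"
    if i: "i \<le> l" for i
  proof -
    have ne: "xs ! Suc (2 * i) \<noteq> xs ! (2 * i)" using dx[of "Suc (2 * i)" "2 * i"] l i by simp
    have e: "EE (xs ! (2 * i)) (xs ! Suc (2 * i))"
      using mm inV[of "2 * i"] l i mE[OF i] ne unfolding matching_def by auto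
    have "fst (xs ! Suc (2 * i)) \<noteq> fst (xs ! (2 * i))"
    proof
      assume "fst (xs ! Suc (2 * i)) = fst (xs ! (2 * i))"
      then have "xs ! Suc (2 * i) = flip (xs ! (2 * i))"
        using same_fst[of "xs ! (2 * i)" "xs ! Suc (2 * i)"] inV[of "2 * i"] inV[of "Suc (2 * i)"] l i ne by simp
      moreover have "Suc (2 * i) \<noteq> 2 * i - 1" "2 * i - 1 < length xs" "Suc (2 * i) < length xs" using l i by auto
      ultimately show False using flE[OF i] dx[of "Suc (2 * i)" 0] dx[of "Suc (2 * i)" "2 * i - 1"] by (metis Zero_not_Suc length_greater_0_conv d(1))
    qed
    then show ?thesis using e unfolding EE_def by auto
  qed
  define p where "p = map (\<lambda>i. fst (xs ! (2 * i))) [0..<Suc l] @ [fst (last xs)]"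
  have lp: "length p = Suc (Suc l)" unfolding p_def by simp
  have pn: "p ! i = fst (xs ! (2 * i))" if "i \<le> l" for i using that unfolding p_def by (simp add: nth_append del: upt_Suc)
  have pl: "p ! Suc l = fst (last xs)" unfolding p_def by (simp add: nth_append del: upt_Suc)
  have hl: "hd p = a" "last p = fst (last xs)"
    using pn[of 0] d(2) lp unfolding p_def by (auto simp: hd_conv_nth simp del: upt_Suc)
  have "successively E p" unfolding successively_conv_nth
  proof (intro allI impI)
    fix i assume "Suc i < length p"
    then have i: "i \<le> l" using lp by simp
    have "fst (xs ! Suc (2 * i)) = p ! Suc i"
    proof (cases "i = l")
      case True then show ?thesis using pl la by simp
    next
      case False
      then show ?thesis using pn[of "Suc i"] fS[of i] i fst_flip by simp
    qed
    then show "E (p ! i) (p ! Suc i)" using edge[OF i] pn[OF i] by simp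
  qed
  moreover have "distinct p"
  proof -
    have "inj_on (\<lambda>i. fst (xs ! (2 * i))) {0..<Suc l}"
    proof (rule inj_onI)
      fix i j assume ij: "i \<in> {0..<Suc l}" "j \<in> {0..<Suc l}" "fst (xs ! (2 * i)) = fst (xs ! (2 * j))"
      show "i = j"
      proof (rule ccontr)
        assume n: "i \<noteq> j"
        have "xs ! (2 * j) = flip (xs ! (2 * i))"
          using same_fst[of "xs ! (2 * i)" "xs ! (2 * j)"] inV[of "2 * i"] inV[of "2 * j"] ij l n dx[of "2 * j" "2 * i"] by auto
        then have i0: "i \<noteq> 0" "xs ! (2 * j) = xs ! (2 * i - 1)"
          using flE[of i] ij n dx[of "2 * j" 0] l by (auto split: if_splits)
        have "2 * j \<noteq> 2 * i - 1" "2 * j < length xs" "2 * i - 1 < length xs" using i0(1) ij(1,2) l by (presburger, auto)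
        then show False using dx i0(2) by blast
      qed
    qed
    then have "distinct (map (\<lambda>i. fst (xs ! (2 * i))) [0..<Suc l])" by (simp add: distinct_map del: upt_Suc)
    moreover have nl: "fst (last xs) \<noteq> fst (xs ! (2 * i))" if i: "i \<le> l" for i
    proof
      assume f: "fst (last xs) = fst (xs ! (2 * i))"
      have "last xs \<in> VV" using inV[of "Suc (2 * l)"] la l by simp
      then have "xs ! (2 * i) = last xs" using same_fst[of "last xs" "xs ! (2 * i)"] inV[of "2 * i"] f i l flL by auto
      moreover have "2 * i \<noteq> Suc (2 * l)" by presburger
      ultimately show False using dx[of "2 * i" "Suc (2 * l)"] i l la by simp
    qed
    moreover have "fst (last xs) \<notin> set (map (\<lambda>i. fst (xs ! (2 * i))) [0..<Suc l])"
    proof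
      assume "fst (last xs) \<in> set (map (\<lambda>i. fst (xs ! (2 * i))) [0..<Suc l])"
      then obtain i where i: "i \<in> set [0..<Suc l]" "fst (last xs) = fst (xs ! (2 * i))" unfolding set_map by (rule imageE)
      have "i \<le> l" using i(1) by (simp add: less_Suc_eq_le del: upt_Suc)
      then show False using nl i(2) by blast
    qed
    ultimately show ?thesis unfolding p_def by (simp only: distinct_append) (simp del: upt_Suc)
  qed
  moreover have sub: "set p \<subseteq> fst ` set xs"
  proof -
    have "xs ! (2 * i) \<in> set xs" if "i \<le> l" for i using that l by simp
    moreover have "last xs \<in> set xs" using d(1) by simp
    ultimately have "fst (xs ! (2 * i)) \<in> fst ` set xs" if "i \<le> l" for i using that by blast
    moreover have "fst (last xs) \<in> fst ` set xs" using d(1) by simp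
    ultimately show ?thesis unfolding p_def by (auto simp del: upt_Suc simp: less_Suc_eq_le)
  qed
  moreover have lA: "fst (last xs) \<in> A" using flL flip_fix by simp
  have "set p \<inter> A = {hd p, last p}"
  proof
    have "p \<noteq> []" using lp by auto
    then have "hd p \<in> set p" "last p \<in> set p" by simp_all
    then show "{hd p, last p} \<subseteq> set p \<inter> A" using hl a lA by simp
    show "set p \<inter> A \<subseteq> {hd p, last p}"
    proof
      fix v assume v: "v \<in> set p \<inter> A"
      then obtain x where x: "x \<in> set xs" "v = fst x" using sub by auto
      then have "flip x = x" using v flip_fix by simp
      then have "x = (a, \<phi> a) \<or> x = last xs" using alt_orbit_fixed[OF o m invol_flip x(1)] by simp
      then show "v \<in> {hd p, last p}" using hl x by auto
    qed
  qed
  moreover have "odd (length p) \<longleftrightarrow> \<phi> (hd p) \<noteq> \<phi> (last p)"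
  proof -
    have "snd (xs ! (2 * i)) = (if even i then \<phi> a else \<not> \<phi> a)" if "i \<le> l" for i using that
    proof (induction i)
      case 0 then show ?case using d(2) by simp
    next
      case (Suc i)
      have i: "i < l" using Suc.prems by simp
      have "xs ! (2 * Suc i) \<noteq> xs ! Suc (2 * i)" using dx[of "2 * Suc i" "Suc (2 * i)"] i l by simp
      then have ff: "flip (xs ! Suc (2 * i)) \<noteq> xs ! Suc (2 * i)" using fS[OF i] by simp
      have "snd (flip x) \<noteq> snd x" if "flip x \<noteq> x" for x using that unfolding flip_def by (auto split: if_splits)
      from this[OF ff] have "snd (xs ! (2 * Suc i)) \<noteq> snd (xs ! Suc (2 * i))" using fS[OF i] by simp
      moreover have "snd (xs ! (2 * i)) = snd (xs ! Suc (2 * i))" using edge[of i] i by simp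
      moreover have "snd (xs ! (2 * i)) = (if even i then \<phi> a else \<not> \<phi> a)" using Suc.IH i by simp
      ultimately show ?case by (auto split: if_splits)
    qed
    then have "snd (last xs) = (if even l then \<phi> a else \<not> \<phi> a)" using edge[of l] la by simp
    moreover have "snd (last xs) = \<phi> (fst (last xs))"
      using inV[of "Suc (2 * l)"] la l lA unfolding VV_def by simp
    ultimately show ?thesis using hl lp by auto
  qed
  ultimately have "odd_path E A \<phi> p" using lp unfolding odd_path_def by simp
  then show ?thesis using sub by (rule that)
qed

text \<open>Orbits of odd length end in different vertices unmatched by \<open>m\<close>, so at
  least \<open>2 * j\<close> of the vertices of \<open>A\<close> start an orbit of even length. The
  same orbit arises from at most two of them, its ends.\<close>

lemma many_odd_paths:
  assumes mm: "matching VV EE m" and f: "card (fx VV m) + 2 * j \<le> card A"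
  shows "\<exists>PP. finite PP \<and> card PP = j \<and> (\<forall>p\<in>PP. odd_path E A \<phi> p \<and> set p \<subseteq> V) \<and>
      (\<forall>p\<in>PP. \<forall>q\<in>PP. p \<noteq> q \<longrightarrow> set p \<inter> set q = {})"
proof -
  have m: "invol VV m" using mm unfolding matching_def by simp
  have fA: "finite A" using finite_subset[OF AV gd(1)] .
  have "\<exists>xs. alt_orbit VV m flip (a, \<phi> a) xs" if "a \<in> A" for a
  proof -
    have "(a, \<phi> a) \<in> VV" "flip (a, \<phi> a) = (a, \<phi> a)" using that AV unfolding VV_def flip_def by auto
    then show ?thesis using alt_orbit_exists[OF finVV m invol_flip] by metis
  qed
  then obtain xs where o: "\<And>a. a \<in> A \<Longrightarrow> alt_orbit VV m flip (a, \<phi> a) (xs a)" by metis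
  have fa: "flip (a, \<phi> a) = (a, \<phi> a)" if "a \<in> A" for a using that unfolding flip_def by simp
  have st: "(a, \<phi> a) \<in> set (xs a)" if "a \<in> A" for a
    using alt_orbitD(1,2)[OF o[OF that]] by (metis length_greater_0_conv nth_mem)
  have sub: "set (xs a) \<subseteq> set (xs b)" if "a \<in> A" "b \<in> A" "x \<in> set (xs a)" "x \<in> set (xs b)" for a b x
    by (rule alt_orbit_minimal[OF o[OF that(1)] m invol_flip _ _ that(3,4)])
      (use alt_orbit_closed[OF o[OF that(2)] m invol_flip fa[OF that(2)]] in auto)
  have eqs: "set (xs a) = set (xs b)" if "a \<in> A" "b \<in> A" "x \<in> set (xs a)" "x \<in> set (xs b)" for a b x
    using sub[OF that] sub[OF that(2,1,4,3)] by simp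
  have ends: "b = a \<or> (b, \<phi> b) = last (xs a)" if "a \<in> A" "b \<in> A" "x \<in> set (xs a)" "x \<in> set (xs b)" for a b x
  proof -
    have "(b, \<phi> b) \<in> set (xs a)" using st[OF that(2)] eqs[OF that] by simp
    from alt_orbit_fixed[OF o[OF that(1)] m invol_flip this] fa[OF that(2)] show ?thesis by auto
  qed
  define A1 where "A1 = {a \<in> A. even (length (xs a))}"
  have A1: "A1 \<subseteq> A" "finite A1" using fA unfolding A1_def by auto
  have "card (A - A1) \<le> card (fx VV m)"
  proof (rule card_inj_on_le[of "\<lambda>a. last (xs a)"])
    show "inj_on (\<lambda>a. last (xs a)) (A - A1)"
    proof (rule inj_onI)
      fix a b assume ab: "a \<in> A - A1" "b \<in> A - A1" "last (xs a) = last (xs b)"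
      have aA: "a \<in> A" "b \<in> A" using ab by auto
      have l: "last (xs a) \<in> set (xs a)" "last (xs a) \<in> set (xs b)"
        using last_in_set[OF alt_orbitD(1)[OF o[OF aA(1)]]] last_in_set[OF alt_orbitD(1)[OF o[OF aA(2)]]] ab(3) by auto
      have 1: "b = a \<or> (b, \<phi> b) = last (xs a)" using ends[OF aA l] .
      have 2: "a = b \<or> (a, \<phi> a) = last (xs b)" using ends[OF aA(2,1) l(2,1)] .
      show "a = b" using 1 2 ab(3) by (metis fst_conv)
    qed
    show "(\<lambda>a. last (xs a)) ` (A - A1) \<subseteq> fx VV m"
    proof
      fix x assume "x \<in> (\<lambda>a. last (xs a)) ` (A - A1)"
      then obtain a where a: "a \<in> A" "odd (length (xs a))" "x = last (xs a)" unfolding A1_def by auto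
      note d = alt_orbitD[OF o[OF a(1)]]
      show "x \<in> fx VV m" using d(6) d(4) last_in_set[OF d(1)] a unfolding fx_def by auto
    qed
    show "finite (fx VV m)" unfolding fx_def using finVV by simp
  qed
  then have c1: "2 * j \<le> card A1"
    using card_Diff_subset[OF A1(2,1)] card_mono[OF fA A1(1)] f by simp
  define S where "S a = set (xs a)" for a
  have fib: "card {a \<in> A1. S a = T} \<le> 2" for T
  proof (cases "{a \<in> A1. S a = T} = {}")
    case False
    then obtain a where a: "a \<in> A1" "S a = T" by auto
    have "{b \<in> A1. S b = T} \<subseteq> {a, fst (last (xs a))}"
    proof
      fix b assume "b \<in> {b \<in> A1. S b = T}"
      then have b: "b \<in> A1" "S b = S a" using a by auto
      then have "b = a \<or> (b, \<phi> b) = last (xs a)" using ends[of a b "(a, \<phi> a)"] a A1(1) st unfolding S_def by auto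
      then show "b \<in> {a, fst (last (xs a))}" by (metis fst_conv insertCI)
    qed
    then have "card {b \<in> A1. S b = T} \<le> card {a, fst (last (xs a))}" by (intro card_mono) auto
    also have "\<dots> \<le> 2" by (simp add: card_insert_if)
    finally show ?thesis .
  next
    case True
    then show ?thesis by (simp only: card.empty)
  qed
  have "card A1 = card (\<Union>T\<in>S ` A1. {a \<in> A1. S a = T})" by (rule arg_cong[where f = card]) auto
  also have "\<dots> \<le> (\<Sum>T\<in>S ` A1. card {a \<in> A1. S a = T})" using A1(2) by (intro card_UN_le) auto
  also have "\<dots> \<le> (\<Sum>T\<in>S ` A1. 2)" by (intro sum_mono fib)
  finally have "j \<le> card (S ` A1)" using c1 by simp
  then obtain F where F: "F \<subseteq> S ` A1" "card F = j" using obtain_subset_with_card_n by metis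
  have fF: "finite F" using finite_subset[OF F(1)] A1(2) by simp
  have "\<exists>p. odd_path E A \<phi> p \<and> set p \<subseteq> fst ` T" if TF: "T \<in> F" for T
  proof -
    have "T \<in> S ` A1" using F(1) TF by blast
    then obtain a where a: "a \<in> A" "even (length (xs a))" "T = set (xs a)" unfolding A1_def S_def by blast
    show ?thesis using orbit_odd_path[OF o[OF a(1)] mm a(1,2)] a(3) by metis
  qed
  then obtain P where P: "\<And>T. T \<in> F \<Longrightarrow> odd_path E A \<phi> (P T) \<and> set (P T) \<subseteq> fst ` T" by metis
  have dis: "fst ` T \<inter> fst ` T' = {}" if TT: "T \<in> F" "T' \<in> F" "T \<noteq> T'" for T T'
  proof (rule ccontr)
    assume "fst ` T \<inter> fst ` T' \<noteq> {}"
    then obtain x y where xy: "x \<in> T" "y \<in> T'" "fst x = fst y" by auto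
    have "T \<in> S ` A1" "T' \<in> S ` A1" using F(1) TT by auto
    then obtain a b where a: "a \<in> A" "T = set (xs a)" and b: "b \<in> A" "T' = set (xs b)" using A1(1) unfolding S_def by blast
    have "x \<in> VV" "y \<in> VV" using alt_orbitD(4)[OF o] a b xy by auto
    then have "y = x \<or> y = flip x" using same_fst xy(3) by simp
    moreover have "x \<in> set (xs a)" using xy(1) a(2) by simp
    ultimately have "y \<in> set (xs a)" using alt_orbit_closed(2)[OF o[OF a(1)] m invol_flip fa[OF a(1)], of x] by metis
    then show False using eqs[OF a(1) b(1)] xy(2) a b TT(3) by auto
  qed
  have ne: "P T \<noteq> []" if "T \<in> F" for T using P[OF that] unfolding odd_path_def by auto
  have pd: "set (P T) \<inter> set (P T') = {}" if "T \<in> F" "T' \<in> F" "T \<noteq> T'" for T T'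
    using dis[OF that] P[OF that(1)] P[OF that(2)] by blast
  have "inj_on P F"
  proof (rule inj_onI)
    fix T T' assume t: "T \<in> F" "T' \<in> F" "P T = P T'"
    show "T = T'"
    proof (rule ccontr)
      assume "T \<noteq> T'"
      from pd[OF t(1,2) this] show False using t(3) ne[OF t(1)] by simp
    qed
  qed
  then have "card (P ` F) = j" using F(2) card_image by metis
  moreover have "odd_path E A \<phi> p \<and> set p \<subseteq> V" if "p \<in> P ` F" for p
  proof -
    obtain T where T: "T \<in> F" "p = P T" using \<open>p \<in> P ` F\<close> by auto
    have "T \<in> S ` A1" using F(1) T(1) by auto
    then obtain a where a: "a \<in> A" "T = set (xs a)" using A1(1) unfolding S_def by blast
    have "fst ` T \<subseteq> V" using alt_orbitD(4)[OF o[OF a(1)]] a(2) unfolding VV_def by auto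
    then show ?thesis using P[OF T(1)] T(2) by auto
  qed
  moreover have "set p \<inter> set q = {}" if "p \<in> P ` F" "q \<in> P ` F" "p \<noteq> q" for p q
  proof -
    obtain T T' where T: "T \<in> F" "T' \<in> F" "p = P T" "q = P T'" using \<open>p \<in> P ` F\<close> \<open>q \<in> P ` F\<close> by auto
    then have "T \<noteq> T'" using \<open>p \<noteq> q\<close> by auto
    then show ?thesis using pd T by simp
  qed
  ultimately show ?thesis using fF by (intro exI[of _ "P ` F"]) simp
qed

text \<open>A parity version of Gallai's theorem on disjoint paths between vertices of
  \<open>A\<close>. Each path accounts for two vertices of \<open>A\<close>, whence the factor 2 in
  the bound on \<open>Z\<close>.\<close>

theorem odd_paths_or_cover:
  assumes j: "2 * j < card A"
    and two: "\<And>Z P Q. Z \<subseteq> V \<Longrightarrow> card Z < 2 * j \<Longrightarrow> P \<union> Q = V - Z \<Longrightarrow> sep (ind E (V - Z)) P Q \<Longrightarrow>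
      P - Q \<noteq> {} \<Longrightarrow> Q - P \<noteq> {} \<Longrightarrow> 2 \<le> card (P \<inter> Q)"
  shows "(\<exists>PP. finite PP \<and> card PP = j \<and> (\<forall>p\<in>PP. odd_path E A \<phi> p \<and> set p \<subseteq> V) \<and>
      (\<forall>p\<in>PP. \<forall>q\<in>PP. p \<noteq> q \<longrightarrow> set p \<inter> set q = {})) \<or>
    (\<exists>Z \<psi>. Z \<subseteq> V \<and> card Z < 2 * j \<and> (\<forall>x\<in>V - Z. \<forall>y\<in>V - Z. E x y \<longrightarrow> \<psi> x \<noteq> (\<psi> y :: bool)))"
proof -
  obtain m U KK where mm: "matching VV EE m" and U: "U \<subseteq> VV" "pairwise disjnt KK" "\<Union>KK = VV - U"
    and cl: "\<forall>K\<in>KK. \<forall>x\<in>K. \<forall>y\<in>VV - U. EE x y \<longrightarrow> y \<in> K"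
    and c: "card (fx VV m) + card U \<le> card {K \<in> KK. odd (card K)}"
    using tutte_berge[OF gEE] by (elim exE conjE)
  show ?thesis
  proof (cases "card (fx VV m) + 2 * j \<le> card A")
    case True
    show ?thesis using many_odd_paths[OF mm True] ..
  next
    case False
    have "\<exists>Z \<psi>. Z \<subseteq> V \<and> card Z < 2 * j \<and> (\<forall>x\<in>V - Z. \<forall>y\<in>V - Z. E x y \<longrightarrow> \<psi> x \<noteq> (\<psi> y :: bool))"
    proof (rule cover_of_barrier[OF U _ c _ j])
      fix K x y assume "K \<in> KK" "x \<in> K" "y \<in> VV - U" "EE x y"
      then show "y \<in> K" using cl by simp
    next
      show "card A < card (fx VV m) + 2 * j" using False by simp
    next
      fix Z P Q assume "Z \<subseteq> V" "card Z < 2 * j" "P \<union> Q = V - Z" "sep (ind E (V - Z)) P Q"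
        "P - Q \<noteq> {}" "Q - P \<noteq> {}"
      then show "2 \<le> card (P \<inter> Q)" by (rule two)
    qed
    then show ?thesis ..
  qed
qed

end

section \<open>Odd cycles through linked bipartite subgraphs\<close>

lemma is_cycleI:
  assumes "distinct cs" "3 \<le> length cs" "successively E cs" "E (last cs) (hd cs)"
  shows "is_cycle E cs"
  unfolding is_cycle_def
proof (intro conjI allI impI)
  fix i assume i: "i < length cs"
  show "E (cs ! i) (cs ! ((i + 1) mod length cs))"
  proof (cases "Suc i < length cs")
    case True
    then show ?thesis using assms(3) unfolding successively_conv_nth by simp
  next
    case False
    then have l: "Suc i = length cs" using i by simp
    have ne: "cs \<noteq> []" using assms(2) by auto
    have "last cs = cs ! i" "hd cs = cs ! 0" using last_conv_nth[OF ne] hd_conv_nth[OF ne] l[symmetric] by auto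
    then show ?thesis using assms(4) l by simp
  qed
qed (use assms in auto)

lemma hd_neq_last: "distinct xs \<Longrightarrow> 2 \<le> length xs \<Longrightarrow> hd xs \<noteq> last xs"
  by (cases xs; cases "tl xs") auto

lemma successively_glue:
  assumes "successively E xs" "xs \<noteq> []" "successively E (last xs # ys)"
  shows "successively E (xs @ ys)"
  using assms by (cases ys) (auto simp: successively_append_iff)

text \<open>Lengths count vertices, so odd length means an even number of edges.\<close>

lemma bichromatic_parity:
  assumes "successively F xs" "xs \<noteq> []" "\<And>x y. F x y \<Longrightarrow> \<phi> x \<noteq> (\<phi> y :: bool)"
  shows "odd (length xs) \<longleftrightarrow> \<phi> (hd xs) = \<phi> (last xs)"
  using assms(1,2)
proof (induction xs rule: induct_list012)
  case (3 x y zs)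
  then have "\<phi> x \<noteq> \<phi> y" using assms(3) by simp
  moreover have "odd (length (y # zs)) \<longleftrightarrow> \<phi> y = \<phi> (last (y # zs))" using 3 by simp
  ultimately show ?case by auto
qed auto

lemma conn_middle:
  assumes "conn F C" "a \<in> C" "b \<in> C" "a \<noteq> b" "\<And>x y. F x y \<Longrightarrow> \<phi> x \<noteq> (\<phi> y :: bool)"
  obtains M where "successively F (a # M @ [b])" "distinct (a # M @ [b])" "set M \<subseteq> C"
    "even (length M) \<longleftrightarrow> \<phi> a \<noteq> \<phi> b"
proof -
  obtain xs where xs: "xs \<noteq> []" "hd xs = a" "last xs = b" "distinct xs" "set xs \<subseteq> C" "successively F xs"
    by (rule conn_path[OF assms(1-3)])
  obtain ys where ys: "xs = a # ys" using xs(1,2) by (cases xs) auto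
  then have "ys \<noteq> []" "last ys = b" using xs(3) assms(4) by (auto split: if_splits)
  then obtain M where M: "xs = a # M @ [b]" using ys by (metis append_butlast_last_id)
  have "odd (length xs) \<longleftrightarrow> \<phi> (hd xs) = \<phi> (last xs)" by (rule bichromatic_parity[OF xs(6,1) assms(5)])
  then have "even (length M) \<longleftrightarrow> \<phi> a \<noteq> \<phi> b" using M by auto
  then show ?thesis using that[of M] M xs(4-6) by simp
qed

lemma close_path:
  assumes q: "distinct Q" "successively E Q" "3 \<le> length Q"
    and M: "successively E (last Q # M @ [hd Q])" "distinct M" "set M \<inter> set Q = {}"
    and par: "odd (length Q) \<longleftrightarrow> \<phi> (hd Q) \<noteq> (\<phi> (last Q) :: bool)"
    and Mpar: "even (length M) \<longleftrightarrow> \<phi> (last Q) \<noteq> \<phi> (hd Q)"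
  shows "is_cycle E (Q @ M)" "odd (length (Q @ M))"
proof -
  have ne: "Q \<noteq> []" using q by auto
  show "is_cycle E (Q @ M)"
  proof (rule is_cycleI)
    show "distinct (Q @ M)" using q M by auto
    show "3 \<le> length (Q @ M)" using q by simp
    have s: "successively E (Q @ M @ [hd Q])" by (rule successively_glue[OF q(2) ne M(1)])
    then have "successively E ((Q @ M) @ [hd Q])" by simp
    then show "successively E (Q @ M)" "E (last (Q @ M)) (hd (Q @ M))"
      unfolding successively_append_iff using ne by simp_all
  qed
  show "odd (length (Q @ M))" using par Mpar by auto
qed

lemma join_paths:
  assumes q: "distinct Q" "successively E Q" "Q \<noteq> []" and p: "distinct P" "successively E P" "P \<noteq> []"
    and M: "successively E (last Q # M @ [hd P])" "distinct M" "set M \<inter> set Q = {}" "set M \<inter> set P = {}"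
    and QP: "set Q \<inter> set P = {}"
  shows "distinct (Q @ M @ P)" "successively E (Q @ M @ P)" "hd (Q @ M @ P) = hd Q" "last (Q @ M @ P) = last P"
proof -
  show "distinct (Q @ M @ P)" using assms by auto
  have "successively E (Q @ M @ [hd P])" by (rule successively_glue[OF q(2,3) M(1)])
  moreover have "successively E (last (Q @ M @ [hd P]) # tl P)" using p(2,3) by simp
  ultimately have "successively E ((Q @ M @ [hd P]) @ tl P)" using successively_glue[of E "Q @ M @ [hd P]" "tl P"] by blast
  then show "successively E (Q @ M @ P)" using p(3) by simp
  show "hd (Q @ M @ P) = hd Q" "last (Q @ M @ P) = last P" using q p by auto
qed

text \<open>Each path \<open>Q s\<close> is closed up inside the bipartite graph \<open>(K, F)\<close>, after a detour through
  the odd path \<open>P s\<close> if its own parity is wrong.\<close>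

lemma assemble_cycles:
  assumes FE: "\<And>x y. F x y \<Longrightarrow> E x y" and Fphi: "\<And>x y. F x y \<Longrightarrow> \<phi> x \<noteq> (\<phi> y :: bool)"
    and fI: "finite I" and lk: "\<And>X. X \<subseteq> K \<Longrightarrow> card X \<le> 4 * card I \<Longrightarrow> lnk F K X"
    and Q: "\<And>s. s \<in> I \<Longrightarrow> distinct (Q s) \<and> successively E (Q s) \<and> 3 \<le> length (Q s) \<and>
      set (Q s) \<inter> K = {hd (Q s), last (Q s)}"
    and P: "\<And>s. s \<in> I \<Longrightarrow> \<not> odd_path E K \<phi> (Q s) \<Longrightarrow> odd_path E K \<phi> (P s) \<and> set (P s) \<inter> set (Q s) = {}"
    and D: "\<And>s. D s = set (Q s) \<union> (if odd_path E K \<phi> (Q s) then {} else set (P s))"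
    and dis: "\<And>s t. s \<in> I \<Longrightarrow> t \<in> I \<Longrightarrow> s \<noteq> t \<Longrightarrow> D s \<inter> D t = {}"
  shows "\<exists>c. (\<forall>s\<in>I. is_cycle E (c s) \<and> odd (length (c s)) \<and> set (Q s) \<subseteq> set (c s) \<and> set (c s) \<subseteq> D s \<union> K) \<and>
    (\<forall>s\<in>I. \<forall>t\<in>I. s \<noteq> t \<longrightarrow> set (c s) \<inter> set (c t) = {})"
proof -
  define B where "B s \<longleftrightarrow> odd_path E K \<phi> (Q s)" for s
  define T where "T s = D s \<inter> K" for s
  have TB: "T s = {hd (Q s), last (Q s)}" if "s \<in> I" "B s" for s
    using Q[OF that(1)] that(2) unfolding T_def D B_def by auto
  have PK: "set (P s) \<inter> K = {hd (P s), last (P s)}" if "s \<in> I" "\<not> B s" for s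
    using P[OF that(1)] that(2) unfolding B_def odd_path_def by simp
  have TnB: "T s = {hd (Q s), last (Q s), hd (P s), last (P s)}" if "s \<in> I" "\<not> B s" for s
    using Q[OF that(1)] PK[OF that] that(2) unfolding T_def D B_def by auto
  have neq: "hd (Q s) \<noteq> last (Q s)" if "s \<in> I" for s
    using hd_neq_last[of "Q s"] Q[OF that] by simp
  have neP: "hd (P s) \<noteq> last (P s)" "P s \<noteq> []" if "s \<in> I" "\<not> B s" for s
  proof -
    have p: "distinct (P s)" "2 \<le> length (P s)" using P[OF that(1)] that(2) unfolding B_def odd_path_def by auto
    then show "hd (P s) \<noteq> last (P s)" "P s \<noteq> []" using hd_neq_last by auto
  qed
  have QPd: "hd (P s) \<noteq> hd (Q s)" "hd (P s) \<noteq> last (Q s)" "last (P s) \<noteq> hd (Q s)" "last (P s) \<noteq> last (Q s)"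
    if "s \<in> I" "\<not> B s" for s
  proof -
    have "set (P s) \<inter> set (Q s) = {}" using P[OF that(1)] that(2) unfolding B_def by simp
    moreover have "hd (P s) \<in> set (P s)" "last (P s) \<in> set (P s)" using neP[OF that] by auto
    moreover have "Q s \<noteq> []" using Q[OF that(1)] by auto
    then have "hd (Q s) \<in> set (Q s)" "last (Q s) \<in> set (Q s)" by auto
    ultimately show "hd (P s) \<noteq> hd (Q s)" "hd (P s) \<noteq> last (Q s)" "last (P s) \<noteq> hd (Q s)" "last (P s) \<noteq> last (Q s)"
      by (metis disjoint_iff)+
  qed
  define X where "X = (\<Union>s\<in>I. T s)"
  define idx where "idx x = (SOME s. s \<in> I \<and> x \<in> T s)" for x
  have idx: "idx x = s" if "s \<in> I" "x \<in> T s" for x s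
  proof -
    have "idx x \<in> I \<and> x \<in> T (idx x)" unfolding idx_def using that by (intro someI[of "\<lambda>s. s \<in> I \<and> x \<in> T s" s]) simp
    then show ?thesis using dis[of "idx x" s] that unfolding T_def by auto
  qed
  \<comment> \<open>A path \<open>Q s\<close> of the right parity is closed directly. Otherwise the
    cycle runs through \<open>Q s\<close>, then \<open>P s\<close>, and back, so the last vertex of
    \<open>Q s\<close> is paired with the first of \<open>P s\<close>, and the last of
    \<open>P s\<close> with the first of \<open>Q s\<close>. With at most four terminals for each
    index the bound \<open>4 * card I\<close> suffices.\<close>
  define p where "p x = (let s = idx x in
    if x = hd (Q s) then (if B s then last (Q s) else last (P s))
    else if x = last (Q s) then (if B s then hd (Q s) else hd (P s))
    else if x = hd (P s) then last (Q s) else hd (Q s))" for x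
  have p1: "p (hd (Q s)) = last (Q s)" "p (last (Q s)) = hd (Q s)" if "s \<in> I" "B s" for s
    using idx[OF that(1), of "hd (Q s)"] idx[OF that(1), of "last (Q s)"] TB[OF that] that(2) neq[OF that(1)]
    unfolding p_def by simp_all
  have p2: "p (hd (Q s)) = last (P s)" "p (last (Q s)) = hd (P s)" "p (hd (P s)) = last (Q s)" "p (last (P s)) = hd (Q s)"
    if "s \<in> I" "\<not> B s" for s
    using idx[OF that(1), of "hd (Q s)"] idx[OF that(1), of "last (Q s)"] idx[OF that(1), of "hd (P s)"]
      idx[OF that(1), of "last (P s)"] TnB[OF that] that(2) neq[OF that(1)] neP(1)[OF that] QPd[OF that]
    unfolding p_def by simp_all
  have pT: "p x \<in> T s \<and> p (p x) = x" if "s \<in> I" "x \<in> T s" for s x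
  proof (cases "B s")
    case True
    then show ?thesis using TB[OF that(1) True] p1[OF that(1) True] that(2) by auto
  next
    case False
    then show ?thesis using TnB[OF that(1) False] p2[OF that(1) False] that(2) by auto
  qed
  have "invol X p" unfolding invol_def
  proof
    fix x assume "x \<in> X"
    then obtain s where s: "s \<in> I" "x \<in> T s" unfolding X_def by auto
    then show "p x \<in> X \<and> p (p x) = x" using pT[OF s] unfolding X_def by auto
  qed
  moreover have "lnk F K X"
  proof (rule lk)
    show "X \<subseteq> K" unfolding X_def T_def by auto
    have "card (T s) \<le> 4" if "s \<in> I" for s
      by (cases "B s") (use TB[OF that] TnB[OF that] in \<open>auto simp: card_insert_if\<close>)
    then have "(\<Sum>s\<in>I. card (T s)) \<le> (\<Sum>s\<in>I. 4)" by (rule sum_mono)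
    then show "card X \<le> 4 * card I" unfolding X_def using card_UN_le[OF fI, of T] by simp
  qed
  ultimately have "lnkp F K X p" unfolding lnk_def by blast
  then obtain C where "links F K X p C" unfolding lnkp_def ..
  note C = linksD[OF this]
  have TX: "x \<in> X" if "s \<in> I" "x \<in> T s" for s x using that unfolding X_def by auto
  have CX: "y = x \<or> y = p x" if "x \<in> X" "y \<in> X" "y \<in> C x" for x y
    using C(5)[OF that(1,2)] C(1)[OF that(2)] that(3) by blast
  \<comment> \<open>Linking sets lie in \<open>K\<close>, which the given paths meet only in their
    ends, and all these ends are terminals.\<close>
  have CD: "C x \<inter> D t \<subseteq> {x, p x} \<inter> T t" if "s \<in> I" "x \<in> T s" "t \<in> I" for s x t
  proof
    fix y assume y: "y \<in> C x \<inter> D t"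
    then have "y \<in> T t" using C(3)[OF TX[OF that(1,2)]] unfolding T_def by auto
    then show "y \<in> {x, p x} \<inter> T t" using CX[OF TX[OF that(1,2)] TX[OF that(3)]] y by auto
  qed
  have CC: "C x \<inter> C y = {}" if "s \<in> I" "x \<in> T s" "t \<in> I" "y \<in> T t" "s \<noteq> t" for s t x y
  proof (rule C(5))
    show "x \<in> X" "y \<in> X" using TX that by auto
    have "T s \<inter> T t = {}" using dis[OF that(1,3,5)] unfolding T_def by auto
    moreover have "p x \<in> T s" using pT[OF that(1,2)] by simp
    ultimately show "y \<noteq> x" "y \<noteq> p x" using that(2,4) by auto
  qed
  have one: "\<exists>c. is_cycle E c \<and> odd (length c) \<and> set (Q s) \<subseteq> set c \<and> set c \<subseteq> D s \<union> C (hd (Q s)) \<union> C (last (Q s))"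
    if s: "s \<in> I" for s
  proof -
    note q = Q[OF s]
    have qne: "Q s \<noteq> []" using q by auto
    have hT: "hd (Q s) \<in> T s" "last (Q s) \<in> T s" using TB[OF s] TnB[OF s] by (cases "B s"; auto)+
    note hX = TX[OF s hT(1)] TX[OF s hT(2)]
    show ?thesis
    proof (cases "B s")
      case True
      have "hd (Q s) \<in> C (last (Q s))" using C(4)[OF hX(2)] C(1)[OF hX(1)] p1[OF s True] by simp
      then obtain M where M: "successively F (last (Q s) # M @ [hd (Q s)])" "distinct (last (Q s) # M @ [hd (Q s)])"
        "set M \<subseteq> C (last (Q s))" "even (length M) \<longleftrightarrow> \<phi> (last (Q s)) \<noteq> \<phi> (hd (Q s))"
        by (rule conn_middle[OF C(2)[OF hX(2)] C(1)[OF hX(2)] _ neq[OF s, symmetric] Fphi])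
      have "set M \<inter> D s = {}" using CD[OF s hT(2) s] M(2,3) p1[OF s True] by auto
      then have mq: "set M \<inter> set (Q s) = {}" unfolding D by auto
      have "successively E (last (Q s) # M @ [hd (Q s)])" using successively_mono[OF M(1)] FE by blast
      moreover have "odd (length (Q s)) \<longleftrightarrow> \<phi> (hd (Q s)) \<noteq> \<phi> (last (Q s))"
        using True unfolding B_def odd_path_def by simp
      ultimately have "is_cycle E (Q s @ M)" "odd (length (Q s @ M))"
        using close_path[of "Q s" E M \<phi>] q M(2,4) mq by auto
      moreover have "set (Q s @ M) \<subseteq> D s \<union> C (hd (Q s)) \<union> C (last (Q s))" using M(3) unfolding D by auto
      ultimately show ?thesis by (intro exI[of _ "Q s @ M"]) simp
    next
      case False
      have pp: "odd_path E K \<phi> (P s)" "set (P s) \<inter> set (Q s) = {}" using P[OF s] False unfolding B_def by auto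
      have Tp: "hd (P s) \<in> T s" "last (P s) \<in> T s" using TnB[OF s False] by auto
      note pX = TX[OF s Tp(1)] TX[OF s Tp(2)]
      have "hd (P s) \<in> C (last (Q s))" using C(4)[OF hX(2)] C(1)[OF pX(1)] p2[OF s False] by simp
      then obtain M where M: "successively F (last (Q s) # M @ [hd (P s)])" "distinct (last (Q s) # M @ [hd (P s)])"
        "set M \<subseteq> C (last (Q s))" "even (length M) \<longleftrightarrow> \<phi> (last (Q s)) \<noteq> \<phi> (hd (P s))"
        by (rule conn_middle[OF C(2)[OF hX(2)] C(1)[OF hX(2)] _ QPd(2)[OF s False, symmetric] Fphi])
      have "last (P s) \<in> C (hd (Q s))" using C(4)[OF hX(1)] C(1)[OF pX(2)] p2[OF s False] by simp
      then obtain N where N: "successively F (last (P s) # N @ [hd (Q s)])" "distinct (last (P s) # N @ [hd (Q s)])"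
        "set N \<subseteq> C (hd (Q s))" "even (length N) \<longleftrightarrow> \<phi> (last (P s)) \<noteq> \<phi> (hd (Q s))"
        by (rule conn_middle[OF C(2)[OF hX(1)] _ C(1)[OF hX(1)] QPd(3)[OF s False] Fphi])
      have Dq: "D s = set (Q s) \<union> set (P s)" using False unfolding D B_def by simp
      have "set M \<inter> D s = {}" using CD[OF s hT(2) s] M(2,3) p2[OF s False] by auto
      then have MD: "set M \<inter> set (Q s) = {}" "set M \<inter> set (P s) = {}" unfolding Dq by auto
      have ND: "set N \<inter> D s = {}" using CD[OF s hT(1) s] N(2,3) p2[OF s False] by auto
      have "C (last (Q s)) \<inter> C (hd (Q s)) = {}"
      proof (rule C(5)[OF hX(2,1)])
        show "hd (Q s) \<noteq> last (Q s)" by (rule neq[OF s])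
        show "hd (Q s) \<noteq> p (last (Q s))" using p2(2)[OF s False] QPd(1)[OF s False] by simp
      qed
      then have MN: "set M \<inter> set N = {}" using M(3) N(3) by auto
      have ME: "successively E (last (Q s) # M @ [hd (P s)])" using successively_mono[OF M(1)] FE by blast
      have NE: "successively E (last (P s) # N @ [hd (Q s)])" using successively_mono[OF N(1)] FE by blast
      have op: "distinct (P s)" "successively E (P s)" using pp(1) unfolding odd_path_def by auto
      have "distinct M" using M(2) by simp
      have "set (Q s) \<inter> set (P s) = {}" using pp(2) by auto
      note j = join_paths[OF _ _ qne op neP(2)[OF s False] ME \<open>distinct M\<close> MD this]
      define R where "R = Q s @ M @ P s"
      have R: "distinct R" "successively E R" "hd R = hd (Q s)" "last R = last (P s)" using j q unfolding R_def by auto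
      have Rl: "3 \<le> length R" using q unfolding R_def by simp
      \<comment> \<open>All other conditions of an odd path hold for \<open>Q s\<close>, so it is
        the parity that fails; the detour through \<open>P s\<close> reverses it.\<close>
      have nQ: "\<not> (odd (length (Q s)) \<longleftrightarrow> \<phi> (hd (Q s)) \<noteq> \<phi> (last (Q s)))"
        using False q neq[OF s] unfolding B_def odd_path_def by auto
      have "odd (length (P s)) \<longleftrightarrow> \<phi> (hd (P s)) \<noteq> \<phi> (last (P s))" using pp(1) unfolding odd_path_def by simp
      then have Rp: "odd (length R) \<longleftrightarrow> \<phi> (hd R) \<noteq> \<phi> (last R)"
        using nQ M(4) R(3,4) unfolding R_def by auto
      have "set N \<inter> set R = {}" using ND MN unfolding R_def Dq by auto
      moreover have "successively E (last R # N @ [hd R])" using NE R by simp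
      ultimately have "is_cycle E (R @ N)" "odd (length (R @ N))"
        using close_path[OF R(1,2) Rl _ _ _ Rp] N(2,4) R(3,4) by auto
      moreover have "set (R @ N) \<subseteq> D s \<union> C (hd (Q s)) \<union> C (last (Q s))" using M(3) N(3) unfolding R_def Dq by auto
      moreover have "set (Q s) \<subseteq> set (R @ N)" unfolding R_def by auto
      ultimately show ?thesis by (intro exI[of _ "R @ N"]) simp
    qed
  qed
  define G where "G s = D s \<union> C (hd (Q s)) \<union> C (last (Q s))" for s
  have "\<forall>s. \<exists>c. s \<in> I \<longrightarrow> is_cycle E c \<and> odd (length c) \<and> set (Q s) \<subseteq> set c \<and> set c \<subseteq> G s"
    using one unfolding G_def by blast
  then obtain c where c: "\<And>s. s \<in> I \<Longrightarrow> is_cycle E (c s) \<and> odd (length (c s)) \<and> set (Q s) \<subseteq> set (c s) \<and> set (c s) \<subseteq> G s"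
    by metis
  have hT: "hd (Q s) \<in> T s" "last (Q s) \<in> T s" if "s \<in> I" for s using TB[OF that] TnB[OF that] by (cases "B s"; auto)+
  show ?thesis
  proof (intro exI[of _ c] conjI[of "\<forall>s\<in>I. _ s"] ballI impI)
    fix s assume s: "s \<in> I"
    have "G s \<subseteq> D s \<union> K" unfolding G_def using C(3)[OF TX[OF s hT(1)[OF s]]] C(3)[OF TX[OF s hT(2)[OF s]]] by auto
    then show "is_cycle E (c s) \<and> odd (length (c s)) \<and> set (Q s) \<subseteq> set (c s) \<and> set (c s) \<subseteq> D s \<union> K"
      using c[OF s] by auto
  next
    fix s t assume st: "s \<in> I" "t \<in> I" "s \<noteq> t"
    have a: "C x \<inter> D t = {}" if "s \<in> I" "t \<in> I" "s \<noteq> t" "x \<in> T s" for x s t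
    proof -
      have "T s \<inter> T t = {}" using dis[OF that(1-3)] unfolding T_def by auto
      moreover have "p x \<in> T s" using pT[OF that(1,4)] by simp
      ultimately show ?thesis using CD[OF that(1,4,2)] that(4) by auto
    qed
    have "D s \<inter> D t = {}" using dis[OF st] .
    moreover have "C (hd (Q s)) \<inter> D t = {}" "C (last (Q s)) \<inter> D t = {}" using a[OF st] hT[OF st(1)] by auto
    moreover have "C (hd (Q t)) \<inter> D s = {}" "C (last (Q t)) \<inter> D s = {}" using a[OF st(2,1)] st(3) hT[OF st(2)] by auto
    moreover have "C x \<inter> C y = {}" if "x \<in> T s" "y \<in> T t" for x y using CC[OF st(1) that(1) st(2) that(2) st(3)] .
    moreover from this have "C (hd (Q s)) \<inter> C (hd (Q t)) = {}" "C (hd (Q s)) \<inter> C (last (Q t)) = {}"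
      "C (last (Q s)) \<inter> C (hd (Q t)) = {}" "C (last (Q s)) \<inter> C (last (Q t)) = {}"
      using hT[OF st(1)] hT[OF st(2)] by simp_all
    ultimately have "G s \<inter> G t = {}" unfolding G_def Int_Un_distrib Int_Un_distrib2 by (simp add: Int_commute)
    then show "set (c s) \<inter> set (c t) = {}" using c[OF st(1)] c[OF st(2)] by blast
  qed
qed

section \<open>Connectivity and a dense cut\<close>

lemma k_connected_sep:
  assumes g: "simple_graph V E" and kc: "k_connected n V E" and Z: "Z \<subseteq> V" and PQ: "P \<union> Q = V - Z"
    "sep (ind E (V - Z)) P Q" "P - Q \<noteq> {}" "Q - P \<noteq> {}"
  shows "n \<le> card Z + card (P \<inter> Q)"
proof (rule ccontr)
  assume n: "\<not> n \<le> card Z + card (P \<inter> Q)"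
  note gd = simple_graphD[OF g]
  define X where "X = Z \<union> (P \<inter> Q)"
  have "card X \<le> card Z + card (P \<inter> Q)" unfolding X_def by (rule card_Un_le)
  moreover have "X \<subseteq> V" unfolding X_def using Z PQ(1) by auto
  ultimately have c: "connected_on (V - X) E" using kc n unfolding k_connected_def by simp
  obtain u v where u: "u \<in> P - Q" and v: "v \<in> Q - P" using PQ(3,4) by auto
  have "u \<in> V - X" "v \<in> V - X" using u v PQ(1) unfolding X_def by auto
  then have "(\<lambda>x y. E x y \<and> x \<in> V - X \<and> y \<in> V - X)\<^sup>*\<^sup>* u v" using c unfolding connected_on_def by blast
  then have "v \<in> P - Q"
  proof (induction rule: rtranclp_induct)
    case base show ?case by (rule u)
  next
    case (step y z)
    then have "ind E (V - Z) y z" unfolding ind_def X_def by auto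
    then show ?case using sepD[OF PQ(2), of y z] step unfolding X_def by auto
  qed
  then show False using v by simp
qed

text \<open>A neighbourhood with fewer than \<open>n\<close> vertices would separate
  \<open>v\<close> from the remaining vertices, and there are some, as \<open>V\<close> has more
  than \<open>n\<close> vertices.\<close>

lemma k_connected_degree:
  assumes g: "simple_graph V E" and kc: "k_connected n V E" and v: "v \<in> V"
  shows "n \<le> card {w. E v w}"
proof (rule ccontr)
  assume n: "\<not> n \<le> card {w. E v w}"
  note gd = simple_graphD[OF g]
  have XV: "{w. E v w} \<subseteq> V" using gd(5) by auto
  then have c: "connected_on (V - {w. E v w}) E" using kc n unfolding k_connected_def by simp
  have vX: "v \<in> V - {w. E v w}" using v gd(3) by simp
  have "card (insert v {w. E v w}) \<le> n"
    using n card_insert_le_m1[of n "{w. E v w}" v] by simp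
  then have "insert v {w. E v w} \<noteq> V" using kc unfolding k_connected_def by auto
  then obtain u where u: "u \<in> V" "u \<noteq> v" "\<not> E v u" using XV v by auto
  have "(\<lambda>x y. E x y \<and> x \<in> V - {w. E v w} \<and> y \<in> V - {w. E v w})\<^sup>*\<^sup>* v u"
    using c vX u unfolding connected_on_def by auto
  then show False using u(2) by (cases rule: converse_rtranclpE) auto
qed

text \<open>In a colouring with the fewest monochromatic arcs no vertex gains by changing its
  colour, which would exchange its monochromatic and its bichromatic edges.\<close>

lemma max_cut:
  assumes g: "simple_graph V E"
  shows "\<exists>\<phi>. \<forall>v\<in>V. card {w. E v w} \<le> 2 * card {w. E v w \<and> \<phi> w \<noteq> (\<phi> v :: bool)}"
proof -
  note gd = simple_graphD[OF g]
  define m where "m \<phi> = {(x, y). E x y \<and> \<phi> x = \<phi> y}" for \<phi> :: "'a \<Rightarrow> bool"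
  obtain \<phi> where \<phi>: "\<And>\<psi>. card (m \<phi>) \<le> card (m \<psi>)"
    using ex_has_least_nat[of "\<lambda>_. True" undefined "\<lambda>\<phi>. card (m \<phi>)"] by auto
  have "card {w. E v w} \<le> 2 * card {w. E v w \<and> \<phi> w \<noteq> \<phi> v}" if v: "v \<in> V" for v
  proof -
    define N where "N = {w. E v w \<and> \<phi> w = \<phi> v}"
    define C where "C = {w. E v w \<and> \<phi> w \<noteq> \<phi> v}"
    have fin: "finite N" "finite C" unfolding N_def C_def using gd(5) by (auto intro: finite_subset[OF _ gd(1)])
    have fm: "finite (m \<psi>)" for \<psi> unfolding m_def using finite_arcs[OF g] .
    have vN: "v \<notin> N" "v \<notin> C" unfolding N_def C_def using gd(3) by auto
    define \<psi> where "\<psi> = \<phi>(v := \<not> \<phi> v)"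
    define aN where "aN = {v} \<times> N \<union> N \<times> {v}"
    define aC where "aC = {v} \<times> C \<union> C \<times> {v}"
    have cN: "card aN = 2 * card N" unfolding aN_def using fin vN by (subst card_Un_disjoint) (auto simp: card_cartesian_product)
    have cC: "card aC \<le> 2 * card C" unfolding aC_def using card_Un_le[of "{v} \<times> C" "C \<times> {v}"] by (simp add: card_cartesian_product)
    have sub: "aN \<subseteq> m \<phi>" unfolding aN_def m_def N_def using gd(6) by auto
    have "m \<psi> \<subseteq> (m \<phi> - aN) \<union> aC" unfolding m_def \<psi>_def aN_def aC_def N_def C_def using gd(6) gd(3)
      by (auto split: if_splits)
    then have "card (m \<psi>) \<le> card ((m \<phi> - aN) \<union> aC)" using fm fin unfolding aC_def by (intro card_mono) auto
    also have "\<dots> \<le> card (m \<phi> - aN) + card aC" by (rule card_Un_le)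
    also have "\<dots> \<le> card (m \<phi>) - 2 * card N + 2 * card C"
      using card_Diff_subset[OF finite_subset[OF sub fm] sub] cN cC by simp
    finally have "card (m \<phi>) \<le> card (m \<phi>) - 2 * card N + 2 * card C" using \<phi>[of \<psi>] by simp
    moreover have "2 * card N \<le> card (m \<phi>)" using card_mono[OF fm sub] cN by simp
    ultimately have "card N \<le> card C" by simp
    moreover have "{w. E v w} = N \<union> C" unfolding N_def C_def by auto
    then have "card {w. E v w} \<le> card N + card C" using card_Un_le by metis
    ultimately show ?thesis unfolding C_def by simp
  qed
  then show ?thesis by blast
qed

definition arcs :: "('a \<Rightarrow> 'a \<Rightarrow> bool) \<Rightarrow> 'a set \<Rightarrow> nat" where
  "arcs F W = card {(x, y). F x y \<and> x \<in> W \<and> y \<in> W}"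

lemma finite_arcs_in: "finite W \<Longrightarrow> finite {(x, y). F x y \<and> x \<in> W \<and> y \<in> W}"
  by (rule finite_subset[of _ "W \<times> W"]) auto

lemma bipartite_arcs_le:
  assumes "finite W" "\<And>x y. F x y \<Longrightarrow> \<phi> x \<noteq> (\<phi> y :: bool)"
  shows "2 * arcs F W \<le> card W * card W"
proof -
  define A where "A = {x \<in> W. \<phi> x}"
  define B where "B = {x \<in> W. \<not> \<phi> x}"
  have f: "finite A" "finite B" unfolding A_def B_def using assms by auto
  have w: "card W = card A + card B"
  proof -
    have "W = A \<union> B" "A \<inter> B = {}" unfolding A_def B_def by auto
    then show ?thesis using card_Un_disjoint[OF f] by simp
  qed
  have "{(x, y). F x y \<and> x \<in> W \<and> y \<in> W} \<subseteq> A \<times> B \<union> B \<times> A"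
    unfolding A_def B_def using assms(2) by blast
  then have "arcs F W \<le> card (A \<times> B \<union> B \<times> A)" unfolding arcs_def using f by (intro card_mono) auto
  also have "\<dots> \<le> card (A \<times> B) + card (B \<times> A)" by (rule card_Un_le)
  also have "\<dots> = 2 * (card A * card B)" by (simp add: card_cartesian_product)
  finally have "2 * arcs F W \<le> 4 * (card A * card B)" by simp
  moreover have "4 * (a * b) \<le> (a + b) * (a + b)" for a b :: nat
  proof (cases "a \<le> b")
    case True
    then obtain d where "b = a + d" using le_Suc_ex by blast
    then show ?thesis by (simp add: algebra_simps)
  next
    case False
    then obtain d where "a = b + d" using le_Suc_ex by (metis nat_le_linear)
    then show ?thesis by (simp add: algebra_simps)
  qed
  ultimately show ?thesis unfolding w using le_trans by blast
qed

text \<open>A vertex set \<open>W\<close> is good if \<open>4e > 49k(w - 4k)\<close> for its \<open>w\<close> vertices and \<open>e\<close> edges. The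
  bipartite graph on a smallest good set has at least \<open>44k\<close> vertices, as \<open>4e \<le> w\<^sup>2\<close>, and cannot be
  separated by fewer than \<open>4k\<close> vertices, as one of the sides would be good.\<close>

locale dense_cut =
  fixes V :: "'a set" and F :: "'a \<Rightarrow> 'a \<Rightarrow> bool" and \<phi> :: "'a \<Rightarrow> bool" and k :: nat and W :: "'a set"
  assumes g: "simple_graph V F" and bip: "\<And>x y. F x y \<Longrightarrow> \<phi> x \<noteq> \<phi> y" and k0: "0 < k"
    and WV: "W \<subseteq> V" and W8: "8 * k \<le> card W" and Wa: "49 * k * card W < 2 * arcs F W + 196 * k * k"
    and Wmin: "\<And>U. U \<subseteq> V \<Longrightarrow> 8 * k \<le> card U \<Longrightarrow> 49 * k * card U < 2 * arcs F U + 196 * k * k \<Longrightarrow> card W \<le> card U"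
begin

lemma fW: "finite W"
  using finite_subset[OF WV simple_graphD(1)[OF g]] .

text \<open>Goodness and \<open>4e \<le> w^2\<close> make \<open>w^2 - 49kw + 196k^2\<close>
  positive, but this polynomial is negative for \<open>w\<close> from \<open>8k\<close> to
  \<open>44k\<close>.\<close>

lemma W44: "44 * k < card W"
proof (rule ccontr)
  assume "\<not> 44 * k < card W"
  then obtain u where u: "card W = 8 * k + u" "u \<le> 36 * k" using W8 le_Suc_ex[of "8 * k" "card W"] by auto
  have "2 * arcs F W \<le> card W * card W" using bipartite_arcs_le[OF fW bip] .
  then have "49 * k * (8 * k + u) < (8 * k + u) * (8 * k + u) + 196 * k * k" using Wa u(1) by simp
  then have "392 * (k * k) + 49 * (k * u) < 260 * (k * k) + 16 * (k * u) + u * u" by (simp add: algebra_simps)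
  moreover have "u * u \<le> 36 * (k * u)" using mult_le_mono1[OF u(2), of u] by simp
  moreover have "k * u \<le> 36 * (k * k)" using mult_le_mono2[OF u(2), of k] by simp
  moreover have "0 < k * k" using k0 by simp
  ultimately show False by linarith
qed

text \<open>If \<open>P\<close> had fewer than \<open>8 * k\<close> vertices, removing
  \<open>P - Q\<close> would lower \<open>2 * arcs F W\<close> by at most \<open>32 * k\<close> per
  vertex, less than the \<open>49 * k\<close> by which the threshold falls, and \<open>Q\<close>
  would be a smaller good set.\<close>

lemma small_side:
  assumes PQ: "P \<union> Q = W" "sep (ind F W) P Q" "P - Q \<noteq> {}"
  shows "8 * k \<le> card P"
proof (rule ccontr)
  assume p: "\<not> 8 * k \<le> card P"
  have fin: "finite P" "finite Q" using PQ(1) fW by auto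
  have sub: "{(x, y). F x y \<and> x \<in> W \<and> y \<in> W} \<subseteq> {(x, y). F x y \<and> x \<in> Q \<and> y \<in> Q} \<union> ((P - Q) \<times> P \<union> P \<times> (P - Q))"
  proof
    fix z assume "z \<in> {(x, y). F x y \<and> x \<in> W \<and> y \<in> W}"
    then obtain x y where z: "z = (x, y)" "F x y" "x \<in> W" "y \<in> W" by auto
    then have "(x \<in> P \<and> y \<in> P) \<or> (x \<in> Q \<and> y \<in> Q)" using sepD[OF PQ(2), of x y] unfolding ind_def by simp
    then show "z \<in> {(x, y). F x y \<and> x \<in> Q \<and> y \<in> Q} \<union> ((P - Q) \<times> P \<union> P \<times> (P - Q))" using z by auto
  qed
  have "arcs F W \<le> card ({(x, y). F x y \<and> x \<in> Q \<and> y \<in> Q} \<union> ((P - Q) \<times> P \<union> P \<times> (P - Q)))"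
    unfolding arcs_def by (rule card_mono[OF _ sub]) (use fin finite_arcs_in in auto)
  also have "\<dots> \<le> arcs F Q + card ((P - Q) \<times> P \<union> P \<times> (P - Q))" unfolding arcs_def by (rule card_Un_le)
  also have "card ((P - Q) \<times> P \<union> P \<times> (P - Q)) \<le> 2 * (card (P - Q) * card P)"
    using card_Un_le[of "(P - Q) \<times> P" "P \<times> (P - Q)"] by (simp add: card_cartesian_product mult.commute[of "card P"])
  finally have a: "arcs F W \<le> arcs F Q + 2 * (card (P - Q) * card P)" by simp
  have "card (P - Q) * card P \<le> card (P - Q) * (8 * k)" using p by (intro mult_le_mono2) simp
  then have "card (P - Q) * card P \<le> 8 * (k * card (P - Q))" by (simp only: mult.commute mult.left_commute)
  then have a': "2 * arcs F W \<le> 2 * arcs F Q + 32 * (k * card (P - Q))" using a by linarith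
  have w: "card W = card Q + card (P - Q)"
  proof -
    have "W = Q \<union> (P - Q)" using PQ(1) by auto
    then show ?thesis using card_Un_disjoint[of Q "P - Q"] fin by auto
  qed
  have pd: "0 < card (P - Q)" using PQ(3) fin by (simp add: card_gt_0_iff)
  have "card (P - Q) \<le> card P" using fin by (intro card_mono) auto
  then have "8 * k \<le> card Q" using w W44 p by linarith
  moreover have "49 * k * card Q < 2 * arcs F Q + 196 * k * k"
    using Wa a' unfolding w by (simp add: algebra_simps)
  ultimately have "card W \<le> card Q" using Wmin[of Q] PQ(1) WV by auto
  then show False using w pd by simp
qed

text \<open>Adding the failed inequalities of the two sides counts \<open>196 * k * k\<close> twice,
  against once for \<open>W\<close>. The difference, \<open>49 * k\<close> times
  \<open>4 * k\<close>, has to be made up by the separator, which is counted on both sides with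
  weight \<open>49 * k\<close>.\<close>

lemma sep_order:
  assumes PQ: "P \<union> Q = W" "sep (ind F W) P Q" "P - Q \<noteq> {}" "Q - P \<noteq> {}"
  shows "4 * k \<le> card (P \<inter> Q)"
proof (rule ccontr)
  assume o: "\<not> 4 * k \<le> card (P \<inter> Q)"
  have sp: "sep (ind F W) Q P" using PQ(2) unfolding sep_def by blast
  have c8: "8 * k \<le> card P" "8 * k \<le> card Q" using small_side[OF PQ(1-3)] small_side[OF _ sp PQ(4)] PQ(1) by auto
  have fin: "finite P" "finite Q" using PQ(1) fW by auto
  have "P \<subset> W" "Q \<subset> W" using PQ by auto
  then have "card P < card W" "card Q < card W" using psubset_card_mono[OF fW] by auto
  then have n: "2 * arcs F P + 196 * k * k \<le> 49 * k * card P" "2 * arcs F Q + 196 * k * k \<le> 49 * k * card Q"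
    using Wmin[of P] Wmin[of Q] c8 PQ(1) WV by (meson Un_upper1 Un_upper2 leD le_trans not_le subset_trans)+
  have "{(x, y). F x y \<and> x \<in> W \<and> y \<in> W} \<subseteq> {(x, y). F x y \<and> x \<in> P \<and> y \<in> P} \<union> {(x, y). F x y \<and> x \<in> Q \<and> y \<in> Q}"
    using PQ(2) unfolding sep_def ind_def by auto
  then have "arcs F W \<le> card ({(x, y). F x y \<and> x \<in> P \<and> y \<in> P} \<union> {(x, y). F x y \<and> x \<in> Q \<and> y \<in> Q})"
    unfolding arcs_def by (rule card_mono[rotated]) (use fin finite_arcs_in in auto)
  also have "\<dots> \<le> arcs F P + arcs F Q" unfolding arcs_def by (rule card_Un_le)
  finally have a: "arcs F W \<le> arcs F P + arcs F Q" .
  have "card P + card Q = card W + card (P \<inter> Q)" using card_Un_Int[OF fin] PQ(1) by simp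
  then have e: "49 * k * card P + 49 * k * card Q = 49 * k * card W + 49 * k * card (P \<inter> Q)"
    by (metis distrib_left)
  have "k * (card (P \<inter> Q) + 1) \<le> k * (4 * k)" using o by (intro mult_le_mono2) simp
  then have "49 * k * card (P \<inter> Q) + 49 * k \<le> 196 * k * k" by simp
  then show False using a n e Wa by linarith
qed

text \<open>Massedness is needed for \<open>2 * k\<close> pairs, in twice the count
  \<open>48 * k\<close> per vertex outside \<open>X'\<close>. The surplus of \<open>k\<close> for
  each of at least \<open>40 * k\<close> such vertices outweighs the \<open>16 * k * k\<close> lost
  to edges inside \<open>X'\<close>. By \<open>sep_order\<close> the second condition concerns
  trivial separations only.\<close>

lemma lnk_cut:
  assumes X: "X \<subseteq> W" "card X \<le> 4 * k"
  shows "lnk (ind F W) W X"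
proof -
  have gW: "simple_graph W (ind F W)" by (rule simple_graph_ind[OF g WV])
  obtain X' where X': "X \<subseteq> X'" "X' \<subseteq> W" "card X' = 4 * k"
    using exists_subset_between[of X "4 * k" W] X W44 fW by auto
  have "massed (2 * k) W (ind F W) X'" unfolding massed_def
  proof (intro conjI allI impI)
    have fX: "finite X'" using X'(2) fW finite_subset by blast
    have "{(x, y). F x y \<and> x \<in> W \<and> y \<in> W} \<subseteq>
        {(x, y). ind F W x y \<and> (x \<in> W - X' \<or> y \<in> W - X')} \<union> {(x, y). F x y \<and> x \<in> X' \<and> y \<in> X'}"
      unfolding ind_def by auto
    then have "arcs F W \<le> card ({(x, y). ind F W x y \<and> (x \<in> W - X' \<or> y \<in> W - X')} \<union> {(x, y). F x y \<and> x \<in> X' \<and> y \<in> X'})"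
      unfolding arcs_def by (rule card_mono[rotated]) (use finite_arcs[OF gW] finite_arcs_in[OF fX] in auto)
    also have "\<dots> \<le> rho (ind F W) (W - X') + arcs F X'" unfolding arcs_def rho_def by (rule card_Un_le)
    finally have a: "arcs F W \<le> rho (ind F W) (W - X') + arcs F X'" .
    have "2 * arcs F X' \<le> card X' * card X'" using bipartite_arcs_le[OF fX bip] .
    then have b: "2 * arcs F X' \<le> 16 * (k * k)" using X'(3) by simp
    have w: "card W = card (W - X') + 4 * k" using card_Diff_subset[OF fX X'(2)] X'(3) W44 by simp
    have "k * (40 * k) \<le> k * card (W - X')" using w W44 by (intro mult_le_mono2) simp
    then have "40 * (k * k) \<le> k * card (W - X')" by (simp only: mult.left_commute[of k 40])
    moreover have "49 * (k * card (W - X')) < 2 * arcs F W" using Wa unfolding w by (simp add: algebra_simps)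
    moreover have "0 < k * k" using k0 by simp
    ultimately have "48 * (k * card (W - X')) < 2 * rho (ind F W) (W - X')" using a b by linarith
    then show "12 * (2 * k) * card (W - X') < rho (ind F W) (W - X')" by simp
  next
    fix A B assume AB: "A \<union> B = W \<and> sep (ind F W) A B \<and> X' \<subseteq> A \<and> card (A \<inter> B) < card X'"
    show "rho (ind F W) (B - A) \<le> 12 * (2 * k) * card (B - A)"
    proof (cases "B - A = {}")
      case True then show ?thesis by (simp only: rho_empty)
    next
      case False
      have "A - B \<noteq> {}"
      proof
        assume "A - B = {}"
        then have "X' \<subseteq> A \<inter> B" using AB by auto
        moreover have "finite (A \<inter> B)" using AB fW by auto
        ultimately show False using AB card_mono leD by blast
      qed
      then have "4 * k \<le> card (A \<inter> B)" using sep_order[of A B] AB False by blast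
      then show ?thesis using AB X'(3) by simp
    qed
  qed
  then have "lnk (ind F W) W X'" using massed_linked[OF gW X'(2), of "2 * k"] X'(3) by simp
  then show ?thesis using lnk_subset X'(1) by blast
qed

end

lemma dense_cut_exists:
  assumes g: "simple_graph V F" and k0: "0 < k" and ne: "V \<noteq> {}"
    and deg: "\<And>v. v \<in> V \<Longrightarrow> 49 * k \<le> 2 * card {w. F v w}"
    and bip: "\<And>x y. F x y \<Longrightarrow> \<phi> x \<noteq> (\<phi> y :: bool)"
  obtains W where "dense_cut V F \<phi> k W"
proof -
  note gd = simple_graphD[OF g]
  define good where "good U \<longleftrightarrow> U \<subseteq> V \<and> 8 * k \<le> card U \<and> 49 * k * card U < 2 * arcs F U + 196 * k * k" for U
  have "good V" unfolding good_def
  proof (intro conjI)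
    obtain v where v: "v \<in> V" using ne by auto
    have "card {w. F v w} \<le> card V" by (rule card_mono[OF gd(1)]) (use gd(5) in auto)
    then show "8 * k \<le> card V" using deg[OF v] by simp
    have fN: "finite {w. F v w}" for v by (rule finite_subset[OF _ gd(1)]) (use gd in auto)
    have "arcs F V = card (SIGMA v:V. {w. F v w})" unfolding arcs_def
      by (rule arg_cong[where f = card]) (use gd(4,5) in auto)
    also have "\<dots> = (\<Sum>v\<in>V. card {w. F v w})" using gd(1) fN by simp
    finally have "2 * arcs F V = (\<Sum>v\<in>V. 2 * card {w. F v w})" by (simp add: sum_distrib_left)
    moreover have "(\<Sum>v\<in>V. 49 * k) \<le> (\<Sum>v\<in>V. 2 * card {w. F v w})" by (intro sum_mono deg)
    ultimately have "card V * (49 * k) \<le> 2 * arcs F V" by simp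
    then have "49 * k * card V \<le> 2 * arcs F V" by (simp only: mult.commute)
    moreover have "0 < 196 * k * k" using k0 by simp
    ultimately show "49 * k * card V < 2 * arcs F V + 196 * k * k" by linarith
  qed simp
  then obtain W where W: "good W" "\<And>U. good U \<Longrightarrow> card W \<le> card U"
    using ex_has_least_nat[of good V card] by blast
  have "dense_cut V F \<phi> k W"
    by unfold_locales (use g bip k0 W in \<open>auto simp: good_def\<close>)
  then show ?thesis by (rule that)
qed

section \<open>Many odd paths in the complement of \<open>S\<close>\<close>

lemma odd_path_mono:
  assumes "odd_path E A \<phi> p" "\<And>x y. E x y \<Longrightarrow> F x y"
  shows "odd_path F A \<phi> p"
  using assms successively_mono[of E p F] unfolding odd_path_def by blast

fun outside :: "('a \<Rightarrow> 'a \<Rightarrow> bool) \<Rightarrow> 'a list \<Rightarrow> nat" where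
  "outside R (x # y # zs) = (if R x y then 0 else 1) + outside R (y # zs)"
| "outside R xs = 0"

lemma outside_0: "outside R xs = 0 \<longleftrightarrow> successively R xs"
  by (induction R xs rule: outside.induct) auto

lemma outside_append: "outside R (us @ v # ds) = outside R (us @ [v]) + outside R (v # ds)"
  by (induction us rule: induct_list012) auto

locale k_set =
  fixes V :: "'a set" and E :: "'a \<Rightarrow> 'a \<Rightarrow> bool" and k :: nat and S :: "'a set"
  assumes g: "simple_graph V E" and kc: "k_connected (50 * k) V E" and k0: "0 < k"
    and SV: "S \<subseteq> V" and cS: "card S = k"
begin

lemmas gd = simple_graphD[OF g]

abbreviation "V0 \<equiv> V - S"
abbreviation "E0 \<equiv> ind E V0"

lemma fS: "finite S"
  using finite_subset[OF SV gd(1)] .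

lemma g0: "simple_graph V0 E0"
  by (rule simple_graph_ind[OF g]) auto

lemma degree_outside:
  assumes "v \<in> V" "finite Z"
  shows "50 * k \<le> card {w \<in> V - Z. E v w} + card Z"
proof -
  have "{w \<in> V - Z. E v w} = {w. E v w} - Z" using gd(5) by auto
  then show ?thesis using k_connected_degree[OF g kc assms(1)] diff_card_le_card_Diff[OF assms(2), of "{w. E v w}"] by simp
qed

lemma sep_outside:
  assumes "Z \<subseteq> V0" "P \<union> Q = V0 - Z" "sep (ind E (V0 - Z)) P Q" "P - Q \<noteq> {}" "Q - P \<noteq> {}"
  shows "49 * k \<le> card Z + card (P \<inter> Q)"
proof -
  have e: "V - (S \<union> Z) = V0 - Z" by auto
  have "50 * k \<le> card (S \<union> Z) + card (P \<inter> Q)"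
    by (rule k_connected_sep[OF g kc]) (use assms SV in \<open>auto simp: e\<close>)
  then show ?thesis using card_Un_le[of S Z] cS by linarith
qed

text \<open>Indexed by \<open>S\<close>, since every vertex of the chosen set with \<open>k\<close>
  elements receives a cycle of its own.\<close>

definition packing :: "('a \<Rightarrow> 'a list) \<Rightarrow> bool" where
  "packing c \<longleftrightarrow> (\<forall>s\<in>S. is_cycle E (c s) \<and> odd (length (c s)) \<and> s \<in> set (c s) \<and> set (c s) \<subseteq> V) \<and>
     (\<forall>s\<in>S. \<forall>t\<in>S. s \<noteq> t \<longrightarrow> set (c s) \<inter> set (c t) = {})"

definition stems :: "'a set \<Rightarrow> 'a set \<Rightarrow> ('a \<Rightarrow> 'a list) \<Rightarrow> bool" where
  "stems N W L \<longleftrightarrow> (\<forall>n\<in>N. L n \<noteq> [] \<and> hd (L n) = n \<and> distinct (L n) \<and> set (L n) \<subseteq> V0 \<and>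
       successively E0 (L n) \<and> set (L n) \<inter> W = {last (L n)}) \<and>
     (\<forall>n\<in>N. \<forall>m\<in>N. n \<noteq> m \<longrightarrow> set (L n) \<inter> set (L m) = {})"

text \<open>By Menger's theorem: a proper separation of the graph outside \<open>S\<close> has order
  at least \<open>49 * k\<close>, and an improper one contains \<open>N\<close> or \<open>W\<close>
  in its separator.\<close>

lemma stems_exist:
  assumes N: "N \<subseteq> V0" "card N \<le> 2 * k" and W: "W \<subseteq> V0" "2 * k \<le> card W"
  shows "\<exists>L. stems N W L"
proof -
  have o: "card N \<le> card (P \<inter> Q)" if PQ: "P \<union> Q = V0" "N \<subseteq> P" "W \<subseteq> Q" "sep E0 P Q" for P Q
  proof -
    have fin: "finite P" "finite Q" using PQ(1) gd(1) by (metis finite_Diff finite_Un)+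
    show ?thesis
    proof (cases "P - Q = {} \<or> Q - P = {}")
      case True
      then have "P \<inter> Q = P \<or> P \<inter> Q = Q" by auto
      then show ?thesis using card_mono[OF fin(1) PQ(2)] card_mono[OF fin(2) PQ(3)] N(2) W(2) by auto
    next
      case False
      then have "49 * k \<le> card ({} :: 'a set) + card (P \<inter> Q)" using PQ by (intro sep_outside) auto
      then show ?thesis using N(2) by simp
    qed
  qed
  obtain C where C: "\<And>z. z \<in> N \<Longrightarrow> conn E0 (C z) \<and> C z \<subseteq> V0 \<and> C z \<inter> N = {z} \<and> C z \<inter> W \<noteq> {}"
    "\<And>z y. z \<in> N \<Longrightarrow> y \<in> N \<Longrightarrow> z \<noteq> y \<Longrightarrow> C z \<inter> C y = {}"
  proof (rule menger_indexed[OF g0 N(1) W(1)])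
    fix P Q assume "P \<union> Q = V0" "N \<subseteq> P" "W \<subseteq> Q" "sep E0 P Q"
    then show "card N \<le> card (P \<inter> Q)" by (rule o)
  qed (rule that)
  define good where "good n xs \<longleftrightarrow> xs \<noteq> [] \<and> hd xs = n \<and> distinct xs \<and> set xs \<subseteq> C n \<and> successively E0 xs \<and>
    set xs \<inter> W = {last xs}" for n xs
  have "\<exists>xs. good n xs" if "n \<in> N" for n
    unfolding good_def using path_to_set[of E0 "C n" n W] C(1)[OF that] by auto
  then obtain L where L: "\<And>n. n \<in> N \<Longrightarrow> good n (L n)" by metis
  have "stems N W L" unfolding stems_def
  proof (intro conjI ballI impI)
    fix n m assume nm: "n \<in> N" "m \<in> N" "n \<noteq> m"
    have "C n \<inter> C m = {}" by (rule C(2)[OF nm])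
    moreover have "set (L n) \<subseteq> C n" "set (L m) \<subseteq> C m" using L nm(1,2) unfolding good_def by auto
    ultimately show "set (L n) \<inter> set (L m) = {}" by blast
  next
    fix n assume n: "n \<in> N"
    show "set (L n) \<subseteq> V0" using L[OF n] C(1)[OF n] unfolding good_def by blast
  qed (use L in \<open>auto simp: good_def\<close>)
  then show ?thesis by blast
qed

text \<open>Take the stems with the fewest edges outside the paths. A path that meets a stem has an end on
  some stem, since otherwise it could be used to reroute the first stem it meets.\<close>

lemma few_paths_touched:
  assumes N: "finite N" and ex: "stems N W L0"
    and PP: "finite PP" "\<And>p. p \<in> PP \<Longrightarrow> odd_path E0 W \<phi> p \<and> set p \<subseteq> V0"
      "\<And>p q. p \<in> PP \<Longrightarrow> q \<in> PP \<Longrightarrow> p \<noteq> q \<Longrightarrow> set p \<inter> set q = {}"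
  shows "\<exists>L. stems N W L \<and> card {p \<in> PP. \<exists>n\<in>N. set p \<inter> set (L n) \<noteq> {}} \<le> card N"
proof -
  define R where "R x y \<longleftrightarrow> (\<exists>p\<in>PP. \<exists>i. Suc i < length p \<and> (x = p ! i \<and> y = p ! Suc i \<or> y = p ! i \<and> x = p ! Suc i))" for x y
  have Rsym: "R x y \<Longrightarrow> R y x" for x y unfolding R_def by blast
  have Rp: "y \<in> set p" if xy: "R x y" "x \<in> set p" "p \<in> PP" for x y p
  proof -
    obtain q i where q: "q \<in> PP" "Suc i < length q" "x = q ! i \<and> y = q ! Suc i \<or> y = q ! i \<and> x = q ! Suc i"
      using xy(1) unfolding R_def by blast
    then have in_q: "x \<in> set q" "y \<in> set q" by auto
    then have "q = p" using PP(3)[OF q(1) xy(3)] xy(2) by blast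
    then show ?thesis using in_q by simp
  qed
  have Rsucc: "successively R p" if "p \<in> PP" for p
    unfolding successively_conv_nth R_def using that by blast
  obtain L where L: "stems N W L" "\<And>M. stems N W M \<Longrightarrow> (\<Sum>n\<in>N. outside R (L n)) \<le> (\<Sum>n\<in>N. outside R (M n))"
    using ex_has_least_nat[of "stems N W" L0 "\<lambda>L. \<Sum>n\<in>N. outside R (L n)"] ex by blast
  have Ln: "L n \<noteq> []" "hd (L n) = n" "distinct (L n)" "set (L n) \<subseteq> V0" "successively E0 (L n)" "set (L n) \<inter> W = {last (L n)}"
    if "n \<in> N" for n using L(1) that unfolding stems_def by auto
  have Ld: "set (L n) \<inter> set (L m) = {}" if "n \<in> N" "m \<in> N" "n \<noteq> m" for n m
    using L(1) that unfolding stems_def by auto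
  define St where "St = (\<Union>n\<in>N. set (L n))"
  have touch: "hd p \<in> St \<or> last p \<in> St" if p: "p \<in> PP" "set p \<inter> St \<noteq> {}" for p
  proof (rule ccontr)
    assume no: "\<not> (hd p \<in> St \<or> last p \<in> St)"
    have op: "distinct p" "successively E0 p" "2 \<le> length p" "set p \<inter> W = {hd p, last p}" "set p \<subseteq> V0"
      using PP(2)[OF p(1)] unfolding odd_path_def by auto
    have "\<exists>x\<in>set p. x \<in> St" using p(2) by auto
    then obtain us v vs where sp: "p = us @ v # vs" "v \<in> St" "\<forall>x\<in>set us. x \<notin> St"
      using split_list_first_prop[of p "\<lambda>x. x \<in> St"] by metis
    have usne: "us \<noteq> []" using no sp by auto
    obtain n where n: "n \<in> N" "v \<in> set (L n)" using sp(2) unfolding St_def by auto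
    obtain A B where AB: "L n = A @ v # B" using split_list[OF n(2)] by auto
    have vW: "v \<notin> W"
    proof
      assume "v \<in> W"
      then have "v \<in> set p \<inter> W" using sp(1) by simp
      then show False using op(4) no sp(2) by auto
    qed
    have lW: "last (L n) \<in> W" using Ln(6)[OF n(1)] by auto
    then have Bne: "B \<noteq> []" using AB vW by auto
    then have lB: "last (L n) = last B" "last B \<in> set B" using AB by auto
    \<comment> \<open>The stem through the first vertex \<open>v\<close> of \<open>p\<close> on any
      stem is rerouted back along \<open>p\<close> to its head, using only edges of the paths after
      \<open>v\<close>. By minimality the old stem did the same after \<open>v\<close>; it therefore
      stayed on \<open>p\<close> and ended in an end of \<open>p\<close>.\<close>
    define X where "X = A @ v # rev us"
    have lpu: "last p \<notin> set us" using op(1) sp(1) by (cases vs rule: rev_cases) auto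
    have hpu: "hd p = hd us" "hd us \<in> set us" using sp(1) usne by auto
    have su: "successively R (v # rev us)"
    proof -
      have "successively R (us @ [v])" using Rsucc[OF p(1)] unfolding sp(1) by (auto simp: successively_append_iff)
      then have "successively (\<lambda>x y. R y x) (us @ [v])" by (rule successively_mono) (rule Rsym)
      then have "successively R (rev (us @ [v]))" by (simp only: successively_rev)
      then show ?thesis by simp
    qed
    have suE: "successively E0 (v # rev us)"
    proof -
      have "successively E0 (us @ [v])" using op(2) unfolding sp(1) by (auto simp: successively_append_iff)
      then have "successively (\<lambda>x y. E0 y x) (us @ [v])" by (rule successively_mono) (rule simple_graphD(6)[OF g0])
      then have "successively E0 (rev (us @ [v]))" by (simp only: successively_rev)
      then show ?thesis by simp
    qed
    have usSt: "set us \<inter> set (L m) = {}" if "m \<in> N" for m using sp(3) that unfolding St_def by auto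
    have "stems N W (L(n := X))" unfolding stems_def
    proof (intro conjI ballI impI)
      fix m assume m: "m \<in> N"
      show "(L(n := X)) m \<noteq> []" using Ln(1)[OF m] unfolding X_def by simp
      show "hd ((L(n := X)) m) = m" using Ln(2)[OF m] AB unfolding X_def by (cases A) auto
      show "distinct ((L(n := X)) m)"
        using Ln(3)[OF m] op(1) usSt[OF n(1)] AB sp(1) unfolding X_def by auto
      show "set ((L(n := X)) m) \<subseteq> V0" using Ln(4)[OF m] AB op(5) sp(1) unfolding X_def by auto
      show "successively E0 ((L(n := X)) m)"
      proof (cases "m = n")
        case True
        have "successively E0 (A @ [v])" using Ln(5)[OF n(1)] unfolding AB by (auto simp: successively_append_iff)
        then have "successively E0 ((A @ [v]) @ rev us)" by (rule successively_glue) (use suE in auto)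
        then show ?thesis using True unfolding X_def by simp
      qed (use Ln(5)[OF m] in simp)
      show "set ((L(n := X)) m) \<inter> W = {last ((L(n := X)) m)}"
      proof (cases "m = n")
        case True
        have "set A \<inter> W = {}"
        proof -
          have "set A \<inter> W \<subseteq> {last B}" using Ln(6)[OF n(1)] lB AB by auto
          moreover have "last B \<notin> set A" using Ln(3)[OF n(1)] lB(2) unfolding AB by auto
          ultimately show ?thesis by auto
        qed
        moreover have "set us \<inter> W = {hd p}"
        proof
          show "set us \<inter> W \<subseteq> {hd p}" using op(4) lpu unfolding sp(1) by auto
          have "hd p \<in> W" using op(4) by auto
          then show "{hd p} \<subseteq> set us \<inter> W" using hpu by simp
        qed
        moreover have "last X = hd p" unfolding X_def using usne hpu by (simp add: last_rev)
        ultimately show ?thesis using True vW unfolding X_def by auto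
      qed (use Ln(6)[OF m] in simp)
    next
      have sX: "set X \<subseteq> set (L n) \<union> set us" unfolding X_def AB by auto
      fix a b assume ab: "a \<in> N" "b \<in> N" "a \<noteq> b"
      have 1: "set X \<inter> set (L m) = {}" if "m \<in> N" "m \<noteq> n" for m
        using sX usSt[OF that(1)] Ld[OF that(1) n(1) that(2)] by auto
      show "set ((L(n := X)) a) \<inter> set ((L(n := X)) b) = {}"
        using 1[OF ab(1)] 1[OF ab(2)] Ld[OF ab] ab(3) by (auto simp: Int_commute)
    qed
    from L(2)[OF this] have le: "(\<Sum>m\<in>N. outside R (L m)) \<le> (\<Sum>m\<in>N. outside R ((L(n := X)) m))" .
    have "(\<Sum>m\<in>N. outside R (L m)) = outside R (L n) + (\<Sum>m\<in>N - {n}. outside R (L m))"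
      by (rule sum.remove[OF N n(1)])
    moreover have "(\<Sum>m\<in>N. outside R ((L(n := X)) m)) = outside R X + (\<Sum>m\<in>N - {n}. outside R (L m))"
      using sum.remove[OF N n(1), of "\<lambda>m. outside R ((L(n := X)) m)"] by simp
    ultimately have "outside R (L n) \<le> outside R X" using le by linarith
    moreover have "outside R (v # rev us) = 0" using su outside_0 by blast
    ultimately have "outside R (v # B) = 0"
      using outside_append[of R A v B] outside_append[of R A v "rev us"] unfolding AB X_def by linarith
    then have "successively R (v # B)" using outside_0 by blast
    then have "set (v # B) \<subseteq> set p"
    proof -
      have "set (x # C) \<subseteq> set p" if "successively R (x # C)" "x \<in> set p" for x C
        using that
      proof (induction C arbitrary: x)
        case (Cons y C)
        then have "y \<in> set p" using Rp[of x y p] p(1) by simp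
        then show ?case using Cons.IH[of y] Cons.prems by simp
      qed simp
      from this[of v B] show ?thesis using \<open>successively R (v # B)\<close> sp(1) by simp
    qed
    then have "last (L n) \<in> set p \<inter> W" using lB lW by auto
    then have "last (L n) = hd p \<or> last (L n) = last p" using op(4) by auto
    moreover have "last (L n) \<in> set (L n)" using Ln(1)[OF n(1)] by simp
    then have "last (L n) \<in> St" using n(1) unfolding St_def by blast
    ultimately show False using no by auto
  qed
  define e where "e p = (if hd p \<in> St then hd p else last p)" for p
  define TT where "TT = {p \<in> PP. \<exists>n\<in>N. set p \<inter> set (L n) \<noteq> {}}"
  have TT: "p \<in> PP \<and> set p \<inter> St \<noteq> {}" if "p \<in> TT" for p using that unfolding TT_def St_def by blast
  have e: "e p \<in> set p \<and> e p \<in> W \<and> e p \<in> St" if "p \<in> TT" for p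
  proof -
    have "set p \<inter> W = {hd p, last p}" using PP(2) TT[OF that] unfolding odd_path_def by blast
    then show ?thesis using touch[of p] TT[OF that] unfolding e_def by auto
  qed
  \<comment> \<open>A stem has only its last vertex in \<open>W\<close>, so the chosen ends of the
    touched paths are last vertices of stems, and they differ because the paths are
    disjoint.\<close>
  have "card TT \<le> card ((\<lambda>n. last (L n)) ` N)"
  proof (rule card_inj_on_le[of e])
    show "inj_on e TT"
    proof (rule inj_onI)
      fix p q assume pq: "p \<in> TT" "q \<in> TT" "e p = e q"
      then have "e p \<in> set p \<inter> set q" using e[OF pq(1)] e[OF pq(2)] by simp
      then show "p = q" using PP(3)[of p q] TT[OF pq(1)] TT[OF pq(2)] by blast
    qed
    show "e ` TT \<subseteq> (\<lambda>n. last (L n)) ` N"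
    proof
      fix x assume "x \<in> e ` TT"
      then obtain p where p: "p \<in> TT" "x = e p" by auto
      then obtain n where "n \<in> N" "x \<in> set (L n) \<inter> W" using e[OF p(1)] unfolding St_def by auto
      then show "x \<in> (\<lambda>n. last (L n)) ` N" using Ln(6)[of n] by auto
    qed
  qed (use N in simp)
  also have "\<dots> \<le> card N" by (rule card_image_le[OF N])
  finally show ?thesis using L(1) unfolding TT_def by blast
qed

text \<open>Two stems at each vertex of \<open>S\<close> form a path through it with both ends in
  \<open>W\<close>. The \<open>2 * k\<close> stems can be chosen to touch at most
  \<open>2 * k\<close> of the \<open>3 * k\<close> odd paths, so every vertex of \<open>S\<close>
  has an untouched path \<open>h s\<close> at its disposal in case its parity is wrong.\<close>

lemma packing_from_paths:
  assumes D: "dense_cut V0 F \<phi> k W" and FE: "\<And>x y. F x y \<Longrightarrow> E0 x y"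
    and PP: "finite PP" "card PP = 3 * k" "\<And>p. p \<in> PP \<Longrightarrow> odd_path E0 W \<phi> p \<and> set p \<subseteq> V0"
      "\<And>p q. p \<in> PP \<Longrightarrow> q \<in> PP \<Longrightarrow> p \<noteq> q \<Longrightarrow> set p \<inter> set q = {}"
  shows "\<exists>c. packing c"
proof -
  interpret D: dense_cut V0 F \<phi> k W by (rule D)
  \<comment> \<open>Two requests per vertex of \<open>S\<close>, told apart by a Boolean, so that
    all neighbours chosen are distinct.\<close>
  define J where "J = S \<times> (UNIV :: bool set)"
  have fJ: "finite J" "card J = 2 * k" unfolding J_def using fS cS by (auto simp: card_cartesian_product)
  have "\<exists>r. inj_on r J \<and> (\<forall>i\<in>J. r i \<in> {w \<in> V0. E (fst i) w})"
  proof (rule greedy_reps[OF fJ(1)])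
    fix i assume "i \<in> J"
    then have "fst i \<in> V" unfolding J_def using SV by auto
    then have "50 * k \<le> card {w \<in> V0. E (fst i) w} + k" using degree_outside[OF _ fS] cS by simp
    then show "finite {w \<in> V0. E (fst i) w} \<and> card J \<le> card {w \<in> V0. E (fst i) w}" using fJ(2) gd(1) by simp
  qed
  then obtain r where r: "inj_on r J" "\<And>i. i \<in> J \<Longrightarrow> r i \<in> V0 \<and> E (fst i) (r i)" by auto
  define N where "N = r ` J"
  have N: "N \<subseteq> V0" "card N = 2 * k" "finite N" unfolding N_def using r(2) card_image[OF r(1)] fJ by auto
  have "\<exists>L. stems N W L" by (rule stems_exist) (use N D.WV D.W8 in auto)
  then obtain L0 where L0: "stems N W L0" ..
  obtain L where L: "stems N W L" "card {p \<in> PP. \<exists>n\<in>N. set p \<inter> set (L n) \<noteq> {}} \<le> 2 * k"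
    using few_paths_touched[OF N(3) L0 PP(1,3,4)] unfolding N(2) by blast
  define TT where "TT = {p \<in> PP. \<exists>n\<in>N. set p \<inter> set (L n) \<noteq> {}}"
  have "card (PP - TT) \<ge> card S"
    using L(2) PP(1,2) card_Diff_subset[of TT PP] cS unfolding TT_def by simp
  then obtain h where h: "inj_on h S" "h ` S \<subseteq> PP - TT"
    using card_le_inj[OF fS, of "PP - TT"] PP(1) by auto
  have Ln: "L n \<noteq> []" "hd (L n) = n" "distinct (L n)" "set (L n) \<subseteq> V0" "successively E0 (L n)" "set (L n) \<inter> W = {last (L n)}"
    if "n \<in> N" for n using L(1) that unfolding stems_def by auto
  have Ld: "set (L n) \<inter> set (L m) = {}" if "n \<in> N" "m \<in> N" "n \<noteq> m" for n m
    using L(1) that unfolding stems_def by auto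
  have rN: "r (s, b) \<in> N" if "s \<in> S" for s b unfolding N_def J_def using that by auto
  have rne: "r (s, b) \<noteq> r (t, c)" if "s \<in> S" "t \<in> S" "(s, b) \<noteq> (t, c)" for s t b c
    using inj_onD[OF r(1), of "(s, b)" "(t, c)"] that unfolding J_def by auto
  define Q where "Q s = rev (L (r (s, False))) @ s # L (r (s, True))" for s
  have setQ: "set (Q s) = insert s (set (L (r (s, False))) \<union> set (L (r (s, True))))" for s unfolding Q_def by auto
  have hP: "h s \<in> PP" "h s \<notin> TT" if "s \<in> S" for s using h(2) that by auto
  have hN: "set (h s) \<inter> set (L n) = {}" if "s \<in> S" "n \<in> N" for s n using hP[OF that(1)] that(2) unfolding TT_def by blast
  have hV: "set (h s) \<subseteq> V0" if "s \<in> S" for s using PP(3)[OF hP(1)[OF that]] by simp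
  have hQ: "set (h s) \<inter> set (Q t) = {}" if "s \<in> S" "t \<in> S" for s t
    using hN[OF that(1) rN[OF that(2), of False]] hN[OF that(1) rN[OF that(2), of True]] hV[OF that(1)] that(2)
    unfolding setQ by auto
  define Ds where "Ds s = set (Q s) \<union> (if odd_path E W \<phi> (Q s) then {} else set (h s))" for s
  have dis: "Ds s \<inter> Ds t = {}" if st: "s \<in> S" "t \<in> S" "s \<noteq> t" for s t
  proof -
    have "set (L (r (s, b))) \<inter> set (L (r (t, c))) = {}" for b c
      by (rule Ld[OF rN[OF st(1)] rN[OF st(2)] rne]) (use st in auto)
    moreover have "s \<notin> set (L (r (t, c)))" "t \<notin> set (L (r (s, c)))" for c
      using Ln(4)[OF rN[OF st(2)]] Ln(4)[OF rN[OF st(1)]] st by blast+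
    ultimately have "set (Q s) \<inter> set (Q t) = {}" unfolding setQ using st(3) by auto
    moreover have "set (h s) \<inter> set (h t) = {}"
      using PP(4)[OF hP(1)[OF st(1)] hP(1)[OF st(2)]] inj_onD[OF h(1) _ st(1,2)] st(3) by blast
    moreover have "set (h s) \<inter> set (Q t) = {}" "set (h t) \<inter> set (Q s) = {}" using hQ st by auto
    ultimately show ?thesis unfolding Ds_def by auto
  qed
  have EE0: "E0 x y \<Longrightarrow> E x y" for x y unfolding ind_def by simp
  have pQ: "distinct (Q s) \<and> successively E (Q s) \<and> 3 \<le> length (Q s) \<and> set (Q s) \<inter> W = {hd (Q s), last (Q s)}" if s: "s \<in> S" for s
  proof -
    let ?a = "L (r (s, False))" and ?b = "L (r (s, True))"
    note a = Ln[OF rN[OF s, of False]] and b = Ln[OF rN[OF s, of True]]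
    have ab: "set ?a \<inter> set ?b = {}" by (rule Ld[OF rN[OF s] rN[OF s] rne[OF s s]]) simp
    have sn: "s \<notin> set ?a" "s \<notin> set ?b" using a(4) b(4) s by auto
    have "successively E ?a" "successively E ?b" using successively_mono[OF a(5)] successively_mono[OF b(5)] EE0 by blast+
    moreover from this have "successively (\<lambda>x y. E y x) ?a" using successively_mono[of E ?a "\<lambda>x y. E y x"] gd(6) by blast
    then have "successively E (rev ?a)" by (simp only: successively_rev)
    moreover have "E (hd ?a) s" "E s (hd ?b)"
      using r(2)[of "(s, False)"] r(2)[of "(s, True)"] a(2) b(2) s gd(6) unfolding J_def by auto
    ultimately have "successively E (Q s)" unfolding Q_def using a(1) b(1)
      by (auto simp: successively_append_iff successively_Cons last_rev)
    moreover have "distinct (Q s)" unfolding Q_def using a(3) b(3) ab sn by auto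
    moreover have "1 \<le> length ?a" "1 \<le> length ?b" using a(1) b(1) by (simp_all add: Suc_leI)
    then have "3 \<le> length (Q s)" unfolding Q_def by simp
    moreover have "s \<notin> W" using D.WV s by auto
    then have "set (Q s) \<inter> W = {hd (Q s), last (Q s)}"
      using a(1,6) b(1,6) unfolding setQ unfolding Q_def by (auto simp: hd_rev)
    ultimately show ?thesis by simp
  qed
  have "\<exists>c. (\<forall>s\<in>S. is_cycle E (c s) \<and> odd (length (c s)) \<and> set (Q s) \<subseteq> set (c s) \<and> set (c s) \<subseteq> Ds s \<union> W) \<and>
    (\<forall>s\<in>S. \<forall>t\<in>S. s \<noteq> t \<longrightarrow> set (c s) \<inter> set (c t) = {})"
  proof (rule assemble_cycles[of "ind F W" E \<phi> S W Q h Ds])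
    show "ind F W x y \<Longrightarrow> E x y" for x y using FE EE0 unfolding ind_def[of F] by blast
    show "ind F W x y \<Longrightarrow> \<phi> x \<noteq> \<phi> y" for x y using D.bip unfolding ind_def[of F] by blast
    show "finite S" by (rule fS)
    show "X \<subseteq> W \<Longrightarrow> card X \<le> 4 * card S \<Longrightarrow> lnk (ind F W) W X" for X using D.lnk_cut[of X] cS by simp
    show "s \<in> S \<Longrightarrow> distinct (Q s) \<and> successively E (Q s) \<and> 3 \<le> length (Q s) \<and> set (Q s) \<inter> W = {hd (Q s), last (Q s)}" for s
      by (rule pQ)
    show "odd_path E W \<phi> (h s) \<and> set (h s) \<inter> set (Q s) = {}" if "s \<in> S" for s
    proof -
      have "odd_path E0 W \<phi> (h s)" using PP(3)[OF hP(1)[OF that]] by simp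
      then have "odd_path E W \<phi> (h s)" by (rule odd_path_mono) (rule EE0)
      then show ?thesis using hQ[OF that that] by simp
    qed
    show "Ds s = set (Q s) \<union> (if odd_path E W \<phi> (Q s) then {} else set (h s))" for s by (rule Ds_def)
    show "s \<in> S \<Longrightarrow> t \<in> S \<Longrightarrow> s \<noteq> t \<Longrightarrow> Ds s \<inter> Ds t = {}" for s t by (rule dis)
  qed
  then obtain c where c0: "\<forall>s\<in>S. is_cycle E (c s) \<and> odd (length (c s)) \<and> set (Q s) \<subseteq> set (c s) \<and> set (c s) \<subseteq> Ds s \<union> W"
    "\<forall>s\<in>S. \<forall>t\<in>S. s \<noteq> t \<longrightarrow> set (c s) \<inter> set (c t) = {}" by (elim exE conjE)
  note c = bspec[OF c0(1)]
  have "packing c" unfolding packing_def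
  proof (intro conjI ballI impI)
    fix s assume s: "s \<in> S"
    show "is_cycle E (c s)" "odd (length (c s))" using c[OF s] by simp_all
    show "s \<in> set (c s)" using c[OF s] setQ[of s] by blast
    have "Ds s \<subseteq> V" unfolding Ds_def setQ using hV[OF s] Ln(4)[OF rN[OF s]] s SV by auto
    then show "set (c s) \<subseteq> V" using c[OF s] D.WV by blast
  qed (use c0(2) in blast)
  then show ?thesis by blast
qed

end

section \<open>A colouring with few monochromatic edges\<close>

text \<open>Monochromatic edges are prolonged by fresh neighbours in \<open>B\<close> to short odd paths, which are
  then linked up inside \<open>B\<close>.\<close>

locale coloured_k_set = k_set V E k S
  for V :: "'a set" and E :: "'a \<Rightarrow> 'a \<Rightarrow> bool" and k :: nat and S :: "'a set" +
  fixes B :: "'a set" and \<phi> :: "'a \<Rightarrow> bool"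
  assumes BV: "B \<subseteq> V - S"
    and proper: "\<And>x y. x \<in> B \<Longrightarrow> y \<in> B \<Longrightarrow> E x y \<Longrightarrow> \<phi> x \<noteq> \<phi> y"
    and many: "\<And>y. y \<in> V - B \<Longrightarrow> 21 * k \<le> card {w \<in> B. E y w \<and> \<phi> w \<noteq> \<phi> y}"
    and lk: "\<And>X. X \<subseteq> B \<Longrightarrow> card X \<le> 4 * k \<Longrightarrow> lnk (ind E B) B X"
begin

text \<open>Edges inside \<open>S\<close> are excluded because the cycle through such an edge would
  serve two vertices of \<open>S\<close> at once.\<close>

definition mono_edge where
  "mono_edge e \<longleftrightarrow> E (fst e) (snd e) \<and> \<phi> (fst e) = \<phi> (snd e) \<and> \<not> (fst e \<in> S \<and> snd e \<in> S)" for e :: "'a \<times> 'a"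

definition ends where "ends e = {fst e, snd e}" for e :: "'a \<times> 'a"

definition mono_matching where
  "mono_matching M \<longleftrightarrow> (\<forall>e\<in>M. mono_edge e) \<and> (\<forall>e\<in>M. \<forall>f\<in>M. e \<noteq> f \<longrightarrow> ends e \<inter> ends f = {})"

lemma fB: "finite B"
  using BV gd(1) finite_subset by blast

lemma mono_ends: "mono_edge e \<Longrightarrow> ends e \<subseteq> V"
  unfolding mono_edge_def ends_def using gd(4,5) by auto

lemma mono_not_B: "mono_edge e \<Longrightarrow> fst e \<notin> B \<or> snd e \<notin> B"
  using proper unfolding mono_edge_def by blast

lemma mono_matching_sub: "mono_matching M \<Longrightarrow> M \<subseteq> V \<times> V"
  unfolding mono_matching_def mono_edge_def using gd(4,5) by fastforce

text \<open>By maximality the ends of \<open>M\<close>, at most \<open>2 * (k - 1)\<close> of them,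
  meet all monochromatic edges except those inside \<open>S\<close>, and \<open>C\<close> meets
  these.\<close>

lemma small_matching_cover:
  assumes M: "mono_matching M" "\<And>N. mono_matching N \<Longrightarrow> card N \<le> card M" "card M < k"
    and C: "C \<subseteq> S" "\<And>u v. u \<in> S \<Longrightarrow> v \<in> S \<Longrightarrow> E u v \<Longrightarrow> u \<in> C \<or> v \<in> C"
  shows "\<exists>X. X \<subseteq> V \<and> bipartite_minus V E X \<and> card X \<le> 2 * k - 2 + card C"
proof -
  have fM: "finite M" by (rule finite_subset[OF mono_matching_sub[OF M(1)]]) (use gd(1) in simp)
  define X where "X = (\<Union>e\<in>M. ends e) \<union> C"
  have "ends e \<subseteq> V" if "e \<in> M" for e using mono_ends M(1) that unfolding mono_matching_def by blast
  then have "X \<subseteq> V" unfolding X_def using C(1) SV by blast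
  moreover have "card X \<le> 2 * k - 2 + card C"
  proof -
    have "card (\<Union>e\<in>M. ends e) \<le> (\<Sum>e\<in>M. card (ends e))" by (rule card_UN_le[OF fM])
    also have "\<dots> \<le> (\<Sum>e\<in>M. 2)" by (intro sum_mono) (simp add: ends_def card_insert_if)
    finally have "card (\<Union>e\<in>M. ends e) \<le> 2 * k - 2" using M(3) by simp
    then show ?thesis using card_Un_le[of "\<Union>e\<in>M. ends e" C] unfolding X_def by linarith
  qed
  moreover have "\<phi> u \<noteq> \<phi> v" if uv: "u \<in> V - X" "v \<in> V - X" "E u v" for u v
  proof
    assume e: "\<phi> u = \<phi> v"
    have "\<not> (u \<in> S \<and> v \<in> S)" using C(2)[of u v] uv unfolding X_def by blast
    then have m: "mono_edge (u, v)" unfolding mono_edge_def using e uv(3) by simp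
    have d: "ends (u, v) \<inter> ends f = {}" if "f \<in> M" for f
      using uv(1,2) that unfolding X_def ends_def by auto
    then have "(u, v) \<notin> M" unfolding ends_def by fastforce
    moreover have "mono_matching (insert (u, v) M)"
      using M(1) m d unfolding mono_matching_def by (auto simp: Int_commute)
    ultimately show False using M(2)[of "insert (u, v) M"] fM by simp
  qed
  then have "bipartite_minus V E X" unfolding bipartite_minus_def by (intro exI[of _ "{x. \<phi> x}"]) auto
  ultimately show ?thesis by blast
qed

text \<open>A vertex of \<open>S\<close> on a matching edge is served by this edge, whose
  prolongation is already an odd path. Every other vertex of \<open>S\<close> is given a path
  through two fresh neighbours; its parity is wrong, so it borrows a matching edge that avoids
  \<open>S\<close>. There are enough of these because a matching edge has at most one end in
  \<open>S\<close>.\<close>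

lemma packing_from_matching:
  assumes M: "mono_matching M" "card M = k"
  shows "\<exists>c. packing c"
proof -
  have fM: "finite M" by (rule finite_subset[OF mono_matching_sub[OF M(1)]]) (use gd(1) in simp)
  have mono: "mono_edge e" if "e \<in> M" for e using M(1) that unfolding mono_matching_def by blast
  have dM: "ends e \<inter> ends f = {}" if "e \<in> M" "f \<in> M" "e \<noteq> f" for e f
    using M(1) that unfolding mono_matching_def by blast
  define VM where "VM = (\<Union>e\<in>M. ends e)"
  have eVM: "ends e \<subseteq> VM" if "e \<in> M" for e using that unfolding VM_def by blast
  have VMV: "VM \<subseteq> V" unfolding VM_def using mono mono_ends by blast
  have fVM: "finite VM" using finite_subset[OF VMV gd(1)] .
  have cVM: "card VM \<le> 2 * k"
  proof -
    have "card VM \<le> (\<Sum>e\<in>M. card (ends e))" unfolding VM_def by (rule card_UN_le[OF fM])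
    also have "\<dots> \<le> (\<Sum>e\<in>M. 2)" by (intro sum_mono) (simp add: ends_def card_insert_if)
    finally show ?thesis using M(2) by simp
  qed
  \<comment> \<open>One request for each matched vertex outside \<open>B\<close> and two for each
    vertex of \<open>S\<close>, at most \<open>4 * k\<close> in all; with \<open>VM\<close> excluded
    each has at least \<open>19 * k\<close> candidates.\<close>
  define J where "J = (VM - B) \<times> {False} \<union> S \<times> UNIV"
  have fJ: "finite J" unfolding J_def using fVM fS by simp
  have cJ: "card J \<le> 4 * k"
  proof -
    have "card J \<le> card ((VM - B) \<times> {False}) + card (S \<times> (UNIV :: bool set))" unfolding J_def by (rule card_Un_le)
    also have "\<dots> = card (VM - B) + 2 * k" using cS by (simp add: card_cartesian_product)
    also have "\<dots> \<le> card VM + 2 * k" using fVM by (simp add: card_mono)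
    finally show ?thesis using cVM by simp
  qed
  define cand where "cand i = {w \<in> B. E (fst i) w \<and> \<phi> w \<noteq> \<phi> (fst i)} - VM" for i :: "'a \<times> bool"
  have "\<exists>r. inj_on r J \<and> (\<forall>i\<in>J. r i \<in> cand i)"
  proof (rule greedy_reps[OF fJ])
    fix i assume "i \<in> J"
    then have "fst i \<in> V - B" unfolding J_def using VMV SV BV by auto
    then have "21 * k \<le> card {w \<in> B. E (fst i) w \<and> \<phi> w \<noteq> \<phi> (fst i)}" by (rule many)
    also have "\<dots> \<le> card (cand i) + card VM" unfolding cand_def
      using diff_card_le_card_Diff[OF fVM, of "{w \<in> B. E (fst i) w \<and> \<phi> w \<noteq> \<phi> (fst i)}"] by linarith
    finally show "finite (cand i) \<and> card J \<le> card (cand i)" using cVM cJ fB unfolding cand_def by simp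
  qed
  then obtain r where r: "inj_on r J" "\<forall>i\<in>J. r i \<in> cand i" by blast
  have rc: "r (x, b) \<in> B" "E x (r (x, b))" "E (r (x, b)) x" "\<phi> (r (x, b)) = (\<not> \<phi> x)" "r (x, b) \<notin> VM" if "(x, b) \<in> J" for x b
    using bspec[OF r(2) that] gd(6) unfolding cand_def by auto
  have rne: "r i \<noteq> r j" if "i \<in> J" "j \<in> J" "i \<noteq> j" for i j using inj_onD[OF r(1) _ that(1,2)] that(3) by blast
  define ext where "ext x = (if x \<in> B then [x] else [r (x, False), x])" for x
  define item where "item e = ext (fst e) @ rev (ext (snd e))" for e
  \<comment> \<open>A set together with the fresh neighbours reserved for its elements. As these are
    distinct and avoid \<open>VM \<union> S\<close>, disjointness of the constructed paths reduces
    to that of the sets they are built on.\<close>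
  define full where "full b = b \<union> r ` (J \<inter> b \<times> UNIV)" for b
  have full_Un: "full (b \<union> b') = full b \<union> full b'" for b b' unfolding full_def by auto
  have full_dis: "full b \<inter> full b' = {}" if bb: "b \<inter> b' = {}" "b \<subseteq> VM \<union> S" "b' \<subseteq> VM \<union> S" for b b'
  proof -
    have ri: "r i \<notin> VM \<union> S" if "i \<in> J" for i
      using rc(1)[of "fst i" "snd i"] rc(5)[of "fst i" "snd i"] BV that by auto
    have "r i \<noteq> r j" if "i \<in> J \<inter> b \<times> UNIV" "j \<in> J \<inter> b' \<times> UNIV" for i j
      by (rule rne) (use that bb(1) in auto)
    then have "r ` (J \<inter> b \<times> UNIV) \<inter> r ` (J \<inter> b' \<times> UNIV) = {}" by blast
    moreover have "r ` (J \<inter> b \<times> UNIV) \<inter> (VM \<union> S) = {}" "r ` (J \<inter> b' \<times> UNIV) \<inter> (VM \<union> S) = {}" using ri by auto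
    then have "r ` (J \<inter> b \<times> UNIV) \<inter> b' = {}" "b \<inter> r ` (J \<inter> b' \<times> UNIV) = {}" using bb(2,3) by auto
    ultimately show ?thesis using bb(1) unfolding full_def Int_Un_distrib Int_Un_distrib2 by simp
  qed
  have fullV: "full b \<subseteq> V" if "b \<subseteq> VM \<union> S" for b
  proof -
    have "r i \<in> V" if "i \<in> J" for i using rc(1)[of "fst i" "snd i"] BV that by auto
    then show ?thesis using that VMV SV unfolding full_def by blast
  qed
  have xJ: "(x, False) \<in> J" if "x \<in> VM" "x \<notin> B" for x using that unfolding J_def by simp
  have item_full: "set (item e) \<subseteq> full (ends e)" if e: "e \<in> M" for e
  proof -
    have v: "fst e \<in> VM" "snd e \<in> VM" using eVM[OF e] unfolding ends_def by auto
    have "set (ext x) \<subseteq> full (ends e)" if x: "x \<in> ends e" for x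
    proof (cases "x \<in> B")
      case False
      then have "(x, False) \<in> J \<inter> ends e \<times> UNIV" using xJ x eVM[OF e] by auto
      then have "r (x, False) \<in> full (ends e)" unfolding full_def by (intro UnI2 imageI)
      then show ?thesis using x False unfolding ext_def full_def by simp
    qed (use x in \<open>simp add: ext_def full_def\<close>)
    then show ?thesis unfolding item_def ends_def by simp
  qed
  have item_odd: "odd_path E B \<phi> (item e)" if e: "e \<in> M" for e
  proof -
    obtain x y where xy: "e = (x, y)" by (cases e)
    have v: "x \<in> VM" "y \<in> VM" using eVM[OF e] xy unfolding ends_def by auto
    have E: "E x y" "\<phi> x = \<phi> y" "x \<noteq> y" using mono[OF e] xy gd(7) unfolding mono_edge_def by auto
    show ?thesis
    proof (cases "x \<in> B")
      case True
      then have y: "y \<notin> B" using mono_not_B[OF mono[OF e]] xy by simp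
      note ry = rc[OF xJ[OF v(2) y]]
      have "r (y, False) \<noteq> x" "r (y, False) \<noteq> y" using ry(5) v by auto
      then show ?thesis using ry True y E unfolding odd_path_def item_def ext_def xy by auto
    next
      case x: False
      note rx = rc[OF xJ[OF v(1) x]]
      have nx: "r (x, False) \<noteq> x" "r (x, False) \<noteq> y" using rx(5) v by auto
      show ?thesis
      proof (cases "y \<in> B")
        case True
        then show ?thesis using rx nx x E unfolding odd_path_def item_def ext_def xy by auto
      next
        case y: False
        note ry = rc[OF xJ[OF v(2) y]]
        have "r (y, False) \<noteq> x" "r (y, False) \<noteq> y" using ry(5) v by auto
        moreover have "r (x, False) \<noteq> r (y, False)" by (rule rne[OF xJ[OF v(1) x] xJ[OF v(2) y]]) (use E in simp)
        ultimately show ?thesis using rx ry nx x y E unfolding odd_path_def item_def ext_def xy by auto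
      qed
    qed
  qed
  have "\<exists>e. e \<in> M \<and> s \<in> ends e" if "s \<in> VM" for s using that unfolding VM_def by blast
  then obtain edge where edge: "\<And>s. s \<in> VM \<Longrightarrow> edge s \<in> M \<and> s \<in> ends (edge s)" by metis
  define MS where "MS = {e \<in> M. ends e \<inter> S \<noteq> {}}"
  have "card MS \<le> card (S \<inter> VM)"
  proof (rule card_inj_on_le[of "\<lambda>e. if fst e \<in> S then fst e else snd e"])
    have m: "(if fst e \<in> S then fst e else snd e) \<in> ends e \<inter> S" if "e \<in> MS" for e
      using that unfolding MS_def ends_def by auto
    show "inj_on (\<lambda>e. if fst e \<in> S then fst e else snd e) MS"
    proof (rule inj_onI)
      fix e f assume ef: "e \<in> MS" "f \<in> MS" "(if fst e \<in> S then fst e else snd e) = (if fst f \<in> S then fst f else snd f)"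
      then have "ends e \<inter> ends f \<noteq> {}" using m[OF ef(1)] m[OF ef(2)] by auto
      then show "e = f" using dM[of e f] ef(1,2) unfolding MS_def by blast
    qed
    show "(\<lambda>e. if fst e \<in> S then fst e else snd e) ` MS \<subseteq> S \<inter> VM"
      using m eVM unfolding MS_def by blast
  qed (use fS in simp)
  moreover have "card (S - VM) + card (S \<inter> VM) = k" using card_Diff_subset_Int[of S VM] fS cS card_mono[OF fS, of "S \<inter> VM"] by simp
  moreover have "card (M - MS) + card MS = k"
    using card_Diff_subset[of MS M] fM M(2) card_mono[OF fM, of MS] finite_subset[of MS M] unfolding MS_def by simp
  ultimately have "card (S - VM) \<le> card (M - MS)" by linarith
  then obtain h where h: "inj_on h (S - VM)" "h ` (S - VM) \<subseteq> M - MS"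
    using card_le_inj[of "S - VM" "M - MS"] fS fM by auto
  define Q where "Q s = (if s \<in> VM then item (edge s) else [r (s, False), s, r (s, True)])" for s
  define D where "D s = set (Q s) \<union> (if odd_path E B \<phi> (Q s) then {} else set (item (h s)))" for s
  define base where "base s = (if s \<in> VM then ends (edge s) else {s} \<union> ends (h s))" for s
  have sJ: "(s, b) \<in> J" if "s \<in> S" for s b using that unfolding J_def by simp
  have hM: "h s \<in> M" "h s \<notin> MS" if "s \<in> S" "s \<notin> VM" for s using h(2) that by auto
  have Qs: "set (Q s) \<subseteq> full {s}" if "s \<in> S" "s \<notin> VM" for s
  proof -
    have "r (s, b) \<in> full {s}" for b unfolding full_def by (intro UnI2 imageI) (use sJ that in simp)
    moreover have "s \<in> full {s}" unfolding full_def by simp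
    ultimately show ?thesis using that unfolding Q_def by simp
  qed
  have Dfull: "D s \<subseteq> full (base s)" if s: "s \<in> S" for s
  proof (cases "s \<in> VM")
    case True
    then have "odd_path E B \<phi> (Q s)" "set (Q s) \<subseteq> full (ends (edge s))"
      using item_odd item_full edge unfolding Q_def by auto
    then show ?thesis using True unfolding D_def base_def by simp
  next
    case False
    then have "set (Q s) \<subseteq> full {s}" "set (item (h s)) \<subseteq> full (ends (h s))"
      using Qs[OF s] item_full[OF hM(1)[OF s]] by auto
    then have "D s \<subseteq> full {s} \<union> full (ends (h s))" unfolding D_def by auto
    then show ?thesis using False full_Un[of "{s}" "ends (h s)"] unfolding base_def by simp
  qed
  have base_sub: "base s \<subseteq> VM \<union> S" if s: "s \<in> S" for s
  proof (cases "s \<in> VM")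
    case True
    then show ?thesis using eVM[of "edge s"] edge[OF True] unfolding base_def by auto
  next
    case False
    then show ?thesis using eVM[OF hM(1)[OF s False]] s unfolding base_def by auto
  qed
  have edgeMS: "edge s \<in> MS" if "s \<in> S" "s \<in> VM" for s using edge[OF that(2)] that(1) unfolding MS_def by auto
  have base_dis: "base s \<inter> base t = {}" if st: "s \<in> S" "t \<in> S" "s \<noteq> t" for s t
  proof -
    have mixed: "ends (edge s) \<inter> ({t} \<union> ends (h t)) = {}" if "s \<in> S" "t \<in> S" "s \<in> VM" "t \<notin> VM" for s t
    proof -
      have "edge s \<noteq> h t" using edgeMS[OF that(1,3)] hM(2)[OF that(2,4)] by auto
      then have "ends (edge s) \<inter> ends (h t) = {}" using dM edge[OF that(3)] hM(1)[OF that(2,4)] by blast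
      moreover have "t \<notin> ends (edge s)" using eVM edge[OF that(3)] that(4) by blast
      ultimately show ?thesis by blast
    qed
    consider "s \<in> VM" "t \<in> VM" | "s \<in> VM" "t \<notin> VM" | "s \<notin> VM" "t \<in> VM" | "s \<notin> VM" "t \<notin> VM" by blast
    then show ?thesis
    proof cases
      case 1
      \<comment> \<open>A common edge would have both its ends in \<open>S\<close>.\<close>
      have "edge s \<noteq> edge t"
      proof
        assume "edge s = edge t"
        then have "s \<in> ends (edge s)" "t \<in> ends (edge s)" using edge[OF 1(1)] edge[OF 1(2)] by auto
        then have "fst (edge s) \<in> S \<and> snd (edge s) \<in> S" using st unfolding ends_def by auto
        then show False using mono[of "edge s"] edge[OF 1(1)] unfolding mono_edge_def by blast
      qed
      then show ?thesis using dM edge[OF 1(1)] edge[OF 1(2)] 1 unfolding base_def by simp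
    next
      case 2
      then show ?thesis using mixed[OF st(1,2)] unfolding base_def by simp
    next
      case 3
      then show ?thesis using mixed[OF st(2,1)] unfolding base_def by (simp add: Int_commute)
    next
      case 4
      have "h s \<noteq> h t" using inj_onD[OF h(1), of s t] st 4 by auto
      then have "ends (h s) \<inter> ends (h t) = {}" using dM hM(1)[OF st(1) 4(1)] hM(1)[OF st(2) 4(2)] by blast
      moreover have "s \<notin> ends (h t)" "t \<notin> ends (h s)"
        using eVM[OF hM(1)[OF st(1) 4(1)]] eVM[OF hM(1)[OF st(2) 4(2)]] 4 by blast+
      ultimately show ?thesis using st(3) 4 unfolding base_def by auto
    qed
  qed
  have "\<exists>c. (\<forall>s\<in>S. is_cycle E (c s) \<and> odd (length (c s)) \<and> set (Q s) \<subseteq> set (c s) \<and> set (c s) \<subseteq> D s \<union> B) \<and>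
    (\<forall>s\<in>S. \<forall>t\<in>S. s \<noteq> t \<longrightarrow> set (c s) \<inter> set (c t) = {})"
  proof (rule assemble_cycles[of "ind E B" E \<phi> S B Q "\<lambda>s. item (h s)" D])
    show "ind E B x y \<Longrightarrow> E x y" for x y unfolding ind_def by simp
    show "ind E B x y \<Longrightarrow> \<phi> x \<noteq> \<phi> y" for x y using proper[of x y] unfolding ind_def by simp
    show "finite S" by (rule fS)
    show "X \<subseteq> B \<Longrightarrow> card X \<le> 4 * card S \<Longrightarrow> lnk (ind E B) B X" for X using lk[of X] cS by simp
    show "distinct (Q s) \<and> successively E (Q s) \<and> 3 \<le> length (Q s) \<and> set (Q s) \<inter> B = {hd (Q s), last (Q s)}"
      if s: "s \<in> S" for s
    proof (cases "s \<in> VM")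
      case True
      have "s \<notin> B" using s BV by auto
      then have "fst (edge s) \<notin> B \<or> snd (edge s) \<notin> B" using edge[OF True] unfolding ends_def by auto
      then have "3 \<le> length (item (edge s))" unfolding item_def ext_def by auto
      then show ?thesis using item_odd[of "edge s"] edge[OF True] True unfolding Q_def odd_path_def by simp
    next
      case False
      note a = rc[OF sJ[OF s, of False]] and b = rc[OF sJ[OF s, of True]]
      have "r (s, False) \<noteq> r (s, True)" by (rule rne) (use sJ[OF s] in auto)
      moreover have "s \<notin> B" using s BV by auto
      ultimately show ?thesis using a(1-3) b(1-3) False unfolding Q_def by auto
    qed
    show "odd_path E B \<phi> (item (h s)) \<and> set (item (h s)) \<inter> set (Q s) = {}"
      if s: "s \<in> S" "\<not> odd_path E B \<phi> (Q s)" for s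
    proof -
      have n: "s \<notin> VM" using s(2) item_odd[of "edge s"] edge[of s] unfolding Q_def by auto
      have "full (ends (h s)) \<inter> full {s} = {}"
        using eVM[OF hM(1)[OF s(1) n]] n s(1) by (intro full_dis) auto
      then have "set (item (h s)) \<inter> set (Q s) = {}" using Qs[OF s(1) n] item_full[OF hM(1)[OF s(1) n]] by blast
      then show ?thesis using item_odd[OF hM(1)[OF s(1) n]] by simp
    qed
    show "D s = set (Q s) \<union> (if odd_path E B \<phi> (Q s) then {} else set (item (h s)))" for s by (rule D_def)
    show "D s \<inter> D t = {}" if "s \<in> S" "t \<in> S" "s \<noteq> t" for s t
      using full_dis[OF base_dis[OF that] base_sub[OF that(1)] base_sub[OF that(2)]] Dfull[OF that(1)] Dfull[OF that(2)] by blast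
  qed
  then obtain c where c0: "\<forall>s\<in>S. is_cycle E (c s) \<and> odd (length (c s)) \<and> set (Q s) \<subseteq> set (c s) \<and> set (c s) \<subseteq> D s \<union> B"
    "\<forall>s\<in>S. \<forall>t\<in>S. s \<noteq> t \<longrightarrow> set (c s) \<inter> set (c t) = {}" by (elim exE conjE)
  note c = bspec[OF c0(1)]
  have "packing c" unfolding packing_def
  proof (intro conjI ballI impI)
    fix s assume s: "s \<in> S"
    show "is_cycle E (c s)" "odd (length (c s))" using c[OF s] by simp_all
    have "s \<in> set (Q s)"
    proof (cases "s \<in> VM")
      case True
      have "x \<in> set (ext x)" for x unfolding ext_def by simp
      then have "ends (edge s) \<subseteq> set (item (edge s))" unfolding item_def ends_def by simp
      then show ?thesis using edge[OF True] True unfolding Q_def by auto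
    qed (simp add: Q_def)
    then show "s \<in> set (c s)" using c[OF s] by blast
    have "D s \<subseteq> V" using Dfull[OF s] fullV[OF base_sub[OF s]] by blast
    then show "set (c s) \<subseteq> V" using c[OF s] BV by blast
  qed (use c0(2) in blast)
  then show ?thesis by blast
qed

lemma packing_or_cover:
  assumes C: "C \<subseteq> S" "\<And>u v. u \<in> S \<Longrightarrow> v \<in> S \<Longrightarrow> E u v \<Longrightarrow> u \<in> C \<or> v \<in> C"
  shows "(\<exists>c. packing c) \<or> (\<exists>X. X \<subseteq> V \<and> bipartite_minus V E X \<and> card X \<le> 2 * k - 2 + card C)"
proof -
  have "mono_matching {}" unfolding mono_matching_def by simp
  moreover have "\<forall>M. mono_matching M \<longrightarrow> card M < Suc (card (V \<times> V))"
    using mono_matching_sub card_mono[of "V \<times> V"] gd(1) by (simp add: less_Suc_eq_le)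
  ultimately obtain M where M: "mono_matching M" "\<And>N. mono_matching N \<Longrightarrow> card N \<le> card M"
    using ex_has_greatest_nat[of mono_matching "{}" card] by blast
  show ?thesis
  proof (cases "card M < k")
    case True
    show ?thesis using small_matching_cover[OF M True C] by simp
  next
    case False
    then obtain N where N: "N \<subseteq> M" "card N = k" using obtain_subset_with_card_n[of k M] by auto
    then have "mono_matching N" using M(1) unfolding mono_matching_def by blast
    then show ?thesis using packing_from_matching N(2) by blast
  qed
qed

end

context k_set
begin

text \<open>Removing \<open>S\<close> and \<open>Z\<close>, fewer than \<open>7 * k\<close>
  vertices, leaves at least \<open>43 * k\<close> neighbours of every vertex in \<open>B\<close>.
  This exceeds the \<open>24 * k\<close> needed for massedness with \<open>2 * k\<close> pairs, and
  at least \<open>21 * k\<close> of these neighbours share a colour, against which a vertex outside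
  \<open>B\<close> is coloured. Proper separations of \<open>B\<close> have order above
  \<open>43 * k\<close>, so none is small enough to interfere.\<close>

lemma coloured_from_cover:
  assumes Z: "Z \<subseteq> V0" "card Z < 6 * k" and \<psi>: "\<And>x y. x \<in> V0 - Z \<Longrightarrow> y \<in> V0 - Z \<Longrightarrow> E x y \<Longrightarrow> \<psi> x \<noteq> (\<psi> y :: bool)"
  shows "\<exists>\<phi>. coloured_k_set V E k S (V0 - Z) \<phi>"
proof -
  define B where "B = V0 - Z"
  have fZ: "finite Z" using finite_subset[OF Z(1)] gd(1) by simp
  have fB: "finite B" unfolding B_def using gd(1) by simp
  have BV: "B \<subseteq> V" unfolding B_def by blast
  have degB: "43 * k \<le> card {w \<in> B. E v w}" if "v \<in> V" for v
  proof -
    have e: "V - (S \<union> Z) = B" unfolding B_def by auto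
    have "50 * k \<le> card {w \<in> B. E v w} + card (S \<union> Z)"
      using degree_outside[OF that, of "S \<union> Z"] fS fZ unfolding e by simp
    then show ?thesis using card_Un_le[of S Z] cS Z(2) by linarith
  qed
  have "\<exists>b. 21 * k \<le> card {w \<in> B. E v w \<and> \<psi> w \<noteq> b}" if v: "v \<in> V" for v
  proof (rule ccontr)
    assume n: "\<not> (\<exists>b. 21 * k \<le> card {w \<in> B. E v w \<and> \<psi> w \<noteq> b})"
    have "{w \<in> B. E v w} = {w \<in> B. E v w \<and> \<psi> w \<noteq> True} \<union> {w \<in> B. E v w \<and> \<psi> w \<noteq> False}" by auto
    then have "card {w \<in> B. E v w} \<le> card {w \<in> B. E v w \<and> \<psi> w \<noteq> True} + card {w \<in> B. E v w \<and> \<psi> w \<noteq> False}"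
      using card_Un_le by metis
    moreover have "\<not> 21 * k \<le> card {w \<in> B. E v w \<and> \<psi> w \<noteq> True}" "\<not> 21 * k \<le> card {w \<in> B. E v w \<and> \<psi> w \<noteq> False}"
      using n by blast+
    ultimately show False using degB[OF v] by linarith
  qed
  then obtain \<beta> where \<beta>: "\<And>v. v \<in> V \<Longrightarrow> 21 * k \<le> card {w \<in> B. E v w \<and> \<psi> w \<noteq> \<beta> v}" by metis
  define \<phi> where "\<phi> v = (if v \<in> B then \<psi> v else \<beta> v)" for v
  have gB: "simple_graph B (ind E B)" by (rule simple_graph_ind[OF g BV])
  have lk: "lnk (ind E B) B X" if X: "X \<subseteq> B" "card X \<le> 4 * k" for X
  proof -
    have "S \<noteq> {}" using cS k0 by auto
    then obtain s where "s \<in> V" using SV by auto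
    have "card {w \<in> B. E s w} \<le> card B" by (rule card_mono[OF fB]) auto
    then have cB: "43 * k \<le> card B" using degB[OF \<open>s \<in> V\<close>] by simp
    then obtain X' where X': "X \<subseteq> X'" "X' \<subseteq> B" "card X' = 4 * k"
      using exists_subset_between[of X "4 * k" B] X fB by auto
    have "massed (2 * k) B (ind E B) X'" unfolding massed_def
    proof (intro conjI allI impI)
      have "card (B - X') * (43 * k) = (\<Sum>v\<in>B - X'. 43 * k)" by simp
      also have "\<dots> \<le> (\<Sum>v\<in>B - X'. card {w. ind E B v w})"
      proof (rule sum_mono)
        fix v assume v: "v \<in> B - X'"
        then have "{w. ind E B v w} = {w \<in> B. E v w}" unfolding ind_def by auto
        then show "43 * k \<le> card {w. ind E B v w}" using degB[of v] v BV by auto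
      qed
      also have "\<dots> \<le> rho (ind E B) (B - X')" by (rule rho_le_degrees(1)[OF gB]) auto
      finally have a: "43 * (card (B - X') * k) \<le> rho (ind E B) (B - X')" by simp
      have "finite X'" using X'(2) fB finite_subset by blast
      then have "0 < card (B - X')" using card_Diff_subset[of X' B] X' cB k0 by simp
      then have "0 < card (B - X') * k" using k0 by simp
      then have "24 * (card (B - X') * k) < rho (ind E B) (B - X')" using a by linarith
      then show "12 * (2 * k) * card (B - X') < rho (ind E B) (B - X')" by (simp add: mult_ac)
    next
      fix P Q assume PQ: "P \<union> Q = B \<and> sep (ind E B) P Q \<and> X' \<subseteq> P \<and> card (P \<inter> Q) < card X'"
      show "rho (ind E B) (Q - P) \<le> 12 * (2 * k) * card (Q - P)"
      proof (cases "Q - P = {}")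
        case True then show ?thesis by (simp only: rho_empty)
      next
        case False
        have "P - Q \<noteq> {}"
        proof
          assume "P - Q = {}"
          then have "X' \<subseteq> P \<inter> Q" using PQ by auto
          moreover have "finite (P \<inter> Q)" using PQ fB by auto
          ultimately show False using PQ card_mono leD by blast
        qed
        then have "49 * k \<le> card Z + card (P \<inter> Q)"
          using sep_outside[OF Z(1), of P Q] PQ False unfolding B_def by blast
        then show ?thesis using PQ X'(3) Z(2) by linarith
      qed
    qed
    then have "lnk (ind E B) B X'" using massed_linked[OF gB X'(2), of "2 * k"] X'(3) by simp
    then show ?thesis using lnk_subset X'(1) by blast
  qed
  have "coloured_k_set V E k S B \<phi>"
  proof unfold_locales
    show "B \<subseteq> V - S" unfolding B_def by blast
    show "\<phi> x \<noteq> \<phi> y" if "x \<in> B" "y \<in> B" "E x y" for x y using \<psi>[of x y] that unfolding \<phi>_def B_def by simp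
    show "21 * k \<le> card {w \<in> B. E y w \<and> \<phi> w \<noteq> \<phi> y}" if y: "y \<in> V - B" for y
    proof -
      have "{w \<in> B. E y w \<and> \<phi> w \<noteq> \<phi> y} = {w \<in> B. E y w \<and> \<psi> w \<noteq> \<beta> y}" using y unfolding \<phi>_def by auto
      then show ?thesis using \<beta>[of y] y by simp
    qed
    show "lnk (ind E B) B X" if "X \<subseteq> B" "card X \<le> 4 * k" for X by (rule lk[OF that])
  qed
  then show ?thesis unfolding B_def by blast
qed

theorem packing_or_small_cover:
  assumes C: "C \<subseteq> S" "\<And>u v. u \<in> S \<Longrightarrow> v \<in> S \<Longrightarrow> E u v \<Longrightarrow> u \<in> C \<or> v \<in> C"
  shows "(\<exists>c. packing c) \<or> (\<exists>X. X \<subseteq> V \<and> bipartite_minus V E X \<and> card X \<le> 2 * k - 2 + card C)"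
proof -
  obtain \<phi> where \<phi>: "\<forall>v\<in>V0. card {w. E0 v w} \<le> 2 * card {w. E0 v w \<and> \<phi> w \<noteq> (\<phi> v :: bool)}"
    using max_cut[OF g0] by blast
  define F where "F x y \<longleftrightarrow> E0 x y \<and> \<phi> x \<noteq> \<phi> y" for x y
  have gF: "simple_graph V0 F"
    by (rule simple_graphI) (use g0 simple_graphD[OF g0] in \<open>auto simp: F_def\<close>)
  have FE: "F x y \<Longrightarrow> E0 x y" and Fb: "F x y \<Longrightarrow> \<phi> x \<noteq> \<phi> y" for x y unfolding F_def by auto
  have ne: "V0 \<noteq> {}"
  proof
    assume "V0 = {}"
    then have "card V \<le> k" using card_mono[OF fS, of V] cS by auto
    then show False using kc unfolding k_connected_def by auto
  qed
  have deg: "49 * k \<le> 2 * card {w. F v w}" if v: "v \<in> V0" for v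
  proof -
    have "{w. E0 v w} = {w \<in> V - S. E v w}" using v unfolding ind_def by auto
    moreover have "50 * k \<le> card {w \<in> V - S. E v w} + card S" using degree_outside[OF _ fS, of v] v by simp
    moreover have "{w. F v w} = {w. E0 v w \<and> \<phi> w \<noteq> \<phi> v}" unfolding F_def by auto
    ultimately show ?thesis using bspec[OF \<phi> v] cS by simp
  qed
  obtain W where D: "dense_cut V0 F \<phi> k W"
    by (rule dense_cut_exists[OF gF k0 ne deg Fb])
  interpret D: dense_cut V0 F \<phi> k W by (rule D)
  interpret doubled V0 E0 W \<phi> by unfold_locales (use g0 D.WV in auto)
  have "2 * (3 * k) < card W" using D.W44 by simp
  moreover have "2 \<le> card (P \<inter> Q)" if "Z \<subseteq> V0" "card Z < 2 * (3 * k)" "P \<union> Q = V0 - Z"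
    "sep (ind E0 (V0 - Z)) P Q" "P - Q \<noteq> {}" "Q - P \<noteq> {}" for Z P Q
  proof -
    have "ind E0 (V0 - Z) = ind E (V0 - Z)" unfolding ind_def by auto
    then have "49 * k \<le> card Z + card (P \<inter> Q)" using sep_outside[OF that(1,3) _ that(5,6)] that(4) by simp
    then show ?thesis using that(2) k0 by linarith
  qed
  ultimately consider
    PP where "finite PP \<and> card PP = 3 * k \<and> (\<forall>p\<in>PP. odd_path E0 W \<phi> p \<and> set p \<subseteq> V0) \<and>
      (\<forall>p\<in>PP. \<forall>q\<in>PP. p \<noteq> q \<longrightarrow> set p \<inter> set q = {})"
    | Z \<psi> where "Z \<subseteq> V0 \<and> card Z < 2 * (3 * k) \<and> (\<forall>x\<in>V0 - Z. \<forall>y\<in>V0 - Z. E0 x y \<longrightarrow> \<psi> x \<noteq> (\<psi> y :: bool))"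
    using odd_paths_or_cover[of "3 * k"] by blast
  then show ?thesis
  proof cases
    case 1
    have "\<exists>c. packing c" by (rule packing_from_paths[OF D FE, of PP]) (use 1 in simp_all)
    then show ?thesis ..
  next
    case 2
    have "\<exists>\<phi>. coloured_k_set V E k S (V0 - Z) \<phi>"
    proof (rule coloured_from_cover)
      fix x y assume xy: "x \<in> V0 - Z" "y \<in> V0 - Z" "E x y"
      then have "E0 x y" unfolding ind_def by blast
      then show "\<psi> x \<noteq> \<psi> y" using 2 xy by blast
    qed (use 2 in auto)
    then obtain \<phi>' where "coloured_k_set V E k S (V0 - Z) \<phi>'" ..
    then show ?thesis by (rule coloured_k_set.packing_or_cover[OF _ C])
  qed
qed

end

theorem theorem12:
  fixes V :: "'a set" and E :: "'a \<Rightarrow> 'a \<Rightarrow> bool" and S :: "'a set" and k :: nat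
  assumes "simple_graph V E"
    and "k > 0"
    and "k_connected (50 * k) V E"
    and "S \<subseteq> V"
    and "card S \<ge> k"
  shows "(\<exists>Cs :: 'a list list. length Cs = k \<and> (\<forall>c \<in> set Cs. odd_S_cycle V E S c) \<and>
            (\<forall>i < k. \<forall>j < k. i \<noteq> j \<longrightarrow> set (Cs ! i) \<inter> set (Cs ! j) = {}))
       \<or> (\<exists>X. X \<subseteq> V \<and> bipartite_minus V E X \<and>
            card X \<le> Min {2 * k - 2 + tau_induced E S' | S'. S' \<subseteq> S \<and> card S' = k})"
proof -
  have fS: "finite S" using assms(1,4) finite_subset simple_graphD(1) by blast
  define A where "A = {2 * k - 2 + tau_induced E S' | S'. S' \<subseteq> S \<and> card S' = k}"
  have "A = (\<lambda>S'. 2 * k - 2 + tau_induced E S') ` {S' \<in> Pow S. card S' = k}" unfolding A_def by auto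
  then have "finite A" using fS by simp
  moreover have "A \<noteq> {}" using obtain_subset_with_card_n[OF assms(5)] unfolding A_def by auto
  ultimately have "Min A \<in> A" by (rule Min_in)
  \<comment> \<open>A single subset attaining the minimum is enough: either its vertices lie on
    \<open>k\<close> disjoint odd cycles, or the cover found for it has the size required of the
    minimum.\<close>
  then obtain T where T: "T \<subseteq> S" "card T = k" "Min A = 2 * k - 2 + tau_induced E T" unfolding A_def by auto
  have fT: "finite T" using T(1) fS finite_subset by blast
  define CC where "CC = {C. C \<subseteq> T \<and> (\<forall>u v. u \<in> T \<and> v \<in> T \<and> E u v \<longrightarrow> u \<in> C \<or> v \<in> C)}"
  have "finite CC" unfolding CC_def using fT by simp
  moreover have "T \<in> CC" unfolding CC_def by blast
  ultimately have "Min (card ` CC) \<in> card ` CC" by (intro Min_in) auto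
  moreover have "tau_induced E T = Min (card ` CC)"
    unfolding tau_induced_def CC_def by (rule arg_cong[where f = Min]) auto
  ultimately obtain C where C: "C \<in> CC" "tau_induced E T = card C" by auto
  interpret k_set V E k T by unfold_locales (use assms T in auto)
  have "(\<exists>c. packing c) \<or> (\<exists>X. X \<subseteq> V \<and> bipartite_minus V E X \<and> card X \<le> 2 * k - 2 + card C)"
    by (rule packing_or_small_cover) (use C(1) in \<open>auto simp: CC_def\<close>)
  then show ?thesis
  proof
    assume "\<exists>c. packing c"
    then obtain c where "packing c" ..
    then have c: "\<And>s. s \<in> T \<Longrightarrow> is_cycle E (c s) \<and> odd (length (c s)) \<and> s \<in> set (c s) \<and> set (c s) \<subseteq> V"
      "\<And>s t. s \<in> T \<Longrightarrow> t \<in> T \<Longrightarrow> s \<noteq> t \<Longrightarrow> set (c s) \<inter> set (c t) = {}"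
      unfolding packing_def by blast+
    obtain xs where xs: "set xs = T" "distinct xs" using finite_distinct_list[OF fT] by blast
    have l: "length xs = k" using distinct_card[OF xs(2)] xs(1) T(2) by simp
    have o: "odd_S_cycle V E S (c s)" if "s \<in> T" for s using c(1)[OF that] that T(1) unfolding odd_S_cycle_def by blast
    have d: "set (map c xs ! i) \<inter> set (map c xs ! j) = {}" if "i < k" "j < k" "i \<noteq> j" for i j
      using c(2)[of "xs ! i" "xs ! j"] xs l that by (auto simp: nth_eq_iff_index_eq)
    show ?thesis
      by (intro disjI1 exI[of _ "map c xs"] conjI allI ballI impI) (use l o xs(1) d in auto)
  next
    assume "\<exists>X. X \<subseteq> V \<and> bipartite_minus V E X \<and> card X \<le> 2 * k - 2 + card C"
    then show ?thesis using T(3) C(2) unfolding A_def by auto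
  qed
qed

end
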